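(* Suppose the assessed policy $a:[0,1]\times\mathcal P\to[0,1]$ is measurable and the induced silence drift (the function $\beta$ below, evaluated at $a(\mu,p)$) is locally Lipschitz in $\mu$ on each price slice. Then, by Bayes' rule, between purchases reputation $\mu$ obeys $$\dot\mu=\beta(\mu,p,a)=-\nu\mu(1-\mu)(1-a)D(\lambda,p),$$ and at a purchase it jumps to $$J(\mu,p,a)=\frac{\mu A_H(\lambda,p)}{\bar A(\mu,p,a)},$$ where $a=a(\mu,p)$ and $\lambda=\mu+(1-\mu)a$. A price reset leaves $\mu$ unchanged. Subject to the natural absorbing convention when the drift vanishes, $(\mu,p)$ induces a unique nonexplosive piecewise-deterministic public process and is sufficient for continuation play.
   Context: **Model.** Constants $\nu,\kappa,v,\zeta>0$, $q\in(1/2,1)$, $d=2q-1$; finite price menu $\mathcal P\subset(0,\infty)$. A firm has a fixed hidden type, $C$ (always supplies high quality) or $S$ (supplies high quality with probability $a(\mu,p)$ at a customer opportunity in public state $(\mu,p)$). $\mu$ denotes the probability of type $C$ given the public history; $p$ is the current posted price. Potential customers arrive at Poisson rate $\nu$; independent price-reset opportunities arrive at Poisson rate $\kappa$. At a reset, a pricing desk that observes only the public history (and an independent randomization device), not the type or quality, chooses a new price in $\mathcal P$ according to a type-independent rule depending on $(\mu,p)$; the price is fixed between resets. Purchases, resets and prices are public; customer arrivals and non-purchases are not observed, but calendar time is. **Demand.** An arriving customer assigns probability $\lambda=\mu+(1-\mu)a(\mu,p)$ to current high quality, sees a binary signal of precision $q$, and buys with probability $b_s(\lambda,p)=\Lambda((v\pi_s(\lambda)-p)/\zeta)$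 after signal $s\in\{H,L\}$, where $\Lambda(z)=e^z/(1+e^z)$, $\pi_H(\lambda)=\frac{q\lambda}{(1-q)+d\lambda}$, $\pi_L(\lambda)=\frac{(1-q)\lambda}{q-d\lambda}$. Put $A_H=qb_H+(1-q)b_L$ and $A_L=(1-q)b_H+qb_L$ (purchase probabilities given actual high, low quality), $D=A_H-A_L$, $A_S(\mu,p,a)=A_L(\lambda,p)+aD(\lambda,p)$, $\bar A(\mu,p,a)=\mu A_H+(1-\mu)A_S=A_L+\lambda D$. Conditional on the public state, public purchases arrive with intensity $\nu A_H(\lambda,p)$ under type $C$ and $\nu A_S(\mu,p,a)$ under type $S$. "Sufficient for continuation play" means that, given the stationary policies, the law of the future public process depends on the public history only through $(\mu,p)$. *)

theory Defs
  imports "HOL-Probability.Probability"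
begin

datatype firm_type = Type_C | Type_S

text \<open>\<open>act M \<mu> p\<close> is the probability $a(\mu,p)$ that type S supplies high quality, and
  \<open>rule M \<mu> p\<close> is the distribution of the price chosen at a reset in public state $(\mu,p)$.\<close>

record market =
  nu :: real
  kappa :: real
  val :: real
  zeta :: real
  prec :: real
  menu :: "real set"
  act :: "real \<Rightarrow> real \<Rightarrow> real"
  rule :: "real \<Rightarrow> real \<Rightarrow> real pmf"

definition logistic :: "real \<Rightarrow> real" where
  "logistic z = exp z / (1 + exp z)"

definition dd :: "market \<Rightarrow> real" where
  "dd M = 2 * prec M - 1"

definition pi_H :: "market \<Rightarrow> real \<Rightarrow> real" where
  "pi_H M l = prec M * l / ((1 - prec M) + dd M * l)"

definition pi_L :: "market \<Rightarrow> real \<Rightarrow> real" where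
  "pi_L M l = (1 - prec M) * l / (prec M - dd M * l)"

definition b_H :: "market \<Rightarrow> real \<Rightarrow> real \<Rightarrow> real" where
  "b_H M l p = logistic ((val M * pi_H M l - p) / zeta M)"

definition b_L :: "market \<Rightarrow> real \<Rightarrow> real \<Rightarrow> real" where
  "b_L M l p = logistic ((val M * pi_L M l - p) / zeta M)"

definition A_H :: "market \<Rightarrow> real \<Rightarrow> real \<Rightarrow> real" where
  "A_H M l p = prec M * b_H M l p + (1 - prec M) * b_L M l p"

definition A_L :: "market \<Rightarrow> real \<Rightarrow> real \<Rightarrow> real" where
  "A_L M l p = (1 - prec M) * b_H M l p + prec M * b_L M l p"

definition DD :: "market \<Rightarrow> real \<Rightarrow> real \<Rightarrow> real" where
  "DD M l p = A_H M l p - A_L M l p"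

definition lam :: "real \<Rightarrow> real \<Rightarrow> real" where
  "lam \<mu> a = \<mu> + (1 - \<mu>) * a"

definition A_S :: "market \<Rightarrow> real \<Rightarrow> real \<Rightarrow> real \<Rightarrow> real" where
  "A_S M \<mu> p a = A_L M (lam \<mu> a) p + a * DD M (lam \<mu> a) p"

definition A_bar :: "market \<Rightarrow> real \<Rightarrow> real \<Rightarrow> real \<Rightarrow> real" where
  "A_bar M \<mu> p a = \<mu> * A_H M (lam \<mu> a) p + (1 - \<mu>) * A_S M \<mu> p a"

definition drift :: "market \<Rightarrow> real \<Rightarrow> real \<Rightarrow> real \<Rightarrow> real" where
  "drift M \<mu> p a = - nu M * \<mu> * (1 - \<mu>) * (1 - a) * DD M (lam \<mu> a) p"

definition jump :: "market \<Rightarrow> real \<Rightarrow> real \<Rightarrow> real \<Rightarrow> real" where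
  "jump M \<mu> p a = \<mu> * A_H M (lam \<mu> a) p / A_bar M \<mu> p a"

text \<open>A public record lists the public events in order, each as the waiting time since the
  previous event together with its mark.  A reset is public even if it selects the current price.\<close>

datatype mark = Purchase | Reset real

type_synonym event = "real \<times> mark"
type_synonym public_record = "nat \<Rightarrow> event"

definition marks :: "market \<Rightarrow> mark set" where
  "marks M = insert Purchase (Reset ` menu M)"

definition event_space :: "market \<Rightarrow> event measure" where
  "event_space M = borel \<Otimes>\<^sub>M count_space (marks M)"

definition record_space :: "market \<Rightarrow> public_record measure" where
  "record_space M = PiM UNIV (\<lambda>_. event_space M)"

definition state_space :: "market \<Rightarrow> (real \<times> real) measure" where
  "state_space M = restrict_space borel {0..1} \<Otimes>\<^sub>M count_space (menu M)"

definition history :: "public_record \<Rightarrow> nat \<Rightarrow> event list" where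
  "history \<omega> n = map \<omega> [0..<n]"

definition arrival :: "public_record \<Rightarrow> nat \<Rightarrow> real" where
  "arrival \<omega> n = (\<Sum>k<n. fst (\<omega> k))"

definition event_count :: "public_record \<Rightarrow> real \<Rightarrow> nat" where
  "event_count \<omega> t = card {n. arrival \<omega> (Suc n) \<le> t}"

definition nonexplosive :: "public_record \<Rightarrow> bool" where
  "nonexplosive \<omega> \<longleftrightarrow> filterlim (arrival \<omega>) at_top sequentially"

text \<open>A function \<open>f h s\<close> of the past events \<open>h\<close> and of the time \<open>s\<close> elapsed since the last of
  them is evaluated at calendar time \<open>t\<close>.\<close>

definition at_time :: "(event list \<Rightarrow> real \<Rightarrow> 'b) \<Rightarrow> public_record \<Rightarrow> real \<Rightarrow> 'b" where
  "at_time f \<omega> t =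
     f (history \<omega> (event_count \<omega> t)) (t - arrival \<omega> (event_count \<omega> t))"

text \<open>The record of the events after time \<open>t\<close>, with the clock restarted at \<open>t\<close>.\<close>

definition future :: "real \<Rightarrow> public_record \<Rightarrow> public_record" where
  "future t \<omega> k =
     (let N = event_count \<omega> t in
      if k = 0 then (arrival \<omega> (Suc N) - t, snd (\<omega> N)) else \<omega> (N + k))"

definition current_price :: "real \<Rightarrow> event list \<Rightarrow> real" where
  "current_price p0 h =
     foldl (\<lambda>p e. case snd e of Purchase \<Rightarrow> p | Reset p' \<Rightarrow> p') p0 h"

text \<open>\<open>Q\<close> is the law of a marked point process in which, after the past events \<open>h\<close> and at elapsed
  time \<open>s\<close>, an event with mark \<open>x\<close> has conditional intensity \<open>r h s x\<close>: given the first \<open>n\<close>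
  events, the next waiting time and mark have the density
  \<open>r h s x * exp (- (\<integral>u\<in>{0..s}. (\<Sum>y. r h u y)))\<close> in \<open>s > 0\<close>.\<close>

definition point_process_law ::
  "market \<Rightarrow> (event list \<Rightarrow> real \<Rightarrow> mark \<Rightarrow> real) \<Rightarrow> public_record measure \<Rightarrow> bool" where
  "point_process_law M r Q \<longleftrightarrow>
     prob_space Q \<and> sets Q = sets (record_space M) \<and>
     (\<forall>n. \<forall>B \<in> sets (PiM {..<n} (\<lambda>_. event_space M)). \<forall>t\<ge>0. \<forall>x\<in>marks M.
        measure Q {\<omega> \<in> space Q. restrict \<omega> {..<n} \<in> B \<and> fst (\<omega> n) \<le> t \<and> snd (\<omega> n) = x}
      = (LINT \<omega>:{\<omega> \<in> space Q. restrict \<omega> {..<n} \<in> B}|Q.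
           LINT s:{0..t}|lborel.
             r (history \<omega> n) s x *
             exp (- (LINT u:{0..s}|lborel. \<Sum>y\<in>marks M. r (history \<omega> n) u y))))"

text \<open>Event intensities under type \<open>\<theta>\<close> when the public reputation is \<open>m\<close> and the initial
  price is \<open>p0\<close>.\<close>

definition type_rate ::
  "market \<Rightarrow> real \<Rightarrow> (event list \<Rightarrow> real \<Rightarrow> real) \<Rightarrow> firm_type
     \<Rightarrow> event list \<Rightarrow> real \<Rightarrow> mark \<Rightarrow> real" where
  "type_rate M p0 m \<theta> h s x =
     (let \<mu> = m h s; p = current_price p0 h; a = act M \<mu> p in
      case x of
        Purchase \<Rightarrow>
          nu M * (case \<theta> of Type_C \<Rightarrow> A_H M (lam \<mu> a) p | Type_S \<Rightarrow> A_S M \<mu> p a)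
      | Reset p' \<Rightarrow> kappa M * pmf (rule M \<mu> p) p')"

definition outcome_space :: "market \<Rightarrow> (firm_type \<times> public_record) measure" where
  "outcome_space M = count_space UNIV \<Otimes>\<^sub>M record_space M"

definition joint_law ::
  "market \<Rightarrow> real \<Rightarrow> (firm_type \<Rightarrow> public_record measure)
     \<Rightarrow> (firm_type \<times> public_record) measure" where
  "joint_law M \<mu>0 L =
     measure_pmf (map_pmf (\<lambda>b. if b then Type_C else Type_S) (bernoulli_pmf \<mu>0)) \<bind>
       (\<lambda>\<theta>. distr (L \<theta>) (outcome_space M) (Pair \<theta>))"

definition public_filtration :: "market \<Rightarrow> real \<Rightarrow> (firm_type \<times> public_record) measure" where
  "public_filtration M t =
     sigma (space (outcome_space M))
       {{z \<in> space (outcome_space M). arrival (snd z) (Suc n) \<le> s \<and> snd (snd z n) = x}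
        | n s x. 0 \<le> s \<and> s \<le> t \<and> x \<in> marks M}"

text \<open>\<open>L \<theta>\<close> is the law of the public record under type \<open>\<theta>\<close>.  The reputation \<open>m\<close> and the laws
  \<open>L\<close> determine each other: \<open>m\<close> enters the intensities, and it is required to be a (right-continuous)
  version of the conditional probability of type C given the public history.\<close>

definition reputation_system ::
  "market \<Rightarrow> real \<Rightarrow> real \<Rightarrow> (event list \<Rightarrow> real \<Rightarrow> real)
     \<Rightarrow> (firm_type \<Rightarrow> public_record measure) \<Rightarrow> bool" where
  "reputation_system M \<mu>0 p0 m L \<longleftrightarrow>
     (\<forall>h. \<forall>s\<ge>0. m h s \<in> {0..1} \<and> continuous (at_right s) (m h)) \<and>
     (\<forall>n. (\<lambda>(\<omega>, s). m (history \<omega> n) s) \<in> borel_measurable (record_space M \<Otimes>\<^sub>M borel)) \<and>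
     (\<forall>\<theta>. point_process_law M (type_rate M p0 m \<theta>) (L \<theta>)) \<and>
     (\<forall>t\<ge>0. AE z in joint_law M \<mu>0 L.
        real_cond_exp (joint_law M \<mu>0 L) (public_filtration M t) (indicator {z. fst z = Type_C}) z
        = at_time m (snd z) t)"

definition silence_path :: "market \<Rightarrow> real \<Rightarrow> real \<Rightarrow> (real \<Rightarrow> real) \<Rightarrow> bool" where
  "silence_path M \<mu> p \<phi> \<longleftrightarrow>
     \<phi> 0 = \<mu> \<and>
     (\<forall>s\<ge>0. \<phi> s \<in> {0..1} \<and>
        (\<phi> has_real_derivative drift M (\<phi> s) p (act M (\<phi> s) p)) (at s within {0..}))"

text \<open>In the following, \<open>\<Phi> \<mu> p s\<close> is the reputation after a silence of length \<open>s\<close> started in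
  state $(\mu,p)$.\<close>

fun event_step ::
  "market \<Rightarrow> (real \<Rightarrow> real \<Rightarrow> real \<Rightarrow> real) \<Rightarrow> real \<times> real \<Rightarrow> event \<Rightarrow> real \<times> real" where
  "event_step M \<Phi> (\<mu>, p) (s, Purchase) =
     (jump M (\<Phi> \<mu> p s) p (act M (\<Phi> \<mu> p s) p), p)"
| "event_step M \<Phi> (\<mu>, p) (s, Reset p') = (\<Phi> \<mu> p s, p')"

definition pdmp_state ::
  "market \<Rightarrow> (real \<Rightarrow> real \<Rightarrow> real \<Rightarrow> real) \<Rightarrow> real \<times> real
     \<Rightarrow> event list \<Rightarrow> real \<Rightarrow> real \<times> real" where
  "pdmp_state M \<Phi> z h s =
     (case foldl (event_step M \<Phi>) z h of (\<mu>, p) \<Rightarrow> (\<Phi> \<mu> p s, p))"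

fun public_rate :: "market \<Rightarrow> real \<times> real \<Rightarrow> mark \<Rightarrow> real" where
  "public_rate M (\<mu>, p) Purchase = nu M * A_bar M \<mu> p (act M \<mu> p)"
| "public_rate M (\<mu>, p) (Reset p') = kappa M * pmf (rule M \<mu> p) p'"

definition pdmp_law ::
  "market \<Rightarrow> (real \<Rightarrow> real \<Rightarrow> real \<Rightarrow> real) \<Rightarrow> real \<times> real \<Rightarrow> public_record measure \<Rightarrow> bool" where
  "pdmp_law M \<Phi> z R \<longleftrightarrow>
     point_process_law M (\<lambda>h s. public_rate M (pdmp_state M \<Phi> z h s)) R"

end

theory Submission
  imports Defs
begin

text \<open>
  Between purchases the silence path solves a Lipschitz equation, hence is a flow by Picard and
  Gronwall. The law of a point process with bounded predictable intensities is determined by the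
  conditional law of each event given the earlier ones: cylinder sets give uniqueness,
  Ionescu-Tulcea existence, and the Laplace transforms of the arrival times rule out explosion.

  Along the flow, the weights \<open>\<mu>\<close> and \<open>1 - \<mu>\<close> of the two types satisfy
  \<open>\<phi>' = - \<phi> g\<close> with \<open>g\<close> the excess of the purchase rate of the type over the public one, so
  \<open>\<phi>\<close> times the public survival probability is proportional to the survival probability under
  the type; the jump formula does the same for the rates. Multiplying over the events, the law
  under a type, weighted by its prior, has as density its posterior weight with respect to the
  public law, which is Bayes' rule. Memorylessness of the clocks and the flow property let the
  process be restarted at any calendar time from the current state, which is sufficiency.

  Conversely, any reputation satisfying the filtering identity is pinned down, event by event, at
  the times \<open>t - a\<close> with \<open>t\<close> rational and \<open>a\<close> the last arrival, and then everywhere by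
  right-continuity.
\<close>

section \<open>Silence paths\<close>

text \<open>The policy is only measurable in the reputation, so intensities along a silence need not
  be continuous in time and their cumulated values are only known to be Lipschitz. Regularity enters
  through the drift alone. This shapes two arguments: the mass of the waiting-time density is
  computed from second-order increments instead of the fundamental theorem of calculus, and the
  converse direction works with the difference of the two types' rates, which equals the drift
  divided by \<open>- \<mu> * (1 - \<mu>)\<close> and is continuous along a continuous interior
  reputation. Reputation and laws define each other. The circle is opened by the event index: the
  law of the first \<open>n\<close> events fixes the reputation during the next silence, and this
  fixes the law of the next event. Null sets pass from the public law to a type through its prior
  weight, so types are compared only where this weight is positive; the joint law, which is what the
  conclusions concern, ignores the other type. Resets keep the total intensity at least
  \<open>kappa M\<close>, arrivals keep it at most \<open>nu M + kappa M\<close>. The lower bound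
  makes waiting times finite, the upper one excludes explosion.\<close>

lemma set_nn_integral_eq_LINT:
  fixes f :: "'a \<Rightarrow> real"
  assumes "set_integrable N A f" "\<And>x. x \<in> A \<Longrightarrow> 0 \<le> f x"
  shows "(\<integral>\<^sup>+x\<in>A. ennreal (f x) \<partial>N) = ennreal (LINT x:A|N. f x)"
proof -
  have "(\<integral>\<^sup>+x\<in>A. ennreal (f x) \<partial>N) = (\<integral>\<^sup>+x. ennreal (indicat_real A x *\<^sub>R f x) \<partial>N)"
    by (intro nn_integral_cong) (auto simp: indicator_def)
  also have "\<dots> = ennreal (LINT x:A|N. f x)"
    using assms unfolding set_lebesgue_integral_def set_integrable_def
    by (intro nn_integral_eq_integral) (auto simp: indicator_def)
  finally show ?thesis .
qed

lemma at_within_halfline: "0 \<le> (s::real) \<Longrightarrow> at s within {0..s + 1} = at s within {0..}"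
  by (rule at_within_nhd[of _ "{..<s + 1}"]) auto

text \<open>The derivative at 0 is one-sided, so the mean value argument runs over interior points,
  with continuity at the ends of the interval.\<close>

lemma nonincreasing_halfline:
  fixes w :: "real \<Rightarrow> real"
  assumes w: "\<And>s. 0 \<le> s \<Longrightarrow> (w has_real_derivative w' s) (at s within {0..})"
    and nonpos: "\<And>s. 0 \<le> s \<Longrightarrow> w' s \<le> 0" and t: "0 \<le> t"
  shows "w t \<le> w 0"
proof (rule DERIV_nonpos_imp_decreasing_open[OF t])
  show "continuous_on {0..t} w"
    by (rule continuous_on_subset[OF DERIV_continuous_on[of "{0..}"]]) (use w in auto)
  fix u assume u: "0 < u" "u < t"
  have "at u within {0..} = at u" using u by (intro at_within_interior) auto
  then show "\<exists>y. (w has_real_derivative y) (at u) \<and> y \<le> 0"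
    using w[of u] nonpos[of u] u by auto
qed

text \<open>The contraction estimate of Picard iteration in a weighted sup norm. Measured against
  the weight \<open>exp (2 * K * u)\<close>, integrating a \<open>K\<close>-Lipschitz right-hand
  side gains the factor \<open>K / (2 * K) = 1/2\<close> on the whole half-line at once, which
  spares the continuation from short intervals.\<close>

lemma weighted_integral_lipschitz:
  fixes F x y :: "real \<Rightarrow> real"
  assumes K: "K > 0" and F: "K-lipschitz_on UNIV F"
    and x: "continuous_on {0..} x" and y: "continuous_on {0..} y"
    and d: "\<And>u. u \<ge> 0 \<Longrightarrow> \<bar>x u - y u\<bar> \<le> d * exp (2 * K * u)" and s: "s \<ge> 0"
  shows "\<bar>integral {0..s} (\<lambda>u. F (x u)) - integral {0..s} (\<lambda>u. F (y u))\<bar> \<le> d / 2 * exp (2 * K * s)"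
proof -
  have Fc: "continuous_on UNIV F" using F lipschitz_on_continuous_on by blast
  have cx: "continuous_on {0..s} (\<lambda>u. F (x u))" "continuous_on {0..s} (\<lambda>u. F (y u))"
    using x y by (auto intro!: continuous_on_compose2[OF Fc] elim: continuous_on_subset)
  have d0: "d \<ge> 0" using d[of 0] by simp
  have I: "((\<lambda>u. K * (d * exp (2 * K * u))) has_integral (d/2 * exp (2*K * s) - (d/2) * exp (2*K*(0::real)))) {0..s}"
    by (rule fundamental_theorem_of_calculus[OF s])
       (use K in \<open>auto intro!: derivative_eq_intros simp: has_real_derivative_iff_has_vector_derivative[symmetric]\<close>)
  have "\<bar>integral {0..s} (\<lambda>u. F (x u)) - integral {0..s} (\<lambda>u. F (y u))\<bar>
      = norm (integral {0..s} (\<lambda>u. F (x u) - F (y u)))"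
    using cx by (subst integral_diff) (auto intro: integrable_continuous_real)
  also have "\<dots> \<le> integral {0..s} (\<lambda>u. K * (d * exp (2 * K * u)))"
  proof (rule integral_norm_bound_integral)
    show "(\<lambda>u. F (x u) - F (y u)) integrable_on {0..s}"
      using cx by (auto intro!: integrable_continuous_real continuous_intros)
    show "(\<lambda>u. K * (d * exp (2 * K * u))) integrable_on {0..s}" using I by blast
    fix u assume u: "u \<in> {0..s}"
    have "norm (F (x u) - F (y u)) \<le> K * \<bar>x u - y u\<bar>"
      using lipschitz_onD[OF F, of "x u" "y u"] by (simp add: dist_real_def)
    also have "\<dots> \<le> K * (d * exp (2 * K * u))"
      using u K d[of u] by (intro mult_left_mono) auto
    finally show "norm (F (x u) - F (y u)) \<le> K * (d * exp (2 * K * u))" .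
  qed
  also have "\<dots> = d/2 * exp (2*K * s) - d/2" using integral_unique[OF I] by (simp only: mult_zero_right exp_zero mult_1_right)
  also have "\<dots> \<le> d/2 * exp (2*K * s)" using d0 by simp
  finally show ?thesis .
qed

text \<open>The unknown of the fixed point problem is the path multiplied by
  \<open>exp (- (2 * k * s))\<close>, a bounded continuous function, so a single use of Banach's
  theorem yields a solution for all times. Boundedness of \<open>F\<close> gives linear growth of
  the integral, which the weight absorbs.\<close>

lemma lipschitz_ode_exists:
  fixes F :: "real \<Rightarrow> real"
  assumes F: "K-lipschitz_on UNIV F" and B: "\<And>x. \<bar>F x\<bar> \<le> B"
  obtains x where "x 0 = x0"
    "\<And>s. s \<ge> 0 \<Longrightarrow> (x has_real_derivative F (x s)) (at s within {0..})"
proof -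
  \<comment> \<open>\<open>K\<close> may be 0, but the weight needs a positive exponent.\<close>
  define k where "k = K + 1"
  have K0: "K \<ge> 0" using F by (simp add: lipschitz_on_def)
  have k: "k > 0" using K0 by (simp add: k_def)
  have Fk: "k-lipschitz_on UNIV F" using F by (rule lipschitz_on_le) (simp add: k_def)
  have Fc: "continuous_on UNIV F" using F lipschitz_on_continuous_on by blast
  \<comment> \<open>Bounded continuous functions live on the whole line, so the Picard operator is
    frozen at its value at 0 for negative times.\<close>
  define S where "S s = max 0 (s::real)" for s
  define I where "I g s = integral {0..s} (\<lambda>u. F (exp (2*k*u) * apply_bcontfun g u))"
    for g :: "real \<Rightarrow>\<^sub>C real" and s
  define T where "T g = (\<lambda>s. exp (- (2*k*S s)) * (x0 + I g (S s)))" for g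
  have cg: "continuous_on A (\<lambda>u. exp (2*k*u) * apply_bcontfun g u)" for g A
    by (intro continuous_intros continuous_on_apply_bcontfun)
  have cF: "continuous_on A (\<lambda>u. F (exp (2*k*u) * apply_bcontfun g u))" for g A
    by (rule continuous_on_compose2[OF Fc cg]) auto
  have cI: "continuous_on {0..} (I g)" for g
  proof -
    have "(I g has_real_derivative F (exp (2*k * s) * apply_bcontfun g s)) (at s within {0..})" if "s \<ge> 0" for s
    proof -
      have "(I g has_real_derivative F (exp (2*k * s) * apply_bcontfun g s)) (at s within {0..s+1})"
        unfolding I_def using that by (intro integral_has_real_derivative cF) auto
      then show ?thesis using at_within_halfline[OF that] by simp
    qed
    then show ?thesis by (intro DERIV_continuous_on) auto
  qed
  have Ib: "\<bar>I g s\<bar> \<le> B * s" if "s \<ge> 0" for g s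
  proof -
    have "norm (I g s) \<le> B * (s - 0)" unfolding I_def
      by (rule integral_bound) (use that B cF in auto)
    then show ?thesis by simp
  qed
  have B0: "B \<ge> 0" using B[of 0] by linarith
  \<comment> \<open>The linear growth of the integral is paid for by the weight, since
    \<open>s \<le> exp (2 * k * s) / (2 * k)\<close>.\<close>
  have Tb: "norm (T g s) \<le> \<bar>x0\<bar> + B / (2 * k)" for g s
  proof -
    let ?s = "S s"
    have s: "?s \<ge> 0" by (simp add: S_def)
    have "2*k* ?s \<le> exp (2*k* ?s)" using exp_ge_add_one_self[of "2*k* ?s"] by linarith
    then have "?s \<le> exp (2*k* ?s) / (2*k)" using k by (simp add: field_simps del: exp_ge_add_one_self)
    then have A: "B * ?s \<le> B * (exp (2*k* ?s) / (2*k))" using B0 by (rule mult_left_mono)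
    have "exp (2*k* ?s) \<ge> 1" using k s by simp
    then have "\<bar>x0\<bar> * 1 \<le> \<bar>x0\<bar> * exp (2*k* ?s)" by (intro mult_left_mono) auto
    then have "\<bar>x0 + I g ?s\<bar> \<le> exp (2*k* ?s) * (\<bar>x0\<bar> + B / (2*k))"
      using Ib[OF s, of g] A abs_triangle_ineq[of x0 "I g ?s"] by (simp add: algebra_simps)
    then have "exp (- (2*k* ?s)) * \<bar>x0 + I g ?s\<bar> \<le> exp (- (2*k* ?s)) * (exp (2*k* ?s) * (\<bar>x0\<bar> + B / (2*k)))"
      by (intro mult_left_mono) auto
    also have "\<dots> = \<bar>x0\<bar> + B / (2*k)" by (simp add: exp_minus_inverse mult.assoc[symmetric] flip: exp_add)
    finally show ?thesis by (simp add: T_def abs_mult)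
  qed
  have Tc: "continuous_on UNIV (T g)" for g
    unfolding T_def S_def
    by (intro continuous_intros continuous_on_compose2[OF cI[of g]]) auto
  have Tbc: "T g \<in> bcontfun" for g by (rule bcontfun_normI[OF Tc Tb])
  define TT where "TT g = Bcontfun (T g)" for g
  have TT: "apply_bcontfun (TT g) = T g" for g by (simp add: TT_def Bcontfun_inverse[OF Tbc])
  have "dist (TT g) (TT h) \<le> 1/2 * dist g h" for g h
  proof (rule dist_bound)
    fix s :: real
    let ?s = "S s"
    have s: "?s \<ge> 0" by (simp add: S_def)
    have "\<bar>I g ?s - I h ?s\<bar> \<le> dist g h / 2 * exp (2 * k * ?s)"
      unfolding I_def
    proof (rule weighted_integral_lipschitz[OF k Fk cg cg _ s])
      fix u :: real
      have "\<bar>apply_bcontfun g u - apply_bcontfun h u\<bar> \<le> dist g h"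
        using dist_bounded[of g u h] by (simp add: dist_real_def)
      then show "\<bar>exp (2*k*u) * apply_bcontfun g u - exp (2*k*u) * apply_bcontfun h u\<bar> \<le> dist g h * exp (2 * k * u)"
        by (simp only: right_diff_distrib[symmetric] abs_mult abs_exp_cancel mult.commute[of "dist g h"]) simp
    qed
    then have "exp (- (2*k* ?s)) * \<bar>I g ?s - I h ?s\<bar> \<le> exp (- (2*k* ?s)) * (dist g h / 2 * exp (2 * k * ?s))"
      by (intro mult_left_mono) auto
    also have "\<dots> = 1/2 * dist g h" by (simp add: exp_minus field_simps)
    finally show "dist (apply_bcontfun (TT g) s) (apply_bcontfun (TT h) s) \<le> 1/2 * dist g h"
      by (simp add: TT T_def dist_real_def right_diff_distrib[symmetric] abs_mult)
  qed
  then obtain g where g: "TT g = g" using banach_fix_type[of "1/2" TT] by auto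
  define x where "x s = exp (2*k * s) * apply_bcontfun g s" for s
  have xs: "x s = x0 + I g s" if "s \<ge> 0" for s
  proof -
    have "apply_bcontfun g s = T g s" using TT[of g] g by simp
    then show ?thesis using that by (simp add: x_def T_def S_def exp_minus field_simps)
  qed
  show thesis
  proof
    show "x 0 = x0" using xs[of 0] by (simp add: I_def)
    fix s :: real assume s: "s \<ge> 0"
    have "(I g has_real_derivative F (x s)) (at s within {0..s+1})"
      unfolding I_def x_def using s by (intro integral_has_real_derivative cF) auto
    then have "((\<lambda>s. x0 + I g s) has_real_derivative F (x s)) (at s within {0..})"
      using at_within_halfline[OF s] by (auto intro!: derivative_eq_intros)
    then show "(x has_real_derivative F (x s)) (at s within {0..})"
      by (rule has_field_derivative_transform_within[OF _ zero_less_one]) (use s xs in auto)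
  qed
qed

text \<open>The squared distance times \<open>exp (- (2 * K * s))\<close> is nonincreasing; squaring
  avoids differentiating an absolute value where the two paths meet.\<close>

lemma gronwall_lipschitz:
  fixes x y F :: "real \<Rightarrow> real"
  assumes F: "K-lipschitz_on A F"
    and x: "\<And>s. s \<ge> 0 \<Longrightarrow> x s \<in> A \<and> (x has_real_derivative F (x s)) (at s within {0..})"
    and y: "\<And>s. s \<ge> 0 \<Longrightarrow> y s \<in> A \<and> (y has_real_derivative F (y s)) (at s within {0..})"
    and s: "s \<ge> 0"
  shows "\<bar>x s - y s\<bar> \<le> exp (K * s) * \<bar>x 0 - y 0\<bar>"
proof -
  define w where "w s = (x s - y s)\<^sup>2 * exp (- (2 * K * s))" for s
  define w' where "w' s = 2 * (x s - y s) * (F (x s) - F (y s)) * exp (- (2 * K * s))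
      - 2 * K * (x s - y s)\<^sup>2 * exp (- (2 * K * s))" for s
  have w: "(w has_real_derivative w' s) (at s within {0..})" if "s \<ge> 0" for s
    unfolding w_def w'_def using x[OF that] y[OF that]
    by (auto intro!: derivative_eq_intros simp: algebra_simps power2_eq_square)
  have w'0: "w' s \<le> 0" if "s \<ge> 0" for s
  proof -
    have "\<bar>F (x s) - F (y s)\<bar> \<le> K * \<bar>x s - y s\<bar>"
      using lipschitz_onD[OF F] x[OF that] y[OF that] by (simp add: dist_real_def)
    then have "\<bar>x s - y s\<bar> * \<bar>F (x s) - F (y s)\<bar> \<le> \<bar>x s - y s\<bar> * (K * \<bar>x s - y s\<bar>)"
      by (rule mult_left_mono) simp
    also have "\<dots> = K * (x s - y s)\<^sup>2" by (simp add: power2_eq_square abs_mult_self_eq mult.left_commute)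
    finally have "(x s - y s) * (F (x s) - F (y s)) \<le> K * (x s - y s)\<^sup>2"
      by (metis abs_ge_self abs_mult order_trans)
    then have "2 * exp (- (2 * K * s)) * ((x s - y s) * (F (x s) - F (y s)) - K * (x s - y s)\<^sup>2) \<le> 0"
      by (intro mult_nonneg_nonpos) auto
    then show ?thesis by (simp add: w'_def algebra_simps)
  qed
  have "w s \<le> w 0" by (rule nonincreasing_halfline[OF w w'0 s])
  then have "(x s - y s)\<^sup>2 \<le> (x 0 - y 0)\<^sup>2 * exp (2 * K * s)"
    by (simp add: w_def exp_minus field_simps)
  also have "\<dots> = (exp (K * s) * \<bar>x 0 - y 0\<bar>)\<^sup>2"
    by (simp add: power_mult_distrib exp_double[symmetric] mult.assoc mult.commute)
  finally show ?thesis by (rule abs_le_square_iff[THEN iffD2, of _ "exp (K * s) * \<bar>x 0 - y 0\<bar>", simplified abs_mult, simplified])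
qed

text \<open>Look at the last time at which the path is at least \<open>c\<close>. After it the path
  lies where the right-hand side vanishes, so it is constant and cannot drop below
  \<open>c\<close>.\<close>

lemma ode_frozen_below:
  fixes x F :: "real \<Rightarrow> real"
  assumes x: "\<And>s. s \<ge> 0 \<Longrightarrow> (x has_real_derivative F (x s)) (at s within {0..})"
    and F: "\<And>y. y \<le> c \<Longrightarrow> F y = 0" and x0: "x 0 \<ge> c" and s: "s \<ge> 0"
  shows "x s \<ge> c"
proof (rule ccontr)
  assume "\<not> x s \<ge> c"
  then have xs: "x s < c" by simp
  have cx: "continuous_on {0..} x" by (rule DERIV_continuous_on) (use x in auto)
  define Z where "Z = {t\<in>{0..s}. c \<le> x t}"
  have "closed (x -` {c..} \<inter> {0..s})"
    unfolding Int_commute[of _ "{0..s}"]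
    by (intro continuous_closed_preimage continuous_on_subset[OF cx]) auto
  then have "closed Z" by (simp add: Z_def vimage_def Int_def conj_commute)
  then have "compact Z" by (metis Z_def bounded_closed_interval bounded_subset compact_eq_bounded_closed mem_Collect_eq subsetI)
  moreover have "Z \<noteq> {}" using x0 s by (auto simp: Z_def intro: exI[of _ 0])
  ultimately obtain t where t: "t \<in> Z" and tmax: "\<And>t'. t' \<in> Z \<Longrightarrow> t' \<le> t"
    by (meson compact_attains_sup)
  have t0: "0 \<le> t" "t \<le> s" "c \<le> x t" using t by (auto simp: Z_def)
  have ts: "t < s" using t0 xs by (cases "t = s") auto
  have "x s = x t"
  proof (rule DERIV_isconst_end[OF ts])
    show "continuous_on {t..s} x" using cx t0 by (auto elim: continuous_on_subset)
    fix u assume u: "t < u" "u < s"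
    then have "u \<notin> Z" using tmax[of u] by auto
    then have "x u \<le> c" using u t0 by (auto simp: Z_def)
    moreover have "at u within {0..} = at u" using u t0 by (intro at_within_interior) auto
    ultimately show "DERIV x u :> 0" using x[of u] F[of "x u"] u t0 by simp
  qed
  then show False using xs t0 by simp
qed

lemma lipschitz_ode_exists_unit:
  fixes f :: "real \<Rightarrow> real"
  assumes f: "K-lipschitz_on {0..1} f" and f0: "f 0 = 0" and f1: "f 1 = 0" and x0: "x0 \<in> {0..1}"
  obtains x where "x 0 = x0"
    "\<And>s. s \<ge> 0 \<Longrightarrow> x s \<in> {0..1} \<and> (x has_real_derivative f (x s)) (at s within {0..})"
proof -
  \<comment> \<open>Clamping the argument extends \<open>f\<close> to the line with the same
    Lipschitz constant, and the extension is zero outside the interval because \<open>f\<close>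
    vanishes at both ends. The two barriers below then keep the solution inside.\<close>
  define F where "F y = f (max 0 (min 1 y))" for y
  have K: "K \<ge> 0" using f by (simp add: lipschitz_on_def)
  have "K-lipschitz_on UNIV F"
  proof (rule lipschitz_onI[OF _ K])
    fix a b :: real
    have "dist (F a) (F b) \<le> K * dist (max 0 (min 1 a)) (max 0 (min 1 b))"
      unfolding F_def by (rule lipschitz_onD[OF f]) auto
    also have "\<dots> \<le> K * dist a b" using K by (intro mult_left_mono) (auto simp: dist_real_def)
    finally show "dist (F a) (F b) \<le> K * dist a b" .
  qed
  moreover have "\<bar>F y\<bar> \<le> K" for y
  proof -
    have "\<bar>f (max 0 (min 1 y)) - f 0\<bar> \<le> K * \<bar>max 0 (min 1 y) - 0\<bar>"
      using lipschitz_onD[OF f, of "max 0 (min 1 y)" 0] by (simp add: dist_real_def)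
    also have "\<dots> \<le> K * 1" using K by (intro mult_left_mono) auto
    finally show ?thesis using f0 by (simp add: F_def)
  qed
  ultimately obtain x where x: "x 0 = x0"
    "\<And>s. s \<ge> 0 \<Longrightarrow> (x has_real_derivative F (x s)) (at s within {0..})"
    using lipschitz_ode_exists[of K F K x0] by blast
  have lo: "x s \<ge> 0" if "s \<ge> 0" for s
    by (rule ode_frozen_below[OF x(2) _ _ that]) (use x(1) x0 f0 in \<open>auto simp: F_def max_def min_def\<close>)
  \<comment> \<open>The upper barrier is the lower one for the reflected equation.\<close>
  have "- x s \<ge> -1" if "s \<ge> 0" for s
  proof (rule ode_frozen_below[where F = "\<lambda>y. - F (- y)", OF _ _ _ that])
    show "((\<lambda>s. - x s) has_real_derivative - F (- (- x s))) (at s within {0..})" if "s \<ge> 0" for s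
      using x(2)[OF that] by (auto intro!: derivative_eq_intros)
  qed (use x(1) x0 f1 in \<open>auto simp: F_def max_def min_def\<close>)
  then have hi: "x s \<le> 1" if "s \<ge> 0" for s using that by fastforce
  show thesis
  proof (rule that[of x], rule x(1), intro conjI)
    fix s :: real assume s: "s \<ge> 0"
    show "x s \<in> {0..1}" using lo[OF s] hi[OF s] by simp
    show "(x has_real_derivative f (x s)) (at s within {0..})"
      using x(2)[OF s] lo[OF s] hi[OF s] by (simp add: F_def)
  qed
qed

text \<open>Rates carry information at nonnegative elapsed times only. Measurability is therefore
  phrased through \<open>max 0 s\<close>, a pattern that the later statements on rates
  follow.\<close>

lemma set_integrable_bounded_halfline:
  fixes g :: "real \<Rightarrow> real"
  assumes g: "(\<lambda>s. g (max 0 s)) \<in> borel_measurable borel"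
    and b: "\<And>s. s \<ge> 0 \<Longrightarrow> \<bar>g s\<bar> \<le> C" and "0 \<le> s"
  shows "set_integrable lborel {s..t} g"
proof -
  have "set_integrable lborel {s..t} (\<lambda>s. g (max 0 s))"
    unfolding set_integrable_def
  proof (rule integrableI_bounded_set[where A = "{s..t}" and B = C])
    show "(\<lambda>x. indicat_real {s..t} x *\<^sub>R g (max 0 x)) \<in> borel_measurable lborel"
      using g by measurable
    show "AE x\<in>{s..t} in lborel. norm (indicat_real {s..t} x *\<^sub>R g (max 0 x)) \<le> C"
      using b by auto
  qed (auto simp: emeasure_lborel_Icc_eq)
  then show ?thesis
    by (rule set_integrable_cong[THEN iffD1, rotated 3]) (use assms(3) in auto)
qed

lemma set_integral_Icc_split:
  fixes f :: "real \<Rightarrow> real"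
  assumes f: "set_integrable lborel {a..c} f" and ab: "a \<le> b" "b \<le> c"
  shows "(LINT u:{a..c}|lborel. f u) = (LINT u:{a..b}|lborel. f u) + (LINT u:{b..c}|lborel. f u)"
proof -
  have i: "set_integrable lborel {a..b} f" "set_integrable lborel {b<..c} f" "set_integrable lborel {b..c} f"
    using ab by (auto intro: set_integrable_subset[OF f])
  have "(LINT u:{a..c}|lborel. f u) = (LINT u:{a..b}|lborel. f u) + (LINT u:{b<..c}|lborel. f u)"
    using ab i by (subst set_integral_Un[symmetric])
      (auto intro!: arg_cong2[where f="set_lebesgue_integral lborel"])
  moreover have "(LINT u:{b<..c}|lborel. f u) = (LINT u:{b..c}|lborel. f u)"
  proof (rule set_integral_cong_set)
    show "set_borel_measurable lborel {b..c} f" "set_borel_measurable lborel {b<..c} f"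
      using i by (auto simp: set_integrable_def set_borel_measurable_def)
    show "AE x in lborel. x \<in> {b..c} \<longleftrightarrow> x \<in> {b<..c}"
      using AE_lborel_singleton[of b] by eventually_elim auto
  qed
  ultimately show ?thesis by simp
qed

lemma set_integral_singleton: "(LINT u:{a..a}|lborel. f u) = (0::real)" for a :: real
proof -
  have "AE x in lborel. indicat_real {a} x *\<^sub>R f x = 0"
    using AE_lborel_singleton[of a] by eventually_elim auto
  then show ?thesis by (simp add: set_lebesgue_integral_def integral_eq_zero_AE)
qed

text \<open>Formally \<open>ln \<phi>\<close> has derivative \<open>- g\<close>. As \<open>g\<close>
  is only measurable, the fundamental theorem is used for the gauge integral, whose value agrees
  with the Lebesgue integral by boundedness. The logarithm needs positivity: a path that is positive
  at 0 stays positive, and one that starts at 0 stays at 0.\<close>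

lemma exp_integral_of_log_derivative:
  fixes \<phi> g :: "real \<Rightarrow> real"
  assumes d: "\<And>s. s \<ge> 0 \<Longrightarrow> (\<phi> has_real_derivative - \<phi> s * g s) (at s within {0..})"
    and nn: "\<And>s. s \<ge> 0 \<Longrightarrow> \<phi> s \<ge> 0"
    and g: "(\<lambda>s. g (max 0 s)) \<in> borel_measurable borel"
    and b: "\<And>s. s \<ge> 0 \<Longrightarrow> \<bar>g s\<bar> \<le> C" and s: "s \<ge> 0"
  shows "\<phi> s = \<phi> 0 * exp (- (LINT u:{0..s}|lborel. g u))"
proof -
  \<comment> \<open>Two comparisons with exponentials in one: \<open>\<sigma> = 1\<close> gives
    \<open>\<phi> t \<le> \<phi> 0 * exp (C * t)\<close>, and \<open>\<sigma> = -1\<close> gives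
    \<open>\<phi> 0 \<le> \<phi> t * exp (C * t)\<close>.\<close>
  have bound: "\<sigma> * \<phi> t * exp (- \<sigma> * C * t) \<le> \<sigma> * \<phi> 0"
    if t: "t \<ge> 0" and \<sigma>: "\<sigma> = 1 \<or> \<sigma> = -1" for t \<sigma>
  proof -
    define w where "w t = \<sigma> * \<phi> t * exp (- \<sigma> * C * t)" for t
    define w' where "w' t = - (\<phi> t * (\<sigma> * g t + C) * exp (- \<sigma> * C * t))" for t
    have w: "(w has_real_derivative w' t) (at t within {0..})" if "t \<ge> 0" for t
      unfolding w_def w'_def using d[OF that] \<sigma>
      by (auto intro!: derivative_eq_intros simp: algebra_simps)
    have "w' u \<le> 0" if "0 \<le> u" for u using nn[OF that] b[OF that] \<sigma> by (auto simp: w'_def)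
    from nonincreasing_halfline[OF w this t] have "w t \<le> w 0" .
    then show ?thesis by (simp add: w_def)
  qed
  show ?thesis
  proof (cases "\<phi> 0 = 0")
    case True
    then have "\<phi> s \<le> 0" using bound[OF s, of 1] by (simp add: mult_le_0_iff)
    then show ?thesis using nn[OF s] True by simp
  next
    case False
    then have p0: "\<phi> 0 > 0" using nn[of 0] by simp
    have pos: "\<phi> t > 0" if "t \<ge> 0" for t
    proof -
      have "\<phi> 0 \<le> \<phi> t * exp (C * t)" using bound[OF that, of "-1"] by simp
      then show ?thesis using p0 by (metis exp_gt_zero less_le_trans zero_less_mult_pos2)
    qed
    have "((\<lambda>u. - g u) has_integral (ln (\<phi> s) - ln (\<phi> 0))) {0..s}"
    proof (rule fundamental_theorem_of_calculus[OF s])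
      fix u assume u: "u \<in> {0..s}"
      have "((\<lambda>u. ln (\<phi> u)) has_real_derivative - g u) (at u within {0..})"
        using d[of u] pos[of u] u by (auto intro!: derivative_eq_intros simp: field_simps)
      then show "((\<lambda>u. ln (\<phi> u)) has_vector_derivative - g u) (at u within {0..s})"
        unfolding has_real_derivative_iff_has_vector_derivative
        by (rule has_vector_derivative_within_subset) auto
    qed
    then have I: "(g has_integral - (ln (\<phi> s) - ln (\<phi> 0))) {0..s}"
      using has_integral_neg[of "\<lambda>u. - g u" "ln (\<phi> s) - ln (\<phi> 0)" "{0..s}"] by simp
    have "(LINT u:{0..s}|lborel. g u) = integral {0..s} g"
      by (rule set_borel_integral_eq_integral(2)[OF set_integrable_bounded_halfline[OF g b]]) auto
    then have "(LINT u:{0..s}|lborel. g u) = ln (\<phi> 0) - ln (\<phi> s)"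
      using integral_unique[OF I] by simp
    then show ?thesis using p0 pos[OF s] by (simp add: exp_diff)
  qed
qed

section \<open>Waiting times with a bounded hazard rate\<close>

text \<open>\<open>lo\<close> drives the cumulated hazard to infinity, so that the wait is finite
  almost surely; \<open>hi\<close> bounds the chance of a short wait from above. In the model
  \<open>lo\<close> is the reset rate, and \<open>hi\<close> adds the arrival rate to it.\<close>

locale hazard =
  fixes R :: "real \<Rightarrow> real" and lo hi :: real
  assumes meas: "(\<lambda>s. R (max 0 s)) \<in> borel_measurable borel"
    and lo: "lo > 0" and R: "\<And>s. s \<ge> 0 \<Longrightarrow> R s \<in> {lo..hi}"
begin

definition cum :: "real \<Rightarrow> real" where "cum s = (LINT u:{0..s}|lborel. R u)"

lemma lo_le_hi: "lo \<le> hi" using R[of 0] by auto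

lemma R_abs: "s \<ge> 0 \<Longrightarrow> \<bar>R s\<bar> \<le> hi" using R[of s] lo by auto

lemma R_integrable: "0 \<le> s \<Longrightarrow> set_integrable lborel {s..t} R"
  by (rule set_integrable_bounded_halfline[OF meas R_abs]) auto

lemma cum_diff:
  assumes "0 \<le> s" "s \<le> t"
  shows "cum t - cum s = (LINT u:{s..t}|lborel. R u)"
  unfolding cum_def using set_integral_Icc_split[OF R_integrable[OF order_refl] assms] by simp

lemma cum_0: "cum 0 = 0"
  by (simp only: cum_def set_integral_singleton)

lemma cum_bounds:
  assumes "0 \<le> s" "s \<le> t"
  shows "lo * (t - s) \<le> cum t - cum s" "cum t - cum s \<le> hi * (t - s)"
proof -
  have c: "set_integrable lborel {s..t} (\<lambda>_. c)" "(LINT u:{s..t}|lborel. c) = c * (t - s)" for c :: real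
    using assms by (auto simp: set_integrable_def set_lebesgue_integral_def emeasure_lborel_Icc_eq)
  show "lo * (t - s) \<le> cum t - cum s" "cum t - cum s \<le> hi * (t - s)"
    unfolding cum_diff[OF assms] c(2)[symmetric]
    by (rule set_integral_mono[OF c(1) R_integrable] set_integral_mono[OF R_integrable c(1)];
        use assms R in force)+
qed

lemma cum_nonneg: "0 \<le> s \<Longrightarrow> 0 \<le> cum s"
  using cum_bounds(1)[of 0 s] mult_nonneg_nonneg[OF less_imp_le[OF lo], of s] unfolding cum_0 by auto

lemma cum_mono: "0 \<le> s \<Longrightarrow> s \<le> t \<Longrightarrow> cum s \<le> cum t"
  using cum_bounds(1)[of s t] mult_nonneg_nonneg[OF less_imp_le[OF lo], of "t - s"] by auto

lemma cum_continuous: "continuous_on {0..} cum"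
proof (rule lipschitz_on_continuous_on[of hi], rule lipschitz_on_leI)
  show "0 \<le> hi" using lo lo_le_hi by simp
  fix s t :: real assume "s \<in> {0..}" "t \<in> {0..}" "s \<le> t"
  then show "dist (cum s) (cum t) \<le> hi * dist s t"
    using cum_bounds[of s t] cum_mono[of s t] by (simp add: dist_real_def)
qed

lemma cum_measurable: "(\<lambda>s. cum (max 0 s)) \<in> borel_measurable borel"
  by (intro borel_measurable_continuous_onI continuous_on_compose2[OF cum_continuous] continuous_intros) auto

lemma density_meas:
  "(\<lambda>s. R (max 0 s) * exp (- cum (max 0 s))) \<in> borel_measurable borel"
proof -
  note [measurable] = meas cum_measurable
  show ?thesis by measurable
qed

lemma density_integrable:
  assumes "0 \<le> s" shows "set_integrable lborel {s..t} (\<lambda>u. R u * exp (- cum u))"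
proof (rule set_integrable_bounded_halfline[OF density_meas _ assms])
  fix s :: real assume "s \<ge> 0"
  then show "\<bar>R s * exp (- cum s)\<bar> \<le> hi"
    using R[of s] lo lo_le_hi cum_nonneg[of s] mult_mono[of "R s" hi "exp (- cum s)" 1]
    by (auto simp: abs_mult)
qed

text \<open>For continuous \<open>R\<close> the integrand would be the derivative of
  \<open>- exp (- cum u)\<close>. For measurable \<open>R\<close> the function \<open>cum\<close>
  need not be differentiable everywhere, so increments are compared instead: those of the two sides
  over a short interval differ by at most a multiple of \<open>(t - s)\<^sup>2\<close>, hence the
  difference of the sides has derivative zero and is constant.\<close>

lemma integral_density:
  assumes t: "0 \<le> t"
  shows "(LINT u:{0..t}|lborel. R u * exp (- cum u)) = 1 - exp (- cum t)"
proof -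
  define P where "P t = (LINT u:{0..t}|lborel. R u * exp (- cum u))" for t
  define G where "G t = P t + exp (- cum t)" for t
  have P_diff: "P t - P s = (LINT u:{s..t}|lborel. R u * exp (- cum u))" if "0 \<le> s" "s \<le> t" for s t
    unfolding P_def using set_integral_Icc_split[OF density_integrable[OF order_refl] that] by simp
  \<comment> \<open>The increment of \<open>P\<close> and the decrement of
    \<open>exp (- cum)\<close> both lie between \<open>?D * exp (- cum t)\<close> and
    \<open>?D * exp (- cum s)\<close>. So they differ by at most \<open>?D\<close> times the gap of
    the exponentials, and this gap is itself at most \<open>?D\<close>.\<close>
  have G: "\<bar>G t - G s\<bar> \<le> hi\<^sup>2 * (t - s)\<^sup>2" if st: "0 \<le> s" "s \<le> t" for s t
  proof -
    let ?D = "cum t - cum s"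
    have D: "0 \<le> ?D" "?D \<le> hi * (t - s)" using cum_bounds[OF st] cum_mono[OF st] by auto
    have eu: "exp (- cum t) \<le> exp (- cum u)" "exp (- cum u) \<le> exp (- cum s)" if "u \<in> {s..t}" for u
      using that st cum_mono by auto
    have ic: "set_integrable lborel {s..t} (\<lambda>u. R u * c)" for c
      using R_integrable[OF st(1)] by (rule set_integrable_mult_left)
    have cD: "(LINT u:{s..t}|lborel. R u * c) = ?D * c" for c
      by (simp add: cum_diff[OF st])
    have Rnn: "R u \<ge> 0" if "u \<in> {s..t}" for u using R[of u] lo that st by auto
    have A1: "?D * exp (- cum t) \<le> P t - P s" unfolding cD[symmetric]
      unfolding P_diff[OF st] using eu Rnn
      by (intro set_integral_mono[OF ic density_integrable[OF st(1)]] mult_left_mono) auto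
    have A2: "P t - P s \<le> ?D * exp (- cum s)" unfolding cD[symmetric]
      unfolding P_diff[OF st] using eu Rnn
      by (intro set_integral_mono[OF density_integrable[OF st(1)] ic] mult_left_mono) auto
    note A = A1 A2
    have e1: "exp (- cum s) - exp (- cum t) \<le> ?D * exp (- cum s)"
    proof -
      have "exp (- cum t) = exp (- cum s) * exp (- ?D)" by (simp flip: exp_add)
      moreover have "exp (- ?D) \<ge> 1 - ?D" using exp_ge_add_one_self[of "- ?D"] by linarith
      ultimately have "exp (- cum t) \<ge> exp (- cum s) * (1 - ?D)" by simp
      then show ?thesis by (simp add: algebra_simps)
    qed
    have e2: "exp (- cum s) - exp (- cum t) \<ge> ?D * exp (- cum t)"
    proof -
      have "exp (- cum s) = exp (- cum t) * exp ?D" by (simp flip: exp_add)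
      moreover have "exp ?D \<ge> 1 + ?D" by (rule exp_ge_add_one_self)
      ultimately have "exp (- cum s) \<ge> exp (- cum t) * (1 + ?D)" by (simp only: mult_left_mono exp_ge_zero)
      then show ?thesis by (simp add: algebra_simps)
    qed
    have "exp (- cum s) - exp (- cum t) \<le> ?D * 1"
      by (rule order_trans[OF e1]) (use D cum_nonneg[OF st(1)] in \<open>intro mult_left_mono, auto\<close>)
    then have "?D * (exp (- cum s) - exp (- cum t)) \<le> ?D * ?D" using D by (intro mult_left_mono) auto
    also have "\<dots> \<le> (hi * (t - s)) * (hi * (t - s))" using D by (intro mult_mono) auto
    finally have "?D * (exp (- cum s) - exp (- cum t)) \<le> hi\<^sup>2 * (t - s)\<^sup>2"
      by (simp add: power2_eq_square algebra_simps)
    moreover have "\<bar>G t - G s\<bar> \<le> ?D * (exp (- cum s) - exp (- cum t))"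
      unfolding G_def using A e1 e2 by (simp add: algebra_simps abs_le_iff)
    ultimately show ?thesis by linarith
  qed
  have "(G has_real_derivative 0) (at u within {0..t})" if u: "u \<in> {0..t}" for u
    unfolding has_field_derivative_def has_derivative_within
  proof (intro conjI)
    show "((\<lambda>y. (1 / norm (y - u)) *\<^sub>R (G y - (G u + 0 * (y - u)))) \<longlongrightarrow> 0) (at u within {0..t})"
    proof (rule Lim_null_comparison)
      have "\<bar>G y - G u\<bar> \<le> hi\<^sup>2 * (y - u)\<^sup>2" if "y \<in> {0..t}" for y
        using G[of u y] G[of y u] u that by (cases "u \<le> y") (auto simp: abs_minus_commute power2_commute)
      then have "\<bar>G y - G u\<bar> / \<bar>y - u\<bar> \<le> hi\<^sup>2 * \<bar>y - u\<bar>" if "y \<in> {0..t}" "y \<noteq> u" for y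
        using that by (simp add: divide_le_eq mult.assoc power2_eq_square flip: abs_mult)
      then show "\<forall>\<^sub>F y in at u within {0..t}. norm ((1 / norm (y - u)) *\<^sub>R (G y - (G u + 0 * (y - u)))) \<le> hi\<^sup>2 * \<bar>y - u\<bar>"
        by (auto simp: eventually_at_filter abs_mult intro!: always_eventually)
      show "((\<lambda>y. hi\<^sup>2 * \<bar>y - u\<bar>) \<longlongrightarrow> 0) (at u within {0..t})"
        by (auto intro!: tendsto_eq_intros)
    qed
  qed (simp add: bounded_linear_mult_right)
  then obtain c where c: "\<And>u. u \<in> {0..t} \<Longrightarrow> G u = c"
    using has_field_derivative_zero_constant[of "{0..t}" G] by auto
  have "G t = G 0" using c[of 0] c[of t] t by simp
  moreover have "P 0 = 0" by (simp only: P_def set_integral_singleton)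
  ultimately show ?thesis by (simp add: G_def P_def cum_0)
qed

definition waiting_law :: "real measure" where
  "waiting_law = density lborel (\<lambda>s. if 0 \<le> s then ennreal (R s * exp (- cum s)) else 0)"

lemma waiting_density_meas:
  "(\<lambda>s. if 0 \<le> s then ennreal (R s * exp (- cum s)) else 0) \<in> borel_measurable borel"
proof -
  have "(\<lambda>s. if 0 \<le> s then ennreal (R (max 0 s) * exp (- cum (max 0 s))) else 0) \<in> borel_measurable borel"
    using density_meas by measurable
  then show ?thesis by (rule measurable_cong[THEN iffD1, rotated]) auto
qed

lemma emeasure_waiting_law_Icc:
  assumes "0 \<le> t" shows "emeasure waiting_law {0..t} = ennreal (1 - exp (- cum t))"
proof -
  have "emeasure waiting_law {0..t} = (\<integral>\<^sup>+u\<in>{0..t}. ennreal (R u * exp (- cum u)) \<partial>lborel)"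
    unfolding waiting_law_def using waiting_density_meas
    by (subst emeasure_density) (auto intro!: nn_integral_cong simp: indicator_def)
  also have "\<dots> = ennreal (LINT u:{0..t}|lborel. R u * exp (- cum u))"
  proof (rule set_nn_integral_eq_LINT[OF density_integrable])
    fix x assume "x \<in> {0..t}"
    then have "0 \<le> R x" using R[of x] lo by auto
    then show "0 \<le> R x * exp (- cum x)" by simp
  qed simp
  finally show ?thesis by (simp add: integral_density[OF assms])
qed

text \<open>A positive lower bound on the hazard sends \<open>cum\<close> to infinity, so no mass
  escapes there and an event comes at a finite time.\<close>

lemma emeasure_waiting_law_UNIV: "emeasure waiting_law {0..} = 1"
proof -
  have "(\<lambda>n. emeasure waiting_law {0..real n}) \<longlonglongrightarrow> emeasure waiting_law (\<Union>n. {0..real n})"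
    by (rule Lim_emeasure_incseq) (auto simp: incseq_def waiting_law_def)
  moreover have "(\<Union>n. {0..real n}) = {0..}" by (auto intro: real_arch_simple)
  moreover have "(\<lambda>n. emeasure waiting_law {0..real n}) \<longlonglongrightarrow> 1"
  proof -
    have "filterlim (\<lambda>n. cum (real n)) at_top sequentially"
    proof (rule filterlim_at_top_mono)
      show "filterlim (\<lambda>n. lo * real n) at_top sequentially"
        using lo by (intro filterlim_tendsto_pos_mult_at_top[OF tendsto_const] filterlim_real_sequentially) auto
      show "\<forall>\<^sub>F n in sequentially. lo * real n \<le> cum (real n)"
        using cum_bounds(1)[of 0] by (simp add: cum_0)
    qed
    then have "(\<lambda>n. exp (- cum (real n))) \<longlonglongrightarrow> 0"
      by (intro filterlim_compose[OF exp_at_bot] filterlim_compose[OF filterlim_uminus_at_bot_at_top])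
    then have "(\<lambda>n. ennreal (1 - exp (- cum (real n)))) \<longlonglongrightarrow> ennreal (1 - 0)"
      by (intro tendsto_intros)
    then show ?thesis by (simp add: emeasure_waiting_law_Icc)
  qed
  ultimately show ?thesis using LIMSEQ_unique by metis
qed

lemma emeasure_waiting_law_Ioi:
  assumes "0 \<le> t" shows "emeasure waiting_law {t<..} = ennreal (exp (- cum t))"
proof -
  have "emeasure waiting_law {t<..} = emeasure waiting_law ({0..} - {0..t})"
    using assms by (intro arg_cong[where f="emeasure waiting_law"]) auto
  also have "\<dots> = 1 - ennreal (1 - exp (- cum t))"
    using assms by (subst emeasure_Diff)
      (auto simp: emeasure_waiting_law_Icc emeasure_waiting_law_UNIV, auto simp: waiting_law_def)
  also have "\<dots> = ennreal (exp (- cum t))"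
    using cum_nonneg[OF assms] by (subst ennreal_1[symmetric], subst ennreal_minus) auto
  finally show ?thesis .
qed

end

text \<open>The density of \<open>point_process_law\<close> as a measure on pairs of time and mark.
  This makes the conditional law of the next event a kernel, which can be composed, shifted in time
  and reweighted.\<close>

definition event_law :: "market \<Rightarrow> (real \<Rightarrow> mark \<Rightarrow> real) \<Rightarrow> event measure" where
  "event_law M \<rho> = density (lborel \<Otimes>\<^sub>M count_space (marks M))
     (\<lambda>(s, x). if 0 \<le> s then
        ennreal (\<rho> s x * exp (- (LINT u:{0..s}|lborel. \<Sum>y\<in>marks M. \<rho> u y))) else 0)"

lemma sets_event_law [simp, measurable_cong]: "sets (event_law M \<rho>) = sets (event_space M)"
  unfolding event_law_def event_space_def sets_density
  by (rule sets_pair_measure_cong) auto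

lemma space_event_law [simp]: "space (event_law M \<rho>) = space (event_space M)"
  by (rule sets_eq_imp_space_eq) simp

section \<open>Measurability on event and record spaces\<close>

lemma space_event_space: "space (event_space M) = UNIV \<times> marks M"
  by (simp add: event_space_def space_pair_measure)

lemma space_record_space: "space (record_space M) = {\<omega>. \<forall>k. snd (\<omega> k) \<in> marks M}"
  by (auto simp: record_space_def space_PiM PiE_iff space_event_space mem_Times_iff)

lemma finite_marks: "finite (menu M) \<Longrightarrow> finite (marks M)"
  by (simp add: marks_def)

lemma Purchase_in_marks [simp]: "Purchase \<in> marks M"
  by (simp add: marks_def)

lemma record_nth_measurable [measurable]: "(\<lambda>\<omega>. \<omega> k) \<in> record_space M \<rightarrow>\<^sub>M event_space M"
  unfolding record_space_def by measurable

lemma fst_event_measurable [measurable]: "fst \<in> event_space M \<rightarrow>\<^sub>M borel"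
  unfolding event_space_def by measurable

lemma snd_event_measurable [measurable]: "snd \<in> event_space M \<rightarrow>\<^sub>M count_space (marks M)"
  unfolding event_space_def by measurable

lemma event_section_measurable:
  assumes "f \<in> event_space M \<rightarrow>\<^sub>M N" "x \<in> marks M"
  shows "(\<lambda>s. f (s, x)) \<in> borel \<rightarrow>\<^sub>M N"
proof -
  have "(\<lambda>s. (s, x)) \<in> borel \<rightarrow>\<^sub>M event_space M"
    unfolding event_space_def using assms(2) by (intro measurable_Pair) auto
  then show ?thesis by (rule measurable_compose[OF _ assms(1)])
qed

lemma arrival_measurable [measurable]: "(\<lambda>\<omega>. arrival \<omega> n) \<in> borel_measurable (record_space M)"
  unfolding arrival_def by measurable

lemma measurable_into_record_space:
  assumes "\<And>k. (\<lambda>x. f x k) \<in> N \<rightarrow>\<^sub>M event_space M"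
  shows "f \<in> N \<rightarrow>\<^sub>M record_space M"
proof -
  have "(\<lambda>x k. f x k) \<in> N \<rightarrow>\<^sub>M record_space M"
    unfolding record_space_def
  proof (rule measurable_PiM_single')
    show "(\<lambda>x k. f x k) \<in> space N \<rightarrow> (\<Pi>\<^sub>E i\<in>UNIV. space (event_space M))"
      using measurable_space[OF assms] by (auto simp: PiE_iff)
  qed (use assms in simp)
  then show ?thesis by simp
qed

text \<open>Records keep their length, so a history of \<open>n\<close> events is represented by a record with
  dummy events from index \<open>n\<close> on.\<close>

definition trunc :: "nat \<Rightarrow> public_record \<Rightarrow> public_record" where
  "trunc n \<omega> k = (if k < n then \<omega> k else (0, Purchase))"

lemma dummy_event [simp]: "(0, Purchase) \<in> space (event_space M)"
  by (simp add: space_event_space)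

lemma trunc_measurable [measurable]: "trunc n \<in> record_space M \<rightarrow>\<^sub>M record_space M"
  by (rule measurable_into_record_space) (simp add: trunc_def)

lemma trunc_measurable_PiM [measurable]: "trunc n \<in> PiM {..<n} (\<lambda>_. event_space M) \<rightarrow>\<^sub>M record_space M"
proof (rule measurable_into_record_space)
  fix k show "(\<lambda>x. trunc n x k) \<in> PiM {..<n} (\<lambda>_. event_space M) \<rightarrow>\<^sub>M event_space M"
    by (cases "k < n") (simp_all add: trunc_def)
qed

lemma trunc_restrict [simp]: "trunc n (restrict \<omega> {..<n}) = trunc n \<omega>"
  by (auto simp: trunc_def)

lemma upd_measurable [measurable]:
  "(\<lambda>(\<omega>, e). fun_upd \<omega> n e) \<in> record_space M \<Otimes>\<^sub>M event_space M \<rightarrow>\<^sub>M record_space M"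
proof (rule measurable_into_record_space)
  fix k show "(\<lambda>x. (case x of (\<omega>, e) \<Rightarrow> fun_upd \<omega> n e) k) \<in> record_space M \<Otimes>\<^sub>M event_space M \<rightarrow>\<^sub>M event_space M"
    by (cases "k = n") (simp_all add: case_prod_beta)
qed

lemma history_trunc [simp]: "k \<le> n \<Longrightarrow> history (trunc n \<omega>) k = history \<omega> k"
  by (auto simp: history_def trunc_def)

lemma trunc_trunc [simp]: "trunc k (trunc n \<omega>) = trunc (min k n) \<omega>"
  by (auto simp: trunc_def)

lemma trunc_Suc: "trunc (Suc n) \<omega> = fun_upd (trunc n \<omega>) n (\<omega> n)"
  by (auto simp: trunc_def)

lemma history_Suc: "history \<omega> (Suc n) = history \<omega> n @ [\<omega> n]"
  by (simp add: history_def)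

lemma arrival_Suc: "arrival \<omega> (Suc n) = arrival \<omega> n + fst (\<omega> n)"
  by (simp add: arrival_def)

lemma arrival_trunc [simp]: "k \<le> n \<Longrightarrow> arrival (trunc n \<omega>) k = arrival \<omega> k"
  by (auto simp: arrival_def trunc_def intro!: sum.cong)

section \<open>Competing marks with a common clock\<close>

locale mark_rates =
  fixes M :: market and \<rho> :: "real \<Rightarrow> mark \<Rightarrow> real" and lo hi :: real
  assumes fin: "finite (menu M)"
    and rate_meas [measurable]: "\<And>x. x \<in> marks M \<Longrightarrow> (\<lambda>s. \<rho> (max 0 s) x) \<in> borel_measurable borel"
    and rate_nonneg: "\<And>s x. 0 \<le> s \<Longrightarrow> x \<in> marks M \<Longrightarrow> 0 \<le> \<rho> s x"
    and lo_pos: "lo > 0"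
    and total: "\<And>s. 0 \<le> s \<Longrightarrow> (\<Sum>x\<in>marks M. \<rho> s x) \<in> {lo..hi}"
begin

sublocale hazard "\<lambda>s. \<Sum>x\<in>marks M. \<rho> s x" lo hi
  by standard (use lo_pos total in auto)

lemma nn_integral_event_law:
  assumes f: "f \<in> borel_measurable (event_space M)"
  shows "(\<integral>\<^sup>+e. f e \<partial>event_law M \<rho>) =
    (\<integral>\<^sup>+s\<in>{0..}. (\<Sum>x\<in>marks M. ennreal (\<rho> s x * exp (- cum s)) * f (s, x)) \<partial>lborel)"
proof -
  let ?d = "\<lambda>(s, x). if 0 \<le> s then ennreal (\<rho> s x * exp (- cum s)) else 0"
  interpret C: sigma_finite_measure "count_space (marks M)"
    by (rule sigma_finite_measure_count_space_finite) (simp add: finite_marks fin)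
  have fm [measurable]: "f \<in> borel_measurable (lborel \<Otimes>\<^sub>M count_space (marks M))"
    using f by (simp add: event_space_def cong: measurable_cong_sets)
  note [measurable] = cum_measurable
  have "?d \<in> borel_measurable (lborel \<Otimes>\<^sub>M count_space (marks M))"
  proof (rule measurable_pair_swap_iff[THEN iffD2], rule measurable_pair_measure_countable1)
    show "countable (marks M)" using finite_marks[OF fin] by (rule countable_finite)
    fix x assume [simp]: "x \<in> marks M"
    have "(\<lambda>s. if 0 \<le> s then ennreal (\<rho> (max 0 s) x * exp (- cum (max 0 s))) else 0) \<in> borel_measurable lborel"
      by measurable
    then show "(\<lambda>y. (\<lambda>(s, x). (\<lambda>(s, x). if 0 \<le> s then ennreal (\<rho> s x * exp (- cum s)) else 0) (x, s)) (x, y)) \<in> borel_measurable lborel"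
      by (rule measurable_cong[THEN iffD1, rotated]) (auto simp: max_def)
  qed
  note d = this
  have "(\<integral>\<^sup>+e. f e \<partial>event_law M \<rho>) = (\<integral>\<^sup>+e. ?d e * f e \<partial>(lborel \<Otimes>\<^sub>M count_space (marks M)))"
    unfolding event_law_def cum_def[symmetric] by (rule nn_integral_density[OF d fm])
  also have "\<dots> = (\<integral>\<^sup>+s. \<integral>\<^sup>+x. ?d (s, x) * f (s, x) \<partial>count_space (marks M) \<partial>lborel)"
    by (rule C.nn_integral_fst[OF borel_measurable_times_ennreal[OF d fm], symmetric])
  also have "\<dots> = (\<integral>\<^sup>+s\<in>{0..}. (\<Sum>x\<in>marks M. ennreal (\<rho> s x * exp (- cum s)) * f (s, x)) \<partial>lborel)"
    by (intro nn_integral_cong)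
       (auto simp: nn_integral_count_space_finite[OF finite_marks[OF fin]] indicator_def)
  finally show ?thesis .
qed

lemma nn_integral_event_law_fst:
  assumes [measurable]: "f \<in> borel_measurable borel"
  shows "(\<integral>\<^sup>+e. f (fst e) \<partial>event_law M \<rho>) = (\<integral>\<^sup>+s. f s \<partial>waiting_law)"
proof -
  have "(\<integral>\<^sup>+e. f (fst e) \<partial>event_law M \<rho>)
     = (\<integral>\<^sup>+s. (if 0 \<le> s then ennreal ((\<Sum>x\<in>marks M. \<rho> s x) * exp (- cum s)) else 0) * f s \<partial>lborel)"
    by (subst nn_integral_event_law)
       (auto intro!: nn_integral_cong simp: indicator_def sum_distrib_right sum_ennreal rate_nonneg simp flip: sum_distrib_right)
  also have "\<dots> = (\<integral>\<^sup>+s. f s \<partial>waiting_law)"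
    unfolding waiting_law_def using waiting_density_meas by (subst nn_integral_density) auto
  finally show ?thesis .
qed

lemma emeasure_event_law_fst:
  assumes [measurable]: "A \<in> sets borel"
  shows "emeasure (event_law M \<rho>) {e\<in>space (event_space M). fst e \<in> A} = emeasure waiting_law A"
proof -
  have "emeasure (event_law M \<rho>) {e\<in>space (event_space M). fst e \<in> A}
     = (\<integral>\<^sup>+e. indicator {e\<in>space (event_space M). fst e \<in> A} e \<partial>event_law M \<rho>)"
    by (intro nn_integral_indicator[symmetric]) (simp, measurable)
  also have "\<dots> = (\<integral>\<^sup>+e. indicator A (fst e) \<partial>event_law M \<rho>)"
    by (intro nn_integral_cong) (auto simp: indicator_def)
  also have "\<dots> = emeasure waiting_law A"
    by (subst nn_integral_event_law_fst) (auto simp: waiting_law_def)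
  finally show ?thesis .
qed

lemma waiting_law_support: "emeasure waiting_law {..<0} = 0"
  unfolding waiting_law_def using waiting_density_meas
  by (subst emeasure_density) (auto intro!: nn_integral_zero' AE_I2 simp: indicator_def)

lemma prob_space_event_law: "prob_space (event_law M \<rho>)"
proof
  have "emeasure (event_law M \<rho>) (space (event_law M \<rho>)) = emeasure waiting_law UNIV"
    using emeasure_event_law_fst[of UNIV] by simp
  also have "\<dots> = emeasure waiting_law ({..<0} \<union> {0..})" by (intro arg_cong[where f="emeasure waiting_law"]) auto
  also have "\<dots> = 1"
    using waiting_law_support emeasure_waiting_law_UNIV
    by (subst plus_emeasure[symmetric]) (auto simp: waiting_law_def)
  finally show "emeasure (event_law M \<rho>) (space (event_law M \<rho>)) = 1" .
qed

lemma emeasure_event_law_gt: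
  "0 \<le> t \<Longrightarrow> emeasure (event_law M \<rho>) {e\<in>space (event_space M). t < fst e} = ennreal (exp (- cum t))"
  using emeasure_event_law_fst[of "{t<..}"] emeasure_waiting_law_Ioi by simp

lemma AE_event_law_pos: "AE e in event_law M \<rho>. 0 < fst e"
proof -
  interpret prob_space "event_law M \<rho>" by (rule prob_space_event_law)
  have "prob {e\<in>space (event_law M \<rho>). 0 < fst e} = 1"
    using emeasure_event_law_gt[of 0] by (simp add: cum_0 measure_def)
  then have "AE e in event_law M \<rho>. e \<in> {e\<in>space (event_law M \<rho>). 0 < fst e}"
    by (intro prob_eq_1[THEN iffD1]) auto
  then show ?thesis by eventually_elim auto
qed

text \<open>A wait exceeds 1 with probability at least \<open>exp (- hi)\<close>, and then its
  Laplace factor is at most \<open>exp (-1)\<close>; otherwise the factor is at most 1. The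
  resulting constant is below 1 and the same for all rates with total at most
  \<open>hi\<close>.\<close>

lemma laplace_event_law:
  "(\<integral>\<^sup>+e. ennreal (exp (- fst e)) \<partial>event_law M \<rho>) \<le> ennreal (1 - (1 - exp (-1)) * exp (- hi))"
proof -
  interpret prob_space "event_law M \<rho>" by (rule prob_space_event_law)
  let ?A = "{e\<in>space (event_space M). 1 < fst e}"
  have "?A \<in> sets (event_space M)" by measurable
  then have A [measurable]: "?A \<in> sets (event_law M \<rho>)" by simp
  have int: "integrable (event_law M \<rho>) (\<lambda>e. 1 - (1 - exp (-1)) * indicator ?A e :: real)"
    using A by (intro Bochner_Integration.integrable_diff integrable_mult_right integrable_real_indicator)
      (auto simp: less_top[symmetric])
  have pA: "prob ?A = exp (- cum 1)" using emeasure_event_law_gt[of 1] by (simp add: measure_def)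
  have c1: "cum 1 \<le> hi" using cum_bounds(2)[of 0 1] by (simp add: cum_0)
  have "(\<integral>\<^sup>+e. ennreal (exp (- fst e)) \<partial>event_law M \<rho>)
      \<le> (\<integral>\<^sup>+e. ennreal (1 - (1 - exp (-1)) * indicator ?A e) \<partial>event_law M \<rho>)"
  proof (rule nn_integral_mono_AE)
    show "AE e in event_law M \<rho>. ennreal (exp (- fst e)) \<le> ennreal (1 - (1 - exp (-1)) * indicator ?A e)"
      using AE_event_law_pos AE_space
      by eventually_elim (auto simp: indicator_def intro!: ennreal_leI)
  qed
  also have "\<dots> = ennreal (\<integral>e. 1 - (1 - exp (-1)) * indicator ?A e \<partial>event_law M \<rho>)"
    by (intro nn_integral_eq_integral int AE_I2) (auto simp: indicator_def)
  also have "(\<integral>e. (1::real) - (1 - exp (-1)) * indicator ?A e \<partial>event_law M \<rho>) = 1 - (1 - exp (-1)) * exp (- cum 1)"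
  proof -
    have "integrable (event_law M \<rho>) (indicator ?A :: _ \<Rightarrow> real)"
      using A by (intro integrable_real_indicator) (auto simp: less_top[symmetric])
    then have "(\<integral>e. 1 - (1 - exp (-1)) * indicator ?A e \<partial>event_law M \<rho>)
       = (\<integral>e. (1::real) \<partial>event_law M \<rho>) - (1 - exp (-1)) * (\<integral>e. indicator ?A e \<partial>event_law M \<rho>)"
      by (subst Bochner_Integration.integral_diff) (auto simp del: lebesgue_integral_const)
    then show ?thesis using A pA prob_space by simp
  qed
  also have "\<dots> \<le> 1 - (1 - exp (-1)) * exp (- hi)"
    using c1 by (intro diff_mono mult_left_mono) auto
  finally show ?thesis by (simp add: ennreal_leI)
qed

text \<open>The right-hand side is the inner integral of \<open>point_process_law\<close>, so this
  ties the kernel to the definition.\<close>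

lemma measure_event_law_rect:
  assumes t: "0 \<le> t" and x: "x \<in> marks M"
  shows "measure (event_law M \<rho>) {e\<in>space (event_space M). fst e \<le> t \<and> snd e = x}
    = (LINT s:{0..t}|lborel. \<rho> s x * exp (- (LINT u:{0..s}|lborel. \<Sum>y\<in>marks M. \<rho> u y)))"
proof -
  have [measurable]: "{x} \<in> sets (count_space (marks M))" using x by auto
  let ?A = "{e\<in>space (event_space M). fst e \<le> t \<and> snd e \<in> {x}}"
  have A: "?A \<in> sets (event_space M)" by measurable
  note [measurable] = cum_measurable
  have int: "set_integrable lborel {0..t} (\<lambda>s. \<rho> s x * exp (- cum s))"
  proof (rule set_integrable_bounded_halfline)
    show "(\<lambda>s. \<rho> (max 0 s) x * exp (- cum (max 0 s))) \<in> borel_measurable borel"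
      using x by measurable
    fix s :: real assume s: "0 \<le> s"
    have "\<rho> s x \<le> (\<Sum>x\<in>marks M. \<rho> s x)"
      using x s by (intro member_le_sum) (auto simp: finite_marks fin rate_nonneg)
    then have "\<rho> s x \<le> hi" using total[OF s] by auto
    then show "\<bar>\<rho> s x * exp (- cum s)\<bar> \<le> hi"
      using rate_nonneg[OF s x] cum_nonneg[OF s] mult_mono[of "\<rho> s x" hi "exp (- cum s)" 1]
      by (auto simp: abs_mult)
  qed simp
  have "emeasure (event_law M \<rho>) ?A = (\<integral>\<^sup>+e. indicator ?A e \<partial>event_law M \<rho>)"
    using A by simp
  also have "\<dots> = (\<integral>\<^sup>+s\<in>{0..}. (\<Sum>y\<in>marks M. ennreal (\<rho> s y * exp (- cum s)) * indicator ?A (s, y)) \<partial>lborel)"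
    using A by (intro nn_integral_event_law) auto
  also have "\<dots> = (\<integral>\<^sup>+s\<in>{0..t}. ennreal (\<rho> s x * exp (- cum s)) \<partial>lborel)"
  proof (rule nn_integral_cong)
    fix s :: real
    have "(\<Sum>y\<in>marks M. ennreal (\<rho> s y * exp (- cum s)) * indicator ?A (s, y))
      = (\<Sum>y\<in>marks M. if y = x then ennreal (\<rho> s x * exp (- cum s)) * indicator {..t} s else 0)"
      by (intro sum.cong) (auto simp: indicator_def space_event_space)
    then show "(\<Sum>y\<in>marks M. ennreal (\<rho> s y * exp (- cum s)) * indicator ?A (s, y)) * indicator {0..} s
      = ennreal (\<rho> s x * exp (- cum s)) * indicator {0..t} s"
      using x by (cases "0 \<le> s"; cases "s \<le> t") (simp_all add: finite_marks fin)
  qed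
  also have "\<dots> = ennreal (LINT s:{0..t}|lborel. \<rho> s x * exp (- cum s))"
    by (rule set_nn_integral_eq_LINT[OF int]) (use rate_nonneg x in auto)
  finally have "measure (event_law M \<rho>) ?A = enn2real (ennreal (LINT s:{0..t}|lborel. \<rho> s x * exp (- cum s)))"
    by (simp add: measure_def)
  also have "\<dots> = (LINT s:{0..t}|lborel. \<rho> s x * exp (- cum s))"
    unfolding set_lebesgue_integral_def using rate_nonneg x
    by (intro enn2real_ennreal integral_nonneg_AE AE_I2) (auto simp: indicator_def)
  finally show ?thesis by (simp add: cum_def)
qed

end

lemma event_law_cong:
  assumes "\<And>s x. 0 \<le> s \<Longrightarrow> x \<in> marks M \<Longrightarrow> \<rho> s x = \<rho>' s x"
  shows "event_law M \<rho> = event_law M \<rho>'"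
proof -
  have "(LINT u:{0..s}|lborel. \<Sum>y\<in>marks M. \<rho> u y) = (LINT u:{0..s}|lborel. \<Sum>y\<in>marks M. \<rho>' u y)" for s
    using assms by (intro set_lebesgue_integral_cong) auto
  note I = this
  have "(if 0 \<le> s then ennreal (\<rho> s x * exp (- (LINT u:{0..s}|lborel. \<Sum>y\<in>marks M. \<rho> u y))) else 0)
      = (if 0 \<le> s then ennreal (\<rho>' s x * exp (- (LINT u:{0..s}|lborel. \<Sum>y\<in>marks M. \<rho>' u y))) else 0)"
    if "x \<in> marks M" for s x
    using assms[OF _ that] by (simp add: I)
  then show ?thesis
    unfolding event_law_def density_def
    by (intro arg_cong2[where f = "measure_of _"] refl ext nn_integral_cong) (auto simp: space_pair_measure)
qed

lemma measurable_event_law: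
  assumes rates: "\<And>a. a \<in> space N \<Longrightarrow> mark_rates M (\<rho> a) lo hi"
    and meas: "\<And>x. x \<in> marks M \<Longrightarrow> (\<lambda>(a, s). \<rho> a (max 0 s) x) \<in> borel_measurable (N \<Otimes>\<^sub>M borel)"
  shows "(\<lambda>a. event_law M (\<rho> a)) \<in> N \<rightarrow>\<^sub>M prob_algebra (event_space M)"
proof (intro measurable_prob_algebraI measurable_subprob_algebra)
  show "prob_space (event_law M (\<rho> a))" if "a \<in> space N" for a
    using mark_rates.prob_space_event_law[OF rates[OF that]] .
  then show "subprob_space (event_law M (\<rho> a))" if "a \<in> space N" for a
    using that prob_space_imp_subprob_space by blast
  fix A assume A: "A \<in> sets (event_space M)"
  show "(\<lambda>a. emeasure (event_law M (\<rho> a)) A) \<in> borel_measurable N"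
  proof (cases "space N = {}")
    case False
    then obtain a0 where "a0 \<in> space N" by auto
    then have fin: "finite (menu M)" using rates mark_rates.fin by blast
    define R where "R a u = (\<Sum>y\<in>marks M. \<rho> a (max 0 u) y)" for a u
    have R [measurable]: "case_prod R \<in> borel_measurable (N \<Otimes>\<^sub>M borel)"
      unfolding R_def case_prod_beta using meas by (intro borel_measurable_sum) (simp add: case_prod_beta)
    \<comment> \<open>The cumulated total rate as an integral over the whole line with a case
      distinction in the integrand: in this form it is jointly measurable in the parameter and the
      time.\<close>
    define I where "I a s = (\<integral>u. (if 0 \<le> u \<and> u \<le> s then R a u else 0) \<partial>lborel)" for a s
    have [measurable]: "(\<lambda>p. R (fst (fst p)) (snd p)) \<in> borel_measurable ((N \<Otimes>\<^sub>M borel) \<Otimes>\<^sub>M lborel)"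
      using measurable_compose[OF _ R, of "\<lambda>p. (fst (fst p), snd p)" "(N \<Otimes>\<^sub>M borel) \<Otimes>\<^sub>M lborel"] by simp
    have "(\<lambda>p. if 0 \<le> snd p \<and> snd p \<le> snd (fst p) then R (fst (fst p)) (snd p) else 0)
        \<in> borel_measurable ((N \<Otimes>\<^sub>M borel) \<Otimes>\<^sub>M lborel)"
      by measurable
    then have I [measurable]: "case_prod I \<in> borel_measurable (N \<Otimes>\<^sub>M borel)"
      unfolding I_def case_prod_beta by (intro lborel.borel_measurable_lebesgue_integral) (simp add: case_prod_beta)
    note A_sec = event_section_measurable[OF borel_measurable_indicator[OF A]]
    have "(\<lambda>(a, s). (\<Sum>x\<in>marks M. ennreal (\<rho> a (max 0 s) x * exp (- I a (max 0 s))) * indicator A (s, x)) * indicator {0..} s)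
       \<in> borel_measurable (N \<Otimes>\<^sub>M borel)"
    proof -
      have "(\<lambda>p. ennreal (\<rho> (fst p) (max 0 (snd p)) x * exp (- I (fst p) (max 0 (snd p)))) * indicator A (snd p, x))
         \<in> borel_measurable (N \<Otimes>\<^sub>M borel)" if x: "x \<in> marks M" for x
      proof -
        have [measurable]: "(\<lambda>p. \<rho> (fst p) (max 0 (snd p)) x) \<in> borel_measurable (N \<Otimes>\<^sub>M borel)"
          using meas[OF x] by (simp add: case_prod_beta)
        have [measurable]: "(\<lambda>p. I (fst p) (max 0 (snd p))) \<in> borel_measurable (N \<Otimes>\<^sub>M borel)"
        proof -
          have "(\<lambda>p. case_prod I (fst p, max 0 (snd p))) \<in> borel_measurable (N \<Otimes>\<^sub>M borel)"
            by (rule measurable_compose[OF _ I]) measurable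
          then show ?thesis by simp
        qed
        have [measurable]: "(\<lambda>p. indicator A (snd p, x)::ennreal) \<in> borel_measurable (N \<Otimes>\<^sub>M borel)"
          by (rule measurable_compose[OF measurable_snd A_sec[OF x]])
        show ?thesis by measurable
      qed
      then have [measurable]: "(\<lambda>p. \<Sum>x\<in>marks M. ennreal (\<rho> (fst p) (max 0 (snd p)) x * exp (- I (fst p) (max 0 (snd p)))) * indicator A (snd p, x))
         \<in> borel_measurable (N \<Otimes>\<^sub>M borel)"
        by (rule borel_measurable_sum)
      show ?thesis unfolding case_prod_beta by measurable
    qed
    then have "(\<lambda>a. \<integral>\<^sup>+s\<in>{0..}. (\<Sum>x\<in>marks M. ennreal (\<rho> a (max 0 s) x * exp (- I a (max 0 s))) * indicator A (s, x)) \<partial>lborel)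
       \<in> borel_measurable N"
      by (intro lborel.borel_measurable_nn_integral) (simp add: case_prod_beta)
    moreover have "emeasure (event_law M (\<rho> a)) A =
      (\<integral>\<^sup>+s\<in>{0..}. (\<Sum>x\<in>marks M. ennreal (\<rho> a (max 0 s) x * exp (- I a (max 0 s))) * indicator A (s, x)) \<partial>lborel)"
      if a: "a \<in> space N" for a
    proof -
      interpret mark_rates M "\<rho> a" lo hi by (rule rates[OF a])
      have "cum s = I a s" for s
        unfolding cum_def I_def R_def set_lebesgue_integral_def
        by (intro Bochner_Integration.integral_cong) (auto simp: indicator_def)
      then show ?thesis using A
        by (subst nn_integral_indicator[symmetric], simp, subst nn_integral_event_law)
           (auto intro!: nn_integral_cong simp: indicator_def)
    qed
    ultimately show ?thesis by (simp cong: measurable_cong)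
  qed (simp add: measurable_def)
qed simp

section \<open>Point processes with history-dependent intensities\<close>

text \<open>The bounds are uniform in the history. The Laplace estimate therefore has the same
  constant at every event, which is what excludes explosion.\<close>

definition rate_family :: "market \<Rightarrow> (event list \<Rightarrow> real \<Rightarrow> mark \<Rightarrow> real) \<Rightarrow> real \<Rightarrow> real \<Rightarrow> bool" where
  "rate_family M r lo hi \<longleftrightarrow>
     (\<forall>n. \<forall>\<omega>\<in>space (record_space M). mark_rates M (r (history \<omega> n)) lo hi) \<and>
     (\<forall>n. \<forall>x\<in>marks M. (\<lambda>(\<omega>, s). r (history \<omega> n) (max 0 s) x) \<in> borel_measurable (record_space M \<Otimes>\<^sub>M borel))"

lemma rate_familyD:
  assumes "rate_family M r lo hi" "\<omega> \<in> space (record_space M)"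
  shows "mark_rates M (r (history \<omega> n)) lo hi"
  using assms by (auto simp: rate_family_def)

lemma rate_family_kernel:
  "rate_family M r lo hi \<Longrightarrow>
    (\<lambda>\<omega>. event_law M (r (history \<omega> n))) \<in> record_space M \<rightarrow>\<^sub>M prob_algebra (event_space M)"
  by (rule measurable_event_law) (auto simp: rate_family_def)

text \<open>Disintegration at index \<open>n\<close>: the truncated record and the next event
  together are distributed as the truncated record followed by the kernel. Testing with all
  nonnegative measurable functions, instead of the rectangles of \<open>point_process_law\<close>,
  suits changes of measure and induction on \<open>n\<close>.\<close>

definition next_event_law ::
  "market \<Rightarrow> (event list \<Rightarrow> real \<Rightarrow> mark \<Rightarrow> real) \<Rightarrow> public_record measure \<Rightarrow> nat \<Rightarrow> bool" where
  "next_event_law M r Q n \<longleftrightarrow>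
    (\<forall>f\<in>borel_measurable (record_space M \<Otimes>\<^sub>M event_space M).
      (\<integral>\<^sup>+\<omega>. f (trunc n \<omega>, \<omega> n) \<partial>Q) =
      (\<integral>\<^sup>+\<omega>. \<integral>\<^sup>+e. f (trunc n \<omega>, e) \<partial>event_law M (r (history \<omega> n)) \<partial>Q))"

lemma next_event_lawD:
  assumes "next_event_law M r Q n" "f \<in> borel_measurable (record_space M \<Otimes>\<^sub>M event_space M)"
  shows "(\<integral>\<^sup>+\<omega>. f (trunc n \<omega>, \<omega> n) \<partial>Q) =
    (\<integral>\<^sup>+\<omega>. \<integral>\<^sup>+e. f (trunc n \<omega>, e) \<partial>event_law M (r (history \<omega> n)) \<partial>Q)"
  using assms by (simp add: next_event_law_def)

lemma measure_eqI_atMost: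
  fixes N1 N2 :: "real measure"
  assumes "sets N1 = sets borel" "sets N2 = sets borel" "finite_measure N1"
    and eq: "\<And>t. emeasure N1 {..t} = emeasure N2 {..t}"
  shows "N1 = N2"
proof (rule measure_eqI_generator_eq[where E = "range atMost" and \<Omega> = UNIV and A = "\<lambda>n. {..real n}"])
  show "Int_stable (range (atMost :: real \<Rightarrow> real set))"
    by (auto simp: Int_stable_def)
  show "sets N1 = sigma_sets UNIV (range atMost)" "sets N2 = sigma_sets UNIV (range atMost)"
    using assms(1,2) unfolding borel_eq_atMost by auto
  show "(\<Union>n. {..real n}) = UNIV" by (auto intro: real_arch_simple)
  show "emeasure N1 {..real n} \<noteq> \<infinity>" for n using finite_measure.emeasure_finite[OF assms(3)] by simp
qed (use eq in auto)

text \<open>The hypothesis covers only half-lines of times and single marks. For a fixed mark and a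
  fixed first factor, half-lines determine a measure on the line; summing over the finitely many
  marks reaches every set of events; rectangles then generate the product.\<close>

lemma joint_event_law_eqI:
  assumes fin: "finite (menu M)"
    and S: "sets P1 = sets (N \<Otimes>\<^sub>M event_space M)" "sets P2 = sets (N \<Otimes>\<^sub>M event_space M)"
    and P1: "prob_space P1"
    and eq: "\<And>A t x. A \<in> sets N \<Longrightarrow> x \<in> marks M \<Longrightarrow>
      emeasure P1 (A \<times> ({..t} \<times> {x})) = emeasure P2 (A \<times> ({..t} \<times> {x}))"
  shows "P1 = P2"
proof -
  interpret P1: prob_space P1 by fact
  have sub: "C \<times> {x} \<in> sets (event_space M)" if "C \<in> sets borel" "x \<in> marks M" for C x
    unfolding event_space_def using that by auto
  have rect: "emeasure P1 (A \<times> (C \<times> {x})) = emeasure P2 (A \<times> (C \<times> {x}))"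
    if A: "A \<in> sets N" and x: "x \<in> marks M" and C: "C \<in> sets borel" for A C x
  proof -
    have SA [measurable]: "A \<times> (UNIV \<times> {x}) \<in> sets (N \<Otimes>\<^sub>M event_space M)"
      using A sub[OF _ x, of UNIV] by auto
    define D where "D P = distr (restrict_space P (A \<times> (UNIV \<times> {x}))) borel (\<lambda>z. fst (snd z))"
      for P :: "('a \<times> event) measure"
    have D: "emeasure (D P) C = emeasure P (A \<times> (C \<times> {x}))"
      if P: "sets P = sets (N \<Otimes>\<^sub>M event_space M)" and C: "C \<in> sets borel" for P C
    proof -
      have spP: "space P = space N \<times> (UNIV \<times> marks M)"
        using sets_eq_imp_space_eq[OF P] by (simp add: space_pair_measure space_event_space)
      have m: "(\<lambda>z. fst (snd z)) \<in> P \<rightarrow>\<^sub>M borel"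
        unfolding measurable_cong_sets[OF P refl] by measurable
      have e: "(\<lambda>z. fst (snd z)) -` C \<inter> space (restrict_space P (A \<times> (UNIV \<times> {x}))) = A \<times> (C \<times> {x})"
        using sets.sets_into_space[OF A] x by (auto simp: space_restrict_space spP)
      show ?thesis
      proof -
        have "A \<times> UNIV \<times> {x} \<inter> space P = A \<times> UNIV \<times> {x}"
          using sets.sets_into_space[OF A] x by (auto simp: spP)
        then show ?thesis
          unfolding D_def using P SA emeasure_distr[OF measurable_restrict_space1[OF m] C, of "A \<times> UNIV \<times> {x}"] e sub[OF C x] A
          by (simp add: emeasure_restrict_space)
      qed
    qed
    have "D P1 = D P2"
    proof (rule measure_eqI_atMost)
      show "finite_measure (D P1)"
        by (rule finite_measureI) (use D[OF S(1), of UNIV] in \<open>simp add: D_def\<close>)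
      show "emeasure (D P1) {..t} = emeasure (D P2) {..t}" for t
        using D S eq[OF A x] by simp
    qed (simp_all add: D_def)
    then show ?thesis using D[OF S(1) C] D[OF S(2) C] by simp
  qed
  have rect': "emeasure P1 (A \<times> B) = emeasure P2 (A \<times> B)" if A: "A \<in> sets N" and B: "B \<in> sets (event_space M)" for A B
  proof -
    define C where "C x = (\<lambda>s. (s, x)) -` B" for x
    have C: "C x \<in> sets borel" if "x \<in> marks M" for x
    proof -
      have "(\<lambda>s. (s, x)) \<in> borel \<rightarrow>\<^sub>M event_space M"
        unfolding event_space_def using that by (intro measurable_Pair) auto
      from measurable_sets[OF this B] show ?thesis by (simp add: C_def)
    qed
    have AB: "A \<times> B = (\<Union>x\<in>marks M. A \<times> (C x \<times> {x}))"
      using sets.sets_into_space[OF B] by (auto simp: C_def space_event_space)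
    have "emeasure P (A \<times> B) = (\<Sum>x\<in>marks M. emeasure P (A \<times> (C x \<times> {x})))"
      if "sets P = sets (N \<Otimes>\<^sub>M event_space M)" for P
      unfolding AB using A C sub finite_marks[OF fin]
      by (intro sum_emeasure[symmetric]) (auto simp: that disjoint_family_on_def)
    then show ?thesis using rect[OF A _ C] S by simp
  qed
  show ?thesis
  proof (rule measure_eqI_generator_eq[OF Int_stable_pair_measure_generator[of N "event_space M"]])
    let ?E = "{a \<times> b |a b. a \<in> sets N \<and> b \<in> sets (event_space M)}"
    show "?E \<subseteq> Pow (space N \<times> space (event_space M))"
      using sets.space_closed[of N] sets.space_closed[of "event_space M"] by auto
    show "sets P1 = sigma_sets (space N \<times> space (event_space M)) ?E"
      unfolding S(1) by (rule sets_pair_measure)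
    show "sets P2 = sigma_sets (space N \<times> space (event_space M)) ?E"
      unfolding S(2) by (rule sets_pair_measure)
    have E: "space N \<times> space (event_space M) \<in> ?E"
      by (rule CollectI, intro exI conjI, rule refl) (rule sets.top)+
    show "range (\<lambda>_::nat. space N \<times> space (event_space M)) \<subseteq> ?E" by (rule image_subsetI) (rule E)
    show "(\<Union>i::nat. space N \<times> space (event_space M)) = space N \<times> space (event_space M)" by simp
    show "emeasure P1 (space N \<times> space (event_space M)) \<noteq> \<infinity>" by simp
    fix X assume "X \<in> ?E"
    then obtain a b where X: "X = a \<times> b" "a \<in> sets N" "b \<in> sets (event_space M)" by blast
    show "emeasure P1 X = emeasure P2 X" unfolding X(1) by (rule rect'[OF X(2,3)])
  qed
qed

lemma emeasure_joint_rect: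
  assumes Q: "sets Q = sets (record_space M)" and A: "A \<in> sets (record_space M)" and x: "x \<in> marks M"
  shows "emeasure (distr Q (record_space M \<Otimes>\<^sub>M event_space M) (\<lambda>\<omega>. (trunc n \<omega>, \<omega> n))) (A \<times> ({..t} \<times> {x}))
    = emeasure Q {\<omega>\<in>space Q. trunc n \<omega> \<in> A \<and> fst (\<omega> n) \<le> t \<and> snd (\<omega> n) = x}"
proof -
  have "(\<lambda>\<omega>. (trunc n \<omega>, \<omega> n)) \<in> Q \<rightarrow>\<^sub>M record_space M \<Otimes>\<^sub>M event_space M"
    unfolding measurable_cong_sets[OF Q refl] by measurable
  moreover have "{..t} \<times> {x} \<in> sets (event_space M)"
    unfolding event_space_def using x by auto
  ultimately show ?thesis
    using A by (subst emeasure_distr) (auto intro!: arg_cong[where f = "emeasure Q"] simp: mem_Times_iff)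
qed

text \<open>The semidirect product of the law of the truncated record with the event kernel.\<close>

definition joint_next ::
  "market \<Rightarrow> (event list \<Rightarrow> real \<Rightarrow> mark \<Rightarrow> real) \<Rightarrow> public_record measure \<Rightarrow> nat \<Rightarrow> (public_record \<times> event) measure" where
  "joint_next M r Q n = Q \<bind> (\<lambda>\<omega>. distr (event_law M (r (history \<omega> n)))
     (record_space M \<Otimes>\<^sub>M event_space M) (Pair (trunc n \<omega>)))"

lemma joint_next_kernel:
  assumes "rate_family M r lo hi"
  shows "(\<lambda>\<omega>. distr (event_law M (r (history \<omega> n))) (record_space M \<Otimes>\<^sub>M event_space M) (Pair (trunc n \<omega>)))
    \<in> record_space M \<rightarrow>\<^sub>M prob_algebra (record_space M \<Otimes>\<^sub>M event_space M)"
  using rate_family_kernel[OF assms]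
  by (rule measurable_distr_prob_space2) (simp add: case_prod_beta)

lemma in_prob_algebra: "prob_space Q \<Longrightarrow> sets Q = sets N \<Longrightarrow> Q \<in> space (prob_algebra N)"
  by (simp add: space_prob_algebra)

lemma sets_joint_next:
  assumes "rate_family M r lo hi" "prob_space Q" "sets Q = sets (record_space M)"
  shows "sets (joint_next M r Q n) = sets (record_space M \<Otimes>\<^sub>M event_space M)"
  unfolding joint_next_def
  by (rule sets_bind'[OF in_prob_algebra[OF assms(2,3)] joint_next_kernel[OF assms(1)]])

lemma nn_integral_joint_next:
  assumes rf: "rate_family M r lo hi" and Q: "prob_space Q" "sets Q = sets (record_space M)"
    and f: "f \<in> borel_measurable (record_space M \<Otimes>\<^sub>M event_space M)"
  shows "(\<integral>\<^sup>+z. f z \<partial>joint_next M r Q n) =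
    (\<integral>\<^sup>+\<omega>. \<integral>\<^sup>+e. f (trunc n \<omega>, e) \<partial>event_law M (r (history \<omega> n)) \<partial>Q)"
proof -
  have "(\<integral>\<^sup>+z. f z \<partial>joint_next M r Q n) =
    (\<integral>\<^sup>+\<omega>. \<integral>\<^sup>+z. f z \<partial>distr (event_law M (r (history \<omega> n))) (record_space M \<Otimes>\<^sub>M event_space M) (Pair (trunc n \<omega>)) \<partial>Q)"
    unfolding joint_next_def
    by (rule nn_integral_bind[OF f])
       (use measurable_prob_algebraD[OF joint_next_kernel[OF rf]] in \<open>simp cong: measurable_cong_sets add: Q(2)\<close>)
  also have "\<dots> = (\<integral>\<^sup>+\<omega>. \<integral>\<^sup>+e. f (trunc n \<omega>, e) \<partial>event_law M (r (history \<omega> n)) \<partial>Q)"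
  proof (rule nn_integral_cong)
    fix \<omega> assume "\<omega> \<in> space Q"
    then have "\<omega> \<in> space (record_space M)" using sets_eq_imp_space_eq[OF Q(2)] by simp
    then have "trunc n \<omega> \<in> space (record_space M)" by (rule measurable_space[OF trunc_measurable])
    then have "Pair (trunc n \<omega>) \<in> event_law M (r (history \<omega> n)) \<rightarrow>\<^sub>M record_space M \<Otimes>\<^sub>M event_space M"
      unfolding measurable_cong_sets[OF sets_event_law refl] by simp
    then show "(\<integral>\<^sup>+z. f z \<partial>distr (event_law M (r (history \<omega> n))) (record_space M \<Otimes>\<^sub>M event_space M) (Pair (trunc n \<omega>)))
      = (\<integral>\<^sup>+e. f (trunc n \<omega>, e) \<partial>event_law M (r (history \<omega> n)))"
      using f by (subst nn_integral_distr) auto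
  qed
  finally show ?thesis .
qed

lemma next_event_law_iff:
  assumes rf: "rate_family M r lo hi" and Q: "prob_space Q" "sets Q = sets (record_space M)"
  shows "next_event_law M r Q n \<longleftrightarrow>
    distr Q (record_space M \<Otimes>\<^sub>M event_space M) (\<lambda>\<omega>. (trunc n \<omega>, \<omega> n)) = joint_next M r Q n"
    (is "_ \<longleftrightarrow> ?P1 = ?P2")
proof -
  have m: "(\<lambda>\<omega>. (trunc n \<omega>, \<omega> n)) \<in> Q \<rightarrow>\<^sub>M record_space M \<Otimes>\<^sub>M event_space M"
    unfolding measurable_cong_sets[OF Q(2) refl] by measurable
  have "next_event_law M r Q n \<longleftrightarrow>
    (\<forall>f\<in>borel_measurable (record_space M \<Otimes>\<^sub>M event_space M). (\<integral>\<^sup>+z. f z \<partial>?P1) = (\<integral>\<^sup>+z. f z \<partial>?P2))"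
    unfolding next_event_law_def
    by (intro ball_cong refl) (simp add: nn_integral_distr[OF m] nn_integral_joint_next[OF rf Q])
  also have "\<dots> \<longleftrightarrow> ?P1 = ?P2"
  proof
    assume *: "\<forall>f\<in>borel_measurable (record_space M \<Otimes>\<^sub>M event_space M). (\<integral>\<^sup>+z. f z \<partial>?P1) = (\<integral>\<^sup>+z. f z \<partial>?P2)"
    show "?P1 = ?P2"
    proof (rule measure_eqI)
      fix A assume A: "A \<in> sets ?P1"
      then have "indicator A \<in> borel_measurable (record_space M \<Otimes>\<^sub>M event_space M)" by auto
      from *[rule_format, OF this] show "emeasure ?P1 A = emeasure ?P2 A"
        using A by (simp add: sets_joint_next[OF rf Q])
    qed (simp add: sets_joint_next[OF rf Q])
  qed auto
  finally show ?thesis .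
qed

text \<open>Translates the definition, which speaks of restrictions to \<open>{..<n}\<close>, of
  rectangles and of integrals of the density, into disintegrations along the event kernel. Existence
  and uniqueness are proved for the latter.\<close>

lemma point_process_law_iff:
  assumes fin: "finite (menu M)" and rf: "rate_family M r lo hi"
    and Q: "prob_space Q" "sets Q = sets (record_space M)"
  shows "point_process_law M r Q \<longleftrightarrow> (\<forall>n. next_event_law M r Q n)"
proof -
  interpret Q: prob_space Q by fact
  note [measurable_cong] = Q(2)
  have spQ: "space Q = space (record_space M)" by (rule sets_eq_imp_space_eq[OF Q(2)])
  have K: "(\<lambda>\<omega>. event_law M (r (history \<omega> n))) \<in> Q \<rightarrow>\<^sub>M subprob_algebra (event_space M)" for n
    using measurable_prob_algebraD[OF rate_family_kernel[OF rf, of n]] by (simp cong: measurable_cong_sets add: Q(2))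
  have mr: "mark_rates M (r (history \<omega> n)) lo hi" if "\<omega> \<in> space Q" for \<omega> n
    using rate_familyD[OF rf] that spQ by simp
  define S where "S t x = {e\<in>space (event_space M). fst e \<le> t \<and> snd e = x}" for t x
  have S: "S t x \<in> sets (event_space M)" "S t x = {..t} \<times> {x}" if "x \<in> marks M" for t x
  proof -
    have [measurable]: "{x} \<in> sets (count_space (marks M))" using that by auto
    have "{e\<in>space (event_space M). fst e \<le> t \<and> snd e \<in> {x}} \<in> sets (event_space M)" by measurable
    then show "S t x \<in> sets (event_space M)" by (simp add: S_def)
    show "S t x = {..t} \<times> {x}" using that by (auto simp: S_def space_event_space)
  qed
  define G where "G n t x \<omega> = measure (event_law M (r (history \<omega> n))) (S t x)" for n t x \<omega>
  have Gm [measurable]: "G n t x \<in> borel_measurable Q" if "x \<in> marks M" for n t x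
    unfolding G_def using K[of n] S(1)[OF that] by (rule measurable_compose[OF _ measurable_measure_subprob_algebra])
  have Gb: "\<bar>G n t x \<omega>\<bar> \<le> 1" "0 \<le> G n t x \<omega>" if "\<omega> \<in> space Q" for n t x \<omega>
    using prob_space.prob_le_1[OF mark_rates.prob_space_event_law[OF mr[OF that]]] by (auto simp: G_def)
  have eG: "emeasure (event_law M (r (history \<omega> n))) (S t x) = ennreal (G n t x \<omega>)" if "\<omega> \<in> space Q" for n t x \<omega>
  proof -
    interpret prob_space "event_law M (r (history \<omega> n))" by (rule mark_rates.prob_space_event_law[OF mr[OF that]])
    show ?thesis by (simp add: G_def emeasure_eq_measure)
  qed
  have e1: "emeasure (distr Q (record_space M \<Otimes>\<^sub>M event_space M) (\<lambda>\<omega>. (trunc n \<omega>, \<omega> n))) (A \<times> ({..t} \<times> {x}))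
     = ennreal (measure Q {\<omega>\<in>space Q. trunc n \<omega> \<in> A \<and> fst (\<omega> n) \<le> t \<and> snd (\<omega> n) = x})"
    if "A \<in> sets (record_space M)" "x \<in> marks M" for A x n t
    using that by (subst emeasure_joint_rect[OF Q(2)]) (auto simp: Q.emeasure_eq_measure)
  have e2: "emeasure (joint_next M r Q n) (A \<times> ({..t} \<times> {x}))
     = ennreal (LINT \<omega>:{\<omega>\<in>space Q. trunc n \<omega> \<in> A}|Q. G n t x \<omega>)"
    if A: "A \<in> sets (record_space M)" and x: "x \<in> marks M" for A x n t
  proof -
    have AS: "A \<times> S t x \<in> sets (record_space M \<Otimes>\<^sub>M event_space M)" using A S(1)[OF x] by auto
    have TA: "{\<omega>\<in>space Q. trunc n \<omega> \<in> A} \<in> sets Q"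
      using A by measurable
    have "emeasure (joint_next M r Q n) (A \<times> S t x) = (\<integral>\<^sup>+z. indicator (A \<times> S t x) z \<partial>joint_next M r Q n)"
      using AS by (simp add: sets_joint_next[OF rf Q])
    also have "\<dots> = (\<integral>\<^sup>+\<omega>. \<integral>\<^sup>+e. indicator (A \<times> S t x) (trunc n \<omega>, e) \<partial>event_law M (r (history \<omega> n)) \<partial>Q)"
      using AS by (intro nn_integral_joint_next[OF rf Q]) auto
    also have "\<dots> = (\<integral>\<^sup>+\<omega>\<in>{\<omega>\<in>space Q. trunc n \<omega> \<in> A}. ennreal (G n t x \<omega>) \<partial>Q)"
    proof (rule nn_integral_cong)
      fix \<omega> assume w: "\<omega> \<in> space Q"
      have "(\<integral>\<^sup>+e. indicator (A \<times> S t x) (trunc n \<omega>, e) \<partial>event_law M (r (history \<omega> n)))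
        = (\<integral>\<^sup>+e. indicator A (trunc n \<omega>) * indicator (S t x) e \<partial>event_law M (r (history \<omega> n)))"
        by (intro nn_integral_cong) (auto simp: indicator_def)
      also have "\<dots> = indicator A (trunc n \<omega>) * ennreal (G n t x \<omega>)"
        using S(1)[OF x]
        by (subst nn_integral_cmult) (auto simp: eG[OF w] measurable_cong_sets[OF sets_event_law refl])
      finally show "(\<integral>\<^sup>+e. indicator (A \<times> S t x) (trunc n \<omega>, e) \<partial>event_law M (r (history \<omega> n)))
         = ennreal (G n t x \<omega>) * indicator {\<omega>\<in>space Q. trunc n \<omega> \<in> A} \<omega>"
        using w by (auto simp: indicator_def)
    qed
    also have "\<dots> = ennreal (LINT \<omega>:{\<omega>\<in>space Q. trunc n \<omega> \<in> A}|Q. G n t x \<omega>)"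
    proof (rule set_nn_integral_eq_LINT)
      show "set_integrable Q {\<omega>\<in>space Q. trunc n \<omega> \<in> A} (G n t x)"
        unfolding set_integrable_def
        using TA Gb Gm[OF x] by (intro Q.integrable_const_bound[of _ 1]) (auto simp: indicator_def)
    qed (use Gb in auto)
    finally show ?thesis using S(2)[OF x] by simp
  qed
  have Gt: "(LINT \<omega>:{\<omega>\<in>space Q. trunc n \<omega> \<in> A}|Q. G n t x \<omega>)
     = (LINT \<omega>:{\<omega>\<in>space Q. trunc n \<omega> \<in> A}|Q. LINT s:{0..t}|lborel.
             r (history \<omega> n) s x * exp (- (LINT u:{0..s}|lborel. \<Sum>y\<in>marks M. r (history \<omega> n) u y)))"
    if "0 \<le> t" "x \<in> marks M" for n t x A
    unfolding G_def S_def set_lebesgue_integral_def[of Q]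
    by (intro Bochner_Integration.integral_cong refl) (simp add: mark_rates.measure_event_law_rect[OF mr that])
  define eqn where "eqn n A t x \<longleftrightarrow> measure Q {\<omega>\<in>space Q. trunc n \<omega> \<in> A \<and> fst (\<omega> n) \<le> t \<and> snd (\<omega> n) = x}
     = (LINT \<omega>:{\<omega>\<in>space Q. trunc n \<omega> \<in> A}|Q. G n t x \<omega>)" for n A t x
  have restr: "(\<lambda>\<omega>. restrict \<omega> {..<n}) \<in> record_space M \<rightarrow>\<^sub>M PiM {..<n} (\<lambda>_. event_space M)" for n
    unfolding record_space_def by (rule measurable_restrict_subset) simp
  have restr_trunc: "restrict (trunc n \<omega>) {..<n} = restrict \<omega> {..<n}" for n \<omega> by (auto simp: trunc_def)
  \<comment> \<open>Sets of restrictions to \<open>{..<n}\<close> and sets of truncated records are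
    preimages of each other under measurable maps, so both families of test sets give the same
    equations.\<close>
  have ppl: "point_process_law M r Q \<longleftrightarrow> (\<forall>n. \<forall>A\<in>sets (record_space M). \<forall>t\<ge>0. \<forall>x\<in>marks M. eqn n A t x)"
  proof
    assume P: "point_process_law M r Q"
    show "\<forall>n. \<forall>A\<in>sets (record_space M). \<forall>t\<ge>0. \<forall>x\<in>marks M. eqn n A t x"
    proof (intro allI ballI impI)
      fix n A t x assume A: "A \<in> sets (record_space M)" and t: "0 \<le> (t::real)" and x: "x \<in> marks M"
      define B where "B = trunc n -` A \<inter> space (PiM {..<n} (\<lambda>_. event_space M))"
      have B: "B \<in> sets (PiM {..<n} (\<lambda>_. event_space M))" unfolding B_def by (rule measurable_sets[OF trunc_measurable_PiM A])
      have BA: "restrict \<omega> {..<n} \<in> B \<longleftrightarrow> trunc n \<omega> \<in> A" if "\<omega> \<in> space Q" for \<omega>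
        using measurable_space[OF restr] that spQ by (simp add: B_def)
      show "eqn n A t x" unfolding eqn_def Gt[OF t x]
      proof -
        have s: "{\<omega> \<in> space Q. restrict \<omega> {..<n} \<in> B \<and> P \<omega>} = {\<omega> \<in> space Q. trunc n \<omega> \<in> A \<and> P \<omega>}" for P
          using BA by auto
        show "measure Q {\<omega>\<in>space Q. trunc n \<omega> \<in> A \<and> fst (\<omega> n) \<le> t \<and> snd (\<omega> n) = x}
          = (LINT \<omega>:{\<omega>\<in>space Q. trunc n \<omega> \<in> A}|Q. LINT s:{0..t}|lborel.
             r (history \<omega> n) s x * exp (- (LINT u:{0..s}|lborel. \<Sum>y\<in>marks M. r (history \<omega> n) u y)))"
          using P[unfolded point_process_law_def, THEN conjunct2, THEN conjunct2, rule_format, OF B t x]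
          unfolding s s[of "\<lambda>_. True", simplified] .
      qed
    qed
  next
    assume E: "\<forall>n. \<forall>A\<in>sets (record_space M). \<forall>t\<ge>0. \<forall>x\<in>marks M. eqn n A t x"
    show "point_process_law M r Q"
      unfolding point_process_law_def
    proof (intro conjI allI ballI impI Q)
      fix n :: nat and B t x assume B: "B \<in> sets (PiM {..<n} (\<lambda>_. event_space M))" and t: "0 \<le> (t::real)" and x: "x \<in> marks M"
      define A where "A = (\<lambda>\<omega>::public_record. restrict \<omega> {..<n}) -` B \<inter> space (record_space M)"
      have A: "A \<in> sets (record_space M)" unfolding A_def by (rule measurable_sets[OF restr B])
      have BA: "trunc n \<omega> \<in> A \<longleftrightarrow> restrict \<omega> {..<n} \<in> B" if "\<omega> \<in> space Q" for \<omega>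
        using measurable_space[OF trunc_measurable] that spQ by (simp add: A_def restr_trunc)
      show "measure Q {\<omega> \<in> space Q. restrict \<omega> {..<n} \<in> B \<and> fst (\<omega> n) \<le> t \<and> snd (\<omega> n) = x}
      = (LINT \<omega>:{\<omega> \<in> space Q. restrict \<omega> {..<n} \<in> B}|Q.
           LINT s:{0..t}|lborel. r (history \<omega> n) s x *
             exp (- (LINT u:{0..s}|lborel. \<Sum>y\<in>marks M. r (history \<omega> n) u y)))"
        using E[rule_format, OF A t x, of n, unfolded eqn_def Gt[OF t x]] by (simp add: BA cong: conj_cong)
    qed
  qed
  \<comment> \<open>The definition tests \<open>t \<ge> 0\<close> only, while half-lines with every
    real end point are used to determine the law; nonpositive times carry no mass.\<close>
  have G_le0: "G n t x \<omega> = 0" if "t \<le> 0" "\<omega> \<in> space Q" for n t x \<omega>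
  proof -
    interpret mark_rates M "r (history \<omega> n)" lo hi by (rule mr[OF that(2)])
    interpret prob_space "event_law M (r (history \<omega> n))" by (rule prob_space_event_law)
    have "AE e in event_law M (r (history \<omega> n)). e \<notin> S t x"
      using AE_event_law_pos by eventually_elim (use that in \<open>auto simp: S_def\<close>)
    then show ?thesis unfolding G_def
      by (cases "S t x \<in> events") (auto simp: prob_eq_0 measure_notin_sets)
  qed
  have "(\<forall>A\<in>sets (record_space M). \<forall>t\<ge>0. \<forall>x\<in>marks M. eqn n A t x) \<longleftrightarrow> next_event_law M r Q n" for n
  proof
    assume E: "\<forall>A\<in>sets (record_space M). \<forall>t\<ge>0. \<forall>x\<in>marks M. eqn n A t x"
    have E': "eqn n A t x" if A: "A \<in> sets (record_space M)" and x: "x \<in> marks M" for A t x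
    proof (cases "0 \<le> t")
      case False
      have z: "(LINT \<omega>:{\<omega>\<in>space Q. trunc n \<omega> \<in> A}|Q. G n t' x \<omega>) = 0" if "t' \<le> 0" for t'
        unfolding set_lebesgue_integral_def by (rule integral_eq_zero_AE) (use G_le0 that in auto)
      have "measure Q {\<omega>\<in>space Q. trunc n \<omega> \<in> A \<and> fst (\<omega> n) \<le> t \<and> snd (\<omega> n) = x}
        \<le> measure Q {\<omega>\<in>space Q. trunc n \<omega> \<in> A \<and> fst (\<omega> n) \<le> 0 \<and> snd (\<omega> n) = x}"
      proof (rule Q.finite_measure_mono)
        have [measurable]: "{x} \<in> sets (count_space (marks M))" "A \<in> sets (record_space M)" using x A by auto
        have "{\<omega>\<in>space Q. trunc n \<omega> \<in> A \<and> fst (\<omega> n) \<le> 0 \<and> snd (\<omega> n) \<in> {x}} \<in> sets Q" by measurable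
        then show "{\<omega>\<in>space Q. trunc n \<omega> \<in> A \<and> fst (\<omega> n) \<le> 0 \<and> snd (\<omega> n) = x} \<in> sets Q" by simp
      qed (use False in auto)
      also have "\<dots> = 0" using E[rule_format, OF A order_refl x] by (simp add: eqn_def z)
      finally show ?thesis using False by (simp add: eqn_def z measure_le_0_iff)
    qed (use E A x in auto)
    show "next_event_law M r Q n"
      unfolding next_event_law_iff[OF rf Q]
    proof (rule joint_event_law_eqI[OF fin _ sets_joint_next[OF rf Q]])
      show "prob_space (distr Q (record_space M \<Otimes>\<^sub>M event_space M) (\<lambda>\<omega>. (trunc n \<omega>, \<omega> n)))"
        by (rule Q.prob_space_distr) measurable
      fix A t x assume "A \<in> sets (record_space M)" "x \<in> marks M"
      then show "emeasure (distr Q (record_space M \<Otimes>\<^sub>M event_space M) (\<lambda>\<omega>. (trunc n \<omega>, \<omega> n))) (A \<times> ({..t} \<times> {x}))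
        = emeasure (joint_next M r Q n) (A \<times> ({..t} \<times> {x}))"
        using E'[of A x t] by (simp add: e1 e2 eqn_def)
    qed simp
  next
    assume N: "next_event_law M r Q n"
    show "\<forall>A\<in>sets (record_space M). \<forall>t\<ge>0. \<forall>x\<in>marks M. eqn n A t x"
    proof (intro ballI allI impI)
      fix A t x assume A: "A \<in> sets (record_space M)" and x: "x \<in> marks M"
      have "ennreal (measure Q {\<omega>\<in>space Q. trunc n \<omega> \<in> A \<and> fst (\<omega> n) \<le> t \<and> snd (\<omega> n) = x})
        = ennreal (LINT \<omega>:{\<omega>\<in>space Q. trunc n \<omega> \<in> A}|Q. G n t x \<omega>)"
        using N unfolding next_event_law_iff[OF rf Q] e1[OF A x, symmetric] e2[OF A x, symmetric] by simp
      moreover have "0 \<le> (LINT \<omega>:{\<omega>\<in>space Q. trunc n \<omega> \<in> A}|Q. G n t x \<omega>)"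
        unfolding set_lebesgue_integral_def using Gb
        by (intro integral_nonneg_AE AE_I2) (auto simp: indicator_def)
      ultimately show "eqn n A t x" by (simp add: eqn_def)
    qed
  qed
  then show ?thesis unfolding ppl by blast
qed

lemma point_process_law_rate_cong:
  assumes "\<And>\<omega> n s x. \<omega> \<in> space (record_space M) \<Longrightarrow> 0 \<le> s \<Longrightarrow> x \<in> marks M \<Longrightarrow>
    r (history \<omega> n) s x = r' (history \<omega> n) s x"
    and rf: "rate_family M r lo hi"
  shows "rate_family M r' lo hi"
proof -
  have "mark_rates M (r' (history \<omega> n)) lo hi" if w: "\<omega> \<in> space (record_space M)" for \<omega> n
  proof -
    interpret mark_rates M "r (history \<omega> n)" lo hi by (rule rate_familyD[OF rf w])
    note eq = assms(1)[OF w, of _ _ n]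
    show ?thesis
    proof
      show "(\<lambda>s. r' (history \<omega> n) (max 0 s) x) \<in> borel_measurable borel" if "x \<in> marks M" for x
        using rate_meas[OF that] by (simp add: eq that)
      show "(\<Sum>x\<in>marks M. r' (history \<omega> n) s x) \<in> {lo..hi}" if "0 \<le> s" for s
        using total[OF that] eq that by (simp cong: sum.cong)
    qed (use fin rate_nonneg lo_pos eq in auto)
  qed
  moreover have "(\<lambda>(\<omega>, s). r' (history \<omega> n) (max 0 s) x) \<in> borel_measurable (record_space M \<Otimes>\<^sub>M borel)"
    if x: "x \<in> marks M" for n x
  proof -
    have "(\<lambda>(\<omega>, s). r (history \<omega> n) (max 0 s) x) \<in> borel_measurable (record_space M \<Otimes>\<^sub>M borel)"
      using rf x by (simp add: rate_family_def)
    then show ?thesis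
      by (rule measurable_cong[THEN iffD1, rotated]) (auto simp: space_pair_measure assms(1) x)
  qed
  ultimately show ?thesis by (simp add: rate_family_def)
qed

lemma kernel_integral_measurable:
  assumes "rate_family M r lo hi" and f: "f \<in> borel_measurable (record_space M \<Otimes>\<^sub>M event_space M)"
  shows "(\<lambda>\<omega>. \<integral>\<^sup>+e. f (\<omega>, e) \<partial>event_law M (r (history \<omega> n))) \<in> borel_measurable (record_space M)"
  by (rule nn_integral_measurable_subprob_algebra2[OF _ measurable_prob_algebraD[OF rate_family_kernel[OF assms(1)]]])
     (use f in simp)

definition same_trunc_law ::
  "market \<Rightarrow> public_record measure \<Rightarrow> public_record measure \<Rightarrow> nat \<Rightarrow> bool" where
  "same_trunc_law M Q Q' n \<longleftrightarrow> (\<forall>f\<in>borel_measurable (record_space M).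
     (\<integral>\<^sup>+\<omega>. f (trunc n \<omega>) \<partial>Q) = (\<integral>\<^sup>+\<omega>. f (trunc n \<omega>) \<partial>Q'))"

lemma same_trunc_lawD:
  "same_trunc_law M Q Q' n \<Longrightarrow> f \<in> borel_measurable (record_space M) \<Longrightarrow>
     (\<integral>\<^sup>+\<omega>. f (trunc n \<omega>) \<partial>Q) = (\<integral>\<^sup>+\<omega>. f (trunc n \<omega>) \<partial>Q')"
  by (simp add: same_trunc_law_def)

lemma same_trunc_law_0:
  assumes "prob_space Q" "prob_space Q'"
  shows "same_trunc_law M Q Q' 0"
proof -
  have [simp]: "trunc 0 \<omega> = (\<lambda>_. (0, Purchase))" for \<omega> by (auto simp: trunc_def)
  show ?thesis
    using prob_space.emeasure_space_1[OF assms(1)] prob_space.emeasure_space_1[OF assms(2)]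
    by (simp add: same_trunc_law_def)
qed

text \<open>Agreement of the kernels is asked on \<open>Q\<close>-almost every history only. For two
  laws with the same rates this is trivial; for a reputation, which is determined up to null sets,
  it is the essential case.\<close>

lemma same_trunc_law_Suc:
  assumes rf: "rate_family M r' lo hi"
    and N: "next_event_law M r Q n" and N': "next_event_law M r' Q' n"
    and eq: "same_trunc_law M Q Q' n"
    and ae: "AE \<omega> in Q. event_law M (r (history \<omega> n)) = event_law M (r' (history \<omega> n))"
  shows "same_trunc_law M Q Q' (Suc n)"
  unfolding same_trunc_law_def
proof
  fix f :: "public_record \<Rightarrow> ennreal" assume f: "f \<in> borel_measurable (record_space M)"
  define g where "g = (\<lambda>(\<omega>, e). f (fun_upd \<omega> n e))"
  have g: "g \<in> borel_measurable (record_space M \<Otimes>\<^sub>M event_space M)"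
    unfolding g_def using measurable_compose[OF upd_measurable f] by (simp add: case_prod_beta)
  define F where "F \<omega> = (\<integral>\<^sup>+e. g (\<omega>, e) \<partial>event_law M (r' (history \<omega> n)))" for \<omega>
  have F: "F \<in> borel_measurable (record_space M)"
    unfolding F_def by (rule kernel_integral_measurable[OF rf g])
  have fg: "f (trunc (Suc n) \<omega>) = g (trunc n \<omega>, \<omega> n)" for \<omega> by (simp add: g_def trunc_Suc)
  have "(\<integral>\<^sup>+\<omega>. f (trunc (Suc n) \<omega>) \<partial>Q) = (\<integral>\<^sup>+\<omega>. \<integral>\<^sup>+e. g (trunc n \<omega>, e) \<partial>event_law M (r (history \<omega> n)) \<partial>Q)"
    unfolding fg by (rule next_event_lawD[OF N g])
  also have "\<dots> = (\<integral>\<^sup>+\<omega>. F (trunc n \<omega>) \<partial>Q)"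
    by (rule nn_integral_cong_AE) (use ae in \<open>eventually_elim, simp add: F_def\<close>)
  also have "\<dots> = (\<integral>\<^sup>+\<omega>. F (trunc n \<omega>) \<partial>Q')"
    by (rule same_trunc_lawD[OF eq F])
  also have "\<dots> = (\<integral>\<^sup>+\<omega>. f (trunc (Suc n) \<omega>) \<partial>Q')"
    unfolding fg F_def by (simp add: next_event_lawD[OF N' g])
  finally show "(\<integral>\<^sup>+\<omega>. f (trunc (Suc n) \<omega>) \<partial>Q) = (\<integral>\<^sup>+\<omega>. f (trunc (Suc n) \<omega>) \<partial>Q')" .
qed

text \<open>A cylinder over finitely many indices is decided by a truncation, and cylinders
  determine a finite measure on the infinite product.\<close>

lemma record_measure_eqI:
  assumes Q: "prob_space Q" "sets Q = sets (record_space M)" and Q': "sets Q' = sets (record_space M)"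
    and eq: "\<And>n. same_trunc_law M Q Q' n"
  shows "Q = Q'"
proof (rule measure_eqI_PiM_infinite)
  show "sets Q = sets (PiM UNIV (\<lambda>_. event_space M))" "sets Q' = sets (PiM UNIV (\<lambda>_. event_space M))"
    using Q(2) Q' by (simp_all add: record_space_def)
  show "finite_measure Q" by (rule prob_space_imp_subprob_space[OF Q(1), THEN subprob_space.axioms(1)])
  fix A and J :: "nat set" assume J: "finite J" and A: "\<And>i. i \<in> J \<Longrightarrow> A i \<in> sets (event_space M)"
  define X where "X = prod_emb UNIV (\<lambda>_. event_space M) J (Pi\<^sub>E J A)"
  have X: "X \<in> sets (record_space M)" unfolding X_def record_space_def
    using J A by (intro sets_PiM_I) auto
  obtain n where n: "J \<subseteq> {..<n}" using J finite_nat_iff_bounded by auto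
  have tX: "trunc n \<omega> \<in> X \<longleftrightarrow> \<omega> \<in> X" if "\<omega> \<in> space (record_space M)" for \<omega>
  proof -
    have "restrict (trunc n \<omega>) J = restrict \<omega> J" using n by (intro restrict_ext) (auto simp: trunc_def)
    then show ?thesis using that measurable_space[OF trunc_measurable that, of n]
      unfolding X_def prod_emb_def record_space_def space_PiM by auto
  qed
  have "emeasure R X = (\<integral>\<^sup>+\<omega>. indicator X (trunc n \<omega>) \<partial>R)" if R: "sets R = sets (record_space M)" for R
  proof -
    have "emeasure R X = (\<integral>\<^sup>+\<omega>. indicator X \<omega> \<partial>R)" using X R by simp
    also have "\<dots> = (\<integral>\<^sup>+\<omega>. indicator X (trunc n \<omega>) \<partial>R)"
      using sets_eq_imp_space_eq[OF R] tX by (intro nn_integral_cong) (auto simp: indicator_def)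
    finally show ?thesis .
  qed
  then show "emeasure Q X = emeasure Q' X"
    using same_trunc_lawD[OF eq[of n], of "indicator X"] X Q(2) Q' by auto
qed

lemma point_process_lawD:
  assumes "point_process_law M r Q"
  shows "prob_space Q" "sets Q = sets (record_space M)"
  using assms by (simp_all add: point_process_law_def)

lemma point_process_law_next:
  assumes "finite (menu M)" "rate_family M r lo hi" "point_process_law M r Q"
  shows "next_event_law M r Q n"
  using point_process_law_iff[OF assms(1,2) point_process_lawD[OF assms(3)]] assms(3) by blast

lemma point_process_law_unique:
  assumes fin: "finite (menu M)" and rf: "rate_family M r lo hi"
    and Q: "point_process_law M r Q" and Q': "point_process_law M r Q'"
  shows "Q = Q'"
proof (rule record_measure_eqI[OF point_process_lawD[OF Q] point_process_lawD(2)[OF Q']])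
  show "same_trunc_law M Q Q' n" for n
  proof (induction n)
    case 0 show ?case by (rule same_trunc_law_0[OF point_process_lawD(1)[OF Q] point_process_lawD(1)[OF Q']])
  next
    case (Suc n) show ?case
      by (rule same_trunc_law_Suc[OF rf point_process_law_next[OF fin rf Q] point_process_law_next[OF fin rf Q'] Suc]) simp
  qed
qed

text \<open>The Ionescu-Tulcea kernels are maps on finite products; they read a partial record
  through \<open>trunc\<close>, which pads it with dummy events to a full record.\<close>

lemma point_process_law_exists:
  assumes fin: "finite (menu M)" and rf: "rate_family M r lo hi"
  shows "\<exists>Q. point_process_law M r Q"
proof -
  let ?E = "\<lambda>_::nat. event_space M"
  have tr: "trunc n \<in> PiM {0..<m} ?E \<rightarrow>\<^sub>M record_space M" if "n \<le> m" for n m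
  proof (rule measurable_into_record_space)
    fix k show "(\<lambda>x. trunc n x k) \<in> PiM {0..<m} ?E \<rightarrow>\<^sub>M event_space M"
      using that by (cases "k < n") (simp_all add: trunc_def)
  qed
  have trunc_restrict0: "trunc n (restrict \<omega> {0..<n}) = trunc n \<omega>" for n and \<omega> :: public_record
    by (auto simp: trunc_def)
  have trunc_upd: "trunc n (fun_upd h n e) = trunc n h" for n e and h :: public_record
    by (auto simp: trunc_def)
  define P where "P n h = event_law M (r (history (trunc n h) n))" for n h
  have P: "P n \<in> PiM {0..<n} ?E \<rightarrow>\<^sub>M prob_algebra (event_space M)" for n
    unfolding P_def by (rule measurable_compose[OF tr[OF order_refl] rate_family_kernel[OF rf]])
  interpret IT: Ionescu_Tulcea P ?E
  proof (rule Ionescu_Tulcea.intro)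
    show "P n \<in> PiM {0..<n} ?E \<rightarrow>\<^sub>M subprob_algebra (event_space M)" for n
      by (rule measurable_prob_algebraD[OF P])
  qed (use measurable_space[OF P] in \<open>simp add: space_prob_algebra\<close>)
  let ?Q = "IT.PF.lim"
  let ?u = "\<lambda>_::nat. undefined :: event"
  have sQ: "sets ?Q = sets (record_space M)" by (simp add: record_space_def IT.PF.sets_lim)
  \<comment> \<open>Total mass one is read off the marginal on the empty index set, where the
    projective family is known to consist of probabilities.\<close>
  have pQ: "prob_space ?Q"
  proof (rule prob_space_distrD)
    show "(\<lambda>\<omega>. restrict \<omega> {}) \<in> ?Q \<rightarrow>\<^sub>M PiM {} ?E"
      unfolding measurable_cong_sets[OF IT.PF.sets_lim refl] by (rule measurable_restrict_subset) simp
    show "prob_space (distr ?Q (PiM {} ?E) (\<lambda>\<omega>. restrict \<omega> {}))"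
      unfolding IT.distr_lim[OF finite.emptyI] by (rule IT.PF.prob_space_P) simp_all
  qed
  have u: "?u \<in> space (PiM {0..<0} ?E)" by (simp add: space_PiM)
  have fin_law: "(\<integral>\<^sup>+\<omega>. f (restrict \<omega> {0..<n}) \<partial>?Q) = (\<integral>\<^sup>+h. f h \<partial>IT.C 0 n ?u)"
    if f: "f \<in> borel_measurable (PiM {0..<n} ?E)" for f :: "public_record \<Rightarrow> ennreal" and n
  proof -
    have m: "(\<lambda>\<omega>. restrict \<omega> {0..<n}) \<in> ?Q \<rightarrow>\<^sub>M PiM {0..<n} ?E"
      unfolding measurable_cong_sets[OF IT.PF.sets_lim refl] by (rule measurable_restrict_subset) simp
    \<comment> \<open>A marginal of the limit is a projection of the iterated kernels up to the
      index \<open>IT.up_to\<close>; on an initial segment the projection is trivial.\<close>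
    have "IT.up_to {0..<n} = n"
      by (rule antisym) (simp_all add: IT.up_to_iff, metis IT.up_to_iff atLeastLessThan_iff finite_atLeastLessThan le0 linorder_not_less order_refl)
    then have "IT.CI {0..<n} = IT.C 0 n ?u"
      unfolding IT.CI_def using IT.distr_C[OF order_refl u, of n] by simp
    then have "distr ?Q (PiM {0..<n} ?E) (\<lambda>\<omega>. restrict \<omega> {0..<n}) = IT.C 0 n ?u"
      using IT.distr_lim[of "{0..<n}"] by simp
    moreover have "(\<integral>\<^sup>+h. f h \<partial>distr ?Q (PiM {0..<n} ?E) (\<lambda>\<omega>. restrict \<omega> {0..<n})) = (\<integral>\<^sup>+\<omega>. f (restrict \<omega> {0..<n}) \<partial>?Q)"
      by (rule nn_integral_distr[OF m]) (use f in simp)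
    ultimately show ?thesis by simp
  qed
  have "next_event_law M r ?Q n" for n
    unfolding next_event_law_def
  proof
    fix f :: "public_record \<times> event \<Rightarrow> ennreal" assume f: "f \<in> borel_measurable (record_space M \<Otimes>\<^sub>M event_space M)"
    have m1: "(\<lambda>h. f (trunc n h, h n)) \<in> borel_measurable (PiM {0..<Suc n} ?E)"
    proof -
      have "trunc n \<in> PiM {0..<Suc n} ?E \<rightarrow>\<^sub>M record_space M" by (rule tr) simp
      then have "(\<lambda>h. (trunc n h, h n)) \<in> PiM {0..<Suc n} ?E \<rightarrow>\<^sub>M record_space M \<Otimes>\<^sub>M event_space M"
        by (intro measurable_Pair measurable_component_singleton) auto
      then show ?thesis by (rule measurable_compose[OF _ f])
    qed
    have m2: "(\<lambda>h. \<integral>\<^sup>+e. f (trunc n h, e) \<partial>P n h) \<in> borel_measurable (PiM {0..<n} ?E)"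
      unfolding P_def by (rule measurable_compose[OF tr[OF order_refl] kernel_integral_measurable[OF rf f]])
    have "(\<integral>\<^sup>+\<omega>. f (trunc n \<omega>, \<omega> n) \<partial>?Q) = (\<integral>\<^sup>+\<omega>. f (trunc n (restrict \<omega> {0..<Suc n}), restrict \<omega> {0..<Suc n} n) \<partial>?Q)"
      by (intro nn_integral_cong arg_cong[where f = f]) (auto simp: trunc_def)
    also have "\<dots> = (\<integral>\<^sup>+h. f (trunc n h, h n) \<partial>IT.C 0 (Suc n) ?u)"
      by (rule fin_law[OF m1])
    also have "\<dots> = (\<integral>\<^sup>+h. \<integral>\<^sup>+h'. f (trunc n h', h' n) \<partial>IT.eP n h \<partial>IT.C 0 n ?u)"
      unfolding IT.C.simps add_0
      by (rule nn_integral_bind[OF m1]) (use IT.measurable_eP IT.sets_C[OF u] in \<open>simp cong: measurable_cong_sets\<close>)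
    also have "\<dots> = (\<integral>\<^sup>+h. \<integral>\<^sup>+e. f (trunc n h, e) \<partial>P n h \<partial>IT.C 0 n ?u)"
    proof (rule nn_integral_cong)
      fix h assume "h \<in> space (IT.C 0 n ?u)"
      then have "h \<in> space (PiM {0..<n} ?E)" using IT.space_C[OF u] by simp
      then show "(\<integral>\<^sup>+h'. f (trunc n h', h' n) \<partial>IT.eP n h) = (\<integral>\<^sup>+e. f (trunc n h, e) \<partial>P n h)"
        by (subst IT.nn_integral_eP) (use m1 in \<open>simp_all add: trunc_upd\<close>)
    qed
    also have "\<dots> = (\<integral>\<^sup>+\<omega>. \<integral>\<^sup>+e. f (trunc n (restrict \<omega> {0..<n}), e) \<partial>P n (restrict \<omega> {0..<n}) \<partial>?Q)"
      by (rule fin_law[OF m2, symmetric])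
    also have "\<dots> = (\<integral>\<^sup>+\<omega>. \<integral>\<^sup>+e. f (trunc n \<omega>, e) \<partial>event_law M (r (history \<omega> n)) \<partial>?Q)"
      unfolding P_def trunc_restrict0 by simp
    finally show "(\<integral>\<^sup>+\<omega>. f (trunc n \<omega>, \<omega> n) \<partial>?Q)
      = (\<integral>\<^sup>+\<omega>. \<integral>\<^sup>+e. f (trunc n \<omega>, e) \<partial>event_law M (r (history \<omega> n)) \<partial>?Q)" .
  qed
  then have "point_process_law M r ?Q" using point_process_law_iff[OF fin rf pQ sQ] by blast
  then show ?thesis by blast
qed

lemma point_process_AE_pos:
  assumes fin: "finite (menu M)" and rf: "rate_family M r lo hi" and Q: "point_process_law M r Q"
  shows "AE \<omega> in Q. \<forall>n. 0 < fst (\<omega> n)"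
proof -
  note Q' = point_process_lawD[OF Q]
  note [measurable_cong] = Q'(2)
  have spQ: "space Q = space (record_space M)" by (rule sets_eq_imp_space_eq[OF Q'(2)])
  have "AE \<omega> in Q. 0 < fst (\<omega> n)" for n
  proof -
    define f where "f = (\<lambda>p :: public_record \<times> event. indicator {..0} (fst (snd p)) :: ennreal)"
    have f: "f \<in> borel_measurable (record_space M \<Otimes>\<^sub>M event_space M)"
      unfolding f_def by measurable
    have "(\<integral>\<^sup>+\<omega>. indicator {..0} (fst (\<omega> n)) \<partial>Q)
      = (\<integral>\<^sup>+\<omega>. \<integral>\<^sup>+e. indicator {..0} (fst e) \<partial>event_law M (r (history \<omega> n)) \<partial>Q)"
      using next_event_lawD[OF point_process_law_next[OF fin rf Q] f] by (simp add: f_def)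
    also have "\<dots> = (\<integral>\<^sup>+\<omega>. 0 \<partial>Q)"
    proof (rule nn_integral_cong)
      fix \<omega> assume "\<omega> \<in> space Q"
      then interpret mark_rates M "r (history \<omega> n)" lo hi using rate_familyD[OF rf] spQ by simp
      show "(\<integral>\<^sup>+e. indicator {..0} (fst e) \<partial>event_law M (r (history \<omega> n))) = (0::ennreal)"
      proof (rule nn_integral_zero')
        show "AE e in event_law M (r (history \<omega> n)). indicator {..0} (fst e) = (0::ennreal)"
          using AE_event_law_pos by eventually_elim simp
      qed
    qed
    finally have "(\<integral>\<^sup>+\<omega>. indicator {..0} (fst (\<omega> n)) \<partial>Q) = 0" by simp
    then have "AE \<omega> in Q. indicator {..0} (fst (\<omega> n)) = (0::ennreal)"
      by (subst (asm) nn_integral_0_iff_AE) auto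
    then show ?thesis by eventually_elim (auto simp: indicator_def split: if_splits)
  qed
  then show ?thesis by (simp add: AE_all_countable)
qed

text \<open>The expected value of \<open>exp (- arrival \<omega> n)\<close> decays geometrically, by
  \<open>laplace_event_law\<close> at each event. The sum over \<open>n\<close> then has finite
  expectation, so almost surely its terms tend to 0 and the arrivals to infinity.\<close>

lemma point_process_nonexplosive:
  assumes fin: "finite (menu M)" and rf: "rate_family M r lo hi" and Q: "point_process_law M r Q"
  shows "AE \<omega> in Q. nonexplosive \<omega>"
proof -
  note Q' = point_process_lawD[OF Q]
  interpret prob_space Q by (rule Q')
  note [measurable_cong] = Q'(2)
  have spQ: "space Q = space (record_space M)" by (rule sets_eq_imp_space_eq[OF Q'(2)])
  define c where "c = 1 - (1 - exp (-1)) * exp (- hi)"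
  have hi: "0 \<le> hi"
    using mark_rates.lo_pos[OF rate_familyD[OF rf, of "\<lambda>_. (0, Purchase)" 0]]
      mark_rates.total[OF rate_familyD[OF rf, of "\<lambda>_. (0, Purchase)" 0], of 0] by (auto simp: space_record_space)
  have "(1 - exp (-1)) * exp (- hi) \<le> 1 * (1::real)" using hi by (intro mult_mono) auto
  then have c: "0 \<le> c" "c < 1" by (auto simp: c_def)
  have L: "(\<integral>\<^sup>+\<omega>. ennreal (exp (- arrival \<omega> n)) \<partial>Q) \<le> ennreal (c ^ n)" for n
  proof (induction n)
    case 0 then show ?case by (simp add: arrival_def emeasure_space_1)
  next
    case (Suc n)
    define f where "f = (\<lambda>p :: public_record \<times> event. ennreal (exp (- arrival (fst p) n)) * ennreal (exp (- fst (snd p))))"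
    have f: "f \<in> borel_measurable (record_space M \<Otimes>\<^sub>M event_space M)"
      unfolding f_def by measurable
    have "(\<integral>\<^sup>+\<omega>. ennreal (exp (- arrival \<omega> (Suc n))) \<partial>Q) = (\<integral>\<^sup>+\<omega>. f (trunc n \<omega>, \<omega> n) \<partial>Q)"
      by (intro nn_integral_cong) (simp add: f_def arrival_Suc ennreal_mult[symmetric] flip: exp_add)
    also have "\<dots> = (\<integral>\<^sup>+\<omega>. \<integral>\<^sup>+e. f (trunc n \<omega>, e) \<partial>event_law M (r (history \<omega> n)) \<partial>Q)"
      by (rule next_event_lawD[OF point_process_law_next[OF fin rf Q] f])
    also have "\<dots> \<le> (\<integral>\<^sup>+\<omega>. ennreal (exp (- arrival \<omega> n)) * ennreal c \<partial>Q)"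
    proof (rule nn_integral_mono)
      fix \<omega> assume "\<omega> \<in> space Q"
      then interpret R: mark_rates M "r (history \<omega> n)" lo hi using rate_familyD[OF rf] spQ by simp
      have "(\<lambda>e. ennreal (exp (- fst e))) \<in> borel_measurable (event_law M (r (history \<omega> n)))"
        unfolding measurable_cong_sets[OF sets_event_law refl] by measurable
      then have "(\<integral>\<^sup>+e. f (trunc n \<omega>, e) \<partial>event_law M (r (history \<omega> n)))
        = ennreal (exp (- arrival \<omega> n)) * (\<integral>\<^sup>+e. ennreal (exp (- fst e)) \<partial>event_law M (r (history \<omega> n)))"
        by (simp add: f_def nn_integral_cmult)
      also have "\<dots> \<le> ennreal (exp (- arrival \<omega> n)) * ennreal c"
        unfolding c_def by (intro mult_left_mono R.laplace_event_law) simp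
      finally show "(\<integral>\<^sup>+e. f (trunc n \<omega>, e) \<partial>event_law M (r (history \<omega> n))) \<le> ennreal (exp (- arrival \<omega> n)) * ennreal c" .
    qed
    also have "\<dots> = (\<integral>\<^sup>+\<omega>. ennreal (exp (- arrival \<omega> n)) \<partial>Q) * ennreal c"
      by (rule nn_integral_multc) measurable
    also have "\<dots> \<le> ennreal (c ^ n) * ennreal c" by (intro mult_right_mono Suc) simp
    also have "\<dots> = ennreal (c ^ Suc n)" using c by (simp add: ennreal_mult[symmetric] mult.commute)
    finally show ?case .
  qed
  have "(\<integral>\<^sup>+\<omega>. (\<Sum>n. ennreal (exp (- arrival \<omega> n))) \<partial>Q) = (\<Sum>n. \<integral>\<^sup>+\<omega>. ennreal (exp (- arrival \<omega> n)) \<partial>Q)"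
    by (rule nn_integral_suminf) measurable
  also have "\<dots> \<le> (\<Sum>n. ennreal (c ^ n))" by (intro suminf_le L) auto
  also have "\<dots> = ennreal (\<Sum>n. c ^ n)" using c by (intro suminf_ennreal2 summable_geometric) auto
  also have "\<dots> < \<infinity>" by simp
  finally have "AE \<omega> in Q. (\<Sum>n. ennreal (exp (- arrival \<omega> n))) \<noteq> \<infinity>"
    by (intro nn_integral_PInf_AE) auto
  then show ?thesis
  proof eventually_elim
    fix \<omega> assume "(\<Sum>n. ennreal (exp (- arrival \<omega> n))) \<noteq> \<infinity>"
    then have "summable (\<lambda>n. exp (- arrival \<omega> n))" by (intro summable_suminf_not_top) auto
    then have lim: "(\<lambda>n. exp (- arrival \<omega> n)) \<longlonglongrightarrow> 0" by (rule summable_LIMSEQ_zero)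
    show "nonexplosive \<omega>"
      unfolding nonexplosive_def filterlim_at_top
    proof
      fix Z show "\<forall>\<^sub>F n in sequentially. Z \<le> arrival \<omega> n"
        using order_tendstoD(2)[OF lim, of "exp (- Z)"] by (auto elim: eventually_mono)
    qed
  qed
qed

section \<open>The public state process\<close>

locale market_model =
  fixes M :: market
  assumes nu_pos: "nu M > 0" and kappa_pos: "kappa M > 0"
    and prec: "1/2 < prec M" "prec M < 1"
    and fin: "finite (menu M)"
    and act_range: "\<forall>\<mu>\<in>{0..1}. \<forall>p\<in>menu M. act M \<mu> p \<in> {0..1}"
    and act_measurable: "(\<lambda>(\<mu>, p). act M \<mu> p) \<in> borel_measurable (state_space M)"
    and rule_support: "\<forall>\<mu>\<in>{0..1}. \<forall>p\<in>menu M. set_pmf (rule M \<mu> p) \<subseteq> menu M"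
    and rule_measurable:
      "\<forall>p'\<in>menu M. (\<lambda>(\<mu>, p). pmf (rule M \<mu> p) p') \<in> borel_measurable (state_space M)"
    and drift_lipschitz:
      "\<forall>p\<in>menu M. local_lipschitz {p} {0..1} (\<lambda>p \<mu>. drift M \<mu> p (act M \<mu> p))"
begin

abbreviation "Z \<equiv> state_space M"
abbreviation "Ev \<equiv> event_space M"
abbreviation "Rec \<equiv> record_space M"
abbreviation "adrift p \<mu> \<equiv> drift M \<mu> p (act M \<mu> p)"

lemma space_Z: "space Z = {0..1} \<times> menu M"
  by (simp add: state_space_def space_pair_measure)

lemma logistic_bounds: "0 < logistic z" "logistic z < 1"
  by (simp_all add: logistic_def add_pos_pos)

lemma mix_bounds:
  assumes "0 < (x::real)" "x < 1" "0 < y" "y < 1" "0 \<le> c" "c \<le> 1"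
  shows "0 < c * x + (1 - c) * y" "c * x + (1 - c) * y < 1"
proof -
  have "0 < c * x + (1 - c) * y"
    using assms by (cases "c = 0") (auto intro!: add_pos_nonneg)
  moreover have "0 < c * (1 - x) + (1 - c) * (1 - y)"
    using assms by (cases "c = 0") (auto intro!: add_pos_nonneg)
  ultimately show "0 < c * x + (1 - c) * y" "c * x + (1 - c) * y < 1" by (auto simp: algebra_simps)
qed

lemma A_H_bounds: "0 < A_H M l p" "A_H M l p < 1"
  using mix_bounds[of "b_H M l p" "b_L M l p" "prec M"] prec logistic_bounds
  by (auto simp: A_H_def b_H_def b_L_def)

lemma A_L_bounds: "0 < A_L M l p" "A_L M l p < 1"
  using mix_bounds[of "b_H M l p" "b_L M l p" "1 - prec M"] prec logistic_bounds
  by (auto simp: A_L_def b_H_def b_L_def)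

lemma A_S_alt: "A_S M \<mu> p a = a * A_H M (lam \<mu> a) p + (1 - a) * A_L M (lam \<mu> a) p"
  by (simp add: A_S_def DD_def algebra_simps)

lemma A_S_bounds: "0 \<le> a \<Longrightarrow> a \<le> 1 \<Longrightarrow> 0 < A_S M \<mu> p a" "0 \<le> a \<Longrightarrow> a \<le> 1 \<Longrightarrow> A_S M \<mu> p a < 1"
  unfolding A_S_alt by (intro mix_bounds A_H_bounds A_L_bounds; simp)+

lemma A_bar_bounds:
  assumes "0 \<le> a" "a \<le> 1" "0 \<le> \<mu>" "\<mu> \<le> 1"
  shows "0 < A_bar M \<mu> p a" "A_bar M \<mu> p a < 1"
  unfolding A_bar_def using assms by (intro mix_bounds A_H_bounds A_S_bounds; simp)+

lemma A_H_minus_A_S: "A_H M (lam \<mu> a) p - A_S M \<mu> p a = (1 - a) * DD M (lam \<mu> a) p"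
  by (simp add: A_S_alt DD_def algebra_simps)

text \<open>The form in which Bayes' rule produces the drift: type uncertainty
  \<open>\<mu> * (1 - \<mu>)\<close> times the gap between the purchase intensities of the two
  types.\<close>

lemma drift_alt:
  "drift M \<mu> p a = - \<mu> * (1 - \<mu>) * (nu M * (A_H M (lam \<mu> a) p - A_S M \<mu> p a))"
  by (simp add: A_H_minus_A_S drift_def)

lemma jump_bounds:
  assumes "0 \<le> a" "a \<le> 1" "0 \<le> \<mu>" "\<mu> \<le> 1"
  shows "jump M \<mu> p a \<in> {0..1}"
proof -
  have "\<mu> * A_H M (lam \<mu> a) p \<le> A_bar M \<mu> p a"
    unfolding A_bar_def using assms A_S_bounds(1)[of a \<mu> p] by simp
  moreover have "0 \<le> \<mu> * A_H M (lam \<mu> a) p"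
    using assms A_H_bounds(1)[of "lam \<mu> a" p] by simp
  ultimately show ?thesis
    using A_bar_bounds[OF assms, of p] by (simp add: jump_def divide_le_eq)
qed

lemma act_bounds: "\<mu> \<in> {0..1} \<Longrightarrow> p \<in> menu M \<Longrightarrow> 0 \<le> act M \<mu> p \<and> act M \<mu> p \<le> 1"
  using act_range by auto

text \<open>Compactness of the unit interval turns the local Lipschitz condition into a single
  constant, as Picard iteration and the Gronwall estimate require.\<close>

lemma adrift_lipschitz:
  assumes "p \<in> menu M"
  obtains K where "K-lipschitz_on {0..1} (adrift p)"
proof -
  show thesis
  proof (rule local_lipschitz_compact_implies_lipschitz[where X = "{0..1}" and T = "{p}" and f = adrift])
    show "local_lipschitz {p} {0..1} adrift" using drift_lipschitz assms by auto
  qed (use that in auto)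
qed

lemma adrift_0 [simp]: "drift M 0 p a = 0" and adrift_1 [simp]: "drift M 1 p a = 0"
  by (simp_all add: drift_def)

section \<open>The flow of silence paths\<close>

lemma silence_path_exists:
  assumes "p \<in> menu M" "\<mu> \<in> {0..1}"
  shows "\<exists>\<phi>. silence_path M \<mu> p \<phi>"
proof -
  obtain K where "K-lipschitz_on {0..1} (adrift p)" using adrift_lipschitz[OF assms(1)] .
  then obtain x where "x 0 = \<mu>"
    "\<And>s. s \<ge> 0 \<Longrightarrow> x s \<in> {0..1} \<and> (x has_real_derivative adrift p (x s)) (at s within {0..})"
    using lipschitz_ode_exists_unit[of K "adrift p" \<mu>] assms by auto
  then show ?thesis unfolding silence_path_def by blast
qed

lemma silence_path_lipschitz:
  assumes "K-lipschitz_on {0..1} (adrift p)" "silence_path M \<mu> p \<phi>" "silence_path M \<mu>' p \<phi>'" "0 \<le> s"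
  shows "\<bar>\<phi> s - \<phi>' s\<bar> \<le> exp (K * s) * \<bar>\<mu> - \<mu>'\<bar>"
  using gronwall_lipschitz[OF assms(1), of \<phi> \<phi>' s] assms(2-) by (simp add: silence_path_def)

lemma silence_path_unique:
  assumes "p \<in> menu M" "silence_path M \<mu> p \<phi>" "silence_path M \<mu> p \<phi>'" "0 \<le> s"
  shows "\<phi> s = \<phi>' s"
proof -
  obtain K where "K-lipschitz_on {0..1} (adrift p)" using adrift_lipschitz[OF assms(1)] .
  from silence_path_lipschitz[OF this assms(2-4)] show ?thesis by simp
qed

text \<open>The default value \<open>\<mu>\<close> off the domain keeps the flow in the unit
  interval for every price and time, so that \<open>flow_range\<close> has no side condition on
  them.\<close>

definition flow :: "real \<Rightarrow> real \<Rightarrow> real \<Rightarrow> real" where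
  "flow \<mu> p s = (if p \<in> menu M \<and> \<mu> \<in> {0..1} \<and> 0 \<le> s then (SOME \<phi>. silence_path M \<mu> p \<phi>) s else \<mu>)"

lemma flow_silence_path:
  assumes "p \<in> menu M" "\<mu> \<in> {0..1}"
  shows "silence_path M \<mu> p (flow \<mu> p)"
proof -
  define \<phi> where "\<phi> = (SOME \<phi>. silence_path M \<mu> p \<phi>)"
  have \<phi>: "silence_path M \<mu> p \<phi>"
    unfolding \<phi>_def using silence_path_exists[OF assms] by (rule someI_ex)
  have eq: "flow \<mu> p s = \<phi> s" if "0 \<le> s" for s using assms that by (simp add: flow_def \<phi>_def)
  have "(flow \<mu> p has_real_derivative adrift p (flow \<mu> p s)) (at s within {0..})" if "0 \<le> s" for s
    by (rule has_field_derivative_transform_within[OF _ zero_less_one, of \<phi>])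
       (use \<phi> eq that in \<open>auto simp: silence_path_def\<close>)
  then show ?thesis using \<phi> eq by (simp add: silence_path_def)
qed

lemma flow_unique: "p \<in> menu M \<Longrightarrow> \<mu> \<in> {0..1} \<Longrightarrow> silence_path M \<mu> p \<phi> \<Longrightarrow> 0 \<le> s \<Longrightarrow> \<phi> s = flow \<mu> p s"
  using silence_path_unique flow_silence_path by blast

lemma flow_0: "p \<in> menu M \<Longrightarrow> \<mu> \<in> {0..1} \<Longrightarrow> flow \<mu> p 0 = \<mu>"
  using flow_silence_path by (simp add: silence_path_def)

lemma flow_range: "\<mu> \<in> {0..1} \<Longrightarrow> flow \<mu> p s \<in> {0..1}"
  using flow_silence_path[of p \<mu>] unfolding silence_path_def by (cases "p \<in> menu M \<and> 0 \<le> s") (auto simp: flow_def)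

lemma flow_deriv:
  "p \<in> menu M \<Longrightarrow> \<mu> \<in> {0..1} \<Longrightarrow> 0 \<le> s \<Longrightarrow>
    (flow \<mu> p has_real_derivative adrift p (flow \<mu> p s)) (at s within {0..})"
  using flow_silence_path by (simp add: silence_path_def)

lemma flow_fixed:
  assumes "p \<in> menu M" "\<mu> \<in> {0..1}" "adrift p \<mu> = 0" "0 \<le> s"
  shows "flow \<mu> p s = \<mu>"
  by (rule flow_unique[OF assms(1,2) _ assms(4), symmetric])
     (use assms in \<open>auto simp: silence_path_def\<close>)

text \<open>The shifted path is a silence path from its own starting point, and uniqueness
  identifies it.\<close>

lemma flow_add:
  assumes "p \<in> menu M" "\<mu> \<in> {0..1}" "0 \<le> s" "0 \<le> u"
  shows "flow (flow \<mu> p u) p s = flow \<mu> p (s + u)"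
proof (rule flow_unique[OF assms(1) flow_range[OF assms(2)] _ assms(3), symmetric])
  have "((\<lambda>s. flow \<mu> p (s + u)) has_real_derivative adrift p (flow \<mu> p (s + u))) (at s within {0..})"
    if s: "0 \<le> s" for s
  proof -
    have "(flow \<mu> p has_real_derivative adrift p (flow \<mu> p (s + u))) (at (s + u) within (\<lambda>s. s + u) ` {0..})"
      by (rule DERIV_subset[OF flow_deriv]) (use assms s in auto)
    moreover have "((\<lambda>s. s + u) has_real_derivative 1) (at s within {0..})"
      by (auto intro!: derivative_eq_intros)
    ultimately show ?thesis using DERIV_image_chain[of "flow \<mu> p" _ "\<lambda>s. s + u"] by (force simp: o_def)
  qed
  then show "silence_path M (flow \<mu> p u) p (\<lambda>s. flow \<mu> p (s + u))"
    using flow_range[OF assms(2)] by (simp add: silence_path_def)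
qed


lemma continuous_on_flow:
  assumes "p \<in> menu M" "\<mu> \<in> {0..1}"
  shows "continuous_on {0..} (flow \<mu> p)"
  by (rule DERIV_continuous_on) (use flow_deriv[OF assms] in auto)

text \<open>For a fixed price the flow is jointly continuous: the Gronwall estimate bounds the
  effect of the starting point, locally uniformly in time, and each path is continuous in time.
  Clamping both arguments makes this a statement on the whole plane.\<close>

lemma flow_measurable_slice:
  assumes p: "p \<in> menu M"
  shows "(\<lambda>(\<mu>, s). flow \<mu> p s) \<in> borel_measurable (restrict_space borel {0..1} \<Otimes>\<^sub>M borel)"
proof -
  obtain K where K: "K-lipschitz_on {0..1} (adrift p)" using adrift_lipschitz[OF p] .
  define c where "c \<mu> = max 0 (min 1 (\<mu>::real))" for \<mu>
  define g where "g x = flow (c (fst x)) p (max 0 (snd x))" for x :: "real \<times> real"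
  have c: "c \<mu> \<in> {0..1}" for \<mu> by (auto simp: c_def)
  have "isCont g x" for x
  proof -
    \<comment> \<open>A bound for the change of \<open>g\<close> between \<open>x\<close> and
      \<open>y\<close>: the first summand moves the starting point, the second the time. It is
      continuous and vanishes at \<open>x\<close>.\<close>
    define b where "b y = exp (K * max 0 (snd y)) * \<bar>c (fst y) - c (fst x)\<bar>
      + \<bar>flow (c (fst x)) p (max 0 (snd y)) - flow (c (fst x)) p (max 0 (snd x))\<bar>" for y :: "real \<times> real"
    have "continuous_on UNIV (\<lambda>y::real \<times> real. flow (c (fst x)) p (max 0 (snd y)))"
      by (rule continuous_on_compose2[OF continuous_on_flow[OF p c]]) (auto intro!: continuous_intros)
    moreover have "continuous_on UNIV (\<lambda>y::real \<times> real. c (fst y))"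
      unfolding c_def by (intro continuous_intros)
    ultimately have "continuous_on UNIV b"
      unfolding b_def by (intro continuous_intros)
    then have "(b \<longlongrightarrow> b x) (at x)"
      using continuous_on_eq_continuous_at[OF open_UNIV, of b] unfolding isCont_def by blast
    then have "(b \<longlongrightarrow> 0) (at x)" by (simp add: b_def)
    then have "((\<lambda>y. g x - g y) \<longlongrightarrow> 0) (at x)"
    proof (rule Lim_null_comparison[rotated], intro always_eventually allI)
      fix y
      have "\<bar>flow (c (fst y)) p (max 0 (snd y)) - flow (c (fst x)) p (max 0 (snd y))\<bar>
        \<le> exp (K * max 0 (snd y)) * \<bar>c (fst y) - c (fst x)\<bar>"
        by (rule silence_path_lipschitz[OF K flow_silence_path[OF p c] flow_silence_path[OF p c]]) simp
      then show "norm (g x - g y) \<le> b y" unfolding g_def b_def real_norm_def by linarith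
    qed
    then show ?thesis
      unfolding isCont_def using tendsto_diff[OF tendsto_const[of "g x"], of "\<lambda>y. g x - g y" 0 "at x"] by simp
  qed
  then have "continuous_on UNIV g" by (simp add: continuous_on_eq_continuous_at)
  then have "g \<in> borel_measurable (borel \<Otimes>\<^sub>M borel)"
    unfolding borel_prod by (rule borel_measurable_continuous_onI)
  then have gm: "g \<in> borel_measurable (borel \<Otimes>\<^sub>M borel)" .
  have fm [measurable]: "fst \<in> borel_measurable (restrict_space borel {0..1::real} \<Otimes>\<^sub>M (borel :: real measure))"
    using measurable_fst[of "restrict_space borel {0..1::real}" "borel :: real measure"]
    by (simp add: measurable_restrict_space2_iff)
  have [measurable]: "g \<in> borel_measurable (restrict_space borel {0..1} \<Otimes>\<^sub>M borel)"
    using measurable_compose[OF measurable_Pair[OF fm measurable_snd] gm] by simp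
  have "(\<lambda>x. if 0 \<le> snd x then g x else fst x) \<in> borel_measurable (restrict_space borel {0..1} \<Otimes>\<^sub>M borel)"
    by measurable
  then show ?thesis
    by (rule measurable_cong[THEN iffD1, rotated])
       (auto simp: space_pair_measure space_restrict_space g_def c_def flow_def)
qed

section \<open>Measurability in the public state\<close>

lemma fst_Z [measurable]: "fst \<in> Z \<rightarrow>\<^sub>M restrict_space borel {0..1}"
  and snd_Z [measurable]: "snd \<in> Z \<rightarrow>\<^sub>M count_space (menu M)"
  unfolding state_space_def by simp_all

lemma fst_Z_borel [measurable]: "fst \<in> borel_measurable Z"
  using fst_Z by (simp add: measurable_restrict_space2_iff)

lemma snd_Z_borel [measurable]: "snd \<in> borel_measurable Z"
  by (rule measurable_compose[OF snd_Z]) simp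

text \<open>Prices range over a finite set, so joint measurability can be checked at one fixed price
  at a time.\<close>

lemma measurable_from_Z:
  assumes "\<And>p. p \<in> menu M \<Longrightarrow> (\<lambda>(\<mu>, x). F (\<mu>, p) x) \<in> restrict_space borel {0..1} \<Otimes>\<^sub>M X \<rightarrow>\<^sub>M N"
  shows "(\<lambda>(z, x). F z x) \<in> Z \<Otimes>\<^sub>M X \<rightarrow>\<^sub>M N"
proof -
  have "(\<lambda>y. (\<lambda>p y. F (fst (fst y), p) (snd y)) (snd (fst y)) y) \<in> Z \<Otimes>\<^sub>M X \<rightarrow>\<^sub>M N"
  proof (rule measurable_compose_countable'[where I = "menu M"])
    fix p assume "p \<in> menu M"
    from assms[OF this] have "(\<lambda>y. (\<lambda>(\<mu>, x). F (\<mu>, p) x) (fst (fst y), snd y)) \<in> Z \<Otimes>\<^sub>M X \<rightarrow>\<^sub>M N"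
      by (rule measurable_compose[rotated]) measurable
    then show "(\<lambda>y. F (fst (fst y), p) (snd y)) \<in> Z \<Otimes>\<^sub>M X \<rightarrow>\<^sub>M N" by simp
  qed (use fin in \<open>auto intro: countable_finite measurable_compose[OF measurable_fst]\<close>)
  then show ?thesis by (simp add: case_prod_beta)
qed

lemma measurable_from_Ev:
  assumes "\<And>m. m \<in> marks M \<Longrightarrow> (\<lambda>(x, s). F x (s, m)) \<in> X \<Otimes>\<^sub>M borel \<rightarrow>\<^sub>M N"
  shows "(\<lambda>(x, e). F x e) \<in> X \<Otimes>\<^sub>M Ev \<rightarrow>\<^sub>M N"
proof -
  have "(\<lambda>y. (\<lambda>m y. F (fst y) (fst (snd y), m)) (snd (snd y)) y) \<in> X \<Otimes>\<^sub>M Ev \<rightarrow>\<^sub>M N"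
  proof (rule measurable_compose_countable'[where I = "marks M"])
    fix m assume "m \<in> marks M"
    from assms[OF this] have "(\<lambda>y. (\<lambda>(x, s). F x (s, m)) (fst y, fst (snd y))) \<in> X \<Otimes>\<^sub>M Ev \<rightarrow>\<^sub>M N"
      by (rule measurable_compose[rotated]) measurable
    then show "(\<lambda>y. F (fst y) (fst (snd y), m)) \<in> X \<Otimes>\<^sub>M Ev \<rightarrow>\<^sub>M N" by simp
  qed (use finite_marks[OF fin] in \<open>auto intro: countable_finite measurable_compose[OF measurable_snd]\<close>)
  then show ?thesis by (simp add: case_prod_beta)
qed

definition flow_state :: "real \<times> real \<Rightarrow> real \<Rightarrow> real \<times> real" where
  "flow_state z s = (flow (fst z) (snd z) s, snd z)"

lemma measurable_into_Z:
  assumes "f \<in> borel_measurable N" "g \<in> N \<rightarrow>\<^sub>M count_space (menu M)" "\<And>x. x \<in> space N \<Longrightarrow> f x \<in> {0..1}"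
  shows "(\<lambda>x. (f x, g x)) \<in> N \<rightarrow>\<^sub>M Z"
  unfolding state_space_def
  by (intro measurable_Pair measurable_restrict_space2 assms) (use assms(3) in auto)

lemma flow_state_measurable [measurable]:
  "(\<lambda>(z, s). flow_state z s) \<in> Z \<Otimes>\<^sub>M borel \<rightarrow>\<^sub>M Z"
proof -
  have "(\<lambda>(z, s). flow (fst z) (snd z) s) \<in> borel_measurable (Z \<Otimes>\<^sub>M borel)"
    by (rule measurable_from_Z) (simp add: flow_measurable_slice)
  then have "(\<lambda>x. (flow (fst (fst x)) (snd (fst x)) (snd x), snd (fst x))) \<in> Z \<Otimes>\<^sub>M borel \<rightarrow>\<^sub>M Z"
  proof (intro measurable_into_Z)
    fix x :: "(real \<times> real) \<times> real" assume "x \<in> space (Z \<Otimes>\<^sub>M borel)"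
    then have "fst (fst x) \<in> {0..1}" by (auto simp: space_pair_measure space_Z)
    then show "flow (fst (fst x)) (snd (fst x)) (snd x) \<in> {0..1}" by (rule flow_range)
  qed (auto simp: case_prod_beta intro: measurable_compose[OF measurable_fst])
  then show ?thesis by (simp add: flow_state_def case_prod_beta)
qed

lemma flow_state_space: "z \<in> space Z \<Longrightarrow> flow_state z s \<in> space Z"
  using flow_range[of "fst z" "snd z" s] by (auto simp: space_Z flow_state_def mem_Times_iff)

lemma flow_state_0: "z \<in> space Z \<Longrightarrow> flow_state z 0 = z"
  by (auto simp: space_Z flow_state_def flow_0)

lemma flow_state_add:
  "z \<in> space Z \<Longrightarrow> 0 \<le> s \<Longrightarrow> 0 \<le> u \<Longrightarrow> flow_state (flow_state z u) s = flow_state z (s + u)"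
  by (auto simp: space_Z flow_state_def flow_add)

lemma act_Z [measurable]: "(\<lambda>z. act M (fst z) (snd z)) \<in> borel_measurable Z"
  using act_measurable by (simp add: case_prod_unfold)

lemma lam_Z [measurable]: "(\<lambda>z. lam (fst z) (act M (fst z) (snd z))) \<in> borel_measurable Z"
  unfolding lam_def by measurable

lemma A_H_measurable [measurable (raw)]:
  assumes [measurable]: "f \<in> borel_measurable N" "g \<in> borel_measurable N"
  shows "(\<lambda>x. A_H M (f x) (g x)) \<in> borel_measurable N"
  unfolding A_H_def b_H_def b_L_def pi_H_def pi_L_def logistic_def by measurable

lemma A_L_measurable [measurable (raw)]:
  assumes [measurable]: "f \<in> borel_measurable N" "g \<in> borel_measurable N"
  shows "(\<lambda>x. A_L M (f x) (g x)) \<in> borel_measurable N"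
  unfolding A_L_def b_H_def b_L_def pi_H_def pi_L_def logistic_def by measurable

lemma A_S_Z [measurable]: "(\<lambda>z. A_S M (fst z) (snd z) (act M (fst z) (snd z))) \<in> borel_measurable Z"
  unfolding A_S_alt by measurable

lemma A_bar_Z [measurable]: "(\<lambda>z. A_bar M (fst z) (snd z) (act M (fst z) (snd z))) \<in> borel_measurable Z"
  unfolding A_bar_def by measurable

lemma jump_Z [measurable]: "(\<lambda>z. jump M (fst z) (snd z) (act M (fst z) (snd z))) \<in> borel_measurable Z"
  unfolding jump_def by measurable

abbreviation step :: "real \<times> real \<Rightarrow> event \<Rightarrow> real \<times> real" where
  "step \<equiv> event_step M flow"

lemma step_Purchase: "step z (s, Purchase) =
    (jump M (fst (flow_state z s)) (snd (flow_state z s)) (act M (fst (flow_state z s)) (snd (flow_state z s))), snd z)"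
  by (cases z) (simp add: flow_state_def)

lemma step_Reset: "step z (s, Reset p') = (fst (flow_state z s), p')"
  by (cases z) (simp add: flow_state_def)

lemma jump_state_range:
  "z \<in> space Z \<Longrightarrow> jump M (fst z) (snd z) (act M (fst z) (snd z)) \<in> {0..1}"
  using act_bounds[of "fst z" "snd z"] by (intro jump_bounds) (auto simp: space_Z)

lemma step_measurable [measurable]: "(\<lambda>(z, e). step z e) \<in> Z \<Otimes>\<^sub>M Ev \<rightarrow>\<^sub>M Z"
proof (rule measurable_from_Ev)
  fix m assume m: "m \<in> marks M"
  have fs: "(\<lambda>x. flow_state (fst x) (snd x)) \<in> Z \<Otimes>\<^sub>M borel \<rightarrow>\<^sub>M Z"
    using flow_state_measurable by (simp add: case_prod_beta)
  have sp: "flow_state (fst x) (snd x) \<in> space Z" if "x \<in> space (Z \<Otimes>\<^sub>M (borel :: real measure))" for x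
    using measurable_space[OF fs that] .
  show "(\<lambda>(z, s). step z (s, m)) \<in> Z \<Otimes>\<^sub>M borel \<rightarrow>\<^sub>M Z"
  proof (cases m)
    case Purchase
    show ?thesis
      unfolding Purchase step_Purchase case_prod_beta
      by (intro measurable_into_Z measurable_compose[OF fs jump_Z] jump_state_range sp)
         (auto intro: measurable_compose[OF measurable_fst])
  next
    case (Reset p')
    then have "p' \<in> menu M" using m by (auto simp: marks_def)
    then show ?thesis
      unfolding Reset step_Reset case_prod_beta
      using sp by (intro measurable_into_Z measurable_compose[OF fs fst_Z_borel]) (auto simp: space_Z mem_Times_iff)
  qed
qed

lemma step_space: "z \<in> space Z \<Longrightarrow> e \<in> space Ev \<Longrightarrow> step z e \<in> space Z"
  using measurable_space[OF step_measurable, of "(z, e)"] by (simp add: space_pair_measure)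

section \<open>The embedded chain of states and the laws it drives\<close>

definition event_state :: "real \<times> real \<Rightarrow> public_record \<Rightarrow> nat \<Rightarrow> real \<times> real" where
  "event_state z \<omega> n = foldl step z (history \<omega> n)"

lemma event_state_0 [simp]: "event_state z \<omega> 0 = z" by (simp add: event_state_def history_def)
lemma event_state_Suc: "event_state z \<omega> (Suc n) = step (event_state z \<omega> n) (\<omega> n)" by (simp add: event_state_def history_Suc)
lemma event_state_trunc [simp]: "k \<le> n \<Longrightarrow> event_state z (trunc n \<omega>) k = event_state z \<omega> k" by (simp add: event_state_def)

lemma event_state_measurable [measurable]: "(\<lambda>(z, \<omega>). event_state z \<omega> n) \<in> Z \<Otimes>\<^sub>M Rec \<rightarrow>\<^sub>M Z"
proof (induction n)
  case (Suc n)
  have "(\<lambda>x. (event_state (fst x) (snd x) n, snd x n)) \<in> Z \<Otimes>\<^sub>M Rec \<rightarrow>\<^sub>M Z \<Otimes>\<^sub>M Ev"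
    using Suc by (intro measurable_Pair measurable_compose[OF measurable_snd record_nth_measurable]) (simp add: case_prod_beta)
  from measurable_compose[OF this step_measurable] show ?case by (simp add: event_state_Suc case_prod_beta)
qed (simp add: case_prod_beta)

lemma event_state_measurable' [measurable]: "z \<in> space Z \<Longrightarrow> (\<lambda>\<omega>. event_state z \<omega> n) \<in> Rec \<rightarrow>\<^sub>M Z"
  using measurable_compose[OF measurable_Pair1' event_state_measurable] by simp

lemma event_state_space: "z \<in> space Z \<Longrightarrow> \<omega> \<in> space Rec \<Longrightarrow> event_state z \<omega> n \<in> space Z"
  using measurable_space[OF event_state_measurable'] .

lemma pdmp_state_history: "pdmp_state M flow z (history \<omega> n) s = flow_state (event_state z \<omega> n) s"
  by (simp add: pdmp_state_def event_state_def flow_state_def case_prod_beta)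

lemma snd_step: "snd (step z e) = (case snd e of Purchase \<Rightarrow> snd z | Reset p' \<Rightarrow> p')"
  by (cases e; cases z; cases "snd e") auto

lemma snd_foldl_step: "snd (foldl step z h) = current_price (snd z) h"
  by (induction h rule: rev_induct) (simp_all add: current_price_def snd_step split: mark.split)

lemma snd_event_state: "snd (event_state z \<omega> n) = current_price (snd z) (history \<omega> n)"
  by (simp add: event_state_def snd_foldl_step)

text \<open>A common frame for the intensities under each type and under the public law: all are
  functions of the current public state, with total between the reset rate and the sum of reset and
  arrival rates. One construction of record laws then serves all three.\<close>

definition state_rate :: "(real \<times> real \<Rightarrow> mark \<Rightarrow> real) \<Rightarrow> bool" where
  "state_rate q \<longleftrightarrow> (\<forall>x\<in>marks M. (\<lambda>z. q z x) \<in> borel_measurable Z) \<and>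
     (\<forall>z\<in>space Z. (\<forall>x\<in>marks M. 0 \<le> q z x) \<and> (\<Sum>x\<in>marks M. q z x) \<in> {kappa M..nu M + kappa M})"

definition event_kernel :: "(real \<times> real \<Rightarrow> mark \<Rightarrow> real) \<Rightarrow> real \<times> real \<Rightarrow> event measure" where
  "event_kernel q z = event_law M (\<lambda>s. q (flow_state z s))"

lemma state_rate_measurable:
  assumes "state_rate q" "x \<in> marks M"
  shows "(\<lambda>(z, s). q (flow_state z (max 0 s)) x) \<in> borel_measurable (Z \<Otimes>\<^sub>M borel)"
proof -
  have "(\<lambda>y. (fst y, max 0 (snd y))) \<in> Z \<Otimes>\<^sub>M borel \<rightarrow>\<^sub>M Z \<Otimes>\<^sub>M (borel :: real measure)" by measurable
  from measurable_compose[OF measurable_compose[OF this flow_state_measurable]] assms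
  show ?thesis by (force simp: state_rate_def case_prod_beta)
qed

lemma state_rate_mark_rates:
  assumes "state_rate q" "z \<in> space Z"
  shows "mark_rates M (\<lambda>s. q (flow_state z s)) (kappa M) (nu M + kappa M)"
proof
  fix x assume "x \<in> marks M"
  from measurable_compose[OF measurable_Pair1' state_rate_measurable[OF assms(1) this]] assms(2)
  show "(\<lambda>s. q (flow_state z (max 0 s)) x) \<in> borel_measurable borel" by simp
qed (use assms flow_state_space fin kappa_pos in \<open>auto simp: state_rate_def\<close>)

lemma event_kernel_measurable: "state_rate q \<Longrightarrow> event_kernel q \<in> Z \<rightarrow>\<^sub>M prob_algebra Ev"
  unfolding event_kernel_def[abs_def]
  by (rule measurable_event_law[OF state_rate_mark_rates state_rate_measurable])

abbreviation hist_rate :: "(real \<times> real \<Rightarrow> mark \<Rightarrow> real) \<Rightarrow> real \<times> real \<Rightarrow> event list \<Rightarrow> real \<Rightarrow> mark \<Rightarrow> real" where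
  "hist_rate q z h s \<equiv> q (pdmp_state M flow z h s)"

lemma event_law_hist_rate: "event_law M (hist_rate q z (history \<omega> n)) = event_kernel q (event_state z \<omega> n)"
  by (simp add: event_kernel_def pdmp_state_history)

lemma hist_rate_family:
  assumes q: "state_rate q" and z: "z \<in> space Z"
  shows "rate_family M (hist_rate q z) (kappa M) (nu M + kappa M)"
  unfolding rate_family_def pdmp_state_history
proof (intro conjI allI ballI)
  fix n \<omega> assume "\<omega> \<in> space Rec"
  then show "mark_rates M (\<lambda>s. q (flow_state (event_state z \<omega> n) s)) (kappa M) (nu M + kappa M)"
    using q z by (intro state_rate_mark_rates event_state_space)
next
  fix n x assume x: "x \<in> marks M"
  have "(\<lambda>y. (event_state z (fst y) n, snd y)) \<in> Rec \<Otimes>\<^sub>M borel \<rightarrow>\<^sub>M Z \<Otimes>\<^sub>M (borel :: real measure)"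
    by (intro measurable_Pair measurable_compose[OF measurable_fst event_state_measurable'[OF z]] measurable_snd)
  from measurable_compose[OF this state_rate_measurable[OF q x]]
  show "(\<lambda>(\<omega>, s). q (flow_state (event_state z \<omega> n) (max 0 s)) x) \<in> borel_measurable (Rec \<Otimes>\<^sub>M borel)"
    by (simp add: case_prod_beta)
qed

definition record_law :: "(real \<times> real \<Rightarrow> mark \<Rightarrow> real) \<Rightarrow> real \<times> real \<Rightarrow> public_record measure" where
  "record_law q z = (SOME Q. point_process_law M (hist_rate q z) Q)"

lemma record_law_law: "state_rate q \<Longrightarrow> z \<in> space Z \<Longrightarrow> point_process_law M (hist_rate q z) (record_law q z)"
  unfolding record_law_def by (rule someI_ex) (rule point_process_law_exists[OF fin hist_rate_family])

lemma record_law_unique: "state_rate q \<Longrightarrow> z \<in> space Z \<Longrightarrow> point_process_law M (hist_rate q z) R \<Longrightarrow> R = record_law q z"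
  using point_process_law_unique[OF fin hist_rate_family] record_law_law by blast

lemma record_law_prob: "state_rate q \<Longrightarrow> z \<in> space Z \<Longrightarrow> prob_space (record_law q z)"
  and sets_record_law: "state_rate q \<Longrightarrow> z \<in> space Z \<Longrightarrow> sets (record_law q z) = sets Rec"
  using point_process_lawD[OF record_law_law] by auto

lemma space_record_law: "state_rate q \<Longrightarrow> z \<in> space Z \<Longrightarrow> space (record_law q z) = space Rec"
  using sets_eq_imp_space_eq[OF sets_record_law] .

lemma record_law_next:
  assumes q: "state_rate q" and z: "z \<in> space Z" and f: "f \<in> borel_measurable (Rec \<Otimes>\<^sub>M Ev)"
  shows "(\<integral>\<^sup>+\<omega>. f (trunc n \<omega>, \<omega> n) \<partial>record_law q z) = (\<integral>\<^sup>+\<omega>. \<integral>\<^sup>+e. f (trunc n \<omega>, e) \<partial>event_kernel q (event_state z \<omega> n) \<partial>record_law q z)"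
  using next_event_lawD[OF point_process_law_next[OF fin hist_rate_family[OF q z] record_law_law[OF q z]] f]
  by (simp add: event_law_hist_rate)

end

section \<open>Memorylessness of the waiting-time law\<close>

context mark_rates
begin

lemma mark_rates_shift:
  assumes u: "0 \<le> u"
  shows "mark_rates M (\<lambda>s. \<rho> (s + u)) lo hi"
proof
  fix x assume [measurable]: "x \<in> marks M"
  have "(\<lambda>s. max 0 s + u) \<in> borel_measurable borel" by measurable
  from measurable_compose[OF this rate_meas] u
  show "(\<lambda>s. \<rho> (max 0 s + u) x) \<in> borel_measurable borel" by (simp add: max_def)
qed (use u fin rate_nonneg lo_pos total in auto)

lemma cum_shift:
  assumes u: "0 \<le> u" and s: "0 \<le> s"
  shows "(LINT v:{0..s}|lborel. \<Sum>x\<in>marks M. \<rho> (v + u) x) = cum (s + u) - cum u"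
proof -
  have "cum (s + u) - cum u = (\<integral>v. indicat_real {u..s + u} v * (\<Sum>x\<in>marks M. \<rho> v x) \<partial>lborel)"
    using cum_diff[of u "s + u"] u s by (simp add: set_lebesgue_integral_def)
  also have "\<dots> = (\<integral>v. indicat_real {u..s + u} (u + 1 * v) * (\<Sum>x\<in>marks M. \<rho> (u + 1 * v) x) \<partial>lborel)"
    by (subst lborel_integral_real_affine[where c = 1 and t = u]) simp_all
  also have "\<dots> = (LINT v:{0..s}|lborel. \<Sum>x\<in>marks M. \<rho> (v + u) x)"
    unfolding set_lebesgue_integral_def
    by (intro Bochner_Integration.integral_cong) (auto simp: indicator_def add.commute)
  finally show ?thesis by simp
qed

text \<open>Substituting \<open>s + u\<close> for the time splits the cumulated rate into the part
  up to \<open>u\<close>, which becomes the factor in front, and the cumulated rate of the shifted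
  hazard.\<close>

lemma event_law_memoryless:
  assumes u: "0 \<le> u" and f: "f \<in> borel_measurable (event_space M)"
  shows "(\<integral>\<^sup>+e. indicator {u<..} (fst e) * f (fst e - u, snd e) \<partial>event_law M \<rho>)
    = ennreal (exp (- cum u)) * (\<integral>\<^sup>+e. f e \<partial>event_law M (\<lambda>s. \<rho> (s + u)))"
proof -
  interpret S: mark_rates M "\<lambda>s. \<rho> (s + u)" lo hi by (rule mark_rates_shift[OF u])
  note fx [measurable] = event_section_measurable[OF f]
  note [measurable] = cum_measurable
  have sf: "(\<lambda>e. f (fst e - u, snd e)) \<in> borel_measurable (event_space M)"
  proof -
    have "(\<lambda>e. (fst e - u, snd e)) \<in> event_space M \<rightarrow>\<^sub>M event_space M"
      unfolding event_space_def by measurable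
    then show ?thesis by (rule measurable_compose[OF _ f])
  qed
  \<comment> \<open>A version of the integrand that is measurable on the whole line and uses the
    closed half-line from \<open>u\<close>; the two can differ at the single point \<open>u\<close>
    only.\<close>
  define g where "g s = (\<Sum>x\<in>marks M. ennreal (\<rho> (max 0 s) x * exp (- cum (max 0 s))) * f (s - u, x)) * indicator {u..} s" for s
  have g: "g \<in> borel_measurable borel"
  proof -
    have "(\<lambda>s. \<Sum>x\<in>marks M. ennreal (\<rho> (max 0 s) x * exp (- cum (max 0 s))) * f (s - u, x)) \<in> borel_measurable borel"
    proof (rule borel_measurable_sum)
      fix x assume x [measurable]: "x \<in> marks M"
      have [measurable]: "(\<lambda>s. f (s - u, x)) \<in> borel_measurable borel"
        by (rule measurable_compose[OF _ fx[OF x], of "\<lambda>s. s - u"]) measurable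
      show "(\<lambda>s. ennreal (\<rho> (max 0 s) x * exp (- cum (max 0 s))) * f (s - u, x)) \<in> borel_measurable borel"
        by measurable
    qed
    then show ?thesis unfolding g_def by measurable
  qed
  have "(\<integral>\<^sup>+e. indicator {u<..} (fst e) * f (fst e - u, snd e) \<partial>event_law M \<rho>)
    = (\<integral>\<^sup>+s\<in>{0..}. (\<Sum>x\<in>marks M. ennreal (\<rho> s x * exp (- cum s)) * (indicator {u<..} s * f (s - u, x))) \<partial>lborel)"
    using sf by (subst nn_integral_event_law) auto
  also have "\<dots> = (\<integral>\<^sup>+s. g s \<partial>lborel)"
  proof (rule nn_integral_cong_AE)
    show "AE s in lborel. (\<Sum>x\<in>marks M. ennreal (\<rho> s x * exp (- cum s)) * (indicator {u<..} s * f (s - u, x))) * indicator {0..} s = g s"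
      using AE_lborel_singleton[of u] by eventually_elim (use u in \<open>auto simp: g_def indicator_def\<close>)
  qed
  also have "\<dots> = (\<integral>\<^sup>+s. g (u + 1 * s) \<partial>lborel)"
    by (subst nn_integral_real_affine[OF g, of 1 u]) simp_all
  also have "\<dots> = (\<integral>\<^sup>+s. ennreal (exp (- cum u)) * ((\<Sum>x\<in>marks M. ennreal (\<rho> (s + u) x * exp (- S.cum s)) * f (s, x)) * indicator {0..} s) \<partial>lborel)"
  proof (rule nn_integral_cong)
    fix s :: real
    show "g (u + 1 * s) = ennreal (exp (- cum u)) * ((\<Sum>x\<in>marks M. ennreal (\<rho> (s + u) x * exp (- S.cum s)) * f (s, x)) * indicator {0..} s)"
    proof (cases "0 \<le> s")
      case True
      have "ennreal (\<rho> (s + u) x * exp (- cum (s + u))) = ennreal (exp (- cum u)) * ennreal (\<rho> (s + u) x * exp (- S.cum s))"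
        if "x \<in> marks M" for x
      proof -
        have "exp (- cum (s + u)) = exp (- cum u) * exp (- S.cum s)"
          unfolding S.cum_def using cum_shift[OF u True] by (simp flip: exp_add)
        then show ?thesis using rate_nonneg[of "s + u" x] True u that
          by (simp add: ennreal_mult[symmetric] mult.left_commute)
      qed
      then show ?thesis
        using True u by (simp add: g_def add.commute[of u] sum_distrib_left mult.assoc)
    qed (simp add: g_def)
  qed
  also have "\<dots> = ennreal (exp (- cum u)) * (\<integral>\<^sup>+s\<in>{0..}. (\<Sum>x\<in>marks M. ennreal (\<rho> (s + u) x * exp (- S.cum s)) * f (s, x)) \<partial>lborel)"
  proof (rule nn_integral_cmult)
    define h where "h s = (\<Sum>x\<in>marks M. ennreal (\<rho> (max 0 s + u) x * exp (- S.cum (max 0 s))) * f (s, x)) * indicator {0..} s" for s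
    note [measurable] = S.cum_measurable S.rate_meas
    have "h \<in> borel_measurable borel" unfolding h_def by measurable
    moreover have "(\<lambda>s. (\<Sum>x\<in>marks M. ennreal (\<rho> (s + u) x * exp (- S.cum s)) * f (s, x)) * indicator {0..} s) = h"
      by (rule ext) (auto simp: h_def indicator_def max_def)
    ultimately show "(\<lambda>s. (\<Sum>x\<in>marks M. ennreal (\<rho> (s + u) x * exp (- S.cum s)) * f (s, x)) * indicator {0..} s) \<in> borel_measurable lborel"
      by simp
  qed
  also have "(\<integral>\<^sup>+s\<in>{0..}. (\<Sum>x\<in>marks M. ennreal (\<rho> (s + u) x * exp (- S.cum s)) * f (s, x)) \<partial>lborel)
     = (\<integral>\<^sup>+e. f e \<partial>event_law M (\<lambda>s. \<rho> (s + u)))"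
    by (rule S.nn_integral_event_law[OF f, symmetric])
  finally show ?thesis .
qed

end

section \<open>Gluing records and the Markov property at events\<close>

definition glue :: "nat \<Rightarrow> public_record \<Rightarrow> public_record \<Rightarrow> public_record" where
  "glue n \<omega> w k = (if k < n then \<omega> k else w (k - n))"

definition shift :: "nat \<Rightarrow> public_record \<Rightarrow> public_record" where
  "shift n \<omega> k = \<omega> (n + k)"

lemma shift_measurable [measurable]: "shift n \<in> record_space M \<rightarrow>\<^sub>M record_space M"
  by (rule measurable_into_record_space) (simp add: shift_def)

lemma glue_measurable [measurable]:
  "(\<lambda>(\<omega>, w). glue n \<omega> w) \<in> record_space M \<Otimes>\<^sub>M record_space M \<rightarrow>\<^sub>M record_space M"
proof (rule measurable_into_record_space)
  fix k show "(\<lambda>x. (case x of (\<omega>, w) \<Rightarrow> glue n \<omega> w) k) \<in> record_space M \<Otimes>\<^sub>M record_space M \<rightarrow>\<^sub>M event_space M"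
    by (cases "k < n") (simp_all add: glue_def case_prod_beta)
qed

lemma trunc_glue_le: "k \<le> n \<Longrightarrow> trunc k (glue n \<omega> w) = trunc k \<omega>"
  by (auto simp: trunc_def glue_def)

lemma trunc_glue_add: "trunc (n + j) (glue n \<omega> w) = glue n \<omega> (trunc j w)"
  by (auto simp: trunc_def glue_def fun_eq_iff)

lemma glue_trunc [simp]: "glue n (trunc n \<omega>) w = glue n \<omega> w"
  by (auto simp: trunc_def glue_def)

lemma shift_glue [simp]: "shift n (glue n \<omega> w) = w"
  by (auto simp: shift_def glue_def)

lemma glue_nth_add [simp]: "glue n \<omega> w (n + j) = w j"
  by (simp add: glue_def)

lemma history_glue_le: "k \<le> n \<Longrightarrow> history (glue n \<omega> w) k = history \<omega> k"
  by (auto simp: history_def glue_def)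

lemma history_glue_add: "history (glue n \<omega> w) (n + j) = history \<omega> n @ history w j"
  by (induction j) (simp_all add: history_Suc history_glue_le, simp add: history_def)

context market_model
begin

lemma event_state_glue_le: "k \<le> n \<Longrightarrow> event_state z (glue n \<omega> w) k = event_state z \<omega> k"
  by (simp add: event_state_def history_glue_le)

lemma event_state_glue_add: "event_state z (glue n \<omega> w) (n + j) = event_state (event_state z \<omega> n) w j"
  by (simp add: event_state_def history_glue_add)

lemma event_kernel_integral_measurable:
  assumes q: "state_rate q" and f: "(\<lambda>(x, e). f x e) \<in> borel_measurable (N \<Otimes>\<^sub>M Ev)" and g: "g \<in> N \<rightarrow>\<^sub>M Z"
  shows "(\<lambda>x. \<integral>\<^sup>+e. f x e \<partial>event_kernel q (g x)) \<in> borel_measurable N"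
  by (rule nn_integral_measurable_subprob_algebra2[OF f measurable_compose[OF g measurable_prob_algebraD[OF event_kernel_measurable[OF q]]]])

text \<open>Peeling off the last event replaces \<open>f\<close> by its integral against an event
  kernel that depends on the starting state as well; hence the induction runs over integrands that
  depend on this state.\<close>

lemma record_law_trunc_integral_measurable:
  assumes q: "state_rate q" and f: "(\<lambda>(z, \<omega>). f z \<omega>) \<in> borel_measurable (Z \<Otimes>\<^sub>M Rec)"
  shows "(\<lambda>z. \<integral>\<^sup>+\<omega>. f z (trunc n \<omega>) \<partial>record_law q z) \<in> borel_measurable Z"
  using f
proof (induction n arbitrary: f)
  case 0
  have t0: "trunc 0 \<omega> = (\<lambda>_. (0, Purchase))" for \<omega> by (auto simp: trunc_def)
  have "(\<integral>\<^sup>+\<omega>. f z (trunc 0 \<omega>) \<partial>record_law q z) = f z (\<lambda>_. (0, Purchase))" if "z \<in> space Z" for z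
    using prob_space.emeasure_space_1[OF record_law_prob[OF q that]] by (simp add: t0)
  moreover have "(\<lambda>z. f z (\<lambda>_. (0, Purchase))) \<in> borel_measurable Z"
    using measurable_compose[OF measurable_Pair2', OF _ 0, of "\<lambda>_. (0, Purchase)"]
    by (simp add: space_record_space)
  ultimately show ?case by (simp cong: measurable_cong)
next
  case (Suc n)
  define g where "g z \<omega> = (\<integral>\<^sup>+e. f z (fun_upd \<omega> n e) \<partial>event_kernel q (event_state z \<omega> n))" for z \<omega>
  have m: "(\<lambda>y. fun_upd (snd (fst y)) n (snd y)) \<in> (Z \<Otimes>\<^sub>M Rec) \<Otimes>\<^sub>M Ev \<rightarrow>\<^sub>M Rec"
    using measurable_compose[OF _ upd_measurable, of "\<lambda>y. (snd (fst y), snd y)" "(Z \<Otimes>\<^sub>M Rec) \<Otimes>\<^sub>M Ev"] by simp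
  have "(\<lambda>(y, e). f (fst y) (fun_upd (snd y) n e)) \<in> borel_measurable ((Z \<Otimes>\<^sub>M Rec) \<Otimes>\<^sub>M Ev)"
    using measurable_compose[OF measurable_Pair[OF measurable_compose[OF measurable_fst measurable_fst] m] Suc.prems]
    by (simp add: case_prod_beta)
  then have "(\<lambda>y. \<integral>\<^sup>+e. f (fst y) (fun_upd (snd y) n e) \<partial>event_kernel q (event_state (fst y) (snd y) n)) \<in> borel_measurable (Z \<Otimes>\<^sub>M Rec)"
    by (rule event_kernel_integral_measurable[OF q]) (use event_state_measurable in \<open>simp add: case_prod_beta\<close>)
  then have g: "(\<lambda>(z, \<omega>). g z \<omega>) \<in> borel_measurable (Z \<Otimes>\<^sub>M Rec)" by (simp add: g_def case_prod_beta)
  have "(\<integral>\<^sup>+\<omega>. f z (trunc (Suc n) \<omega>) \<partial>record_law q z) = (\<integral>\<^sup>+\<omega>. g z (trunc n \<omega>) \<partial>record_law q z)" if z: "z \<in> space Z" for z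
  proof -
    define h where "h = (\<lambda>(\<omega>, e). f z (fun_upd \<omega> n e))"
    have h: "h \<in> borel_measurable (Rec \<Otimes>\<^sub>M Ev)"
      using measurable_compose[OF measurable_Pair[OF measurable_const[OF z] upd_measurable] Suc.prems]
      by (simp add: h_def case_prod_beta)
    show ?thesis
      using record_law_next[OF q z h, of n] by (simp add: h_def g_def trunc_Suc)
  qed
  with Suc.IH[OF g] show ?case by (simp cong: measurable_cong)
qed

lemma trunc_space: "\<omega> \<in> space Rec \<Longrightarrow> trunc n \<omega> \<in> space Rec"
  by (rule measurable_space[OF trunc_measurable])

lemma trunc_nth: "k < n \<Longrightarrow> trunc n \<omega> k = \<omega> k"
  by (simp add: trunc_def)

text \<open>Each coordinate is decided by a truncation. These sets form the intersection-stable
  generator on which measurability of the laws in the starting state is checked.\<close>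

lemma sets_trunc_generate:
  "sets Rec = sigma_sets (space Rec) {{\<omega>\<in>space Rec. trunc n \<omega> \<in> A} | n A. A \<in> sets Rec}"
proof (rule antisym)
  let ?G = "{{\<omega>\<in>space Rec. trunc n \<omega> \<in> A} | n A. A \<in> sets Rec}"
  have "?G \<subseteq> sets Rec" by auto
  then show "sigma_sets (space Rec) ?G \<subseteq> sets Rec" by (rule sets.sigma_sets_subset)
  have "id \<in> sigma (space Rec) ?G \<rightarrow>\<^sub>M Rec"
  proof (rule measurable_into_record_space, rule measurableI)
    fix k and A assume A: "A \<in> sets Ev"
    have GP: "?G \<subseteq> Pow (space Rec)" by (auto simp: subset_iff)
    have "(\<lambda>\<omega>. \<omega> k) -` A \<inter> space Rec = {\<omega>\<in>space Rec. trunc (Suc k) \<omega> \<in> (\<lambda>\<omega>. \<omega> k) -` A \<inter> space Rec}"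
      by (auto simp: trunc_space trunc_nth)
    moreover have "(\<lambda>\<omega>. \<omega> k) -` A \<inter> space Rec \<in> sets Rec" using A by (rule measurable_sets[OF record_nth_measurable])
    ultimately have "(\<lambda>\<omega>. \<omega> k) -` A \<inter> space Rec \<in> ?G" by blast
    then show "(\<lambda>x. id x k) -` A \<inter> space (sigma (space Rec) ?G) \<in> sets (sigma (space Rec) ?G)"
      using GP by (simp add: sets_measure_of space_measure_of)
  next
    fix k \<omega> assume "\<omega> \<in> space (sigma (space Rec) ?G)"
    then have "\<omega> \<in> space Rec" by (simp add: space_measure_of_conv)
    then show "id \<omega> k \<in> space Ev" by (simp add: space_record_space space_event_space mem_Times_iff)
  qed
  then show "sets Rec \<subseteq> sigma_sets (space Rec) ?G"
  proof (intro subsetI)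
    fix A assume id: "id \<in> sigma (space Rec) ?G \<rightarrow>\<^sub>M Rec" and A: "A \<in> sets Rec"
    have GP: "?G \<subseteq> Pow (space Rec)" by (auto simp: subset_iff)
    have "id -` A \<inter> space Rec = A" using sets.sets_into_space[OF A] by auto
    then show "A \<in> sigma_sets (space Rec) ?G"
      using measurable_sets[OF id A] GP by (simp add: sets_measure_of space_measure_of)
  qed
qed

text \<open>The laws are chosen for one starting state at a time, so measurability is not built in.
  It holds since on sets decided by finitely many events the law is an iterated integral of
  measurable kernels.\<close>

lemma record_law_measurable:
  assumes q: "state_rate q"
  shows "record_law q \<in> Z \<rightarrow>\<^sub>M prob_algebra Rec"
proof (rule measurable_prob_algebra_generated[OF sets_trunc_generate])
  let ?G = "{{\<omega>\<in>space Rec. trunc n \<omega> \<in> A} | n A. A \<in> sets Rec}"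
  show "Int_stable ?G"
  proof (rule Int_stableI)
    fix a b assume "a \<in> ?G" "b \<in> ?G"
    then obtain n A m B where a: "a = {\<omega>\<in>space Rec. trunc n \<omega> \<in> A}" "A \<in> sets Rec"
      and b: "b = {\<omega>\<in>space Rec. trunc m \<omega> \<in> B}" "B \<in> sets Rec" by blast
    define N where "N = max n m"
    define C where "C = {\<omega>\<in>space Rec. trunc n \<omega> \<in> A \<and> trunc m \<omega> \<in> B}"
    have "C \<in> sets Rec" using a(2) b(2) unfolding C_def by measurable
    moreover have "a \<inter> b = {\<omega>\<in>space Rec. trunc N \<omega> \<in> C}"
      by (auto simp: a b C_def N_def min_def trunc_space)
    ultimately show "a \<inter> b \<in> ?G" by blast
  qed
  show "?G \<subseteq> Pow (space Rec)" by auto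
  show "prob_space (record_law q z)" "sets (record_law q z) = sets Rec" if "z \<in> space Z" for z
    using record_law_prob[OF q that] sets_record_law[OF q that] by auto
  fix X assume "X \<in> ?G"
  then obtain n A where X: "X = {\<omega>\<in>space Rec. trunc n \<omega> \<in> A}" and A: "A \<in> sets Rec" by blast
  have "emeasure (record_law q z) X = (\<integral>\<^sup>+\<omega>. indicator A (trunc n \<omega>) \<partial>record_law q z)" if z: "z \<in> space Z" for z
  proof -
    have "X \<in> sets (record_law q z)" using A unfolding X sets_record_law[OF q z] by measurable
    then have "emeasure (record_law q z) X = (\<integral>\<^sup>+\<omega>. indicator X \<omega> \<partial>record_law q z)" by simp
    also have "\<dots> = (\<integral>\<^sup>+\<omega>. indicator A (trunc n \<omega>) \<partial>record_law q z)"
      by (intro nn_integral_cong) (auto simp: space_record_law[OF q z] X indicator_def)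
    finally show ?thesis .
  qed
  moreover have "(\<lambda>z. \<integral>\<^sup>+\<omega>. indicator A (trunc n \<omega>) \<partial>record_law q z) \<in> borel_measurable Z"
    by (rule record_law_trunc_integral_measurable[OF q]) (use A in measurable)
  ultimately show "(\<lambda>z. emeasure (record_law q z) X) \<in> borel_measurable Z" by (simp cong: measurable_cong)
qed

lemma record_law_integral_measurable:
  assumes q: "state_rate q" and f: "(\<lambda>(x, e). f x e) \<in> borel_measurable (N \<Otimes>\<^sub>M Rec)" and g: "g \<in> N \<rightarrow>\<^sub>M Z"
  shows "(\<lambda>x. \<integral>\<^sup>+e. f x e \<partial>record_law q (g x)) \<in> borel_measurable N"
  by (rule nn_integral_measurable_subprob_algebra2[OF f measurable_compose[OF g measurable_prob_algebraD[OF record_law_measurable[OF q]]]])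


lemma markov_kernel:
  assumes q: "state_rate q" and z: "z \<in> space Z"
  shows "(\<lambda>\<omega>. distr (record_law q (event_state z \<omega> n)) Rec (glue n \<omega>)) \<in> Rec \<rightarrow>\<^sub>M prob_algebra Rec"
  by (rule measurable_distr_prob_space2[OF measurable_compose[OF event_state_measurable'[OF z] record_law_measurable[OF q]] glue_measurable])

text \<open>Let \<open>Q\<close> run the first \<open>n\<close> events and then start afresh from
  the state reached. Its next-event equations below index \<open>n\<close> are those of the first
  phase, and from \<open>n\<close> on those of the second, because the state along a glued record is
  the state of the second phase started where the first one ended. Uniqueness then identifies
  \<open>Q\<close> with the original law.\<close>

lemma record_law_markov:
  assumes q: "state_rate q" and z: "z \<in> space Z" and f: "f \<in> borel_measurable (Rec \<Otimes>\<^sub>M Rec)"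
  shows "(\<integral>\<^sup>+\<omega>. f (trunc n \<omega>, shift n \<omega>) \<partial>record_law q z) =
    (\<integral>\<^sup>+\<omega>. \<integral>\<^sup>+w. f (trunc n \<omega>, w) \<partial>record_law q (event_state z \<omega> n) \<partial>record_law q z)"
proof -
  define Q where "Q = record_law q z \<bind> (\<lambda>\<omega>. distr (record_law q (event_state z \<omega> n)) Rec (glue n \<omega>))"
  have Kz: "record_law q z \<in> space (prob_algebra Rec)"
    by (rule in_prob_algebra[OF record_law_prob[OF q z] sets_record_law[OF q z]])
  have Qp: "prob_space Q" "sets Q = sets Rec"
    unfolding Q_def by (rule prob_space_bind'[OF Kz markov_kernel[OF q z]], rule sets_bind'[OF Kz markov_kernel[OF q z]])
  have nnQ: "(\<integral>\<^sup>+\<omega>. g \<omega> \<partial>Q) = (\<integral>\<^sup>+\<omega>. \<integral>\<^sup>+w. g (glue n \<omega> w) \<partial>record_law q (event_state z \<omega> n) \<partial>record_law q z)"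
    if g: "g \<in> borel_measurable Rec" for g
  proof -
    have "(\<integral>\<^sup>+\<omega>. g \<omega> \<partial>Q) = (\<integral>\<^sup>+\<omega>. \<integral>\<^sup>+w. g w \<partial>distr (record_law q (event_state z \<omega> n)) Rec (glue n \<omega>) \<partial>record_law q z)"
      unfolding Q_def
      by (rule nn_integral_bind[OF g])
         (use measurable_prob_algebraD[OF markov_kernel[OF q z]] in \<open>simp cong: measurable_cong_sets add: sets_record_law[OF q z]\<close>)
    also have "\<dots> = (\<integral>\<^sup>+\<omega>. \<integral>\<^sup>+w. g (glue n \<omega> w) \<partial>record_law q (event_state z \<omega> n) \<partial>record_law q z)"
    proof (rule nn_integral_cong)
      fix \<omega> assume "\<omega> \<in> space (record_law q z)"
      then have w: "\<omega> \<in> space Rec" by (simp add: space_record_law[OF q z])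
      have "glue n \<omega> \<in> record_law q (event_state z \<omega> n) \<rightarrow>\<^sub>M Rec"
        unfolding measurable_cong_sets[OF sets_record_law[OF q event_state_space[OF z w]] refl]
        using measurable_compose[OF measurable_Pair1'[OF w] glue_measurable] by simp
      then show "(\<integral>\<^sup>+w. g w \<partial>distr (record_law q (event_state z \<omega> n)) Rec (glue n \<omega>)) = (\<integral>\<^sup>+w. g (glue n \<omega> w) \<partial>record_law q (event_state z \<omega> n))"
        using g by (subst nn_integral_distr) auto
    qed
    finally show ?thesis .
  qed
  \<comment> \<open>Mass one of the second phase lets integrands that do not see it pass through the
    inner integral.\<close>
  have const: "emeasure (record_law q (event_state z \<omega> n)) (space (record_law q (event_state z \<omega> n))) = 1" if "\<omega> \<in> space (record_law q z)" for \<omega>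
    using prob_space.emeasure_space_1[OF record_law_prob[OF q event_state_space[OF z]]] that by (simp add: space_record_law[OF q z])
  have "next_event_law M (hist_rate q z) Q k" for k
    unfolding next_event_law_def event_law_hist_rate
  proof
    fix f :: "public_record \<times> event \<Rightarrow> ennreal" assume f: "f \<in> borel_measurable (Rec \<Otimes>\<^sub>M Ev)"
    have m1: "(\<lambda>\<omega>. f (trunc k \<omega>, \<omega> k)) \<in> borel_measurable Rec"
      by (rule measurable_compose[OF _ f]) measurable
    have f2: "(\<lambda>(\<omega>, e). f (trunc k \<omega>, e)) \<in> borel_measurable (Rec \<Otimes>\<^sub>M Ev)"
      unfolding case_prod_unfold by (rule measurable_compose[OF _ f]) measurable
    have m2: "(\<lambda>\<omega>. \<integral>\<^sup>+e. f (trunc k \<omega>, e) \<partial>event_kernel q (event_state z \<omega> k)) \<in> borel_measurable Rec"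
      by (rule event_kernel_integral_measurable[OF q f2 event_state_measurable'[OF z]])
    show "(\<integral>\<^sup>+\<omega>. f (trunc k \<omega>, \<omega> k) \<partial>Q) = (\<integral>\<^sup>+\<omega>. \<integral>\<^sup>+e. f (trunc k \<omega>, e) \<partial>event_kernel q (event_state z \<omega> k) \<partial>Q)"
      unfolding nnQ[OF m1] nnQ[OF m2]
    proof (cases "k < n")
      case True
      have g: "glue n \<omega> w k = \<omega> k" for \<omega> w using True by (simp add: glue_def)
      have "(\<integral>\<^sup>+\<omega>. \<integral>\<^sup>+w. f (trunc k (glue n \<omega> w), glue n \<omega> w k) \<partial>record_law q (event_state z \<omega> n) \<partial>record_law q z)
        = (\<integral>\<^sup>+\<omega>. f (trunc k \<omega>, \<omega> k) \<partial>record_law q z)"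
        using True by (intro nn_integral_cong) (simp add: trunc_glue_le g const)
      also have "\<dots> = (\<integral>\<^sup>+\<omega>. \<integral>\<^sup>+e. f (trunc k \<omega>, e) \<partial>event_kernel q (event_state z \<omega> k) \<partial>record_law q z)"
        by (rule record_law_next[OF q z f])
      also have "\<dots> = (\<integral>\<^sup>+\<omega>. \<integral>\<^sup>+w. \<integral>\<^sup>+e. f (trunc k (glue n \<omega> w), e) \<partial>event_kernel q (event_state z (glue n \<omega> w) k) \<partial>record_law q (event_state z \<omega> n) \<partial>record_law q z)"
        using True by (intro nn_integral_cong) (simp add: trunc_glue_le event_state_glue_le const)
      finally show "(\<integral>\<^sup>+\<omega>. \<integral>\<^sup>+w. f (trunc k (glue n \<omega> w), glue n \<omega> w k) \<partial>record_law q (event_state z \<omega> n) \<partial>record_law q z)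
        = (\<integral>\<^sup>+\<omega>. \<integral>\<^sup>+w. \<integral>\<^sup>+e. f (trunc k (glue n \<omega> w), e) \<partial>event_kernel q (event_state z (glue n \<omega> w) k) \<partial>record_law q (event_state z \<omega> n) \<partial>record_law q z)" .
    next
      case False
      then obtain j where k: "k = n + j" by (metis le_add_diff_inverse linorder_not_less)
      show "(\<integral>\<^sup>+\<omega>. \<integral>\<^sup>+w. f (trunc k (glue n \<omega> w), glue n \<omega> w k) \<partial>record_law q (event_state z \<omega> n) \<partial>record_law q z)
        = (\<integral>\<^sup>+\<omega>. \<integral>\<^sup>+w. \<integral>\<^sup>+e. f (trunc k (glue n \<omega> w), e) \<partial>event_kernel q (event_state z (glue n \<omega> w) k) \<partial>record_law q (event_state z \<omega> n) \<partial>record_law q z)"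
      proof (rule nn_integral_cong)
        fix \<omega> assume "\<omega> \<in> space (record_law q z)"
        then have w: "\<omega> \<in> space Rec" by (simp add: space_record_law[OF q z])
        define g where "g = (\<lambda>(w, e). f (glue n \<omega> w, e))"
        have "(\<lambda>y. (glue n \<omega> (fst y), snd y)) \<in> Rec \<Otimes>\<^sub>M Ev \<rightarrow>\<^sub>M Rec \<Otimes>\<^sub>M Ev"
          using measurable_compose[OF measurable_compose[OF measurable_fst measurable_Pair1'[OF w]] glue_measurable]
          by (intro measurable_Pair) auto
        from measurable_compose[OF this f] have g: "g \<in> borel_measurable (Rec \<Otimes>\<^sub>M Ev)"
          by (simp add: g_def case_prod_beta)
        show "(\<integral>\<^sup>+w. f (trunc k (glue n \<omega> w), glue n \<omega> w k) \<partial>record_law q (event_state z \<omega> n))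
          = (\<integral>\<^sup>+w. \<integral>\<^sup>+e. f (trunc k (glue n \<omega> w), e) \<partial>event_kernel q (event_state z (glue n \<omega> w) k) \<partial>record_law q (event_state z \<omega> n))"
          using record_law_next[OF q event_state_space[OF z w] g, of n j]
          by (simp add: g_def k trunc_glue_add event_state_glue_add)
      qed
    qed
  qed
  then have "point_process_law M (hist_rate q z) Q"
    using point_process_law_iff[OF fin hist_rate_family[OF q z] Qp] by blast
  then have QK: "Q = record_law q z" by (rule record_law_unique[OF q z])
  have m: "(\<lambda>\<omega>. f (trunc n \<omega>, shift n \<omega>)) \<in> borel_measurable Rec"
    by (rule measurable_compose[OF _ f]) measurable
  show ?thesis using nnQ[OF m] by (simp add: QK trunc_glue_le)
qed

definition scons :: "event \<Rightarrow> public_record \<Rightarrow> public_record" where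
  "scons e w = case_nat e w"

lemma scons_measurable [measurable]: "(\<lambda>(e, w). scons e w) \<in> Ev \<Otimes>\<^sub>M Rec \<rightarrow>\<^sub>M Rec"
proof (rule measurable_into_record_space)
  fix k show "(\<lambda>x. (case x of (e, w) \<Rightarrow> scons e w) k) \<in> Ev \<Otimes>\<^sub>M Rec \<rightarrow>\<^sub>M Ev"
    by (cases k) (simp_all add: scons_def case_prod_beta)
qed

text \<open>Separates the past, the event in progress and everything after it; this is the
  decomposition required at a calendar time that falls between two events.\<close>

lemma record_law_markov_event:
  assumes q: "state_rate q" and z: "z \<in> space Z" and f: "f \<in> borel_measurable ((Rec \<Otimes>\<^sub>M Ev) \<Otimes>\<^sub>M Rec)"
  shows "(\<integral>\<^sup>+\<omega>. f ((trunc n \<omega>, \<omega> n), shift (Suc n) \<omega>) \<partial>record_law q z) =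
    (\<integral>\<^sup>+\<omega>. \<integral>\<^sup>+e. \<integral>\<^sup>+w. f ((trunc n \<omega>, e), w) \<partial>record_law q (step (event_state z \<omega> n) e) \<partial>event_kernel q (event_state z \<omega> n) \<partial>record_law q z)"
proof -
  define g where "g y = f ((trunc n (fst y), fst y n), snd y)" for y
  have g: "g \<in> borel_measurable (Rec \<Otimes>\<^sub>M Rec)"
    unfolding g_def by (rule measurable_compose[OF _ f]) measurable
  define h where "h = (\<lambda>(\<omega>, e). \<integral>\<^sup>+w. f ((\<omega>, e), w) \<partial>record_law q (step (event_state z \<omega> n) e))"
  have "(\<lambda>(y, w). f (y, w)) \<in> borel_measurable ((Rec \<Otimes>\<^sub>M Ev) \<Otimes>\<^sub>M Rec)" using f by simp
  moreover have "(\<lambda>y. step (event_state z (fst y) n) (snd y)) \<in> Rec \<Otimes>\<^sub>M Ev \<rightarrow>\<^sub>M Z"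
    using measurable_compose[OF measurable_Pair[OF measurable_compose[OF measurable_fst event_state_measurable'[OF z]] measurable_snd] step_measurable]
    by simp
  ultimately have "(\<lambda>y. \<integral>\<^sup>+w. f (y, w) \<partial>record_law q (step (event_state z (fst y) n) (snd y))) \<in> borel_measurable (Rec \<Otimes>\<^sub>M Ev)"
    by (rule record_law_integral_measurable[OF q])
  then have h: "h \<in> borel_measurable (Rec \<Otimes>\<^sub>M Ev)" by (simp add: h_def case_prod_unfold)
  have "(\<integral>\<^sup>+\<omega>. f ((trunc n \<omega>, \<omega> n), shift (Suc n) \<omega>) \<partial>record_law q z) = (\<integral>\<^sup>+\<omega>. g (trunc (Suc n) \<omega>, shift (Suc n) \<omega>) \<partial>record_law q z)"
    by (simp add: g_def trunc_nth)
  also have "\<dots> = (\<integral>\<^sup>+\<omega>. \<integral>\<^sup>+w. g (trunc (Suc n) \<omega>, w) \<partial>record_law q (event_state z \<omega> (Suc n)) \<partial>record_law q z)"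
    by (rule record_law_markov[OF q z g])
  also have "\<dots> = (\<integral>\<^sup>+\<omega>. h (trunc n \<omega>, \<omega> n) \<partial>record_law q z)"
    by (simp add: g_def h_def trunc_nth event_state_Suc)
  also have "\<dots> = (\<integral>\<^sup>+\<omega>. \<integral>\<^sup>+e. h (trunc n \<omega>, e) \<partial>event_kernel q (event_state z \<omega> n) \<partial>record_law q z)"
    by (rule record_law_next[OF q z h])
  finally show ?thesis by (simp add: h_def)
qed

lemma record_law_first_event:
  assumes q: "state_rate q" and z: "z \<in> space Z" and f: "f \<in> borel_measurable Rec"
  shows "(\<integral>\<^sup>+\<omega>. f \<omega> \<partial>record_law q z) = (\<integral>\<^sup>+e. \<integral>\<^sup>+w. f (scons e w) \<partial>record_law q (step z e) \<partial>event_kernel q z)"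
proof -
  define g where "g y = f (scons (snd (fst y)) (snd y))" for y :: "(public_record \<times> event) \<times> public_record"
  have "(\<lambda>y. scons (snd (fst y)) (snd y)) \<in> (Rec \<Otimes>\<^sub>M Ev) \<Otimes>\<^sub>M Rec \<rightarrow>\<^sub>M Rec"
    using measurable_compose[OF measurable_Pair[OF measurable_compose[OF measurable_fst measurable_snd] measurable_snd] scons_measurable]
    by simp
  from measurable_compose[OF this f] have g: "g \<in> borel_measurable ((Rec \<Otimes>\<^sub>M Ev) \<Otimes>\<^sub>M Rec)"
    by (simp add: g_def[abs_def])
  have "scons (\<omega> 0) (shift (Suc 0) \<omega>) = \<omega>" for \<omega>
    by (auto simp: scons_def shift_def fun_eq_iff split: nat.split)
  then have "(\<integral>\<^sup>+\<omega>. f \<omega> \<partial>record_law q z) = (\<integral>\<^sup>+\<omega>. g ((trunc 0 \<omega>, \<omega> 0), shift (Suc 0) \<omega>) \<partial>record_law q z)"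
    by (simp add: g_def)
  also have "\<dots> = (\<integral>\<^sup>+\<omega>. \<integral>\<^sup>+e. \<integral>\<^sup>+w. f (scons e w) \<partial>record_law q (step z e) \<partial>event_kernel q z \<partial>record_law q z)"
    by (subst record_law_markov_event[OF q z g]) (simp add: g_def)
  also have "\<dots> = (\<integral>\<^sup>+e. \<integral>\<^sup>+w. f (scons e w) \<partial>record_law q (step z e) \<partial>event_kernel q z)"
    using prob_space.emeasure_space_1[OF record_law_prob[OF q z]] by simp
  finally show ?thesis .
qed

definition surv :: "(real \<times> real \<Rightarrow> mark \<Rightarrow> real) \<Rightarrow> real \<times> real \<Rightarrow> real \<Rightarrow> real" where
  "surv q z u = exp (- (LINT s:{0..u}|lborel. \<Sum>x\<in>marks M. q (flow_state z s) x))"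

lemma event_kernel_memoryless:
  assumes q: "state_rate q" and z: "z \<in> space Z" and u: "0 \<le> u" and f: "f \<in> borel_measurable Ev"
  shows "(\<integral>\<^sup>+e. indicator {u<..} (fst e) * f (fst e - u, snd e) \<partial>event_kernel q z)
    = ennreal (surv q z u) * (\<integral>\<^sup>+e. f e \<partial>event_kernel q (flow_state z u))"
proof -
  interpret mark_rates M "\<lambda>s. q (flow_state z s)" "kappa M" "nu M + kappa M"
    by (rule state_rate_mark_rates[OF q z])
  have "event_law M (\<lambda>s. q (flow_state z (s + u))) = event_kernel q (flow_state z u)"
    unfolding event_kernel_def by (rule event_law_cong) (simp add: flow_state_add[OF z _ u])
  then show ?thesis
    unfolding event_kernel_def surv_def using event_law_memoryless[OF u f] by (simp add: cum_def)
qed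

lemma step_flow_state:
  assumes "z \<in> space Z" "0 \<le> u" "0 \<le> s"
  shows "step (flow_state z u) (s, x) = step z (s + u, x)"
  using flow_state_add[OF assms(1,3,2)]
  by (cases x) (simp_all add: step_Purchase step_Reset, simp_all add: flow_state_def)

lemma AE_event_kernel_pos: "state_rate q \<Longrightarrow> z \<in> space Z \<Longrightarrow> AE e in event_kernel q z. 0 < fst e"
  unfolding event_kernel_def by (rule mark_rates.AE_event_law_pos[OF state_rate_mark_rates])

lemma sets_event_kernel [simp, measurable_cong]: "sets (event_kernel q z) = sets Ev" and space_event_kernel [simp]: "space (event_kernel q z) = space Ev"
  by (simp_all add: event_kernel_def)

text \<open>A restart inside a silence. Given no event up to \<open>u\<close>, the residual wait has
  the event kernel of \<open>flow_state z u\<close>, and by the flow property the state after that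
  event is the same whether computed from \<open>z\<close> or from the restarted state.\<close>

lemma record_law_restart:
  assumes q: "state_rate q" and z: "z \<in> space Z" and u: "0 \<le> u" and f: "f \<in> borel_measurable Rec"
  shows "(\<integral>\<^sup>+e. \<integral>\<^sup>+w. indicator {u<..} (fst e) * f (scons (fst e - u, snd e) w) \<partial>record_law q (step z e) \<partial>event_kernel q z)
    = ennreal (surv q z u) * (\<integral>\<^sup>+w. f w \<partial>record_law q (flow_state z u))"
proof -
  let ?z = "flow_state z u"
  have z': "?z \<in> space Z" by (rule flow_state_space[OF z])
  define g where "g e = (\<integral>\<^sup>+w. f (scons e w) \<partial>record_law q (step ?z (max 0 (fst e), snd e)))" for e
  have g: "g \<in> borel_measurable Ev"
    unfolding g_def
  proof (rule record_law_integral_measurable[OF q])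
    show "(\<lambda>(e, w). f (scons e w)) \<in> borel_measurable (Ev \<Otimes>\<^sub>M Rec)"
      using measurable_compose[OF scons_measurable f] by (simp add: case_prod_beta)
    have "(\<lambda>e. (max 0 (fst e), snd e)) \<in> Ev \<rightarrow>\<^sub>M Ev" unfolding event_space_def by measurable
    from measurable_compose[OF measurable_compose[OF this measurable_Pair1'[OF z']] step_measurable]
    show "(\<lambda>e. step ?z (max 0 (fst e), snd e)) \<in> Ev \<rightarrow>\<^sub>M Z" by simp
  qed
  have "(\<integral>\<^sup>+e. \<integral>\<^sup>+w. indicator {u<..} (fst e) * f (scons (fst e - u, snd e) w) \<partial>record_law q (step z e) \<partial>event_kernel q z)
    = (\<integral>\<^sup>+e. indicator {u<..} (fst e) * g (fst e - u, snd e) \<partial>event_kernel q z)"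
  proof (rule nn_integral_cong)
    fix e show "(\<integral>\<^sup>+w. indicator {u<..} (fst e) * f (scons (fst e - u, snd e) w) \<partial>record_law q (step z e))
      = indicator {u<..} (fst e) * g (fst e - u, snd e)"
      using step_flow_state[OF z u, of "fst e - u" "snd e"]
      by (cases "u < fst e") (simp_all add: g_def max_def)
  qed
  also have "\<dots> = ennreal (surv q z u) * (\<integral>\<^sup>+e. g e \<partial>event_kernel q ?z)"
    by (rule event_kernel_memoryless[OF q z u g])
  also have "(\<integral>\<^sup>+e. g e \<partial>event_kernel q ?z) = (\<integral>\<^sup>+w. f w \<partial>record_law q ?z)"
    unfolding record_law_first_event[OF q z' f]
  proof (rule nn_integral_cong_AE)
    show "AE e in event_kernel q ?z. g e = (\<integral>\<^sup>+w. f (scons e w) \<partial>record_law q (step ?z e))"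
      using AE_event_kernel_pos[OF q z'] by eventually_elim (simp add: g_def)
  qed
  finally show ?thesis .
qed

section \<open>Bayes' rule for the types\<close>

definition type_intensity :: "firm_type \<Rightarrow> real \<times> real \<Rightarrow> mark \<Rightarrow> real" where
  "type_intensity \<theta> z x = (let \<mu> = fst z; p = snd z; a = act M \<mu> p in
     case x of
       Purchase \<Rightarrow> nu M * (case \<theta> of Type_C \<Rightarrow> A_H M (lam \<mu> a) p | Type_S \<Rightarrow> A_S M \<mu> p a)
     | Reset p' \<Rightarrow> kappa M * pmf (rule M \<mu> p) p')"

abbreviation prate :: "real \<times> real \<Rightarrow> mark \<Rightarrow> real" where
  "prate \<equiv> public_rate M"

lemma prate_simps:
  "prate z Purchase = nu M * A_bar M (fst z) (snd z) (act M (fst z) (snd z))"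
  "prate z (Reset p') = kappa M * pmf (rule M (fst z) (snd z)) p'"
  by (cases z; simp)+

lemma rule_Z [measurable]: "p' \<in> menu M \<Longrightarrow> (\<lambda>z. pmf (rule M (fst z) (snd z)) p') \<in> borel_measurable Z"
  using rule_measurable by (simp add: case_prod_unfold)

lemma sum_marks: "(\<Sum>x\<in>marks M. f x) = f Purchase + (\<Sum>p\<in>menu M. f (Reset p))" for f :: "mark \<Rightarrow> real"
  unfolding marks_def using fin by (subst sum.insert) (auto simp: sum.reindex inj_on_def)

lemma sum_rule: "z \<in> space Z \<Longrightarrow> (\<Sum>p\<in>menu M. kappa M * pmf (rule M (fst z) (snd z)) p) = kappa M"
  using sum_pmf_eq_1[OF fin, of "rule M (fst z) (snd z)"] rule_support
  by (simp add: space_Z mem_Times_iff flip: sum_distrib_left)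

text \<open>Types and public differ in the purchase component only. The reset components add up to
  \<open>kappa M\<close> because the price rule is supported in the menu.\<close>

lemma state_rate_purchase:
  assumes A: "A \<in> borel_measurable Z" "\<And>z. z \<in> space Z \<Longrightarrow> 0 \<le> A z \<and> A z \<le> 1"
    and q: "\<And>z. q z Purchase = nu M * A z" "\<And>z p'. q z (Reset p') = kappa M * pmf (rule M (fst z) (snd z)) p'"
  shows "state_rate q"
  unfolding state_rate_def
proof (intro conjI ballI)
  fix x assume "x \<in> marks M"
  then show "(\<lambda>z. q z x) \<in> borel_measurable Z"
    using A(1) by (cases x) (auto simp: q marks_def intro!: borel_measurable_times rule_Z)
next
  fix z assume z: "z \<in> space Z"
  show "(\<Sum>x\<in>marks M. q z x) \<in> {kappa M..nu M + kappa M}"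
    using A(2)[OF z] nu_pos sum_rule[OF z] by (simp add: sum_marks q mult_le_cancel_left1)
  fix x show "0 \<le> q z x"
    using A(2)[OF z] nu_pos kappa_pos by (cases x) (simp_all add: q)
qed

lemma state_rate_type_intensity: "state_rate (type_intensity \<theta>)"
proof (rule state_rate_purchase)
  let ?A = "\<lambda>z. case \<theta> of Type_C \<Rightarrow> A_H M (lam (fst z) (act M (fst z) (snd z))) (snd z)
    | Type_S \<Rightarrow> A_S M (fst z) (snd z) (act M (fst z) (snd z))"
  show "?A \<in> borel_measurable Z" by (cases \<theta>) simp_all
  show "0 \<le> ?A z \<and> ?A z \<le> 1" if "z \<in> space Z" for z
    using act_bounds[of "fst z" "snd z"] that A_H_bounds[of "lam (fst z) (act M (fst z) (snd z))" "snd z"]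
      A_S_bounds[of "act M (fst z) (snd z)" "fst z" "snd z"]
    by (cases \<theta>) (auto simp: space_Z mem_Times_iff less_imp_le)
qed (simp_all add: type_intensity_def Let_def)

lemma state_rate_prate: "state_rate prate"
proof (rule state_rate_purchase[OF A_bar_Z])
  show "0 \<le> A_bar M (fst z) (snd z) (act M (fst z) (snd z)) \<and> A_bar M (fst z) (snd z) (act M (fst z) (snd z)) \<le> 1"
    if "z \<in> space Z" for z
    using act_bounds[of "fst z" "snd z"] that A_bar_bounds[of "act M (fst z) (snd z)" "fst z" "snd z"]
    by (auto simp: space_Z mem_Times_iff less_imp_le)
qed (simp_all add: prate_simps)

definition type_weight :: "firm_type \<Rightarrow> real \<Rightarrow> real" where
  "type_weight \<theta> \<mu> = (case \<theta> of Type_C \<Rightarrow> \<mu> | Type_S \<Rightarrow> 1 - \<mu>)"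

lemma type_weight_nonneg: "\<mu> \<in> {0..1} \<Longrightarrow> 0 \<le> type_weight \<theta> \<mu>"
  by (cases \<theta>) (auto simp: type_weight_def)

lemma type_weight_measurable [measurable (raw)]: "f \<in> borel_measurable N \<Longrightarrow> (\<lambda>x. type_weight \<theta> (f x)) \<in> borel_measurable N"
  by (cases \<theta>) (simp_all add: type_weight_def)

text \<open>Reset rates do not depend on the type and cancel, so a silence is informative about the
  type through the missing purchases only.\<close>

lemma total_rate_diff:
  "(\<Sum>x\<in>marks M. type_intensity \<theta> z x) - (\<Sum>x\<in>marks M. prate z x) = type_intensity \<theta> z Purchase - prate z Purchase"
  by (simp add: sum_marks type_intensity_def prate_simps Let_def)

text \<open>With the gap \<open>A_H - A_S\<close> of the purchase probabilities, type C exceeds the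
  public rate by \<open>nu * (1 - \<mu>)\<close> times the gap and type S falls short of it by
  \<open>nu * \<mu>\<close> times the gap. Multiplied by the weight of the type, both give the drift
  up to sign.\<close>

lemma type_weight_flow_deriv:
  assumes z: "z \<in> space Z" and s: "0 \<le> s"
  shows "((\<lambda>s. type_weight \<theta> (fst (flow_state z s))) has_real_derivative
    - type_weight \<theta> (fst (flow_state z s)) * (type_intensity \<theta> (flow_state z s) Purchase - prate (flow_state z s) Purchase))
    (at s within {0..})"
proof -
  have d: "(flow (fst z) (snd z) has_real_derivative adrift (snd z) (flow (fst z) (snd z) s)) (at s within {0..})"
    using z s by (intro flow_deriv) (auto simp: space_Z)
  show ?thesis
  proof (cases \<theta>)
    case Type_C
    show ?thesis
      using d unfolding drift_alt Type_C
      by (simp add: type_weight_def flow_state_def type_intensity_def prate_simps A_bar_def Let_def algebra_simps)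
  next
    case Type_S
    have "((\<lambda>s. 1 - flow (fst z) (snd z) s) has_real_derivative - adrift (snd z) (flow (fst z) (snd z) s)) (at s within {0..})"
      using d by (auto intro!: derivative_eq_intros)
    then show ?thesis
      unfolding drift_alt Type_S
      by (simp add: type_weight_def flow_state_def type_intensity_def prate_simps A_bar_def Let_def algebra_simps)
  qed
qed

lemma surv_pos: "0 < surv q z u"
  by (simp add: surv_def)

text \<open>Bayes' rule for the observation that nothing happens up to \<open>s\<close>: prior
  weight times likelihood under the type equals posterior weight times public likelihood. It is the
  solution formula of the linear equation for the weight.\<close>

lemma type_weight_surv:
  assumes z: "z \<in> space Z" and s: "0 \<le> s"
  shows "type_weight \<theta> (fst z) * surv (type_intensity \<theta>) z s = type_weight \<theta> (fst (flow_state z s)) * surv prate z s"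
proof -
  interpret T: mark_rates M "\<lambda>s. type_intensity \<theta> (flow_state z s)" "kappa M" "nu M + kappa M"
    by (rule state_rate_mark_rates[OF state_rate_type_intensity z])
  interpret P: mark_rates M "\<lambda>s. prate (flow_state z s)" "kappa M" "nu M + kappa M"
    by (rule state_rate_mark_rates[OF state_rate_prate z])
  define g where "g s = type_intensity \<theta> (flow_state z s) Purchase - prate (flow_state z s) Purchase" for s
  have g: "g s = (\<Sum>x\<in>marks M. type_intensity \<theta> (flow_state z s) x) - (\<Sum>x\<in>marks M. prate (flow_state z s) x)" for s
    unfolding g_def total_rate_diff ..
  have "type_weight \<theta> (fst (flow_state z s)) = type_weight \<theta> (fst (flow_state z 0)) * exp (- (LINT u:{0..s}|lborel. g u))"
  proof (rule exp_integral_of_log_derivative[OF _ _ _ _ s, of "\<lambda>s. type_weight \<theta> (fst (flow_state z s))"])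
    show "((\<lambda>s. type_weight \<theta> (fst (flow_state z s))) has_real_derivative - type_weight \<theta> (fst (flow_state z s)) * g s) (at s within {0..})"
      if "0 \<le> s" for s
      unfolding g_def by (rule type_weight_flow_deriv[OF z that])
    show "0 \<le> type_weight \<theta> (fst (flow_state z s))" for s
      using flow_state_space[OF z, of s] by (intro type_weight_nonneg) (auto simp: space_Z)
    show "(\<lambda>s. g (max 0 s)) \<in> borel_measurable borel" unfolding g by measurable
    \<comment> \<open>Both totals lie in the same interval of length \<open>nu M\<close>.\<close>
    show "\<bar>g s\<bar> \<le> nu M" if "0 \<le> s" for s
      unfolding g using T.total[OF that] P.total[OF that] by auto
  qed
  moreover have "(LINT u:{0..s}|lborel. g u) = T.cum s - P.cum s"
    unfolding g T.cum_def P.cum_def by (rule set_integral_diff[OF T.R_integrable P.R_integrable]) auto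
  ultimately show ?thesis
    by (simp add: flow_state_0[OF z] surv_def T.cum_def P.cum_def exp_diff exp_minus field_simps)
qed

text \<open>Bayes' rule for an event without preceding silence: \<open>jump\<close> is the posterior
  after a purchase, and a reset leaves the weight alone because its rate is the same under the type
  and under the public law.\<close>

lemma type_weight_type_intensity:
  assumes z: "z \<in> space Z"
  shows "type_weight \<theta> (fst z) * type_intensity \<theta> z x = type_weight \<theta> (fst (step z (0, x))) * prate z x"
proof (cases x)
  case Purchase
  let ?a = "act M (fst z) (snd z)"
  have A: "0 < A_bar M (fst z) (snd z) ?a"
    using act_bounds[of "fst z" "snd z"] z by (intro A_bar_bounds) (auto simp: space_Z)
  have "fst (step z (0, x)) * A_bar M (fst z) (snd z) ?a = fst z * A_H M (lam (fst z) ?a) (snd z)"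
    using A by (simp add: Purchase step_Purchase flow_state_0[OF z] jump_def)
  moreover have "(1 - fst (step z (0, x))) * A_bar M (fst z) (snd z) ?a = (1 - fst z) * A_S M (fst z) (snd z) ?a"
    using calculation by (simp add: algebra_simps) (simp add: A_bar_def algebra_simps)
  ultimately show ?thesis
    by (cases \<theta>) (auto simp: Purchase type_intensity_def prate_simps type_weight_def Let_def mult.left_commute)
next
  case (Reset p')
  then show ?thesis
    by (simp add: step_Reset flow_state_0[OF z] type_intensity_def prate_simps Let_def)
qed

lemma type_weight_type_intensity_surv:
  assumes z: "z \<in> space Z" and s: "0 \<le> s"
  shows "type_weight \<theta> (fst z) * (type_intensity \<theta> (flow_state z s) x * surv (type_intensity \<theta>) z s)
    = type_weight \<theta> (fst (step z (s, x))) * (prate (flow_state z s) x * surv prate z s)"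
proof -
  have "type_weight \<theta> (fst z) * (type_intensity \<theta> (flow_state z s) x * surv (type_intensity \<theta>) z s)
    = (type_weight \<theta> (fst (flow_state z s)) * type_intensity \<theta> (flow_state z s) x) * surv prate z s"
    using type_weight_surv[OF z s, of \<theta>] by (simp add: mult.assoc mult.left_commute)
  also have "\<dots> = type_weight \<theta> (fst (step z (s, x))) * (prate (flow_state z s) x * surv prate z s)"
    unfolding type_weight_type_intensity[OF flow_state_space[OF z]] using step_flow_state[OF z s order_refl, of x] by simp
  finally show ?thesis .
qed

lemma event_kernel_bayes:
  assumes z: "z \<in> space Z" and f: "f \<in> borel_measurable Ev"
  shows "ennreal (type_weight \<theta> (fst z)) * (\<integral>\<^sup>+e. f e \<partial>event_kernel (type_intensity \<theta>) z)
    = (\<integral>\<^sup>+e. f e * ennreal (type_weight \<theta> (fst (step z e))) \<partial>event_kernel prate z)"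
proof -
  interpret T: mark_rates M "\<lambda>s. type_intensity \<theta> (flow_state z s)" "kappa M" "nu M + kappa M"
    by (rule state_rate_mark_rates[OF state_rate_type_intensity z])
  interpret P: mark_rates M "\<lambda>s. prate (flow_state z s)" "kappa M" "nu M + kappa M"
    by (rule state_rate_mark_rates[OF state_rate_prate z])
  have s: "surv (type_intensity \<theta>) z s = exp (- T.cum s)" "surv prate z s = exp (- P.cum s)" for s
    by (simp_all add: surv_def T.cum_def P.cum_def)
  have wz: "0 \<le> type_weight \<theta> (fst z)" using z by (intro type_weight_nonneg) (auto simp: space_Z)
  have "(\<lambda>e. step z e) \<in> Ev \<rightarrow>\<^sub>M Z"
    using measurable_compose[OF measurable_Pair1'[OF z] step_measurable] by simp
  then have [measurable]: "(\<lambda>e. fst (step z e)) \<in> borel_measurable Ev"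
    by (rule measurable_compose[OF _ fst_Z_borel])
  have f2: "(\<lambda>e. f e * ennreal (type_weight \<theta> (fst (step z e)))) \<in> borel_measurable Ev"
    using f by measurable
  note fx [measurable] = event_section_measurable[OF f]
  define h where "h s = (\<Sum>x\<in>marks M. ennreal (type_intensity \<theta> (flow_state z (max 0 s)) x * exp (- T.cum (max 0 s))) * f (s, x)) * indicator {0..} s" for s
  note [measurable] = T.cum_measurable
  have h [measurable]: "h \<in> borel_measurable borel" unfolding h_def by measurable
  have "(\<integral>\<^sup>+e. f e \<partial>event_kernel (type_intensity \<theta>) z) = (\<integral>\<^sup>+s. h s \<partial>lborel)"
    unfolding event_kernel_def T.nn_integral_event_law[OF f]
    by (intro nn_integral_cong) (auto simp: h_def indicator_def)
  then have "ennreal (type_weight \<theta> (fst z)) * (\<integral>\<^sup>+e. f e \<partial>event_kernel (type_intensity \<theta>) z) = (\<integral>\<^sup>+s. ennreal (type_weight \<theta> (fst z)) * h s \<partial>lborel)"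
    by (simp add: nn_integral_cmult)
  also have "\<dots> = (\<integral>\<^sup>+e. f e * ennreal (type_weight \<theta> (fst (step z e))) \<partial>event_kernel prate z)"
    unfolding event_kernel_def P.nn_integral_event_law[OF f2]
  proof (rule nn_integral_cong)
    fix s :: real
    show "ennreal (type_weight \<theta> (fst z)) * h s = (\<Sum>x\<in>marks M. ennreal (prate (flow_state z s) x * exp (- P.cum s)) *
         (f (s, x) * ennreal (type_weight \<theta> (fst (step z (s, x)))))) * indicator {0..} s"
    proof (cases "0 \<le> s")
      case True
      have "ennreal (type_weight \<theta> (fst z)) * (ennreal (type_intensity \<theta> (flow_state z s) x * exp (- T.cum s)) * f (s, x))
        = ennreal (prate (flow_state z s) x * exp (- P.cum s)) * (f (s, x) * ennreal (type_weight \<theta> (fst (step z (s, x)))))"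
        if x: "x \<in> marks M" for x
      proof -
        have "step z (s, x) \<in> space Z" using x by (intro step_space z) (simp add: space_event_space)
        then have w: "0 \<le> type_weight \<theta> (fst (step z (s, x)))" by (intro type_weight_nonneg) (auto simp: space_Z mem_Times_iff)
        have "ennreal (type_weight \<theta> (fst z)) * ennreal (type_intensity \<theta> (flow_state z s) x * exp (- T.cum s))
          = ennreal (type_weight \<theta> (fst (step z (s, x)))) * ennreal (prate (flow_state z s) x * exp (- P.cum s))"
          using type_weight_type_intensity_surv[OF z True, of \<theta> x] wz w T.rate_nonneg[OF True x] P.rate_nonneg[OF True x]
          by (simp add: s ennreal_mult[symmetric])
        note eq = this
        show ?thesis unfolding mult.assoc[symmetric] eq by (simp only: ac_simps)
      qed
      then show ?thesis using True by (simp add: h_def sum_distrib_left)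
    qed (simp add: h_def)
  qed
  finally show ?thesis .
qed

text \<open>Bayes' rule as a change of measure on the first \<open>n\<close> events. In the
  induction the integral over the last event becomes part of the test function, hence the arbitrary
  \<open>f\<close>.\<close>

lemma record_law_bayes:
  assumes z: "z \<in> space Z" and f: "f \<in> borel_measurable Rec"
  shows "ennreal (type_weight \<theta> (fst z)) * (\<integral>\<^sup>+\<omega>. f (trunc n \<omega>) \<partial>record_law (type_intensity \<theta>) z)
    = (\<integral>\<^sup>+\<omega>. f (trunc n \<omega>) * ennreal (type_weight \<theta> (fst (event_state z \<omega> n))) \<partial>record_law prate z)"
  using f
proof (induction n arbitrary: f)
  case 0
  have t0: "trunc 0 \<omega> = (\<lambda>_. (0, Purchase))" for \<omega> by (auto simp: trunc_def)
  show ?case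
    using prob_space.emeasure_space_1[OF record_law_prob[OF state_rate_type_intensity z]]
      prob_space.emeasure_space_1[OF record_law_prob[OF state_rate_prate z]]
    by (simp add: t0 mult.commute)
next
  case (Suc n)
  define g where "g = (\<lambda>(\<omega>, e). f (fun_upd \<omega> n e))"
  have g: "g \<in> borel_measurable (Rec \<Otimes>\<^sub>M Ev)"
  proof -
    have "(\<lambda>y. f ((\<lambda>(\<omega>, e). fun_upd \<omega> n e) y)) \<in> borel_measurable (Rec \<Otimes>\<^sub>M Ev)"
      by (rule measurable_compose[OF upd_measurable Suc.prems])
    moreover have "g = (\<lambda>y. f ((\<lambda>(\<omega>, e). fun_upd \<omega> n e) y))"
      unfolding g_def by (rule ext) (simp add: split_beta)
    ultimately show ?thesis by simp
  qed
  define F where "F \<omega> = (\<integral>\<^sup>+e. g (\<omega>, e) \<partial>event_kernel (type_intensity \<theta>) (event_state z \<omega> n))" for \<omega>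
  have F: "F \<in> borel_measurable Rec"
    unfolding F_def using g by (intro event_kernel_integral_measurable[OF state_rate_type_intensity _ event_state_measurable'[OF z]]) simp
  have stm: "(\<lambda>y. step (event_state z (fst y) n) (snd y)) \<in> Rec \<Otimes>\<^sub>M Ev \<rightarrow>\<^sub>M Z"
    using measurable_compose[OF measurable_Pair[OF measurable_compose[OF measurable_fst event_state_measurable'[OF z]] measurable_snd] step_measurable]
    by simp
  define h where "h y = g y * ennreal (type_weight \<theta> (fst (step (event_state z (fst y) n) (snd y))))" for y
  have h: "h \<in> borel_measurable (Rec \<Otimes>\<^sub>M Ev)"
    unfolding h_def using g measurable_compose[OF stm fst_Z_borel] by measurable
  have "(\<integral>\<^sup>+\<omega>. f (trunc (Suc n) \<omega>) \<partial>record_law (type_intensity \<theta>) z) = (\<integral>\<^sup>+\<omega>. F (trunc n \<omega>) \<partial>record_law (type_intensity \<theta>) z)"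
    using record_law_next[OF state_rate_type_intensity z g, of \<theta> n] by (simp add: F_def trunc_Suc g_def)
  then have "ennreal (type_weight \<theta> (fst z)) * (\<integral>\<^sup>+\<omega>. f (trunc (Suc n) \<omega>) \<partial>record_law (type_intensity \<theta>) z)
    = (\<integral>\<^sup>+\<omega>. F (trunc n \<omega>) * ennreal (type_weight \<theta> (fst (event_state z \<omega> n))) \<partial>record_law prate z)"
    using Suc.IH[OF F] by simp
  also have "\<dots> = (\<integral>\<^sup>+\<omega>. \<integral>\<^sup>+e. h (trunc n \<omega>, e) \<partial>event_kernel prate (event_state z \<omega> n) \<partial>record_law prate z)"
  proof (rule nn_integral_cong)
    fix \<omega> assume "\<omega> \<in> space (record_law prate z)"
    then have w: "\<omega> \<in> space Rec" by (simp add: space_record_law[OF state_rate_prate z])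
    have "(\<lambda>e. g (trunc n \<omega>, e)) \<in> borel_measurable Ev"
      using measurable_compose[OF measurable_Pair1'[OF trunc_space[OF w]] g] .
    from event_kernel_bayes[OF event_state_space[OF z w] this, of \<theta> n]
    show "F (trunc n \<omega>) * ennreal (type_weight \<theta> (fst (event_state z \<omega> n))) = (\<integral>\<^sup>+e. h (trunc n \<omega>, e) \<partial>event_kernel prate (event_state z \<omega> n))"
      by (simp add: F_def h_def mult.commute)
  qed
  also have "\<dots> = (\<integral>\<^sup>+\<omega>. h (trunc n \<omega>, \<omega> n) \<partial>record_law prate z)"
    by (rule record_law_next[OF state_rate_prate z h, symmetric])
  also have "\<dots> = (\<integral>\<^sup>+\<omega>. f (trunc (Suc n) \<omega>) * ennreal (type_weight \<theta> (fst (event_state z \<omega> (Suc n)))) \<partial>record_law prate z)"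
    by (simp add: h_def g_def trunc_Suc event_state_Suc)
  finally show ?case .
qed

end

section \<open>The public filtration at calendar times\<close>

text \<open>The almost sure properties under which \<open>event_count\<close> counts events: an
  explosive record with positive waits has infinitely many arrivals before some time, and
  \<open>card\<close> returns 0 there.\<close>

definition good :: "public_record \<Rightarrow> bool" where
  "good \<omega> \<longleftrightarrow> (\<forall>n. 0 < fst (\<omega> n)) \<and> nonexplosive \<omega>"

definition in_slot :: "real \<Rightarrow> nat \<Rightarrow> public_record \<Rightarrow> bool" where
  "in_slot t n \<omega> \<longleftrightarrow> arrival \<omega> n \<le> t \<and> t < arrival \<omega> (Suc n)"

text \<open>Agrees with \<open>event_count\<close> on good records at nonnegative times; the form as
  a least index makes measurability with respect to the public filtration immediate.\<close>

definition slot :: "real \<Rightarrow> public_record \<Rightarrow> nat" where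
  "slot t \<omega> = (LEAST n. \<not> arrival \<omega> (Suc n) \<le> t)"

lemma good_arrival_strict_mono: "good \<omega> \<Longrightarrow> strict_mono (arrival \<omega>)"
  by (auto simp: good_def strict_mono_Suc_iff arrival_Suc)

lemma arrival_0 [simp]: "arrival \<omega> 0 = 0"
  by (simp add: arrival_def)

lemma good_slot:
  assumes g: "good \<omega>" and t: "0 \<le> t"
  shows "in_slot t (slot t \<omega>) \<omega>" "in_slot t n \<omega> \<Longrightarrow> n = slot t \<omega>" "event_count \<omega> t = slot t \<omega>"
proof -
  note sm = good_arrival_strict_mono[OF g]
  have "\<forall>\<^sub>F n in sequentially. t + 1 \<le> arrival \<omega> n"
    using g by (simp add: good_def nonexplosive_def filterlim_at_top)
  then obtain N where "\<And>n. n \<ge> N \<Longrightarrow> t + 1 \<le> arrival \<omega> n"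
    by (auto simp: eventually_sequentially)
  from this[of "Suc N"] have ex: "\<not> arrival \<omega> (Suc N) \<le> t" by auto
  then have L: "\<not> arrival \<omega> (Suc (slot t \<omega>)) \<le> t" unfolding slot_def by (rule LeastI)
  have below: "arrival \<omega> (Suc n) \<le> t" if "n < slot t \<omega>" for n
    using not_less_Least[OF that[unfolded slot_def]] by simp
  have "arrival \<omega> (slot t \<omega>) \<le> t"
    using below t by (cases "slot t \<omega>") auto
  then show s: "in_slot t (slot t \<omega>) \<omega>" using L by (simp add: in_slot_def)
  have iff: "arrival \<omega> (Suc n) \<le> t \<longleftrightarrow> n < slot t \<omega>" for n
  proof
    assume "arrival \<omega> (Suc n) \<le> t"
    then have "arrival \<omega> (Suc n) < arrival \<omega> (Suc (slot t \<omega>))" using L by simp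
    then show "n < slot t \<omega>" using sm by (simp add: strict_mono_less)
  qed (rule below)
  show "n = slot t \<omega>" if "in_slot t n \<omega>"
  proof (rule antisym)
    show "slot t \<omega> \<le> n" using that iff[of n] by (auto simp: in_slot_def)
    show "n \<le> slot t \<omega>" using that L sm by (metis in_slot_def not_less_eq_eq order_trans strict_mono_less_eq)
  qed
  have "{n. arrival \<omega> (Suc n) \<le> t} = {..<slot t \<omega>}" using iff by auto
  then show "event_count \<omega> t = slot t \<omega>" by (simp add: event_count_def)
qed

text \<open>The events up to time \<open>t\<close>, with all later arrivals replaced by an arrival at \<open>t + 1\<close>.\<close>

definition clip_time :: "real \<Rightarrow> public_record \<Rightarrow> nat \<Rightarrow> real" where
  "clip_time t \<omega> k = (if k = 0 then 0 else if arrival \<omega> k \<le> t then max 0 (arrival \<omega> k) else t + 1)"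

definition clip :: "real \<Rightarrow> public_record \<Rightarrow> public_record" where
  "clip t \<omega> k = (clip_time t \<omega> (Suc k) - clip_time t \<omega> k,
     if arrival \<omega> (Suc k) \<le> t then snd (\<omega> k) else Purchase)"

text \<open>The clipped record is observable at time \<open>t\<close>, the record itself is not. On
  slot \<open>n\<close>, functions of the first \<open>n\<close> events can thus be replaced by
  functions that are measurable at time \<open>t\<close>.\<close>

lemma trunc_clip:
  assumes g: "good \<omega>" and s: "in_slot t n \<omega>"
  shows "trunc n (clip t \<omega>) = trunc n \<omega>"
proof -
  note sm = good_arrival_strict_mono[OF g]
  have a: "0 \<le> arrival \<omega> k" for k using strict_mono_less_eq[OF sm, of 0 k] by simp
  have ct: "clip_time t \<omega> k = arrival \<omega> k" if "k \<le> n" for k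
  proof -
    have "arrival \<omega> k \<le> t" using that s strict_mono_less_eq[OF sm, of k n] by (auto simp: in_slot_def)
    then show ?thesis using a[of k] by (simp add: clip_time_def)
  qed
  have "clip t \<omega> k = \<omega> k" if k: "k < n" for k
  proof -
    have "arrival \<omega> (Suc k) \<le> t" using k s strict_mono_less_eq[OF sm, of "Suc k" n] by (auto simp: in_slot_def)
    then show ?thesis using ct[of k] ct[of "Suc k"] k by (simp add: clip_def arrival_Suc prod_eq_iff)
  qed
  then show ?thesis by (auto simp: trunc_def fun_eq_iff)
qed

lemma UNIV_firm_type: "(UNIV :: firm_type set) = {Type_C, Type_S}"
  using firm_type.exhaust by auto

section \<open>The joint law of type and record\<close>

context market_model
begin

abbreviation "Out \<equiv> outcome_space M"

lemma space_Out: "space Out = UNIV \<times> space Rec"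
  by (simp add: outcome_space_def space_pair_measure)

lemma snd_Out [measurable]: "snd \<in> Out \<rightarrow>\<^sub>M Rec" and fst_Out [measurable]: "fst \<in> Out \<rightarrow>\<^sub>M count_space UNIV"
  unfolding outcome_space_def by simp_all

lemma measurable_from_Out:
  assumes "\<And>\<theta>. F \<theta> \<in> Rec \<rightarrow>\<^sub>M N"
  shows "(\<lambda>z. F (fst z) (snd z)) \<in> Out \<rightarrow>\<^sub>M N"
  unfolding outcome_space_def
  by (rule measurable_pair_measure_countable1) (use assms in \<open>simp_all add: UNIV_firm_type countable_finite\<close>)

lemma indicator_type_measurable: "indicat_real {x. fst x = \<theta>} \<in> borel_measurable Out"
proof -
  have "(\<lambda>x. (\<lambda>\<theta>' \<omega>. indicat_real {\<theta>} \<theta>') (fst x) (snd x)) \<in> borel_measurable Out"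
    by (rule measurable_from_Out) simp
  moreover have "indicat_real {x. fst x = \<theta>} = (\<lambda>x :: firm_type \<times> public_record. indicator {\<theta>} (fst x))"
    by (auto simp: indicator_def fun_eq_iff)
  ultimately show ?thesis by simp
qed

lemma joint_law_kernel:
  assumes L: "\<And>\<theta>. prob_space (L \<theta>)" "\<And>\<theta>. sets (L \<theta>) = sets Rec"
  shows "distr (L \<theta>) Out (Pair \<theta>) \<in> space (prob_algebra Out)"
proof (rule in_prob_algebra)
  have "Pair \<theta> \<in> L \<theta> \<rightarrow>\<^sub>M Out"
    unfolding measurable_cong_sets[OF L(2) refl] outcome_space_def by (rule measurable_Pair1') simp
  then show "prob_space (distr (L \<theta>) Out (Pair \<theta>))" by (rule prob_space.prob_space_distr[OF L(1)])
qed simp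

lemma joint_law_space:
  assumes L: "\<And>\<theta>. prob_space (L \<theta>)" "\<And>\<theta>. sets (L \<theta>) = sets Rec"
  shows "prob_space (joint_law M \<mu> L)" "sets (joint_law M \<mu> L) = sets Out"
proof -
  let ?p = "map_pmf (\<lambda>b. if b then Type_C else Type_S) (bernoulli_pmf \<mu>)"
  have p: "measure_pmf ?p \<in> space (prob_algebra (measure_pmf ?p))"
    by (rule in_prob_algebra) (simp_all add: measure_pmf.prob_space_axioms)
  have k: "(\<lambda>\<theta>. distr (L \<theta>) Out (Pair \<theta>)) \<in> measure_pmf ?p \<rightarrow>\<^sub>M prob_algebra Out"
    using joint_law_kernel[of L, OF L] by simp
  show "prob_space (joint_law M \<mu> L)" unfolding joint_law_def by (rule prob_space_bind'[OF p k])
  show "sets (joint_law M \<mu> L) = sets Out" unfolding joint_law_def by (rule sets_bind'[OF p k])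
qed

lemma nn_integral_joint_law:
  assumes L: "\<And>\<theta>. prob_space (L \<theta>)" "\<And>\<theta>. sets (L \<theta>) = sets Rec" and \<mu>: "\<mu> \<in> {0..1}"
    and f: "f \<in> borel_measurable Out"
  shows "(\<integral>\<^sup>+z. f z \<partial>joint_law M \<mu> L) =
    ennreal (type_weight Type_C \<mu>) * (\<integral>\<^sup>+\<omega>. f (Type_C, \<omega>) \<partial>L Type_C) + ennreal (type_weight Type_S \<mu>) * (\<integral>\<^sup>+\<omega>. f (Type_S, \<omega>) \<partial>L Type_S)"
proof -
  let ?p = "map_pmf (\<lambda>b. if b then Type_C else Type_S) (bernoulli_pmf \<mu>)"
  have k: "(\<lambda>\<theta>. distr (L \<theta>) Out (Pair \<theta>)) \<in> measure_pmf ?p \<rightarrow>\<^sub>M subprob_algebra Out"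
    using joint_law_kernel[of L, OF L]
    by (auto simp: space_prob_algebra space_subprob_algebra intro: prob_space_imp_subprob_space)
  have "(\<integral>\<^sup>+z. f z \<partial>joint_law M \<mu> L) = (\<integral>\<^sup>+\<theta>. \<integral>\<^sup>+z. f z \<partial>distr (L \<theta>) Out (Pair \<theta>) \<partial>measure_pmf ?p)"
    unfolding joint_law_def by (rule nn_integral_bind[OF f k])
  also have "\<dots> = (\<integral>\<^sup>+\<theta>. \<integral>\<^sup>+\<omega>. f (\<theta>, \<omega>) \<partial>L \<theta> \<partial>measure_pmf ?p)"
  proof (rule nn_integral_cong)
    fix \<theta>
    have "Pair \<theta> \<in> L \<theta> \<rightarrow>\<^sub>M Out"
      unfolding measurable_cong_sets[OF L(2) refl] outcome_space_def by (rule measurable_Pair1') simp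
    then show "(\<integral>\<^sup>+z. f z \<partial>distr (L \<theta>) Out (Pair \<theta>)) = (\<integral>\<^sup>+\<omega>. f (\<theta>, \<omega>) \<partial>L \<theta>)"
      using f by (subst nn_integral_distr) auto
  qed
  also have "\<dots> = ennreal (type_weight Type_C \<mu>) * (\<integral>\<^sup>+\<omega>. f (Type_C, \<omega>) \<partial>L Type_C) + ennreal (type_weight Type_S \<mu>) * (\<integral>\<^sup>+\<omega>. f (Type_S, \<omega>) \<partial>L Type_S)"
    using \<mu> by (simp add: type_weight_def mult.commute)
  finally show ?thesis .
qed

text \<open>A type of prior weight zero leaves no trace in the mixture, so the laws are compared
  only for types of positive weight.\<close>

lemma joint_law_cong:
  assumes L: "\<And>\<theta>. prob_space (L \<theta>)" "\<And>\<theta>. sets (L \<theta>) = sets Rec"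
    and L': "\<And>\<theta>. prob_space (L' \<theta>)" "\<And>\<theta>. sets (L' \<theta>) = sets Rec" and \<mu>: "\<mu> \<in> {0..1}"
    and eq: "\<And>\<theta>. 0 < type_weight \<theta> \<mu> \<Longrightarrow> L \<theta> = L' \<theta>"
  shows "joint_law M \<mu> L = joint_law M \<mu> L'"
proof (rule measure_eqI)
  show "sets (joint_law M \<mu> L) = sets (joint_law M \<mu> L')" using joint_law_space L L' by simp
  fix A assume "A \<in> sets (joint_law M \<mu> L)"
  then have A: "A \<in> sets Out" by (simp add: joint_law_space L)
  have w: "ennreal (type_weight \<theta> \<mu>) * (\<integral>\<^sup>+\<omega>. indicator A (\<theta>, \<omega>) \<partial>L \<theta>) = ennreal (type_weight \<theta> \<mu>) * (\<integral>\<^sup>+\<omega>. indicator A (\<theta>, \<omega>) \<partial>L' \<theta>)" for \<theta>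
    using eq[of \<theta>] type_weight_nonneg[OF \<mu>, of \<theta>] by (cases "0 < type_weight \<theta> \<mu>") auto
  have "(\<integral>\<^sup>+z. indicator A z \<partial>joint_law M \<mu> L) = (\<integral>\<^sup>+z. indicator A z \<partial>joint_law M \<mu> L')"
    using A by (simp add: nn_integral_joint_law[OF L \<mu>] nn_integral_joint_law[OF L' \<mu>] w del: nn_integral_indicator)
  then show "emeasure (joint_law M \<mu> L) A = emeasure (joint_law M \<mu> L') A"
    using A joint_law_space L L' by simp
qed

section \<open>Information available at a calendar time\<close>

abbreviation "F t \<equiv> public_filtration M t"

definition obs :: "nat \<Rightarrow> real \<Rightarrow> mark \<Rightarrow> (firm_type \<times> public_record) set" where
  "obs k s x = {z \<in> space Out. arrival (snd z) (Suc k) \<le> s \<and> snd (snd z k) = x}"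

lemma space_F [simp]: "space (F t) = space Out"
  by (simp add: public_filtration_def space_measure_of_conv)

lemma sets_F: "sets (F t) = sigma_sets (space Out) {obs k s x | k s x. 0 \<le> s \<and> s \<le> t \<and> x \<in> marks M}"
  unfolding public_filtration_def obs_def[symmetric]
  by (rule sets_measure_of) (auto simp: obs_def)

lemma obs_in_F: "0 \<le> s \<Longrightarrow> s \<le> t \<Longrightarrow> x \<in> marks M \<Longrightarrow> obs k s x \<in> sets (F t)"
  unfolding sets_F by (rule sigma_sets.Basic) blast

lemma obs_in_Out: "x \<in> marks M \<Longrightarrow> obs k s x \<in> sets Out"
proof -
  assume "x \<in> marks M"
  then have [measurable]: "{x} \<in> sets (count_space (marks M))" by auto
  have [measurable]: "(\<lambda>z. arrival (snd z) (Suc k)) \<in> borel_measurable Out"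
    by (rule measurable_compose[OF snd_Out arrival_measurable])
  have [measurable]: "(\<lambda>z. snd (snd z k)) \<in> Out \<rightarrow>\<^sub>M count_space (marks M)"
    by (rule measurable_compose[OF measurable_compose[OF snd_Out record_nth_measurable] snd_event_measurable])
  have "{z \<in> space Out. arrival (snd z) (Suc k) \<le> s \<and> snd (snd z k) \<in> {x}} \<in> sets Out" by measurable
  then show ?thesis by (simp add: obs_def)
qed

lemma subalgebra_F: "sets P = sets Out \<Longrightarrow> subalgebra P (F t)"
proof -
  assume P: "sets P = sets Out"
  have "{obs k s x | k s x. 0 \<le> s \<and> s \<le> t \<and> x \<in> marks M} \<subseteq> sets Out"
    using obs_in_Out by blast
  then have "sets (F t) \<subseteq> sets Out" unfolding sets_F by (rule sets.sigma_sets_subset)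
  then show ?thesis unfolding subalgebra_def space_F P using sets_eq_imp_space_eq[OF P] by simp
qed

lemma arrival_le_in_F:
  assumes "0 \<le> s" "s \<le> t" shows "{z \<in> space Out. arrival (snd z) (Suc k) \<le> s} \<in> sets (F t)"
proof -
  have "{z \<in> space Out. arrival (snd z) (Suc k) \<le> s} = (\<Union>x\<in>marks M. obs k s x)"
    by (auto simp: obs_def space_Out space_record_space)
  then show ?thesis using obs_in_F[OF assms] finite_marks[OF fin] by auto
qed

lemma clip_time_measurable: "0 \<le> t \<Longrightarrow> (\<lambda>z. clip_time t (snd z) k) \<in> borel_measurable (F t)"
proof (cases k)
  case (Suc j)
  assume t: "0 \<le> t"
  show ?thesis
    unfolding borel_measurable_iff_le
  proof
    fix a
    consider "a < 0" | "0 \<le> a" "a < t + 1" | "t + 1 \<le> a" by linarith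
    then show "{w \<in> space (F t). clip_time t (snd w) k \<le> a} \<in> sets (F t)"
    proof cases
      case 1
      then have e: "{w \<in> space (F t). clip_time t (snd w) k \<le> a} = {}" using t by (auto simp: clip_time_def Suc)
      show ?thesis unfolding e by (rule sets.empty_sets)
    next
      \<comment> \<open>All values above \<open>t\<close> equal \<open>t + 1\<close>, so a level
        below that sees only the arrivals up to \<open>min a t\<close>.\<close>
      case 2
      then have e: "{w \<in> space (F t). clip_time t (snd w) k \<le> a} = {z \<in> space Out. arrival (snd z) (Suc j) \<le> min a t}"
        by (auto simp: clip_time_def Suc)
      show ?thesis unfolding e using arrival_le_in_F[of "min a t" t j] 2 t by simp
    next
      case 3
      then have e: "{w \<in> space (F t). clip_time t (snd w) k \<le> a} = space (F t)" using t by (auto simp: clip_time_def Suc)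
      show ?thesis unfolding e by (rule sets.top)
    qed
  qed
qed (simp add: clip_time_def)

lemma clip_measurable:
  assumes t: "0 \<le> t" shows "(\<lambda>z. clip t (snd z)) \<in> F t \<rightarrow>\<^sub>M Rec"
proof (rule measurable_into_record_space)
  fix k
  have "(\<lambda>z. if arrival (snd z) (Suc k) \<le> t then snd (snd z k) else Purchase) \<in> F t \<rightarrow>\<^sub>M count_space (marks M)" (is "?f \<in> _")
    unfolding measurable_count_space_eq2[OF finite_marks[OF fin]]
  proof (intro conjI ballI)
    show "?f \<in> space (F t) \<rightarrow> marks M" by (auto simp: space_Out space_record_space)
    fix x assume x: "x \<in> marks M"
    have a: "{z \<in> space Out. arrival (snd z) (Suc k) \<le> t} \<in> sets (F t)" by (rule arrival_le_in_F[OF t order_refl])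
    have "?f -` {x} \<inter> space (F t) = (if x = Purchase then obs k t x \<union> (space (F t) - {z \<in> space Out. arrival (snd z) (Suc k) \<le> t}) else obs k t x)"
      by (auto simp: obs_def split: if_splits)
    then show "?f -` {x} \<inter> space (F t) \<in> sets (F t)"
      using obs_in_F[OF t order_refl x, of k] sets.Un[OF obs_in_F[OF t order_refl x, of k] sets.compl_sets[OF a]]
      by presburger
  qed
  then show "(\<lambda>z. clip t (snd z) k) \<in> F t \<rightarrow>\<^sub>M Ev"
    unfolding clip_def event_space_def
    using clip_time_measurable[OF t] by (intro measurable_Pair) auto
qed

lemma slot_measurable:
  assumes t: "0 \<le> t" shows "(\<lambda>z. slot t (snd z)) \<in> F t \<rightarrow>\<^sub>M count_space UNIV"
  unfolding slot_def
proof (rule measurable_Least)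
  fix n
  have e: "{z \<in> space (F t). \<not> arrival (snd z) (Suc n) \<le> t} = space (F t) - {z \<in> space Out. arrival (snd z) (Suc n) \<le> t}"
    by auto
  show "Measurable.pred (F t) (\<lambda>z. \<not> arrival (snd z) (Suc n) \<le> t)"
    unfolding pred_def e by (rule sets.compl_sets[OF arrival_le_in_F[OF t order_refl]])
qed

lemma slot_function_measurable:
  assumes t: "0 \<le> t" and G: "\<And>n. G n \<in> borel_measurable Rec"
  shows "(\<lambda>z. G (slot t (snd z)) (trunc (slot t (snd z)) (clip t (snd z)))) \<in> borel_measurable (F t)"
  by (rule measurable_compose_countable[OF _ slot_measurable[OF t], where f = "\<lambda>n z. G n (trunc n (clip t (snd z)))"])
     (rule measurable_compose[OF measurable_compose[OF clip_measurable[OF t] trunc_measurable] G])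

text \<open>Within slot \<open>n\<close> the information at time \<open>t\<close> is that of the
  first \<open>n\<close> events. A generator with index at least \<open>n\<close> speaks of an event
  that comes after \<open>t\<close> there and leaves an empty trace; complements and unions carry
  the property along.\<close>

lemma F_slot_trace:
  assumes t: "0 \<le> t" and A: "A \<in> sets (F t)"
  shows "\<exists>B\<in>sets Rec. \<forall>z\<in>space Out. good (snd z) \<longrightarrow> in_slot t n (snd z) \<longrightarrow> (z \<in> A \<longleftrightarrow> trunc n (snd z) \<in> B)"
  using A unfolding sets_F
proof (induction rule: sigma_sets.induct)
  case (Basic a)
  then obtain k s x where a: "a = obs k s x" and s: "s \<le> t" and x: "x \<in> marks M" by blast
  show ?case
  proof (cases "k < n")
    case True
    have [measurable]: "{x} \<in> sets (count_space (marks M))" using x by auto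
    have "{\<omega>\<in>space Rec. arrival \<omega> (Suc k) \<le> s \<and> snd (\<omega> k) \<in> {x}} \<in> sets Rec" by measurable
    then show ?thesis
      using True by (intro bexI[of _ "{\<omega>\<in>space Rec. arrival \<omega> (Suc k) \<le> s \<and> snd (\<omega> k) \<in> {x}}"])
        (auto simp: a obs_def space_Out trunc_space trunc_nth)
  next
    case False
    have "z \<notin> a" if "good (snd z)" "in_slot t n (snd z)" for z
      using strict_mono_less_eq[OF good_arrival_strict_mono[OF that(1)], of "Suc n" "Suc k"] that(2) False s
      by (auto simp: a obs_def in_slot_def)
    then show ?thesis by (intro bexI[of _ "{}"]) auto
  qed
next
  case Empty
  then show ?case by (intro bexI[of _ "{}"]) auto
next
  case (Compl a)
  then obtain B where B: "B \<in> sets Rec" "\<forall>z\<in>space Out. good (snd z) \<longrightarrow> in_slot t n (snd z) \<longrightarrow> (z \<in> a \<longleftrightarrow> trunc n (snd z) \<in> B)"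
    by blast
  then show ?case by (intro bexI[of _ "space Rec - B"]) (auto simp: space_Out trunc_space)
next
  case (Union a)
  then have "\<forall>i. \<exists>B. B \<in> sets Rec \<and> (\<forall>z\<in>space Out. good (snd z) \<longrightarrow> in_slot t n (snd z) \<longrightarrow> (z \<in> a i \<longleftrightarrow> trunc n (snd z) \<in> B))"
    by blast
  then obtain B where B: "\<And>i. B i \<in> sets Rec"
    "\<And>i. \<forall>z\<in>space Out. good (snd z) \<longrightarrow> in_slot t n (snd z) \<longrightarrow> (z \<in> a i \<longleftrightarrow> trunc n (snd z) \<in> B i)"
    by metis
  have "(\<Union>i. B i) \<in> sets Rec" using B(1) by auto
  then show ?case using B(2) by (intro bexI[of _ "\<Union>i. B i"]) auto
qed

lemma in_slot_measurable [measurable]: "Measurable.pred Rec (in_slot t n)"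
  unfolding in_slot_def by measurable

definition slot_part :: "real \<Rightarrow> nat \<Rightarrow> public_record set \<Rightarrow> public_record set" where
  "slot_part t n B = {\<omega>\<in>space Rec. in_slot t n \<omega> \<and> trunc n \<omega> \<in> B}"

lemma slot_part_sets:
  assumes [measurable]: "B \<in> sets Rec" shows "slot_part t n B \<in> sets Rec"
  unfolding slot_part_def by measurable

text \<open>Reduces a conditional expectation given the public filtration to integral identities on
  the slots: up to a null set, a set of the filtration splits into countably many slot parts, and on
  each of them the candidate is a function of the first \<open>n\<close> events. Clipping turns the
  candidate into a function that is measurable at time \<open>t\<close>.\<close>

lemma cond_exp_slotI:
  assumes P: "prob_space P" "sets P = sets Out" and g: "AE z in P. good (snd z)" and t: "0 \<le> t"
    and f: "f \<in> borel_measurable Out" "\<And>z. z \<in> space Out \<Longrightarrow> f z \<in> {0..1}"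
    and G: "\<And>n. G n \<in> borel_measurable Rec" "\<And>n \<omega>. \<omega> \<in> space Rec \<Longrightarrow> G n \<omega> \<in> {0..1}"
    and eq: "\<And>n B. B \<in> sets Rec \<Longrightarrow>
      (\<integral>\<^sup>+z. ennreal (f z) * indicator (slot_part t n B) (snd z) \<partial>P) =
      (\<integral>\<^sup>+z. ennreal (G n (trunc n (snd z))) * indicator (slot_part t n B) (snd z) \<partial>P)"
  shows "AE z in P. real_cond_exp P (F t) f z = G (slot t (snd z)) (trunc (slot t (snd z)) (snd z))"
proof -
  interpret P: prob_space P by fact
  have sub: "subalgebra P (F t)" by (rule subalgebra_F[OF P(2)])
  interpret finite_measure_subalgebra P "F t" by standard (rule sub)
  have spP: "space P = space Out" by (rule sets_eq_imp_space_eq[OF P(2)])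
  define g where "g z = G (slot t (snd z)) (trunc (slot t (snd z)) (clip t (snd z)))" for z :: "firm_type \<times> public_record"
  have gF: "g \<in> borel_measurable (F t)" unfolding g_def by (rule slot_function_measurable[OF t G(1)])
  have gP: "g \<in> borel_measurable P" by (rule measurable_from_subalg[OF sub gF])
  have gb: "g z \<in> {0..1}" if "z \<in> space Out" for z
  proof -
    have "clip t (snd z) \<in> space Rec" using measurable_space[OF clip_measurable[OF t]] that by simp
    then show ?thesis unfolding g_def by (intro G(2) trunc_space)
  qed
  have fP: "f \<in> borel_measurable P" using f(1) by (simp cong: measurable_cong_sets add: P(2))
  have if': "integrable P f" using f(2) fP by (intro P.integrable_const_bound[of _ 1]) (auto simp: spP)
  have ig: "integrable P g" using gb gP by (intro P.integrable_const_bound[of _ 1]) (auto simp: spP)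
  have "AE z in P. real_cond_exp P (F t) f z = g z"
  proof (rule real_cond_exp_charact[OF _ if' ig gF])
    fix A assume A: "A \<in> sets (F t)"
    then have AP: "A \<in> sets P" using sub by (auto simp: subalgebra_def)
    obtain B where B: "\<And>n. B n \<in> sets Rec"
      "\<And>n z. z \<in> space Out \<Longrightarrow> good (snd z) \<Longrightarrow> in_slot t n (snd z) \<Longrightarrow> (z \<in> A \<longleftrightarrow> trunc n (snd z) \<in> B n)"
      using F_slot_trace[OF t A] by metis
    have split: "(\<integral>\<^sup>+z\<in>A. ennreal (h z) \<partial>P) = (\<Sum>n. \<integral>\<^sup>+z. ennreal (h z) * indicator (slot_part t n (B n)) (snd z) \<partial>P)"
      if h: "h \<in> borel_measurable P" for h
    proof -
      have ind: "(\<lambda>z. indicator (slot_part t n (B n)) (snd z) :: ennreal) \<in> borel_measurable P" for n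
        unfolding measurable_cong_sets[OF P(2) refl]
        by (rule measurable_compose[OF snd_Out borel_measurable_indicator[OF slot_part_sets[OF B(1)]]])
      have "(\<integral>\<^sup>+z\<in>A. ennreal (h z) \<partial>P) = (\<integral>\<^sup>+z. (\<Sum>n. ennreal (h z) * indicator (slot_part t n (B n)) (snd z)) \<partial>P)"
      proof (rule nn_integral_cong_AE)
        show "AE z in P. ennreal (h z) * indicator A z = (\<Sum>n. ennreal (h z) * indicator (slot_part t n (B n)) (snd z))"
          using g AE_space
        proof eventually_elim
          case (elim z)
          then have z: "z \<in> space Out" by (simp add: spP)
          then have w: "snd z \<in> space Rec" by (auto simp: space_Out)
          let ?n = "slot t (snd z)"
          have "(\<Sum>n. ennreal (h z) * indicator (slot_part t n (B n)) (snd z))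
            = (\<Sum>n\<in>{?n}. ennreal (h z) * indicator (slot_part t n (B n)) (snd z))"
            by (rule suminf_finite) (use good_slot(2)[OF elim(1) t] in \<open>auto simp: slot_part_def indicator_def\<close>)
          also have "\<dots> = ennreal (h z) * indicator A z"
            using B(2)[OF z elim(1) good_slot(1)[OF elim(1) t]] good_slot(1)[OF elim(1) t] w
            by (auto simp: slot_part_def indicator_def)
          finally show ?case by simp
        qed
      qed
      also have "\<dots> = (\<Sum>n. \<integral>\<^sup>+z. ennreal (h z) * indicator (slot_part t n (B n)) (snd z) \<partial>P)"
        by (intro nn_integral_suminf borel_measurable_times_ennreal ind measurable_compose[OF h measurable_ennreal])
      finally show ?thesis .
    qed
    have "(\<integral>\<^sup>+z\<in>A. ennreal (f z) \<partial>P) = (\<integral>\<^sup>+z\<in>A. ennreal (g z) \<partial>P)"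
      unfolding split[OF fP] split[OF gP] eq[OF B(1)]
    proof (intro suminf_cong nn_integral_cong_AE)
      fix n
      show "AE z in P. ennreal (G n (trunc n (snd z))) * indicator (slot_part t n (B n)) (snd z)
        = ennreal (g z) * indicator (slot_part t n (B n)) (snd z)"
        using g
      proof eventually_elim
        case (elim z)
        show ?case
        proof (cases "in_slot t n (snd z)")
          case True
          then have "n = slot t (snd z)" by (rule good_slot(2)[OF elim t])
          then show ?thesis using trunc_clip[OF elim True] by (simp add: g_def)
        qed (simp add: slot_part_def)
      qed
    qed
    moreover have "(\<integral>\<^sup>+z\<in>A. ennreal (h z) \<partial>P) = ennreal (LINT z:A|P. h z)"
      if ih: "integrable P h" and hb: "\<And>z. z \<in> space Out \<Longrightarrow> h z \<in> {0..1}" for h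
    proof (rule set_nn_integral_eq_LINT)
      show "set_integrable P A h" unfolding set_integrable_def by (rule integrable_mult_indicator[OF AP ih])
      fix z assume "z \<in> A"
      then have "z \<in> space Out" using sets.sets_into_space[OF AP] spP by blast
      from hb[OF this] show "0 \<le> h z" by simp
    qed
    moreover have "0 \<le> (LINT z:A|P. h z)" if "\<And>z. z \<in> space Out \<Longrightarrow> h z \<in> {0..1}" for h :: "_ \<Rightarrow> real"
      unfolding set_lebesgue_integral_def using that by (intro integral_nonneg_AE AE_I2) (auto simp: spP indicator_def)
    ultimately show "(LINT z:A|P. f z) = (LINT z:A|P. g z)"
      using if' ig f(2) gb by simp
  qed
  then show ?thesis using g
  proof eventually_elim
    case (elim z)
    then show ?case using trunc_clip[OF elim(2) good_slot(1)[OF elim(2) t]] by (simp add: g_def)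
  qed
qed

text \<open>The converse: on good records a slot part coincides with a set of the filtration,
  against which the conditional expectation may be tested.\<close>

lemma cond_exp_slotD:
  assumes P: "prob_space P" "sets P = sets Out" and g: "AE z in P. good (snd z)" and t: "0 \<le> t"
    and f: "f \<in> borel_measurable Out" "\<And>z. z \<in> space Out \<Longrightarrow> f z \<in> {0..1}"
    and G: "\<And>n. G n \<in> borel_measurable Rec" "\<And>n \<omega>. \<omega> \<in> space Rec \<Longrightarrow> G n \<omega> \<in> {0..1}"
    and ce: "AE z in P. real_cond_exp P (F t) f z = G (slot t (snd z)) (trunc (slot t (snd z)) (snd z))"
    and B: "B \<in> sets Rec"
  shows "(\<integral>\<^sup>+z. ennreal (f z) * indicator (slot_part t n B) (snd z) \<partial>P) =
      (\<integral>\<^sup>+z. ennreal (G n (trunc n (snd z))) * indicator (slot_part t n B) (snd z) \<partial>P)"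
proof -
  interpret P: prob_space P by fact
  have sub: "subalgebra P (F t)" by (rule subalgebra_F[OF P(2)])
  interpret finite_measure_subalgebra P "F t" by standard (rule sub)
  have spP: "space P = space Out" by (rule sets_eq_imp_space_eq[OF P(2)])
  define g where "g z = G (slot t (snd z)) (trunc (slot t (snd z)) (clip t (snd z)))" for z :: "firm_type \<times> public_record"
  have gF: "g \<in> borel_measurable (F t)" unfolding g_def by (rule slot_function_measurable[OF t G(1)])
  have gP: "g \<in> borel_measurable P" by (rule measurable_from_subalg[OF sub gF])
  have gb: "g z \<in> {0..1}" if "z \<in> space Out" for z
  proof -
    have "clip t (snd z) \<in> space Rec" using measurable_space[OF clip_measurable[OF t]] that by simp
    then show ?thesis unfolding g_def by (intro G(2) trunc_space)
  qed
  have fP: "f \<in> borel_measurable P" using f(1) by (simp cong: measurable_cong_sets add: P(2))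
  have if': "integrable P f" using f(2) fP by (intro P.integrable_const_bound[of _ 1]) (auto simp: spP)
  have ig: "integrable P g" using gb gP by (intro P.integrable_const_bound[of _ 1]) (auto simp: spP)
  \<comment> \<open>Reading the truncation from the clipped record instead of the full one gives a
    set that is known at time \<open>t\<close>.\<close>
  define A where "A = {z\<in>space (F t). slot t (snd z) = n \<and> trunc n (clip t (snd z)) \<in> B}"
  have A: "A \<in> sets (F t)"
  proof -
    have [measurable]: "(\<lambda>z. slot t (snd z)) \<in> F t \<rightarrow>\<^sub>M count_space UNIV" by (rule slot_measurable[OF t])
    have [measurable]: "(\<lambda>z. trunc n (clip t (snd z))) \<in> F t \<rightarrow>\<^sub>M Rec"
      by (rule measurable_compose[OF clip_measurable[OF t] trunc_measurable])
    show ?thesis unfolding A_def using B by measurable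
  qed
  then have AP: "A \<in> sets P" using sub by (auto simp: subalgebra_def)
  have Aiff: "z \<in> A \<longleftrightarrow> snd z \<in> slot_part t n B" if "z \<in> space Out" "good (snd z)" for z
  proof (cases "in_slot t n (snd z)")
    case True
    then have "slot t (snd z) = n" using good_slot(2)[OF that(2) t] by simp
    moreover have "snd z \<in> space Rec" using that(1) by (simp add: space_Out mem_Times_iff)
    ultimately show ?thesis using True that(1) trunc_clip[OF that(2) True] by (simp add: A_def slot_part_def)
  next
    case False
    then have "slot t (snd z) \<noteq> n" using good_slot(1)[OF that(2) t] by metis
    then show ?thesis using False by (simp add: A_def slot_part_def)
  qed
  have "(LINT z:A|P. f z) = (LINT z:A|P. real_cond_exp P (F t) f z)"
    by (rule real_cond_exp_intA[OF if' A])
  also have "\<dots> = (LINT z:A|P. g z)"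
    unfolding set_lebesgue_integral_def
  proof (rule integral_cong_AE)
    show "AE z in P. indicat_real A z *\<^sub>R real_cond_exp P (F t) f z = indicat_real A z *\<^sub>R g z"
      using ce g
    proof eventually_elim
      case (elim z)
      then show ?case using trunc_clip[OF elim(2) good_slot(1)[OF elim(2) t]] by (simp add: g_def)
    qed
    show "(\<lambda>z. indicat_real A z *\<^sub>R real_cond_exp P (F t) f z) \<in> borel_measurable P"
      by (intro borel_measurable_scaleR borel_measurable_indicator AP borel_measurable_cond_exp2)
    show "(\<lambda>z. indicat_real A z *\<^sub>R g z) \<in> borel_measurable P"
      by (intro borel_measurable_scaleR borel_measurable_indicator AP gP)
  qed
  finally have L: "(LINT z:A|P. f z) = (LINT z:A|P. g z)" .
  have nn: "(\<integral>\<^sup>+z\<in>A. ennreal (h z) \<partial>P) = ennreal (LINT z:A|P. h z)"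
    if ih: "integrable P h" and hb: "\<And>z. z \<in> space Out \<Longrightarrow> h z \<in> {0..1}" for h
  proof (rule set_nn_integral_eq_LINT)
    show "set_integrable P A h" unfolding set_integrable_def by (rule integrable_mult_indicator[OF AP ih])
    fix z assume "z \<in> A"
      then have "z \<in> space Out" using sets.sets_into_space[OF AP] spP by blast
      from hb[OF this] show "0 \<le> h z" by simp
  qed
  have "(\<integral>\<^sup>+z. ennreal (f z) * indicator (slot_part t n B) (snd z) \<partial>P) = (\<integral>\<^sup>+z\<in>A. ennreal (f z) \<partial>P)"
  proof (rule nn_integral_cong_AE)
    show "AE z in P. ennreal (f z) * indicator (slot_part t n B) (snd z) = ennreal (f z) * indicator A z"
      using g AE_space by eventually_elim (auto simp: Aiff spP indicator_def)
  qed
  also have "\<dots> = (\<integral>\<^sup>+z\<in>A. ennreal (g z) \<partial>P)"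
    using nn[OF if' f(2)] nn[OF ig gb] L by simp
  also have "\<dots> = (\<integral>\<^sup>+z. ennreal (G n (trunc n (snd z))) * indicator (slot_part t n B) (snd z) \<partial>P)"
  proof (rule nn_integral_cong_AE)
    show "AE z in P. ennreal (g z) * indicator A z = ennreal (G n (trunc n (snd z))) * indicator (slot_part t n B) (snd z)"
      using g AE_space
    proof eventually_elim
      case (elim z)
      show ?case
      proof (cases "snd z \<in> slot_part t n B")
        case True
        then have s: "in_slot t n (snd z)" by (simp add: slot_part_def)
        then have "slot t (snd z) = n" using good_slot(2)[OF elim(1) t] by simp
        then show ?thesis using Aiff[of z] elim True trunc_clip[OF elim(1) s] by (simp add: g_def spP)
      qed (use Aiff[of z] elim in \<open>simp add: spP\<close>)
    qed
  qed
  finally show ?thesis .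
qed

end

text \<open>Stated for rates that depend on the whole history, as those of an arbitrary reputation
  may; for rates driven by the public state it reduces to \<open>surv\<close>.\<close>

definition hist_surv :: "market \<Rightarrow> (event list \<Rightarrow> real \<Rightarrow> mark \<Rightarrow> real) \<Rightarrow> nat \<Rightarrow> real \<Rightarrow> public_record \<Rightarrow> real" where
  "hist_surv M r n t \<omega> = exp (- (LINT s:{0..t - arrival \<omega> n}|lborel. \<Sum>x\<in>marks M. r (history \<omega> n) s x))"

text \<open>The part of being in slot \<open>n\<close> that the first \<open>n\<close> events
  decide; on it the elapsed time \<open>t - arrival \<omega> n\<close> is nonnegative.\<close>

definition early :: "market \<Rightarrow> real \<Rightarrow> nat \<Rightarrow> public_record set \<Rightarrow> public_record set" where
  "early M t n B = {\<omega>\<in>space (record_space M). arrival \<omega> n \<le> t \<and> \<omega> \<in> B}"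

lemma early_sets [measurable]: 
  assumes [measurable]: "B \<in> sets (record_space M)" shows "early M t n B \<in> sets (record_space M)"
  unfolding early_def by measurable

lemma hist_surv_trunc [simp]: "hist_surv M r n t (trunc n \<omega>) = hist_surv M r n t \<omega>"
  by (simp add: hist_surv_def)

lemma event_law_surv:
  assumes rf: "rate_family M r lo hi" and w: "\<omega> \<in> space (record_space M)" and t: "arrival \<omega> n \<le> t"
  shows "(\<integral>\<^sup>+e. indicator {t - arrival \<omega> n<..} (fst e) \<partial>event_law M (r (history \<omega> n))) = ennreal (hist_surv M r n t \<omega>)"
proof -
  interpret mark_rates M "r (history \<omega> n)" lo hi by (rule rate_familyD[OF rf w])
  have "(\<integral>\<^sup>+e. indicator {t - arrival \<omega> n<..} (fst e) \<partial>event_law M (r (history \<omega> n))) = emeasure waiting_law {t - arrival \<omega> n<..}"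
    by (subst nn_integral_event_law_fst) (auto simp: waiting_law_def)
  also have "\<dots> = ennreal (hist_surv M r n t \<omega>)"
    using t by (subst emeasure_waiting_law_Ioi) (auto simp: hist_surv_def cum_def)
  finally show ?thesis .
qed

text \<open>The survival factor is the kernel probability that the next wait exceeds the elapsed
  time, so measurability is inherited from the event kernel.\<close>

lemma hist_surv_measurable:
  assumes rf: "rate_family M r lo hi" and B [measurable]: "B \<in> sets (record_space M)"
  shows "(\<lambda>\<omega>. indicator (early M t n B) \<omega> * ennreal (hist_surv M r n t \<omega>)) \<in> borel_measurable (record_space M)"
proof -
  define f where "f = (\<lambda>p :: public_record \<times> event. (if t - arrival (fst p) n < fst (snd p) then 1 else 0 :: ennreal))"
  have f: "f \<in> borel_measurable (record_space M \<Otimes>\<^sub>M event_space M)" unfolding f_def by measurable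
  have [measurable]: "(\<lambda>\<omega>. \<integral>\<^sup>+e. f (\<omega>, e) \<partial>event_law M (r (history \<omega> n))) \<in> borel_measurable (record_space M)"
    by (rule kernel_integral_measurable[OF rf f])
  have "(\<lambda>\<omega>. indicator (early M t n B) \<omega> * (\<integral>\<^sup>+e. f (\<omega>, e) \<partial>event_law M (r (history \<omega> n)))) \<in> borel_measurable (record_space M)"
    by measurable
  then show ?thesis
  proof (rule measurable_cong[THEN iffD1, rotated])
    fix \<omega> assume w: "\<omega> \<in> space (record_space M)"
    have "f (\<omega>, e) = indicator {t - arrival \<omega> n<..} (fst e)" for e by (simp add: f_def indicator_def)
    then show "indicator (early M t n B) \<omega> * (\<integral>\<^sup>+e. f (\<omega>, e) \<partial>event_law M (r (history \<omega> n)))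
      = indicator (early M t n B) \<omega> * ennreal (hist_surv M r n t \<omega>)"
      using event_law_surv[OF rf w, of n t] by (cases "\<omega> \<in> early M t n B") (simp_all add: early_def)
  qed
qed

section \<open>Integrals over slots\<close>

context market_model
begin

lemma indicator_slot_part:
  assumes "\<omega> \<in> space Rec"
  shows "indicator (slot_part t n B) \<omega>
    = (indicator (early M t n B) (trunc n \<omega>) * indicator {t - arrival (trunc n \<omega>) n<..} (fst (\<omega> n)) :: ennreal)"
  using assms trunc_space[OF assms, of n]
  by (auto simp: slot_part_def early_def in_slot_def arrival_Suc indicator_def)

text \<open>Being in slot \<open>n\<close> means \<open>n\<close> arrivals up to \<open>t\<close>
  and a next wait beyond the elapsed time. Integrating out the next event turns the second condition
  into the survival factor.\<close>

lemma slot_integral: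
  assumes rf: "rate_family M r lo hi" and Q: "sets Q = sets Rec" and N: "next_event_law M r Q n"
    and f [measurable]: "f \<in> borel_measurable Rec" and B [measurable]: "B \<in> sets Rec"
  shows "(\<integral>\<^sup>+\<omega>. f (trunc n \<omega>) * indicator (slot_part t n B) \<omega> \<partial>Q)
    = (\<integral>\<^sup>+\<omega>. f (trunc n \<omega>) * (indicator (early M t n B) (trunc n \<omega>) * ennreal (hist_surv M r n t (trunc n \<omega>))) \<partial>Q)"
proof -
  have spQ: "space Q = space Rec" by (rule sets_eq_imp_space_eq[OF Q])
  define g where "g = (\<lambda>p :: public_record \<times> event. f (fst p) * (indicator (early M t n B) (fst p) *
    (if t - arrival (fst p) n < fst (snd p) then 1 else 0 :: ennreal)))"
  have g: "g \<in> borel_measurable (Rec \<Otimes>\<^sub>M Ev)" unfolding g_def by measurable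
  have gi: "g (\<omega>, e) = f \<omega> * (indicator (early M t n B) \<omega> * indicator {t - arrival \<omega> n<..} (fst e))" for \<omega> e
    by (simp add: g_def indicator_def)
  have "(\<integral>\<^sup>+\<omega>. f (trunc n \<omega>) * indicator (slot_part t n B) \<omega> \<partial>Q) = (\<integral>\<^sup>+\<omega>. g (trunc n \<omega>, \<omega> n) \<partial>Q)"
    by (intro nn_integral_cong) (simp add: gi indicator_slot_part spQ)
  also have "\<dots> = (\<integral>\<^sup>+\<omega>. \<integral>\<^sup>+e. g (trunc n \<omega>, e) \<partial>event_law M (r (history \<omega> n)) \<partial>Q)"
    by (rule next_event_lawD[OF N g])
  also have "\<dots> = (\<integral>\<^sup>+\<omega>. f (trunc n \<omega>) * (indicator (early M t n B) (trunc n \<omega>) * ennreal (hist_surv M r n t (trunc n \<omega>))) \<partial>Q)"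
  proof (rule nn_integral_cong)
    fix \<omega> assume "\<omega> \<in> space Q"
    then have w: "\<omega> \<in> space Rec" by (simp add: spQ)
    have m: "(\<lambda>e. indicator {t - arrival \<omega> n<..} (fst e) :: ennreal) \<in> borel_measurable (event_law M (r (history \<omega> n)))"
      unfolding measurable_cong_sets[OF sets_event_law refl] by measurable
    have "(\<integral>\<^sup>+e. g (trunc n \<omega>, e) \<partial>event_law M (r (history \<omega> n)))
      = f (trunc n \<omega>) * (indicator (early M t n B) (trunc n \<omega>) *
          (\<integral>\<^sup>+e. indicator {t - arrival \<omega> n<..} (fst e) \<partial>event_law M (r (history \<omega> n))))"
      unfolding gi using m by (simp add: nn_integral_cmult mult.assoc[symmetric])
    also have "\<dots> = f (trunc n \<omega>) * (indicator (early M t n B) (trunc n \<omega>) * ennreal (hist_surv M r n t (trunc n \<omega>)))"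
      using event_law_surv[OF rf w, of n t] by (cases "trunc n \<omega> \<in> early M t n B") (simp_all add: early_def)
    finally show "(\<integral>\<^sup>+e. g (trunc n \<omega>, e) \<partial>event_law M (r (history \<omega> n)))
      = f (trunc n \<omega>) * (indicator (early M t n B) (trunc n \<omega>) * ennreal (hist_surv M r n t (trunc n \<omega>)))" .
  qed
  finally show ?thesis .
qed

lemma record_law_slot_integral:
  assumes q: "state_rate q" and z: "z \<in> space Z" and f: "f \<in> borel_measurable Rec" and B: "B \<in> sets Rec"
  shows "(\<integral>\<^sup>+\<omega>. f (trunc n \<omega>) * indicator (slot_part t n B) \<omega> \<partial>record_law q z)
    = (\<integral>\<^sup>+\<omega>. f (trunc n \<omega>) * (indicator (early M t n B) (trunc n \<omega>) * ennreal (hist_surv M (hist_rate q z) n t (trunc n \<omega>))) \<partial>record_law q z)"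
  by (rule slot_integral[OF hist_rate_family[OF q z] sets_record_law[OF q z]
      point_process_law_next[OF fin hist_rate_family[OF q z] record_law_law[OF q z]] f B])

lemma hist_surv_hist_rate: "hist_surv M (hist_rate q z) n t \<omega> = surv q (event_state z \<omega> n) (t - arrival \<omega> n)"
  by (simp add: hist_surv_def surv_def pdmp_state_history)

lemma point_process_AE_good:
  assumes "rate_family M r lo hi" "point_process_law M r Q"
  shows "AE \<omega> in Q. good \<omega>"
  using point_process_AE_pos[OF fin assms] point_process_nonexplosive[OF fin assms]
  by eventually_elim (simp add: good_def)

lemma record_law_AE_good: "state_rate q \<Longrightarrow> z \<in> space Z \<Longrightarrow> AE \<omega> in record_law q z. good \<omega>"
  by (rule point_process_AE_good[OF hist_rate_family record_law_law])

lemma AE_joint_law: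
  assumes L: "\<And>\<theta>. prob_space (L \<theta>)" "\<And>\<theta>. sets (L \<theta>) = sets Rec" and \<mu>: "\<mu> \<in> {0..1}"
    and ae: "\<And>\<theta>. 0 < type_weight \<theta> \<mu> \<Longrightarrow> AE \<omega> in L \<theta>. R \<omega>"
  shows "AE z in joint_law M \<mu> L. R (snd z)"
proof -
  have spL: "space (L \<theta>) = space Rec" for \<theta> by (rule sets_eq_imp_space_eq[OF L(2)])
  have "\<exists>N\<in>sets Rec. {\<omega>\<in>space Rec. \<not> R \<omega>} \<subseteq> N \<and> ennreal (type_weight \<theta> \<mu>) * emeasure (L \<theta>) N = 0" for \<theta>
  proof (cases "0 < type_weight \<theta> \<mu>")
    case True
    from ae[OF True] obtain N where N: "{\<omega>\<in>space (L \<theta>). \<not> R \<omega>} \<subseteq> N" "emeasure (L \<theta>) N = 0" "N \<in> sets (L \<theta>)"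
      by (rule AE_E)
    show ?thesis
    proof (intro bexI conjI)
      show "{\<omega>\<in>space Rec. \<not> R \<omega>} \<subseteq> N" using N(1) unfolding spL .
      show "ennreal (type_weight \<theta> \<mu>) * emeasure (L \<theta>) N = 0" using N(2) by simp
      show "N \<in> sets Rec" using N(3) unfolding L(2) .
    qed
  next
    case False
    then have "type_weight \<theta> \<mu> = 0" using type_weight_nonneg[OF \<mu>, of \<theta>] by simp
    \<comment> \<open>A type of weight zero contributes nothing, so the whole space serves as its
      exceptional set.\<close>
    then show ?thesis by (intro bexI[of _ "space Rec"]) auto
  qed
  then have "\<forall>\<theta>. \<exists>N. N \<in> sets Rec \<and> {\<omega>\<in>space Rec. \<not> R \<omega>} \<subseteq> N \<and> ennreal (type_weight \<theta> \<mu>) * emeasure (L \<theta>) N = 0"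
    unfolding Bex_def by (rule allI)
  from choice[OF this] obtain N where
    "\<forall>\<theta>. N \<theta> \<in> sets Rec \<and> {\<omega>\<in>space Rec. \<not> R \<omega>} \<subseteq> N \<theta> \<and> ennreal (type_weight \<theta> \<mu>) * emeasure (L \<theta>) (N \<theta>) = 0" ..
  then have N: "\<And>\<theta>. N \<theta> \<in> sets Rec" "\<And>\<theta>. {\<omega>\<in>space Rec. \<not> R \<omega>} \<subseteq> N \<theta>"
    "\<And>\<theta>. ennreal (type_weight \<theta> \<mu>) * emeasure (L \<theta>) (N \<theta>) = 0" by simp_all
  define f :: "firm_type \<times> public_record \<Rightarrow> ennreal" where "f z = indicator (N (fst z)) (snd z)" for z
  have f: "f \<in> borel_measurable Out"
    unfolding f_def by (rule measurable_from_Out) (use N(1) in simp)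
  have "(\<integral>\<^sup>+z. f z \<partial>joint_law M \<mu> L) = 0"
    using N(1,3) L(2) by (simp add: nn_integral_joint_law[of L, OF L \<mu> f]) (simp add: f_def)
  then have "AE z in joint_law M \<mu> L. f z = 0"
    using f joint_law_space(2)[OF L] by (subst (asm) nn_integral_0_iff_AE) (auto cong: measurable_cong_sets)
  then show ?thesis
    using AE_space
  proof eventually_elim
    case (elim z)
    have "snd z \<in> space Rec"
      using elim(2) sets_eq_imp_space_eq[OF joint_law_space(2)[OF L]] by (auto simp: space_Out)
    moreover have "snd z \<notin> N (fst z)" using elim(1) by (simp add: f_def indicator_def split: if_splits)
    ultimately show ?case using N(2) by blast
  qed
qed

section \<open>The canonical model and its filter\<close>

definition canonical_law :: "real \<times> real \<Rightarrow> firm_type \<Rightarrow> public_record measure" where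
  "canonical_law z \<theta> = record_law (type_intensity \<theta>) z"

definition canonical_joint :: "real \<times> real \<Rightarrow> (firm_type \<times> public_record) measure" where
  "canonical_joint z = joint_law M (fst z) (canonical_law z)"

lemma canonical_law_space: "z \<in> space Z \<Longrightarrow> prob_space (canonical_law z \<theta>)" "z \<in> space Z \<Longrightarrow> sets (canonical_law z \<theta>) = sets Rec"
  by (simp_all add: canonical_law_def record_law_prob sets_record_law state_rate_type_intensity)

lemma canonical_joint_space: "z \<in> space Z \<Longrightarrow> prob_space (canonical_joint z)" "z \<in> space Z \<Longrightarrow> sets (canonical_joint z) = sets Out"
  unfolding canonical_joint_def by (rule joint_law_space; simp add: canonical_law_space)+

lemma type_weight_sum: "\<mu> \<in> {0..1} \<Longrightarrow> ennreal (type_weight Type_C \<mu>) + ennreal (type_weight Type_S \<mu>) = 1"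
  by (simp add: type_weight_def flip: ennreal_plus)

lemma nn_integral_canonical_joint:
  assumes z: "z \<in> space Z" and f: "\<And>\<theta>. f \<theta> \<in> borel_measurable Rec"
  shows "(\<integral>\<^sup>+x. f (fst x) (trunc n (snd x)) \<partial>canonical_joint z)
    = (\<integral>\<^sup>+\<omega>. f Type_C (trunc n \<omega>) * ennreal (type_weight Type_C (fst (event_state z \<omega> n))) \<partial>record_law prate z)
    + (\<integral>\<^sup>+\<omega>. f Type_S (trunc n \<omega>) * ennreal (type_weight Type_S (fst (event_state z \<omega> n))) \<partial>record_law prate z)"
proof -
  have \<mu>: "fst z \<in> {0..1}" using z by (auto simp: space_Z)
  have "(\<lambda>x. f (fst x) (trunc n (snd x))) \<in> borel_measurable Out"
    by (rule measurable_from_Out) (rule measurable_compose[OF trunc_measurable f])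
  then show ?thesis
    unfolding canonical_joint_def
    by (subst nn_integral_joint_law[OF canonical_law_space(1)[OF z] canonical_law_space(2)[OF z] \<mu>])
       (simp_all add: canonical_law_def record_law_bayes[OF z f])
qed

lemma fst_event_state_range: "z \<in> space Z \<Longrightarrow> \<omega> \<in> space Rec \<Longrightarrow> fst (event_state z \<omega> n) \<in> {0..1}"
  using event_state_space[of z \<omega> n] by (simp add: space_Z mem_Times_iff)

lemma type_weight_event_state_measurable: "z \<in> space Z \<Longrightarrow> (\<lambda>\<omega>. ennreal (type_weight \<theta> (fst (event_state z \<omega> n)))) \<in> borel_measurable Rec"
  by (intro measurable_compose[OF _ measurable_ennreal] type_weight_measurable measurable_compose[OF event_state_measurable' fst_Z_borel])

text \<open>The posterior weights of the two types sum to 1 along every record, so mixing the type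
  laws by the prior gives the public law.\<close>

lemma distr_canonical_joint:
  assumes z: "z \<in> space Z"
  shows "distr (canonical_joint z) Rec snd = record_law prate z"
proof -
  have m: "snd \<in> canonical_joint z \<rightarrow>\<^sub>M Rec"
    unfolding measurable_cong_sets[OF canonical_joint_space(2)[OF z] refl] by (rule snd_Out)
  show ?thesis
  proof (rule record_measure_eqI)
    show "prob_space (distr (canonical_joint z) Rec snd)"
      by (rule prob_space.prob_space_distr[OF canonical_joint_space(1)[OF z] m])
    show "sets (record_law prate z) = sets Rec" by (rule sets_record_law[OF state_rate_prate z])
    fix n show "same_trunc_law M (distr (canonical_joint z) Rec snd) (record_law prate z) n"
      unfolding same_trunc_law_def
    proof
      fix f :: "public_record \<Rightarrow> ennreal" assume f [measurable]: "f \<in> borel_measurable Rec"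
      note w = type_weight_event_state_measurable[OF z]
      have m2: "(\<lambda>\<omega>. f (trunc n \<omega>) * ennreal (type_weight \<theta> (fst (event_state z \<omega> n)))) \<in> borel_measurable (record_law prate z)" for \<theta>
        unfolding measurable_cong_sets[OF sets_record_law[OF state_rate_prate z] refl]
        by (intro borel_measurable_times_ennreal w measurable_compose[OF trunc_measurable f])
      have "(\<integral>\<^sup>+\<omega>. f (trunc n \<omega>) \<partial>distr (canonical_joint z) Rec snd) = (\<integral>\<^sup>+x. f (trunc n (snd x)) \<partial>canonical_joint z)"
        by (rule nn_integral_distr[OF m]) (use f in simp)
      also have "\<dots> = (\<integral>\<^sup>+\<omega>. f (trunc n \<omega>) * ennreal (type_weight Type_C (fst (event_state z \<omega> n))) + f (trunc n \<omega>) * ennreal (type_weight Type_S (fst (event_state z \<omega> n))) \<partial>record_law prate z)"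
        using nn_integral_canonical_joint[OF z f, of n] nn_integral_add[OF m2 m2] by simp
      also have "\<dots> = (\<integral>\<^sup>+\<omega>. f (trunc n \<omega>) \<partial>record_law prate z)"
      proof (rule nn_integral_cong)
        fix \<omega> assume "\<omega> \<in> space (record_law prate z)"
        then have "\<omega> \<in> space Rec" by (simp add: space_record_law[OF state_rate_prate z])
        from type_weight_sum[OF fst_event_state_range[OF z this, of n]]
        show "f (trunc n \<omega>) * ennreal (type_weight Type_C (fst (event_state z \<omega> n))) + f (trunc n \<omega>) * ennreal (type_weight Type_S (fst (event_state z \<omega> n))) = f (trunc n \<omega>)"
          unfolding distrib_left[symmetric] by simp
      qed
      finally show "(\<integral>\<^sup>+\<omega>. f (trunc n \<omega>) \<partial>distr (canonical_joint z) Rec snd) = (\<integral>\<^sup>+\<omega>. f (trunc n \<omega>) \<partial>record_law prate z)" .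
    qed
  qed simp
qed

lemma nn_integral_canonical_joint_snd:
  assumes z: "z \<in> space Z" and f: "f \<in> borel_measurable Rec"
  shows "(\<integral>\<^sup>+x. f (snd x) \<partial>canonical_joint z) = (\<integral>\<^sup>+\<omega>. f \<omega> \<partial>record_law prate z)"
proof -
  have m: "snd \<in> canonical_joint z \<rightarrow>\<^sub>M Rec"
    unfolding measurable_cong_sets[OF canonical_joint_space(2)[OF z] refl] by (rule snd_Out)
  have "(\<integral>\<^sup>+\<omega>. f \<omega> \<partial>distr (canonical_joint z) Rec snd) = (\<integral>\<^sup>+x. f (snd x) \<partial>canonical_joint z)"
    by (rule nn_integral_distr[OF m]) (use f in simp)
  then show ?thesis by (simp add: distr_canonical_joint[OF z])
qed

lemma AE_canonical_joint:
  assumes z: "z \<in> space Z" and ae: "AE \<omega> in record_law prate z. R \<omega>"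
  shows "AE x in canonical_joint z. R (snd x)"
proof -
  have m: "snd \<in> canonical_joint z \<rightarrow>\<^sub>M Rec"
    unfolding measurable_cong_sets[OF canonical_joint_space(2)[OF z] refl] by (rule snd_Out)
  have "AE \<omega> in distr (canonical_joint z) Rec snd. R \<omega>" unfolding distr_canonical_joint[OF z] by (rule ae)
  then show ?thesis by (rule AE_distrD[OF m])
qed

definition reached :: "real \<times> real \<Rightarrow> real \<Rightarrow> nat \<Rightarrow> public_record \<Rightarrow> real \<times> real" where
  "reached z t n \<omega> = flow_state (event_state z \<omega> n) (t - arrival \<omega> n)"

lemma reached_trunc [simp]: "reached z t n (trunc n \<omega>) = reached z t n \<omega>"
  by (simp add: reached_def)

lemma reached_measurable: "z \<in> space Z \<Longrightarrow> reached z t n \<in> Rec \<rightarrow>\<^sub>M Z"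
proof -
  assume z: "z \<in> space Z"
  have "(\<lambda>\<omega>. (event_state z \<omega> n, t - arrival \<omega> n)) \<in> Rec \<rightarrow>\<^sub>M Z \<Otimes>\<^sub>M (borel :: real measure)"
    by (intro measurable_Pair event_state_measurable'[OF z]) measurable
  from measurable_compose[OF this flow_state_measurable] show ?thesis
    by (simp add: reached_def[abs_def])
qed

lemma reached_space: "z \<in> space Z \<Longrightarrow> \<omega> \<in> space Rec \<Longrightarrow> reached z t n \<omega> \<in> space Z"
  by (rule measurable_space[OF reached_measurable])

text \<open>On slot \<open>n\<close> the likelihood of type C is that of the first \<open>n\<close>
  events times that of the silence since then. \<open>record_law_bayes\<close> and
  \<open>type_weight_surv\<close> convert the two factors in turn, and the posterior left over is
  the reputation reached by the flow.\<close>

lemma canonical_filter: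
  assumes z: "z \<in> space Z" and t: "0 \<le> t"
  shows "AE x in canonical_joint z. real_cond_exp (canonical_joint z) (F t) (indicator {x. fst x = Type_C}) x
    = fst (reached z t (slot t (snd x)) (snd x))"
proof -
  define f :: "firm_type \<times> public_record \<Rightarrow> real" where "f = indicator {x. fst x = Type_C}"
  have f: "f \<in> borel_measurable Out" unfolding f_def by (rule indicator_type_measurable)
  have ind: "(\<lambda>\<omega>. indicator (slot_part t n B) \<omega> :: ennreal) \<in> borel_measurable Rec" if "B \<in> sets Rec" for n B
    using slot_part_sets[OF that] by simp
  have "AE x in canonical_joint z. real_cond_exp (canonical_joint z) (F t) f x
    = fst (reached z t (slot t (snd x)) (trunc (slot t (snd x)) (snd x)))"
  proof (rule cond_exp_slotI[OF canonical_joint_space(1)[OF z] canonical_joint_space(2)[OF z] AE_canonical_joint[OF z record_law_AE_good[OF state_rate_prate z]] t f])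
    show "f x \<in> {0..1}" for x by (simp add: f_def indicator_def)
    show "(\<lambda>\<omega>. fst (reached z t n \<omega>)) \<in> borel_measurable Rec" for n
      by (rule measurable_compose[OF reached_measurable[OF z] fst_Z_borel])
    show "fst (reached z t n \<omega>) \<in> {0..1}" if "\<omega> \<in> space Rec" for n \<omega>
      using reached_space[OF z that] by (simp add: space_Z mem_Times_iff)
    fix n B assume B: "B \<in> sets Rec"
    have \<mu>: "fst z \<in> {0..1}" using z by (auto simp: space_Z)
    \<comment> \<open>On early records, the probability under type C, given the first
      \<open>n\<close> events, that the next one comes after \<open>t\<close>.\<close>
    define a where "a \<omega> = indicator (early M t n B) \<omega> * ennreal (hist_surv M (hist_rate (type_intensity Type_C) z) n t \<omega>)" for \<omega>
    have a: "a \<in> borel_measurable Rec"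
      unfolding a_def by (rule hist_surv_measurable[OF hist_rate_family[OF state_rate_type_intensity z] B])
    have fm: "(\<lambda>x. ennreal (f x) * indicator (slot_part t n B) (snd x)) \<in> borel_measurable Out"
      by (intro borel_measurable_times_ennreal measurable_compose[OF f measurable_ennreal] measurable_compose[OF snd_Out ind[OF B]])
    have "(\<integral>\<^sup>+x. ennreal (f x) * indicator (slot_part t n B) (snd x) \<partial>canonical_joint z)
      = ennreal (type_weight Type_C (fst z)) * (\<integral>\<^sup>+\<omega>. indicator (slot_part t n B) \<omega> \<partial>canonical_law z Type_C)"
      unfolding canonical_joint_def
      by (subst nn_integral_joint_law[OF canonical_law_space(1)[OF z] canonical_law_space(2)[OF z] \<mu> fm])
         (simp add: f_def del: nn_integral_indicator)
    also have "\<dots> = ennreal (type_weight Type_C (fst z)) * (\<integral>\<^sup>+\<omega>. a (trunc n \<omega>) \<partial>record_law (type_intensity Type_C) z)"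
      using record_law_slot_integral[OF state_rate_type_intensity[of Type_C] z borel_measurable_const[where c = 1] B, where n = n and t = t]
      by (simp add: canonical_law_def a_def del: nn_integral_indicator hist_surv_trunc)
    also have "\<dots> = (\<integral>\<^sup>+\<omega>. a (trunc n \<omega>) * ennreal (type_weight Type_C (fst (event_state z \<omega> n))) \<partial>record_law prate z)"
      by (rule record_law_bayes[OF z a])
    also have "\<dots> = (\<integral>\<^sup>+\<omega>. ennreal (fst (reached z t n (trunc n \<omega>))) *
        (indicator (early M t n B) (trunc n \<omega>) * ennreal (hist_surv M (hist_rate prate z) n t (trunc n \<omega>))) \<partial>record_law prate z)"
    proof (rule nn_integral_cong)
      fix \<omega> assume "\<omega> \<in> space (record_law prate z)"
      then have w: "\<omega> \<in> space Rec" by (simp add: space_record_law[OF state_rate_prate z])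
      show "a (trunc n \<omega>) * ennreal (type_weight Type_C (fst (event_state z \<omega> n))) = ennreal (fst (reached z t n (trunc n \<omega>))) *
        (indicator (early M t n B) (trunc n \<omega>) * ennreal (hist_surv M (hist_rate prate z) n t (trunc n \<omega>)))"
      proof (cases "trunc n \<omega> \<in> early M t n B")
        case True
        then have u: "0 \<le> t - arrival \<omega> n" by (simp add: early_def)
        have "0 \<le> fst (event_state z \<omega> n)" "0 \<le> fst (reached z t n \<omega>)"
          using fst_event_state_range[OF z w] reached_space[OF z w, of t n] by (auto simp: space_Z mem_Times_iff)
        then show ?thesis
          using True type_weight_surv[OF event_state_space[OF z w] u, of Type_C n] surv_pos
          by (simp add: a_def hist_surv_hist_rate reached_def type_weight_def ennreal_mult[symmetric] less_imp_le mult.commute)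
      qed (simp add: a_def)
    qed
    also have "\<dots> = (\<integral>\<^sup>+\<omega>. ennreal (fst (reached z t n (trunc n \<omega>))) * indicator (slot_part t n B) \<omega> \<partial>record_law prate z)"
      by (rule record_law_slot_integral[OF state_rate_prate z _ B, symmetric])
         (rule measurable_compose[OF measurable_compose[OF reached_measurable[OF z] fst_Z_borel] measurable_ennreal])
    also have "\<dots> = (\<integral>\<^sup>+x. ennreal (fst (reached z t n (trunc n (snd x)))) * indicator (slot_part t n B) (snd x) \<partial>canonical_joint z)"
    proof (rule nn_integral_canonical_joint_snd[OF z, symmetric])
      show "(\<lambda>\<omega>. ennreal (fst (reached z t n (trunc n \<omega>))) * indicator (slot_part t n B) \<omega>) \<in> borel_measurable Rec"
        by (intro borel_measurable_times_ennreal ind[OF B] measurable_compose[OF _ measurable_ennreal]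
            measurable_compose[OF measurable_compose[OF trunc_measurable reached_measurable[OF z]] fst_Z_borel])
    qed
    finally show "(\<integral>\<^sup>+x. ennreal (f x) * indicator (slot_part t n B) (snd x) \<partial>canonical_joint z)
      = (\<integral>\<^sup>+x. ennreal (fst (reached z t n (trunc n (snd x)))) * indicator (slot_part t n B) (snd x) \<partial>canonical_joint z)" .
  qed
  then show ?thesis by (simp add: f_def)
qed

section \<open>The future after a calendar time\<close>

lemma event_count_measurable [measurable]: "(\<lambda>\<omega>. event_count \<omega> t) \<in> Rec \<rightarrow>\<^sub>M count_space UNIV"
  unfolding event_count_def by measurable

lemma future_measurable: "future t \<in> Rec \<rightarrow>\<^sub>M Rec"
proof (rule measurable_into_record_space)
  fix k
  have "(\<lambda>\<omega>. (\<lambda>N \<omega>. if k = 0 then (arrival \<omega> (Suc N) - t, snd (\<omega> N)) else \<omega> (N + k)) (event_count \<omega> t) \<omega>) \<in> Rec \<rightarrow>\<^sub>M Ev"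
  proof (rule measurable_compose_countable[OF _ event_count_measurable])
    fix N
    have "(\<lambda>\<omega>. (arrival \<omega> (Suc N) - t, snd (\<omega> N))) \<in> Rec \<rightarrow>\<^sub>M Ev"
      unfolding event_space_def
      by (intro measurable_Pair measurable_compose[OF record_nth_measurable snd_event_measurable]) measurable
    then show "(\<lambda>\<omega>. if k = 0 then (arrival \<omega> (Suc N) - t, snd (\<omega> N)) else \<omega> (N + k)) \<in> Rec \<rightarrow>\<^sub>M Ev"
      by (cases "k = 0") simp_all
  qed
  then show "(\<lambda>\<omega>. future t \<omega> k) \<in> Rec \<rightarrow>\<^sub>M Ev" by (simp add: future_def Let_def)
qed

lemma future_slot:
  assumes "good \<omega>" "0 \<le> t" "in_slot t n \<omega>"
  shows "future t \<omega> = scons (fst (\<omega> n) - (t - arrival \<omega> n), snd (\<omega> n)) (shift (Suc n) \<omega>)"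
proof -
  have "event_count \<omega> t = n" using good_slot[OF assms(1,2)] assms(3) by simp
  then show ?thesis
    by (auto simp: future_def scons_def shift_def arrival_Suc fun_eq_iff split: nat.split)
qed

text \<open>In slot \<open>n\<close> the future consists of the remainder of the current wait, its
  mark and the later events. \<open>record_law_markov_event\<close> isolates these, and
  \<open>record_law_restart\<close> recognises them as a fresh record from the state reached, with
  the survival factor of the slot in front.\<close>

lemma record_law_future_slot:
  assumes z: "z \<in> space Z" and t: "0 \<le> t" and B: "B \<in> sets Rec" and C: "C \<in> sets Rec"
  shows "(\<integral>\<^sup>+\<omega>. indicator C (future t \<omega>) * indicator (slot_part t n B) \<omega> \<partial>record_law prate z)
    = (\<integral>\<^sup>+\<omega>. emeasure (record_law prate (reached z t n (trunc n \<omega>))) C * indicator (slot_part t n B) \<omega> \<partial>record_law prate z)"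
proof -
  note q = state_rate_prate
  have [measurable]: "B \<in> sets Rec" "C \<in> sets Rec" by fact+
  \<comment> \<open>A function of the past, the event in progress and the later events that equals
    the left integrand on good records; the elapsed silence is deducted from the wait of the event
    in progress.\<close>
  define g where "g = (\<lambda>y :: (public_record \<times> event) \<times> public_record. indicator (early M t n B) (fst (fst y)) *
    ((if t - arrival (fst (fst y)) n < fst (snd (fst y)) then 1 else 0) *
      indicator C (scons (fst (snd (fst y)) - (t - arrival (fst (fst y)) n), snd (snd (fst y))) (snd y))) :: ennreal)"
  have "(\<lambda>y. (fst (snd (fst y)) - (t - arrival (fst (fst y)) n), snd (snd (fst y)))) \<in> (Rec \<Otimes>\<^sub>M Ev) \<Otimes>\<^sub>M Rec \<rightarrow>\<^sub>M Ev"
    unfolding event_space_def by (intro measurable_Pair) (simp_all add: event_space_def[symmetric])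
  from measurable_compose[OF measurable_Pair[OF this measurable_snd] scons_measurable]
  have [measurable]: "(\<lambda>y. scons (fst (snd (fst y)) - (t - arrival (fst (fst y)) n), snd (snd (fst y))) (snd y)) \<in> (Rec \<Otimes>\<^sub>M Ev) \<Otimes>\<^sub>M Rec \<rightarrow>\<^sub>M Rec"
    by simp
  have g: "g \<in> borel_measurable ((Rec \<Otimes>\<^sub>M Ev) \<Otimes>\<^sub>M Rec)" unfolding g_def by measurable
  have Cm: "(\<lambda>\<omega>. emeasure (record_law prate (reached z t n \<omega>)) C) \<in> borel_measurable Rec"
    by (rule measurable_compose[OF measurable_compose[OF reached_measurable[OF z] measurable_prob_algebraD[OF record_law_measurable[OF q]]]])
       (rule measurable_emeasure_subprob_algebra[OF C])
  have "(\<integral>\<^sup>+\<omega>. indicator C (future t \<omega>) * indicator (slot_part t n B) \<omega> \<partial>record_law prate z)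
    = (\<integral>\<^sup>+\<omega>. g ((trunc n \<omega>, \<omega> n), shift (Suc n) \<omega>) \<partial>record_law prate z)"
  proof (rule nn_integral_cong_AE)
    show "AE \<omega> in record_law prate z. indicator C (future t \<omega>) * indicator (slot_part t n B) \<omega> = g ((trunc n \<omega>, \<omega> n), shift (Suc n) \<omega>)"
      using record_law_AE_good[OF q z] AE_space
    proof eventually_elim
      case (elim \<omega>)
      then have w: "\<omega> \<in> space Rec" by (simp add: space_record_law[OF q z])
      show ?case
      proof (cases "\<omega> \<in> slot_part t n B")
        case True
        then have s: "in_slot t n \<omega>" by (simp add: slot_part_def)
        have "indicator (slot_part t n B) \<omega> = (1 :: ennreal)" using True by simp
        then show ?thesis
          using future_slot[OF elim(1) t s] s True trunc_space[OF w, of n]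
          by (simp add: g_def in_slot_def arrival_Suc early_def slot_part_def)
      next
        case False
        then have "indicator (early M t n B) (trunc n \<omega>) * indicator {t - arrival \<omega> n<..} (fst (\<omega> n)) = (0 :: ennreal)"
          using indicator_slot_part[OF w, of t n B] by simp
        then show ?thesis using False by (auto simp: g_def indicator_def split: if_splits)
      qed
    qed
  qed
  also have "\<dots> = (\<integral>\<^sup>+\<omega>. \<integral>\<^sup>+e. \<integral>\<^sup>+w. g ((trunc n \<omega>, e), w) \<partial>record_law prate (step (event_state z \<omega> n) e) \<partial>event_kernel prate (event_state z \<omega> n) \<partial>record_law prate z)"
    by (rule record_law_markov_event[OF q z g])
  also have "\<dots> = (\<integral>\<^sup>+\<omega>. emeasure (record_law prate (reached z t n (trunc n \<omega>))) C *
      (indicator (early M t n B) (trunc n \<omega>) * ennreal (hist_surv M (hist_rate prate z) n t (trunc n \<omega>))) \<partial>record_law prate z)"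
  proof (rule nn_integral_cong)
    fix \<omega> assume "\<omega> \<in> space (record_law prate z)"
    then have w: "\<omega> \<in> space Rec" by (simp add: space_record_law[OF q z])
    show "(\<integral>\<^sup>+e. \<integral>\<^sup>+w. g ((trunc n \<omega>, e), w) \<partial>record_law prate (step (event_state z \<omega> n) e) \<partial>event_kernel prate (event_state z \<omega> n))
      = emeasure (record_law prate (reached z t n (trunc n \<omega>))) C *
      (indicator (early M t n B) (trunc n \<omega>) * ennreal (hist_surv M (hist_rate prate z) n t (trunc n \<omega>)))"
    proof (cases "trunc n \<omega> \<in> early M t n B")
      case True
      then have u: "0 \<le> t - arrival \<omega> n" by (simp add: early_def)
      have "(\<integral>\<^sup>+e. \<integral>\<^sup>+w. g ((trunc n \<omega>, e), w) \<partial>record_law prate (step (event_state z \<omega> n) e) \<partial>event_kernel prate (event_state z \<omega> n))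
        = (\<integral>\<^sup>+e. \<integral>\<^sup>+w. indicator {t - arrival \<omega> n<..} (fst e) * indicator C (scons (fst e - (t - arrival \<omega> n), snd e) w)
            \<partial>record_law prate (step (event_state z \<omega> n) e) \<partial>event_kernel prate (event_state z \<omega> n))"
        using True by (intro nn_integral_cong) (simp add: g_def indicator_def)
      also have "\<dots> = ennreal (surv prate (event_state z \<omega> n) (t - arrival \<omega> n)) * (\<integral>\<^sup>+w. indicator C w \<partial>record_law prate (flow_state (event_state z \<omega> n) (t - arrival \<omega> n)))"
        by (rule record_law_restart[OF q event_state_space[OF z w] u]) (use C in simp)
      also have "(\<integral>\<^sup>+w. indicator C w \<partial>record_law prate (flow_state (event_state z \<omega> n) (t - arrival \<omega> n)))
        = emeasure (record_law prate (flow_state (event_state z \<omega> n) (t - arrival \<omega> n))) C"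
        using C by (intro nn_integral_indicator) (simp add: sets_record_law[OF q flow_state_space[OF event_state_space[OF z w]]])
      finally show ?thesis using True by (simp add: hist_surv_hist_rate reached_def mult.commute)
    qed (simp add: g_def)
  qed
  also have "\<dots> = (\<integral>\<^sup>+\<omega>. emeasure (record_law prate (reached z t n (trunc n \<omega>))) C * indicator (slot_part t n B) \<omega> \<partial>record_law prate z)"
    by (rule record_law_slot_integral[OF q z Cm B, symmetric])
  finally show ?thesis .
qed

lemma future_cond_exp:
  assumes z: "z \<in> space Z" and t: "0 \<le> t" and C: "C \<in> sets Rec"
  shows "AE x in canonical_joint z. real_cond_exp (canonical_joint z) (F t) (indicator {x. future t (snd x) \<in> C}) x
    = measure (record_law prate (reached z t (slot t (snd x)) (snd x))) C"
proof -
  note q = state_rate_prate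
  define f :: "firm_type \<times> public_record \<Rightarrow> real" where "f = indicator {x. future t (snd x) \<in> C}"
  have fC: "f x = indicator C (future t (snd x))" for x by (simp add: f_def indicator_def)
  have f: "f \<in> borel_measurable Out"
    unfolding fC[abs_def] by (rule measurable_compose[OF measurable_compose[OF snd_Out future_measurable] borel_measurable_indicator[OF C]])
  have Kp: "prob_space (record_law prate (reached z t n \<omega>))" if "\<omega> \<in> space Rec" for n \<omega>
    by (rule record_law_prob[OF q reached_space[OF z that]])
  have Gm: "(\<lambda>\<omega>. measure (record_law prate (reached z t n \<omega>)) C) \<in> borel_measurable Rec" for n
    by (rule measurable_compose[OF measurable_compose[OF reached_measurable[OF z] measurable_prob_algebraD[OF record_law_measurable[OF q]]]])
       (rule measurable_measure_subprob_algebra[OF C])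
  have "AE x in canonical_joint z. real_cond_exp (canonical_joint z) (F t) f x
    = measure (record_law prate (reached z t (slot t (snd x)) (trunc (slot t (snd x)) (snd x)))) C"
  proof (rule cond_exp_slotI[OF canonical_joint_space(1)[OF z] canonical_joint_space(2)[OF z] AE_canonical_joint[OF z record_law_AE_good[OF q z]] t f])
    show "f x \<in> {0..1}" for x by (simp add: f_def indicator_def)
    show "(\<lambda>\<omega>. measure (record_law prate (reached z t n \<omega>)) C) \<in> borel_measurable Rec" for n by (rule Gm)
    show "measure (record_law prate (reached z t n \<omega>)) C \<in> {0..1}" if "\<omega> \<in> space Rec" for n \<omega>
      using prob_space.prob_le_1[OF Kp[OF that]] by simp
    fix n B assume B: "B \<in> sets Rec"
    have ind: "(\<lambda>\<omega>. indicator (slot_part t n B) \<omega> :: ennreal) \<in> borel_measurable Rec"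
      using slot_part_sets[OF B] by simp
    have "(\<integral>\<^sup>+x. ennreal (f x) * indicator (slot_part t n B) (snd x) \<partial>canonical_joint z)
      = (\<integral>\<^sup>+x. indicator C (future t (snd x)) * indicator (slot_part t n B) (snd x) \<partial>canonical_joint z)"
      by (intro nn_integral_cong) (simp add: fC ennreal_indicator)
    also have "\<dots> = (\<integral>\<^sup>+\<omega>. indicator C (future t \<omega>) * indicator (slot_part t n B) \<omega> \<partial>record_law prate z)"
      by (rule nn_integral_canonical_joint_snd[OF z])
         (intro borel_measurable_times_ennreal ind measurable_compose[OF future_measurable borel_measurable_indicator[OF C]])
    also have "\<dots> = (\<integral>\<^sup>+\<omega>. emeasure (record_law prate (reached z t n (trunc n \<omega>))) C * indicator (slot_part t n B) \<omega> \<partial>record_law prate z)"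
      by (rule record_law_future_slot[OF z t B C])
    also have "\<dots> = (\<integral>\<^sup>+\<omega>. ennreal (measure (record_law prate (reached z t n (trunc n \<omega>))) C) * indicator (slot_part t n B) \<omega> \<partial>record_law prate z)"
    proof (rule nn_integral_cong)
      fix \<omega> assume "\<omega> \<in> space (record_law prate z)"
      then have "\<omega> \<in> space Rec" by (simp add: space_record_law[OF q z])
      then interpret prob_space "record_law prate (reached z t n (trunc n \<omega>))" by (intro Kp trunc_space)
      show "emeasure (record_law prate (reached z t n (trunc n \<omega>))) C * indicator (slot_part t n B) \<omega>
        = ennreal (measure (record_law prate (reached z t n (trunc n \<omega>))) C) * indicator (slot_part t n B) \<omega>"
        unfolding emeasure_eq_measure ..
    qed
    also have "\<dots> = (\<integral>\<^sup>+x. ennreal (measure (record_law prate (reached z t n (trunc n (snd x)))) C) * indicator (slot_part t n B) (snd x) \<partial>canonical_joint z)"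
      by (rule nn_integral_canonical_joint_snd[OF z, symmetric])
         (intro borel_measurable_times_ennreal ind measurable_compose[OF _ measurable_ennreal] measurable_compose[OF trunc_measurable Gm])
    finally show "(\<integral>\<^sup>+x. ennreal (f x) * indicator (slot_part t n B) (snd x) \<partial>canonical_joint z)
      = (\<integral>\<^sup>+x. ennreal (measure (record_law prate (reached z t n (trunc n (snd x)))) C) * indicator (slot_part t n B) (snd x) \<partial>canonical_joint z)" .
  qed
  then show ?thesis by (simp add: f_def)
qed

section \<open>Rates induced by an arbitrary reputation\<close>

lemma type_rate_alt: "type_rate M p0 m \<theta> h s = type_intensity \<theta> (m h s, current_price p0 h)"
  by (rule ext) (simp add: type_rate_def type_intensity_def Let_def)

lemma current_price_menu: "p0 \<in> menu M \<Longrightarrow> \<omega> \<in> space Rec \<Longrightarrow> current_price p0 (history \<omega> n) \<in> menu M"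
  using event_state_space[of "(0, p0)" \<omega> n] snd_event_state[of "(0, p0)" \<omega> n] by (auto simp: space_Z mem_Times_iff)

lemma current_price_measurable:
  assumes "p0 \<in> menu M" shows "(\<lambda>\<omega>. current_price p0 (history \<omega> n)) \<in> Rec \<rightarrow>\<^sub>M count_space (menu M)"
proof -
  have "(0, p0) \<in> space Z" using assms by (simp add: space_Z)
  from measurable_compose[OF event_state_measurable'[OF this] snd_Z] show ?thesis by (simp add: snd_event_state)
qed

lemma type_rate_family:
  assumes p0: "p0 \<in> menu M" and mr: "\<And>h s. 0 \<le> s \<Longrightarrow> m h s \<in> {0..1}"
    and mm: "\<And>n. (\<lambda>(\<omega>, s). m (history \<omega> n) s) \<in> borel_measurable (Rec \<Otimes>\<^sub>M borel)"
  shows "rate_family M (type_rate M p0 m \<theta>) (kappa M) (nu M + kappa M)"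
proof -
  have meas: "(\<lambda>y. type_rate M p0 m \<theta> (history (fst y) n) (max 0 (snd y)) x) \<in> borel_measurable (Rec \<Otimes>\<^sub>M borel)"
    if x: "x \<in> marks M" for n x
  proof -
    have "(\<lambda>y. (\<lambda>(\<omega>, s). m (history \<omega> n) s) (fst y, max 0 (snd y))) \<in> borel_measurable (Rec \<Otimes>\<^sub>M borel)"
      by (rule measurable_compose[OF _ mm]) measurable
    then have "(\<lambda>y. (m (history (fst y) n) (max 0 (snd y)), current_price p0 (history (fst y) n))) \<in> Rec \<Otimes>\<^sub>M borel \<rightarrow>\<^sub>M Z"
      by (intro measurable_into_Z measurable_compose[OF measurable_fst current_price_measurable[OF p0]] mr) simp_all
    moreover have "(\<lambda>z. type_intensity \<theta> z x) \<in> borel_measurable Z"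
      using state_rate_type_intensity x by (simp add: state_rate_def)
    ultimately show ?thesis unfolding type_rate_alt by (rule measurable_compose)
  qed
  have "mark_rates M (type_rate M p0 m \<theta> (history \<omega> n)) (kappa M) (nu M + kappa M)" if w: "\<omega> \<in> space Rec" for \<omega> n
  proof
    fix x assume "x \<in> marks M"
    from measurable_compose[OF measurable_Pair1'[OF w] meas[OF this, of n]]
    show "(\<lambda>s. type_rate M p0 m \<theta> (history \<omega> n) (max 0 s) x) \<in> borel_measurable borel" by simp
  next
    fix s :: real assume s: "0 \<le> s"
    have "(m (history \<omega> n) s, current_price p0 (history \<omega> n)) \<in> space Z"
      using mr[OF s] current_price_menu[OF p0 w] by (simp add: space_Z)
    then show "(\<Sum>x\<in>marks M. type_rate M p0 m \<theta> (history \<omega> n) s x) \<in> {kappa M..nu M + kappa M}"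
      "\<And>x. x \<in> marks M \<Longrightarrow> 0 \<le> type_rate M p0 m \<theta> (history \<omega> n) s x"
      using state_rate_type_intensity[of \<theta>] unfolding state_rate_def type_rate_alt by blast+
  qed (use fin kappa_pos in auto)
  then show ?thesis using meas by (auto simp: rate_family_def case_prod_unfold)
qed

text \<open>\<open>post\<close> is Bayes' rule during a silence with rates computed from the unknown
  \<open>x\<close> itself. For an interior prior it solves to
  \<open>x u = 1 / (1 + c * exp (D u))\<close>, where \<open>D\<close> is the difference of the
  cumulated rates of the types. As \<open>D\<close> is continuous, so is \<open>x\<close>; then the
  difference of the rates is \<open>- adrift p (x s) / (x s * (1 - x s))\<close>, which is
  continuous since the drift is Lipschitz, although the policy need not be continuous. Hence
  \<open>D\<close> is differentiable, \<open>x\<close> solves the silence equation, and uniqueness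
  of silence paths applies.\<close>

lemma posterior_is_flow:
  assumes \<mu>: "\<mu> \<in> {0..1}" and p: "p \<in> menu M"
    and x: "\<And>s. 0 \<le> s \<Longrightarrow> x s \<in> {0..1}"
    and T: "\<And>\<theta>. mark_rates M (\<lambda>s. type_intensity \<theta> (x s, p)) (kappa M) (nu M + kappa M)"
    and post: "\<And>u. 0 \<le> u \<Longrightarrow>
      x u * (\<mu> * exp (- (LINT s:{0..u}|lborel. \<Sum>y\<in>marks M. type_intensity Type_C (x s, p) y))
        + (1 - \<mu>) * exp (- (LINT s:{0..u}|lborel. \<Sum>y\<in>marks M. type_intensity Type_S (x s, p) y)))
      = \<mu> * exp (- (LINT s:{0..u}|lborel. \<Sum>y\<in>marks M. type_intensity Type_C (x s, p) y))"
    and s: "0 \<le> s"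
  shows "x s = flow \<mu> p s"
proof -
  consider "\<mu> = 0" | "\<mu> = 1" | "0 < \<mu>" "\<mu> < 1" using \<mu> by fastforce
  then show ?thesis
  proof cases
    \<comment> \<open>At the extreme priors Bayes' rule pins \<open>x\<close> at once, and both ends
      are rest points of the drift.\<close>
    case 1
    then show ?thesis using post[OF s] flow_fixed[OF p \<mu> _ s] by simp
  next
    case 2
    then show ?thesis using post[OF s] flow_fixed[OF p \<mu> _ s] by simp
  next
    case 3
    interpret C: mark_rates M "\<lambda>s. type_intensity Type_C (x s, p)" "kappa M" "nu M + kappa M" by (rule T)
    interpret S: mark_rates M "\<lambda>s. type_intensity Type_S (x s, p)" "kappa M" "nu M + kappa M" by (rule T)
    \<comment> \<open>The prior odds of type S against type C.\<close>
    define c where "c = (1 - \<mu>) / \<mu>"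
    have c: "0 < c" using 3 by (simp add: c_def)
    define D where "D u = C.cum u - S.cum u" for u
    have xD: "x u = 1 / (1 + c * exp (D u))" if "0 \<le> u" for u
    proof -
      have p0: "0 < 1 + c * exp (D u)" using c by (simp add: add_pos_pos)
      have "x u * (\<mu> * exp (- C.cum u) + (1 - \<mu>) * exp (- S.cum u)) = \<mu> * exp (- C.cum u)"
        using post[OF that] by (simp add: C.cum_def S.cum_def)
      moreover have "\<mu> * exp (- C.cum u) + (1 - \<mu>) * exp (- S.cum u) = \<mu> * exp (- C.cum u) * (1 + c * exp (D u))"
        using 3 by (simp add: c_def D_def exp_diff exp_minus field_simps)
      ultimately have "\<mu> * exp (- C.cum u) * (x u * (1 + c * exp (D u))) = \<mu> * exp (- C.cum u) * 1"
        by (simp add: mult.left_commute)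
      then have "x u * (1 + c * exp (D u)) = 1" using 3 by simp
      then show ?thesis using p0 by (simp add: field_simps)
    qed
    have x01: "0 < x u" "x u < 1" if "0 \<le> u" for u
      using xD[OF that] c by (simp_all add: add_pos_pos)
    have "continuous_on {0..} (\<lambda>u. 1 / (1 + c * exp (D u)))"
      unfolding D_def using c
      by (intro continuous_intros C.cum_continuous S.cum_continuous) (metis add_pos_pos exp_gt_zero mult_pos_pos order_less_irrefl zero_less_one)
    then have xc: "continuous_on {0..} x"
      by (rule continuous_on_eq) (simp add: xD)
    obtain k where k: "k-lipschitz_on {0..1} (adrift p)" using adrift_lipschitz[OF p] .
    \<comment> \<open>The excess of the total rate of type C over that of type S, written through
      the drift so that its continuity is visible; the fact \<open>g\<close> below proves the
      equality.\<close>
    define g where "g s = - adrift p (x s) / (x s * (1 - x s))" for s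
    have gc: "continuous_on {0..} g"
    proof -
      have "continuous_on {0..} (\<lambda>s. adrift p (x s))"
        by (rule continuous_on_compose2[OF lipschitz_on_continuous_on[OF k] xc]) (intro image_subsetI x, simp)
      moreover have "\<forall>s\<in>{0..}. x s * (1 - x s) \<noteq> 0"
      proof
        fix s :: real assume "s \<in> {0..}"
        then show "x s * (1 - x s) \<noteq> 0" using x01[of s] by simp
      qed
      ultimately show ?thesis unfolding g_def
        by (intro continuous_on_divide continuous_on_minus continuous_on_mult continuous_on_diff continuous_on_const xc)
    qed
    have g: "(\<Sum>y\<in>marks M. type_intensity Type_C (x s, p) y) - (\<Sum>y\<in>marks M. type_intensity Type_S (x s, p) y) = g s"
      if "0 \<le> s" for s
      using x01[OF that] unfolding g_def drift_alt
      by (simp add: sum_marks type_intensity_def Let_def) (simp add: right_diff_distrib)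
    have Dg: "D u = integral {0..u} g" if "0 \<le> u" for u
    proof -
      have i: "set_integrable lborel {0..u} (\<lambda>s. (\<Sum>y\<in>marks M. type_intensity Type_C (x s, p) y) - (\<Sum>y\<in>marks M. type_intensity Type_S (x s, p) y))"
        by (rule set_integral_diff(1)[OF C.R_integrable S.R_integrable]) auto
      have "D u = (LINT s:{0..u}|lborel. (\<Sum>y\<in>marks M. type_intensity Type_C (x s, p) y) - (\<Sum>y\<in>marks M. type_intensity Type_S (x s, p) y))"
        unfolding D_def C.cum_def S.cum_def
        by (rule set_integral_diff(2)[OF C.R_integrable S.R_integrable, symmetric]) auto
      also have "\<dots> = integral {0..u} (\<lambda>s. (\<Sum>y\<in>marks M. type_intensity Type_C (x s, p) y) - (\<Sum>y\<in>marks M. type_intensity Type_S (x s, p) y))"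
        by (rule set_borel_integral_eq_integral(2)[OF i])
      also have "\<dots> = integral {0..u} g" by (rule integral_cong) (simp add: g)
      finally show ?thesis .
    qed
    have Dd: "(D has_real_derivative g u) (at u within {0..})" if u: "0 \<le> u" for u
    proof -
      have "((\<lambda>u. integral {0..u} g) has_real_derivative g u) (at u within {0..u + 1})"
        using u by (intro integral_has_real_derivative continuous_on_subset[OF gc]) auto
      then have "((\<lambda>u. integral {0..u} g) has_real_derivative g u) (at u within {0..})"
        using at_within_halfline[OF u] by simp
      then show ?thesis
        by (rule has_field_derivative_transform_within[OF _ zero_less_one]) (use u Dg in auto)
    qed
    have "silence_path M \<mu> p x"
      unfolding silence_path_def
    proof (intro conjI allI impI x)
      show "x 0 = \<mu>" using xD[of 0] 3 by (simp add: D_def C.cum_0 S.cum_0 c_def field_simps)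
      fix u :: real assume u: "0 \<le> u"
      have p0: "0 < 1 + c * exp (D u)" using c by (simp add: add_pos_pos)
      have "((\<lambda>u. 1 / (1 + c * exp (D u))) has_real_derivative - (c * (exp (D u) * g u)) / (1 + c * exp (D u))\<^sup>2) (at u within {0..})"
        using p0 Dd[OF u] by (auto intro!: derivative_eq_intros simp: power2_eq_square)
      moreover have "- (c * (exp (D u) * g u)) / (1 + c * exp (D u))\<^sup>2 = - (x u * (1 - x u)) * g u"
      proof -
        have "1 - x u = c * exp (D u) / (1 + c * exp (D u))" using xD[OF u] p0 by (simp add: field_simps)
        then show ?thesis using xD[OF u] by (simp add: power2_eq_square)
      qed
      moreover have "- (x u * (1 - x u)) * g u = adrift p (x u)"
        using x01[OF u] by (simp add: g_def)
      ultimately have "((\<lambda>u. 1 / (1 + c * exp (D u))) has_real_derivative adrift p (x u)) (at u within {0..})" by simp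
      then show "(x has_real_derivative adrift p (x u)) (at u within {0..})"
        by (rule has_field_derivative_transform_within[OF _ zero_less_one]) (use u xD in auto)
    qed
    then show ?thesis by (rule flow_unique[OF p \<mu> _ s])
  qed
qed

end

section \<open>Uniqueness of the reputation\<close>

text \<open>A right-continuous function is determined by its values on the points of the form \<open>t - a\<close>
  with \<open>t\<close> rational, which are the only times at which the filtering identity holds outside of
  a single null set.\<close>

lemma right_continuous_eq_on_rational_shift:
  fixes x W V :: "real \<Rightarrow> real"
  assumes x: "\<And>s. 0 \<le> s \<Longrightarrow> continuous (at_right s) x"
    and W: "continuous_on {0..} W" and V: "continuous_on {0..} V"
    and eq: "\<And>t. t \<in> \<rat> \<Longrightarrow> 0 \<le> t \<Longrightarrow> a \<le> t \<Longrightarrow> x (t - a) * W (t - a) = V (t - a)"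
    and a: "0 \<le> a" and u: "0 \<le> u"
  shows "x u * W u = V u"
proof -
  have "\<exists>t\<in>\<rat>. a + u < t \<and> t < a + u + 1 / real (Suc k)" for k
    by (rule Rats_dense_in_real) simp
  then obtain t where t: "\<And>k. t k \<in> \<rat>" "\<And>k. a + u < t k" "\<And>k. t k < a + u + 1 / real (Suc k)"
    by metis
  define v where "v k = t k - a" for k
  have v: "u < v k" "v k < u + 1 / real (Suc k)" for k using t(2,3)[of k] by (simp_all add: v_def)
  have "v \<longlonglongrightarrow> u"
  proof (rule real_tendsto_sandwich[of "\<lambda>_. u" v _ "\<lambda>k. u + 1 / real (Suc k)"])
    show "(\<lambda>k. u + 1 / real (Suc k)) \<longlonglongrightarrow> u"
      using tendsto_add[OF tendsto_const LIMSEQ_Suc[OF lim_1_over_n], of u] by simp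
  qed (use v in \<open>auto intro!: always_eventually less_imp_le\<close>)
  \<comment> \<open>The strict inequality \<open>u < v k\<close> makes this a limit from the right,
    the side on which \<open>x\<close> is known to be continuous.\<close>
  then have vr: "filterlim v (at_right u) sequentially"
    using v(1) by (auto simp: filterlim_at intro: always_eventually)
  have lim: "(\<lambda>k. f (v k)) \<longlonglongrightarrow> f u" if "continuous (at_right u) f" for f :: "real \<Rightarrow> real"
    using that by (intro filterlim_compose[OF _ vr]) (simp add: continuous_within)
  have cr: "continuous (at_right u) f" if "continuous_on {0..} f" for f :: "real \<Rightarrow> real"
    using that u by (auto simp: continuous_on_eq_continuous_within intro: continuous_within_subset)
  have "(\<lambda>k. x (v k) * W (v k)) \<longlonglongrightarrow> x u * W u"
    by (intro tendsto_mult lim x u cr W)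
  moreover have "x (v k) * W (v k) = V (v k)" for k
    unfolding v_def using t(2)[of k] a u by (intro eq t(1)) auto
  ultimately have "(\<lambda>k. V (v k)) \<longlonglongrightarrow> x u * W u" by simp
  then show ?thesis using lim[OF cr[OF V]] LIMSEQ_unique by blast
qed

context market_model
begin

text \<open>The public law of the first \<open>n\<close> events serves as one reference measure for
  both types: by \<open>record_law_bayes\<close> the type laws, scaled by their prior weights, have
  densities with respect to it.\<close>

definition trunc_law :: "real \<times> real \<Rightarrow> nat \<Rightarrow> public_record measure" where
  "trunc_law z n = distr (record_law prate z) Rec (trunc n)"

lemma trunc_record_law_measurable: "z \<in> space Z \<Longrightarrow> trunc n \<in> record_law prate z \<rightarrow>\<^sub>M Rec"
  using measurable_cong_sets[OF sets_record_law[OF state_rate_prate] refl] trunc_measurable by blast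

lemma trunc_law_prob: "z \<in> space Z \<Longrightarrow> prob_space (trunc_law z n)"
  unfolding trunc_law_def by (rule prob_space.prob_space_distr[OF record_law_prob[OF state_rate_prate] trunc_record_law_measurable])

lemma sets_trunc_law [simp]: "sets (trunc_law z n) = sets Rec"
  by (simp add: trunc_law_def)

lemma space_trunc_law [simp]: "space (trunc_law z n) = space Rec"
  by (simp add: trunc_law_def)

lemma nn_integral_trunc_law:
  "z \<in> space Z \<Longrightarrow> f \<in> borel_measurable Rec \<Longrightarrow> (\<integral>\<^sup>+\<omega>. f \<omega> \<partial>trunc_law z n) = (\<integral>\<^sup>+\<omega>. f (trunc n \<omega>) \<partial>record_law prate z)"
  unfolding trunc_law_def by (rule nn_integral_distr[OF trunc_record_law_measurable]) simp_all

text \<open>If the prior weight vanishes, the left side is zero for any \<open>L\<close>, which is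
  why \<open>same\<close> is asked for positive weight only.\<close>

lemma same_trunc_law_weighted:
  assumes z: "z \<in> space Z" and same: "0 < type_weight \<theta> (fst z) \<Longrightarrow> same_trunc_law M L (record_law (type_intensity \<theta>) z) n"
    and f: "f \<in> borel_measurable Rec"
  shows "ennreal (type_weight \<theta> (fst z)) * (\<integral>\<^sup>+\<omega>. f (trunc n \<omega>) \<partial>L)
    = (\<integral>\<^sup>+\<omega>. f \<omega> * ennreal (type_weight \<theta> (fst (event_state z \<omega> n))) \<partial>trunc_law z n)"
proof -
  have \<mu>: "fst z \<in> {0..1}" using z by (auto simp: space_Z)
  have "ennreal (type_weight \<theta> (fst z)) * (\<integral>\<^sup>+\<omega>. f (trunc n \<omega>) \<partial>L) = ennreal (type_weight \<theta> (fst z)) * (\<integral>\<^sup>+\<omega>. f (trunc n \<omega>) \<partial>record_law (type_intensity \<theta>) z)"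
    using same_trunc_lawD[OF same f] type_weight_nonneg[OF \<mu>, of \<theta>] by (cases "0 < type_weight \<theta> (fst z)") auto
  also have "\<dots> = (\<integral>\<^sup>+\<omega>. f (trunc n \<omega>) * ennreal (type_weight \<theta> (fst (event_state z \<omega> n))) \<partial>record_law prate z)"
    by (rule record_law_bayes[OF z f])
  also have "\<dots> = (\<integral>\<^sup>+\<omega>. f \<omega> * ennreal (type_weight \<theta> (fst (event_state z \<omega> n))) \<partial>trunc_law z n)"
    by (subst nn_integral_trunc_law[OF z]) (simp_all add: borel_measurable_times_ennreal f type_weight_event_state_measurable z)
  finally show ?thesis .
qed

text \<open>The scaled type law has a density with respect to the reference measure, so null sets
  pass over to it; a positive prior weight allows the scaling factor to be cancelled.\<close>

lemma AE_trunc_law_transfer: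
  assumes z: "z \<in> space Z" and pos: "0 < type_weight \<theta> (fst z)" and L: "sets L = sets Rec"
    and same: "same_trunc_law M L (record_law (type_intensity \<theta>) z) n"
    and ae: "AE \<omega> in trunc_law z n. R \<omega>"
  shows "AE \<omega> in L. R (trunc n \<omega>)"
proof -
  from ae obtain N where N: "{\<omega>\<in>space (trunc_law z n). \<not> R \<omega>} \<subseteq> N" "emeasure (trunc_law z n) N = 0" "N \<in> sets (trunc_law z n)"
    by (rule AE_E)
  have NR: "N \<in> sets Rec" using N(3) by simp
  have "AE \<omega> in trunc_law z n. indicator N \<omega> * ennreal (type_weight \<theta> (fst (event_state z \<omega> n))) = 0"
    using AE_not_in[of N "trunc_law z n"] N(2,3) by (auto simp: null_sets_def elim!: eventually_mono)
  then have "(\<integral>\<^sup>+\<omega>. indicator N \<omega> * ennreal (type_weight \<theta> (fst (event_state z \<omega> n))) \<partial>trunc_law z n) = 0"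
    by (intro nn_integral_zero')
  then have "(\<integral>\<^sup>+\<omega>. indicator N (trunc n \<omega>) \<partial>L) = 0"
    using same_trunc_law_weighted[OF z same, of "indicator N"] NR pos by simp
  moreover have "(\<lambda>\<omega>. indicator N (trunc n \<omega>) :: ennreal) \<in> borel_measurable L"
    unfolding measurable_cong_sets[OF L refl]
    by (rule measurable_compose[OF trunc_measurable borel_measurable_indicator[OF NR]])
  ultimately have "AE \<omega> in L. indicator N (trunc n \<omega>) = (0 :: ennreal)"
    by (subst (asm) nn_integral_0_iff_AE)
  then show ?thesis
    using AE_space
  proof eventually_elim
    case (elim \<omega>)
    then have "trunc n \<omega> \<in> space Rec" "trunc n \<omega> \<notin> N"
      using sets_eq_imp_space_eq[OF L] trunc_space by (auto simp: indicator_def split: if_splits)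
    then show ?case using N(1) by auto
  qed
qed

lemma trunc_law_arrival_nonneg: "z \<in> space Z \<Longrightarrow> AE \<omega> in trunc_law z n. 0 \<le> arrival \<omega> n"
proof -
  assume z: "z \<in> space Z"
  have "AE \<omega> in record_law prate z. 0 \<le> arrival (trunc n \<omega>) n"
    using record_law_AE_good[OF state_rate_prate z]
  proof eventually_elim
    case (elim \<omega>)
    then show ?case using strict_mono_less_eq[OF good_arrival_strict_mono, of \<omega> 0 n] by simp
  qed
  then show ?thesis unfolding trunc_law_def
    by (subst AE_distr_iff[OF trunc_record_law_measurable[OF z]]) simp_all
qed

lemma reputation_systemD:
  assumes "reputation_system M \<mu>0 p0 m L"
  shows "\<And>h s. 0 \<le> s \<Longrightarrow> m h s \<in> {0..1}" "\<And>h s. 0 \<le> s \<Longrightarrow> continuous (at_right s) (m h)"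
    "\<And>n. (\<lambda>(\<omega>, s). m (history \<omega> n) s) \<in> borel_measurable (Rec \<Otimes>\<^sub>M borel)"
    "\<And>\<theta>. point_process_law M (type_rate M p0 m \<theta>) (L \<theta>)"
    "\<And>t. 0 \<le> t \<Longrightarrow> AE z in joint_law M \<mu>0 L.
        real_cond_exp (joint_law M \<mu>0 L) (F t) (indicator {z. fst z = Type_C}) z = at_time m (snd z) t"
  using assms unfolding reputation_system_def by blast+

text \<open>One instance of the filtering identity, at time \<open>t\<close> on slot
  \<open>n\<close>, written on the reference measure. The joint probability of type C and the slot
  has density \<open>X\<close>; the reputation integrated over the slot has density
  \<open>Y\<close>. Equality on all sets of first \<open>n\<close> events gives equality almost
  everywhere.\<close>

lemma reputation_posterior:
  assumes z: "(\<mu>0, p0) \<in> space Z" and rs: "reputation_system M \<mu>0 p0 m L"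
    and same: "\<And>\<theta>. 0 < type_weight \<theta> \<mu>0 \<Longrightarrow> same_trunc_law M (L \<theta>) (record_law (type_intensity \<theta>) (\<mu>0, p0)) n"
    and t: "0 \<le> t"
  shows "AE \<omega> in trunc_law (\<mu>0, p0) n. arrival \<omega> n \<le> t \<longrightarrow>
    m (history \<omega> n) (t - arrival \<omega> n) *
      (type_weight Type_C (fst (event_state (\<mu>0, p0) \<omega> n)) * hist_surv M (type_rate M p0 m Type_C) n t \<omega>
        + type_weight Type_S (fst (event_state (\<mu>0, p0) \<omega> n)) * hist_surv M (type_rate M p0 m Type_S) n t \<omega>)
    = type_weight Type_C (fst (event_state (\<mu>0, p0) \<omega> n)) * hist_surv M (type_rate M p0 m Type_C) n t \<omega>"
proof -
  let ?z = "(\<mu>0, p0)" and ?P = "joint_law M \<mu>0 L" and ?r = "type_rate M p0 m"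
  note rsD = reputation_systemD[OF rs]
  have \<mu>: "\<mu>0 \<in> {0..1}" and p0: "p0 \<in> menu M" using z by (auto simp: space_Z)
  have rf: "rate_family M (?r \<theta>) (kappa M) (nu M + kappa M)" for \<theta>
    by (rule type_rate_family[OF p0 rsD(1,3)])
  have L: "prob_space (L \<theta>)" "sets (L \<theta>) = sets Rec" for \<theta> by (rule point_process_lawD[OF rsD(4)])+
  have N: "next_event_law M (?r \<theta>) (L \<theta>) n" for \<theta> by (rule point_process_law_next[OF fin rf rsD(4)])
  have good: "AE x in ?P. good (snd x)"
    by (rule AE_joint_law[of L, OF L \<mu>]) (rule point_process_AE_good[OF rf rsD(4)])
  define f :: "firm_type \<times> public_record \<Rightarrow> real" where "f = indicator {x. fst x = Type_C}"
  have f: "f \<in> borel_measurable Out" unfolding f_def by (rule indicator_type_measurable)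
  \<comment> \<open>\<open>cond_exp_slotD\<close> asks for values in the unit interval on every
    record; \<open>max 0\<close> secures this where \<open>arrival \<omega> n\<close> exceeds
    \<open>t\<close>.\<close>
  define G where "G n \<omega> = m (history \<omega> n) (max 0 (t - arrival \<omega> n))" for n \<omega>
  have Gm: "G n \<in> borel_measurable Rec" for n
  proof -
    have "(\<lambda>\<omega>. (\<omega>, max 0 (t - arrival \<omega> n))) \<in> Rec \<rightarrow>\<^sub>M Rec \<Otimes>\<^sub>M (borel :: real measure)" by measurable
    from measurable_compose[OF this rsD(3)[of n]] show ?thesis by (simp add: G_def[abs_def])
  qed
  have Gb: "G n \<omega> \<in> {0..1}" for n \<omega> unfolding G_def by (rule rsD(1)) simp
  have Gtr: "G n (trunc n \<omega>) = G n \<omega>" for n \<omega> by (simp add: G_def)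
  have ce: "AE x in ?P. real_cond_exp ?P (F t) f x = G (slot t (snd x)) (trunc (slot t (snd x)) (snd x))"
    using rsD(5)[OF t] good
  proof eventually_elim
    case (elim x)
    have "arrival (snd x) (slot t (snd x)) \<le> t" using good_slot(1)[OF elim(2) t] by (simp add: in_slot_def)
    then show ?case
      using elim(1) good_slot(3)[OF elim(2) t] by (simp add: Gtr) (simp add: f_def G_def at_time_def)
  qed
  define a where "a \<theta> B \<omega> = indicator (early M t n B) \<omega> * ennreal (hist_surv M (?r \<theta>) n t \<omega>)" for \<theta> B \<omega>
  have am: "a \<theta> B \<in> borel_measurable Rec" if "B \<in> sets Rec" for \<theta> B
    unfolding a_def by (rule hist_surv_measurable[OF rf that])
  define w where "w \<theta> \<omega> = ennreal (type_weight \<theta> (fst (event_state ?z \<omega> n)))" for \<theta> \<omega>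
  have wm: "w \<theta> \<in> borel_measurable Rec" for \<theta> unfolding w_def[abs_def] by (rule type_weight_event_state_measurable[OF z])
  have Gm': "(\<lambda>\<omega>. ennreal (G n \<omega>)) \<in> borel_measurable Rec" by (rule measurable_compose[OF Gm measurable_ennreal])
  have H: "ennreal (type_weight \<theta> \<mu>0) * (\<integral>\<^sup>+\<omega>. h (trunc n \<omega>) \<partial>L \<theta>) = (\<integral>\<^sup>+\<omega>. h \<omega> * w \<theta> \<omega> \<partial>trunc_law ?z n)"
    if "h \<in> borel_measurable Rec" for h \<theta>
    using same_trunc_law_weighted[OF z _ that, of \<theta> "L \<theta>" n] same by (simp add: w_def)
  define X where "X \<omega> = a Type_C (space Rec) \<omega> * w Type_C \<omega>" for \<omega>
  define Y where "Y \<omega> = ennreal (G n \<omega>) * a Type_C (space Rec) \<omega> * w Type_C \<omega> + ennreal (G n \<omega>) * a Type_S (space Rec) \<omega> * w Type_S \<omega>" for \<omega>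
  have XYm: "X \<in> borel_measurable (trunc_law ?z n)" "Y \<in> borel_measurable (trunc_law ?z n)"
    unfolding measurable_cong_sets[OF sets_trunc_law refl] X_def Y_def
    by (intro borel_measurable_times_ennreal borel_measurable_add am wm Gm' sets.top)+
  have aB: "a \<theta> B \<omega> = a \<theta> (space Rec) \<omega> * indicator B \<omega>" for \<theta> B \<omega>
    by (auto simp: a_def early_def indicator_def)
  have XY: "(\<integral>\<^sup>+\<omega>. X \<omega> * indicator B \<omega> \<partial>trunc_law ?z n) = (\<integral>\<^sup>+\<omega>. Y \<omega> * indicator B \<omega> \<partial>trunc_law ?z n)"
    if B: "B \<in> sets Rec" for B
  proof -
    have ind: "(\<lambda>\<omega>. indicator (slot_part t n B) \<omega> :: ennreal) \<in> borel_measurable Rec"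
      using slot_part_sets[OF B] by simp
    have fm: "(\<lambda>x. ennreal (f x) * indicator (slot_part t n B) (snd x)) \<in> borel_measurable Out"
      by (intro borel_measurable_times_ennreal measurable_compose[OF f measurable_ennreal] measurable_compose[OF snd_Out ind])
    have gm: "(\<lambda>x. ennreal (G n (trunc n (snd x))) * indicator (slot_part t n B) (snd x)) \<in> borel_measurable Out"
      by (intro borel_measurable_times_ennreal measurable_compose[OF snd_Out ind]
          measurable_compose[OF measurable_compose[OF snd_Out trunc_measurable] Gm'])
    have "(\<integral>\<^sup>+x. ennreal (f x) * indicator (slot_part t n B) (snd x) \<partial>?P)
      = ennreal (type_weight Type_C \<mu>0) * (\<integral>\<^sup>+\<omega>. indicator (slot_part t n B) \<omega> \<partial>L Type_C)"
      by (subst nn_integral_joint_law[of L, OF L \<mu> fm]) (simp add: f_def del: nn_integral_indicator)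
    also have "\<dots> = ennreal (type_weight Type_C \<mu>0) * (\<integral>\<^sup>+\<omega>. a Type_C B (trunc n \<omega>) \<partial>L Type_C)"
      using slot_integral[OF rf L(2) N borel_measurable_const[where c = 1] B, where t = t]
      by (simp add: a_def del: nn_integral_indicator hist_surv_trunc)
    also have "\<dots> = (\<integral>\<^sup>+\<omega>. X \<omega> * indicator B \<omega> \<partial>trunc_law ?z n)"
      unfolding H[OF am[OF B]] by (simp add: X_def aB[of _ B] ac_simps)
    finally have lhs: "(\<integral>\<^sup>+x. ennreal (f x) * indicator (slot_part t n B) (snd x) \<partial>?P)
      = (\<integral>\<^sup>+\<omega>. X \<omega> * indicator B \<omega> \<partial>trunc_law ?z n)" .
    have part: "ennreal (type_weight \<theta> \<mu>0) * (\<integral>\<^sup>+\<omega>. ennreal (G n (trunc n \<omega>)) * indicator (slot_part t n B) \<omega> \<partial>L \<theta>)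
      = (\<integral>\<^sup>+\<omega>. ennreal (G n \<omega>) * a \<theta> B \<omega> * w \<theta> \<omega> \<partial>trunc_law ?z n)" for \<theta>
      unfolding slot_integral[OF rf L(2) N Gm' B] a_def[symmetric]
      by (rule H) (intro borel_measurable_times_ennreal Gm' am B)
    have "(\<integral>\<^sup>+x. ennreal (G n (trunc n (snd x))) * indicator (slot_part t n B) (snd x) \<partial>?P)
      = (\<integral>\<^sup>+\<omega>. ennreal (G n \<omega>) * a Type_C B \<omega> * w Type_C \<omega> \<partial>trunc_law ?z n)
      + (\<integral>\<^sup>+\<omega>. ennreal (G n \<omega>) * a Type_S B \<omega> * w Type_S \<omega> \<partial>trunc_law ?z n)"
      by (subst nn_integral_joint_law[of L, OF L \<mu> gm]) (simp only: part snd_conv)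
    also have "\<dots> = (\<integral>\<^sup>+\<omega>. ennreal (G n \<omega>) * a Type_C B \<omega> * w Type_C \<omega> + ennreal (G n \<omega>) * a Type_S B \<omega> * w Type_S \<omega> \<partial>trunc_law ?z n)"
      by (rule nn_integral_add[symmetric])
         (simp_all only: measurable_cong_sets[OF sets_trunc_law refl] borel_measurable_times_ennreal Gm' am[OF B] wm)
    also have "\<dots> = (\<integral>\<^sup>+\<omega>. Y \<omega> * indicator B \<omega> \<partial>trunc_law ?z n)"
      by (rule nn_integral_cong) (simp add: Y_def aB[of _ B] distrib_right distrib_left ac_simps)
    finally show ?thesis
      using cond_exp_slotD[OF joint_law_space[of L, OF L] good t f _ Gm Gb ce B, of n] lhs
      by (simp add: f_def indicator_def)
  qed
  interpret TL: prob_space "trunc_law ?z n" by (rule trunc_law_prob[OF z])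
  \<comment> \<open>Functions with the same integral over every measurable set agree almost
    everywhere, in the form of uniqueness of densities.\<close>
  have "density (trunc_law ?z n) X = density (trunc_law ?z n) Y"
  proof (rule measure_eqI)
    fix B assume "B \<in> sets (density (trunc_law ?z n) X)"
    then show "emeasure (density (trunc_law ?z n) X) B = emeasure (density (trunc_law ?z n) Y) B"
      using XY[of B] XYm by (simp add: emeasure_density)
  qed simp
  then have "AE \<omega> in trunc_law ?z n. X \<omega> = Y \<omega>"
    using TL.density_unique_iff[OF XYm] by simp
  then show ?thesis
    using AE_space
  proof eventually_elim
    case (elim \<omega>)
    then have wR: "\<omega> \<in> space Rec" by simp
    show ?case
    proof
      assume at: "arrival \<omega> n \<le> t"
      have wn: "0 \<le> type_weight \<theta> (fst (event_state ?z \<omega> n))" for \<theta> by (rule type_weight_nonneg[OF fst_event_state_range[OF z wR]])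
      have hn: "0 \<le> hist_surv M (?r \<theta>) n t \<omega>" for \<theta> by (simp add: hist_surv_def)
      have G0: "0 \<le> G n \<omega>" using Gb[of n \<omega>] by simp
      have "a \<theta> (space Rec) \<omega> = ennreal (hist_surv M (?r \<theta>) n t \<omega>)" for \<theta>
        using at wR by (simp add: a_def early_def)
      then have "ennreal (hist_surv M (?r Type_C) n t \<omega> * type_weight Type_C (fst (event_state ?z \<omega> n)))
        = ennreal (G n \<omega> * hist_surv M (?r Type_C) n t \<omega> * type_weight Type_C (fst (event_state ?z \<omega> n))
          + G n \<omega> * hist_surv M (?r Type_S) n t \<omega> * type_weight Type_S (fst (event_state ?z \<omega> n)))"
        using elim(1) wn hn G0 by (simp add: X_def Y_def w_def ennreal_mult)
      then have "hist_surv M (?r Type_C) n t \<omega> * type_weight Type_C (fst (event_state ?z \<omega> n))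
        = G n \<omega> * hist_surv M (?r Type_C) n t \<omega> * type_weight Type_C (fst (event_state ?z \<omega> n))
          + G n \<omega> * hist_surv M (?r Type_S) n t \<omega> * type_weight Type_S (fst (event_state ?z \<omega> n))"
        using wn hn G0 by (subst (asm) ennreal_inj) (auto intro!: add_nonneg_nonneg mult_nonneg_nonneg)
      then show "m (history \<omega> n) (t - arrival \<omega> n) *
        (type_weight Type_C (fst (event_state ?z \<omega> n)) * hist_surv M (?r Type_C) n t \<omega>
          + type_weight Type_S (fst (event_state ?z \<omega> n)) * hist_surv M (?r Type_S) n t \<omega>)
        = type_weight Type_C (fst (event_state ?z \<omega> n)) * hist_surv M (?r Type_C) n t \<omega>"
        using at by (simp add: G_def distrib_left ac_simps)
    qed
  qed
qed

text \<open>Passes from identities that hold at single times, each off its own null set, to one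
  pathwise equation that \<open>posterior_is_flow\<close> can solve. The survival factors are
  continuous in time, which allows the passage to the limit.\<close>

lemma reputation_is_flow:
  assumes z: "(\<mu>0, p0) \<in> space Z" and rs: "reputation_system M \<mu>0 p0 m L"
    and same: "\<And>\<theta>. 0 < type_weight \<theta> \<mu>0 \<Longrightarrow> same_trunc_law M (L \<theta>) (record_law (type_intensity \<theta>) (\<mu>0, p0)) n"
  shows "AE \<omega> in trunc_law (\<mu>0, p0) n. \<forall>s\<ge>0. m (history \<omega> n) s = fst (flow_state (event_state (\<mu>0, p0) \<omega> n) s)"
proof -
  let ?z = "(\<mu>0, p0)" and ?r = "type_rate M p0 m"
  note rsD = reputation_systemD[OF rs]
  have p0: "p0 \<in> menu M" using z by (auto simp: space_Z)
  have rf: "rate_family M (?r \<theta>) (kappa M) (nu M + kappa M)" for \<theta>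
    by (rule type_rate_family[OF p0 rsD(1,3)])
  have "AE \<omega> in trunc_law ?z n. \<forall>t\<in>{t\<in>\<rat>. 0 \<le> t}. arrival \<omega> n \<le> t \<longrightarrow>
    m (history \<omega> n) (t - arrival \<omega> n) *
      (type_weight Type_C (fst (event_state ?z \<omega> n)) * hist_surv M (?r Type_C) n t \<omega>
        + type_weight Type_S (fst (event_state ?z \<omega> n)) * hist_surv M (?r Type_S) n t \<omega>)
    = type_weight Type_C (fst (event_state ?z \<omega> n)) * hist_surv M (?r Type_C) n t \<omega>"
    by (rule AE_ball_countable[THEN iffD2])
       (use countable_rat reputation_posterior[OF z rs same] in \<open>auto intro: countable_subset\<close>)
  then show ?thesis
    using trunc_law_arrival_nonneg[OF z, of n] AE_space
  proof eventually_elim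
    case (elim \<omega>)
    then have w: "\<omega> \<in> space Rec" by simp
    let ?x = "m (history \<omega> n)" and ?p = "current_price p0 (history \<omega> n)" and ?\<mu> = "fst (event_state ?z \<omega> n)"
    have T: "mark_rates M (\<lambda>s. type_intensity \<theta> (?x s, ?p)) (kappa M) (nu M + kappa M)" for \<theta>
      using rate_familyD[OF rf w, of \<theta> n] by (simp add: type_rate_alt[abs_def])
    interpret C: mark_rates M "\<lambda>s. type_intensity Type_C (?x s, ?p)" "kappa M" "nu M + kappa M" by (rule T)
    interpret S: mark_rates M "\<lambda>s. type_intensity Type_S (?x s, ?p)" "kappa M" "nu M + kappa M" by (rule T)
    have hs: "hist_surv M (?r Type_C) n t \<omega> = exp (- C.cum (t - arrival \<omega> n))"
      "hist_surv M (?r Type_S) n t \<omega> = exp (- S.cum (t - arrival \<omega> n))" for t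
      by (simp_all add: hist_surv_def C.cum_def S.cum_def type_rate_alt)
    have post: "?x u * (?\<mu> * exp (- C.cum u) + (1 - ?\<mu>) * exp (- S.cum u)) = ?\<mu> * exp (- C.cum u)"
      if "0 \<le> u" for u
    proof (rule right_continuous_eq_on_rational_shift[OF rsD(2) _ _ _ elim(2) that,
        where W = "\<lambda>u. ?\<mu> * exp (- C.cum u) + (1 - ?\<mu>) * exp (- S.cum u)" and V = "\<lambda>u. ?\<mu> * exp (- C.cum u)"])
      show "continuous_on {0..} (\<lambda>u. ?\<mu> * exp (- C.cum u) + (1 - ?\<mu>) * exp (- S.cum u))"
        "continuous_on {0..} (\<lambda>u. ?\<mu> * exp (- C.cum u))"
        by (intro continuous_intros C.cum_continuous S.cum_continuous)+
    qed (use elim(1) in \<open>auto simp: hs type_weight_def\<close>)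
    have \<mu>: "?\<mu> \<in> {0..1}" by (rule fst_event_state_range[OF z w])
    have p: "?p \<in> menu M" by (rule current_price_menu[OF p0 w])
    show ?case
    proof (intro allI impI)
      fix s :: real assume s: "0 \<le> s"
      have "?x s = flow ?\<mu> ?p s"
        by (rule posterior_is_flow[OF \<mu> p rsD(1) T _ s]) (use post in \<open>simp_all add: C.cum_def S.cum_def\<close>)
      then show "?x s = fst (flow_state (event_state ?z \<omega> n) s)"
        by (simp add: flow_state_def snd_event_state)
    qed
  qed
qed

text \<open>Agreement on the first \<open>n\<close> events identifies the reputation in the silence
  that follows, hence the kernel of the next event, hence agreement on one event more.
  \<open>\<theta>\<close> varies in the induction because identifying the reputation uses agreement
  for every type of positive weight.\<close>

lemma reputation_same_law:
  assumes z: "(\<mu>0, p0) \<in> space Z" and rs: "reputation_system M \<mu>0 p0 m L" and pos: "0 < type_weight \<theta> \<mu>0"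
  shows "same_trunc_law M (L \<theta>) (record_law (type_intensity \<theta>) (\<mu>0, p0)) n"
  using pos
proof (induction n arbitrary: \<theta>)
  case 0
  show ?case
    by (rule same_trunc_law_0[OF point_process_lawD(1)[OF reputation_systemD(4)[OF rs]] record_law_prob[OF state_rate_type_intensity z]])
next
  case (Suc n)
  let ?z = "(\<mu>0, p0)" and ?r = "type_rate M p0 m"
  note rsD = reputation_systemD[OF rs]
  have p0: "p0 \<in> menu M" using z by (auto simp: space_Z)
  have rf: "rate_family M (?r \<theta>) (kappa M) (nu M + kappa M)"
    by (rule type_rate_family[OF p0 rsD(1,3)])
  show ?case
  proof (rule same_trunc_law_Suc[OF hist_rate_family[OF state_rate_type_intensity z]])
    show "next_event_law M (?r \<theta>) (L \<theta>) n" by (rule point_process_law_next[OF fin rf rsD(4)])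
    show "next_event_law M (hist_rate (type_intensity \<theta>) ?z) (record_law (type_intensity \<theta>) ?z) n"
      by (rule point_process_law_next[OF fin hist_rate_family[OF state_rate_type_intensity z] record_law_law[OF state_rate_type_intensity z]])
    show "same_trunc_law M (L \<theta>) (record_law (type_intensity \<theta>) ?z) n" by (rule Suc.IH[OF Suc.prems])
    have "AE \<omega> in L \<theta>. \<forall>s\<ge>0. m (history (trunc n \<omega>) n) s = fst (flow_state (event_state ?z (trunc n \<omega>) n) s)"
    proof (rule AE_trunc_law_transfer[OF z])
      show "0 < type_weight \<theta> (fst ?z)" using Suc.prems by simp
      show "sets (L \<theta>) = sets Rec" by (rule point_process_lawD(2)[OF rsD(4)])
      show "same_trunc_law M (L \<theta>) (record_law (type_intensity \<theta>) ?z) n" by (rule Suc.IH[OF Suc.prems])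
      show "AE \<omega> in trunc_law ?z n. \<forall>s\<ge>0. m (history \<omega> n) s = fst (flow_state (event_state ?z \<omega> n) s)"
        by (rule reputation_is_flow[OF z rs Suc.IH])
    qed
    then show "AE \<omega> in L \<theta>. event_law M (?r \<theta> (history \<omega> n)) = event_law M (hist_rate (type_intensity \<theta>) ?z (history \<omega> n))"
    proof eventually_elim
      case (elim \<omega>)
      show ?case
      proof (rule event_law_cong)
        fix s :: real and x assume "0 \<le> s"
        then show "?r \<theta> (history \<omega> n) s x = hist_rate (type_intensity \<theta>) ?z (history \<omega> n) s x"
          using elim by (simp add: type_rate_alt pdmp_state_history flow_state_def snd_event_state)
      qed
    qed
  qed
qed

text \<open>After this, almost sure statements about any reputation system can be checked on the
  canonical model.\<close>

lemma reputation_joint_law: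
  assumes z: "(\<mu>0, p0) \<in> space Z" and rs: "reputation_system M \<mu>0 p0 m L"
  shows "joint_law M \<mu>0 L = canonical_joint (\<mu>0, p0)"
proof -
  note rsD = reputation_systemD[OF rs]
  have \<mu>: "\<mu>0 \<in> {0..1}" using z by (auto simp: space_Z)
  have L: "prob_space (L \<theta>)" "sets (L \<theta>) = sets Rec" for \<theta> by (rule point_process_lawD[OF rsD(4)])+
  have "joint_law M \<mu>0 L = joint_law M \<mu>0 (canonical_law (\<mu>0, p0))"
  proof (rule joint_law_cong[of L "canonical_law (\<mu>0, p0)", OF L canonical_law_space[OF z] \<mu>])
    fix \<theta> assume "0 < type_weight \<theta> \<mu>0"
    then show "L \<theta> = canonical_law (\<mu>0, p0) \<theta>"
      unfolding canonical_law_def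
      by (intro record_measure_eqI[OF L sets_record_law[OF state_rate_type_intensity z]] reputation_same_law[OF z rs])
  qed
  then show ?thesis by (simp add: canonical_joint_def)
qed

lemma reputation_tracks_flow:
  assumes z: "(\<mu>0, p0) \<in> space Z" and rs: "reputation_system M \<mu>0 p0 m L"
  shows "AE \<omega> in record_law prate (\<mu>0, p0). \<forall>n. \<forall>s\<ge>0. m (history \<omega> n) s = fst (flow_state (event_state (\<mu>0, p0) \<omega> n) s)"
proof (rule AE_all_countable[THEN iffD2], intro allI)
  fix n
  have "AE \<omega> in distr (record_law prate (\<mu>0, p0)) Rec (trunc n). \<forall>s\<ge>0. m (history \<omega> n) s = fst (flow_state (event_state (\<mu>0, p0) \<omega> n) s)"
    unfolding trunc_law_def[symmetric] by (rule reputation_is_flow[OF z rs reputation_same_law[OF z rs]])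
  from AE_distrD[OF trunc_record_law_measurable[OF z] this]
  show "AE \<omega> in record_law prate (\<mu>0, p0). \<forall>s\<ge>0. m (history \<omega> n) s = fst (flow_state (event_state (\<mu>0, p0) \<omega> n) s)"
    by simp
qed

end

text \<open>Serves to exchange rates driven by the state for the \<open>type_rate\<close> of the
  canonical reputation, which agree with them on histories of market records.\<close>

lemma point_process_law_cong:
  assumes fin: "finite (menu M)" and rf: "rate_family M r lo hi"
    and eq: "\<And>\<omega> n s x. \<omega> \<in> space (record_space M) \<Longrightarrow> 0 \<le> s \<Longrightarrow> x \<in> marks M \<Longrightarrow>
      r (history \<omega> n) s x = r' (history \<omega> n) s x"
    and Q: "point_process_law M r Q"
  shows "point_process_law M r' Q"
proof -
  note Q' = point_process_lawD[OF Q]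
  have rf': "rate_family M r' lo hi" by (rule point_process_law_rate_cong[OF eq rf])
  have "next_event_law M r' Q n" for n
    unfolding next_event_law_def
  proof
    fix f :: "public_record \<times> event \<Rightarrow> ennreal" assume f: "f \<in> borel_measurable (record_space M \<Otimes>\<^sub>M event_space M)"
    have "(\<integral>\<^sup>+\<omega>. \<integral>\<^sup>+e. f (trunc n \<omega>, e) \<partial>event_law M (r (history \<omega> n)) \<partial>Q)
      = (\<integral>\<^sup>+\<omega>. \<integral>\<^sup>+e. f (trunc n \<omega>, e) \<partial>event_law M (r' (history \<omega> n)) \<partial>Q)"
    proof (rule nn_integral_cong)
      fix \<omega> assume "\<omega> \<in> space Q"
      then have "\<omega> \<in> space (record_space M)" using sets_eq_imp_space_eq[OF Q'(2)] by simp
      then have "event_law M (r (history \<omega> n)) = event_law M (r' (history \<omega> n))"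
        by (intro event_law_cong eq)
      then show "(\<integral>\<^sup>+e. f (trunc n \<omega>, e) \<partial>event_law M (r (history \<omega> n))) = (\<integral>\<^sup>+e. f (trunc n \<omega>, e) \<partial>event_law M (r' (history \<omega> n)))"
        by simp
    qed
    then show "(\<integral>\<^sup>+\<omega>. f (trunc n \<omega>, \<omega> n) \<partial>Q) = (\<integral>\<^sup>+\<omega>. \<integral>\<^sup>+e. f (trunc n \<omega>, e) \<partial>event_law M (r' (history \<omega> n)) \<partial>Q)"
      using next_event_lawD[OF point_process_law_next[OF fin rf Q] f] by simp
  qed
  then show ?thesis using point_process_law_iff[OF fin rf' Q'] by blast
qed

section \<open>Existence and the properties of every reputation\<close>

context market_model
begin

lemma foldl_step_space:
  "z \<in> space Z \<Longrightarrow> (\<And>e. e \<in> set h \<Longrightarrow> snd e \<in> marks M) \<Longrightarrow> foldl step z h \<in> space Z"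
proof (induction h rule: rev_induct)
  case (snoc e h)
  have "e \<in> space Ev"
    using snoc.prems(2)[of e] by (simp add: space_event_space mem_Times_iff)
  moreover have "foldl step z h \<in> space Z" using snoc by simp
  ultimately show ?case by (simp add: step_space)
qed simp

lemma space_canonical_joint: "z \<in> space Z \<Longrightarrow> x \<in> space (canonical_joint z) \<Longrightarrow> snd x \<in> space Rec"
  using sets_eq_imp_space_eq[OF canonical_joint_space(2)] by (simp add: space_Out mem_Times_iff)

text \<open>Range and right-continuity are demanded for every list of events, also for lists with
  marks outside the market, along which the state could leave the state space; there the value is
  set to 0.\<close>

definition canonical_reputation :: "real \<times> real \<Rightarrow> event list \<Rightarrow> real \<Rightarrow> real" where
  "canonical_reputation z h s = (if \<forall>e\<in>set h. snd e \<in> marks M then fst (pdmp_state M flow z h s) else 0)"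

lemma canonical_reputation_history:
  "\<omega> \<in> space Rec \<Longrightarrow> canonical_reputation z (history \<omega> n) s = fst (flow_state (event_state z \<omega> n) s)"
proof -
  assume "\<omega> \<in> space Rec"
  then have "\<forall>e\<in>set (history \<omega> n). snd e \<in> marks M"
    by (simp add: history_def space_record_space)
  then show ?thesis by (simp add: canonical_reputation_def pdmp_state_history)
qed

lemma reputation_system_exists:
  assumes z: "(\<mu>0, p0) \<in> space Z"
  shows "reputation_system M \<mu>0 p0 (canonical_reputation (\<mu>0, p0)) (canonical_law (\<mu>0, p0))"
proof -
  let ?z = "(\<mu>0, p0)"
  let ?m = "canonical_reputation ?z"
  have range_cont: "?m h s \<in> {0..1} \<and> continuous (at_right s) (?m h)" if s: "0 \<le> s" for h s
  proof (cases "\<forall>e\<in>set h. snd e \<in> marks M")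
    case True
    define y where "y = foldl step ?z h"
    have y: "fst y \<in> {0..1}" "snd y \<in> menu M"
      using foldl_step_space[OF z, of h] True by (auto simp: y_def space_Z mem_Times_iff)
    have eq: "?m h = flow (fst y) (snd y)"
      using True by (auto simp: canonical_reputation_def pdmp_state_def y_def case_prod_beta fun_eq_iff)
    have "continuous (at s within {0..}) (flow (fst y) (snd y))"
      using continuous_on_flow[OF y(2,1)] s by (simp add: continuous_on_eq_continuous_within)
    then have "continuous (at_right s) (flow (fst y) (snd y))"
      by (rule continuous_within_subset) (use s in auto)
    then show ?thesis using flow_range[OF y(1)] by (simp add: eq)
  next
    case False
    then have "?m h = (\<lambda>_. 0)" by (auto simp: canonical_reputation_def fun_eq_iff)
    then show ?thesis by simp
  qed
  have meas: "(\<lambda>(\<omega>, s). ?m (history \<omega> n) s) \<in> borel_measurable (Rec \<Otimes>\<^sub>M borel)" for n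
  proof -
    have "(\<lambda>y. (event_state ?z (fst y) n, snd y)) \<in> Rec \<Otimes>\<^sub>M borel \<rightarrow>\<^sub>M Z \<Otimes>\<^sub>M (borel :: real measure)"
      by (intro measurable_Pair measurable_compose[OF measurable_fst event_state_measurable'[OF z]] measurable_snd)
    from measurable_compose[OF measurable_compose[OF this flow_state_measurable] fst_Z_borel]
    have "(\<lambda>y. fst (flow_state (event_state ?z (fst y) n) (snd y))) \<in> borel_measurable (Rec \<Otimes>\<^sub>M borel)" by simp
    then show ?thesis
      by (rule measurable_cong[THEN iffD1, rotated]) (auto simp: space_pair_measure canonical_reputation_history)
  qed
  have law: "point_process_law M (type_rate M p0 ?m \<theta>) (canonical_law ?z \<theta>)" for \<theta>
    unfolding canonical_law_def
  proof (rule point_process_law_cong[OF fin hist_rate_family[OF state_rate_type_intensity z] _ record_law_law[OF state_rate_type_intensity z]])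
    fix \<omega> n and s :: real and x assume "\<omega> \<in> space Rec"
    then show "hist_rate (type_intensity \<theta>) ?z (history \<omega> n) s x = type_rate M p0 ?m \<theta> (history \<omega> n) s x"
      by (simp add: type_rate_alt canonical_reputation_history pdmp_state_history flow_state_def snd_event_state)
  qed
  have "AE x in canonical_joint ?z. real_cond_exp (canonical_joint ?z) (F t) (indicator {x. fst x = Type_C}) x = at_time ?m (snd x) t"
    if t: "0 \<le> t" for t
    using canonical_filter[OF z t] AE_canonical_joint[OF z record_law_AE_good[OF state_rate_prate z]] AE_space
  proof eventually_elim
    case (elim x)
    have "snd x \<in> space Rec" by (rule space_canonical_joint[OF z elim(3)])
    then show ?case
      using elim(1) good_slot(3)[OF elim(2) t] by (simp add: at_time_def canonical_reputation_history reached_def)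
  qed
  then show ?thesis
    unfolding reputation_system_def using range_cont meas law unfolding canonical_joint_def fst_conv by blast
qed

text \<open>\<open>m [] 0\<close> does not depend on the record, so an almost sure statement under a
  probability measure decides it.\<close>

lemma reputation_start:
  assumes z: "(\<mu>0, p0) \<in> space Z" and rs: "reputation_system M \<mu>0 p0 m L"
  shows "m [] 0 = \<mu>0"
proof -
  interpret prob_space "record_law prate (\<mu>0, p0)" by (rule record_law_prob[OF state_rate_prate z])
  have "AE \<omega> in record_law prate (\<mu>0, p0). m [] 0 = \<mu>0"
    using reputation_tracks_flow[OF z rs]
  proof eventually_elim
    case (elim \<omega>)
    from elim[rule_format, of 0 0] show ?case
      by (simp add: flow_state_0[OF z]) (simp add: history_def)
  qed
  then show ?thesis by simp
qed

lemma reputation_paths: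
  assumes z: "(\<mu>0, p0) \<in> space Z" and rs: "reputation_system M \<mu>0 p0 m L"
  shows "AE x in joint_law M \<mu>0 L. \<forall>n.
    let h = history (snd x) n; h' = history (snd x) (Suc n);
        p = current_price p0 h; S = fst (snd x n)
    in (\<forall>s\<in>{0..<S}. (m h has_real_derivative drift M (m h s) p (act M (m h s) p)) (at s within {0..<S})) \<and>
       (\<exists>l. (m h \<longlongrightarrow> l) (at_left S) \<and>
         (case snd (snd x n) of
            Purchase \<Rightarrow> m h' 0 = jump M l p (act M l p)
          | Reset p' \<Rightarrow> m h' 0 = l))"
  unfolding reputation_joint_law[OF z rs]
  using AE_canonical_joint[OF z reputation_tracks_flow[OF z rs]] AE_canonical_joint[OF z record_law_AE_good[OF state_rate_prate z]] AE_space
proof eventually_elim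
  case (elim x)
  let ?w = "snd x"
  have w: "?w \<in> space Rec" by (rule space_canonical_joint[OF z elim(3)])
  show ?case
  proof
    fix n
    let ?h = "history ?w n" and ?S = "fst (?w n)"
    let ?\<mu> = "fst (event_state (\<mu>0, p0) ?w n)" and ?p = "current_price p0 (history ?w n)"
    have S: "0 < ?S" using elim(2) by (simp add: good_def)
    have \<mu>: "?\<mu> \<in> {0..1}" by (rule fst_event_state_range[OF z w])
    have p: "?p \<in> menu M" using z by (intro current_price_menu w) (simp add: space_Z)
    have mh: "m ?h s = flow ?\<mu> ?p s" if "0 \<le> s" for s
      using elim(1) that by (simp add: flow_state_def snd_event_state)
    have der: "(m ?h has_real_derivative drift M (m ?h s) ?p (act M (m ?h s) ?p)) (at s within {0..<?S})"
      if s: "s \<in> {0..<?S}" for s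
    proof -
      have "(flow ?\<mu> ?p has_real_derivative adrift ?p (flow ?\<mu> ?p s)) (at s within {0..<?S})"
        by (rule DERIV_subset[OF flow_deriv[OF p \<mu>]]) (use s in auto)
      then have "(m ?h has_real_derivative adrift ?p (flow ?\<mu> ?p s)) (at s within {0..<?S})"
        by (rule has_field_derivative_transform_within[OF _ zero_less_one]) (use s mh in auto)
      then show ?thesis using s mh[of s] by simp
    qed
    \<comment> \<open>The witness \<open>l\<close> is the flow continued up to the event time, which
      is the left limit by continuity of the flow.\<close>
    have lim: "(m ?h \<longlongrightarrow> flow ?\<mu> ?p ?S) (at_left ?S)"
    proof -
      have "(flow ?\<mu> ?p \<longlongrightarrow> flow ?\<mu> ?p ?S) (at ?S within {0..})"
        using continuous_on_flow[OF p \<mu>] S by (auto simp: continuous_on_def)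
      moreover have "at ?S within {0..} = at ?S" using S by (intro at_within_interior) auto
      ultimately have "(flow ?\<mu> ?p \<longlongrightarrow> flow ?\<mu> ?p ?S) (at_left ?S)"
        by (metis subset_UNIV tendsto_within_subset)
      moreover have "\<forall>\<^sub>F s in at_left ?S. flow ?\<mu> ?p s = m ?h s"
        using eventually_at_left_real[OF S] by eventually_elim (simp add: mh)
      ultimately show ?thesis by (rule Lim_transform_eventually)
    qed
    have next0: "m (history ?w (Suc n)) 0 = fst (step (event_state (\<mu>0, p0) ?w n) (?w n))"
      using elim(1)[rule_format, of 0 "Suc n"] flow_state_0[OF event_state_space[OF z w, of "Suc n"]] by (simp add: event_state_Suc)
    have pe: "?p = snd (event_state (\<mu>0, p0) ?w n)" by (simp add: snd_event_state)
    have "case snd (?w n) of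
        Purchase \<Rightarrow> m (history ?w (Suc n)) 0 = jump M (flow ?\<mu> ?p ?S) ?p (act M (flow ?\<mu> ?p ?S) ?p)
      | Reset p' \<Rightarrow> m (history ?w (Suc n)) 0 = flow ?\<mu> ?p ?S"
    proof (cases "snd (?w n)")
      case Purchase
      then have e: "?w n = (?S, Purchase)" by (simp add: prod_eq_iff)
      have "step (event_state (\<mu>0, p0) ?w n) (?w n) = step (event_state (\<mu>0, p0) ?w n) (?S, Purchase)" using e by simp
      then show ?thesis using Purchase by (simp add: next0 step_Purchase flow_state_def pe)
    next
      case (Reset p')
      then have e: "?w n = (?S, Reset p')" by (simp add: prod_eq_iff)
      have "step (event_state (\<mu>0, p0) ?w n) (?w n) = step (event_state (\<mu>0, p0) ?w n) (?S, Reset p')" using e by simp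
      then show ?thesis using Reset by (simp add: next0 step_Reset flow_state_def pe)
    qed
    with der lim show "let h = history ?w n; h' = history ?w (Suc n);
        p = current_price p0 h; S = fst (?w n)
      in (\<forall>s\<in>{0..<S}. (m h has_real_derivative drift M (m h s) p (act M (m h s) p)) (at s within {0..<S})) \<and>
       (\<exists>l. (m h \<longlongrightarrow> l) (at_left S) \<and>
         (case snd (?w n) of
            Purchase \<Rightarrow> m h' 0 = jump M l p (act M l p)
          | Reset p' \<Rightarrow> m h' 0 = l))"
      unfolding Let_def by blast
  qed
qed

text \<open>The exceptional null set is common to all times: the reputation follows the flow after
  each of countably many events, and every time falls into the silence after one of them.\<close>

lemma reputation_state:
  assumes z: "(\<mu>0, p0) \<in> space Z" and rs: "reputation_system M \<mu>0 p0 m L"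
  shows "AE x in canonical_joint (\<mu>0, p0). \<forall>t\<ge>0.
    (at_time m (snd x) t, at_time (\<lambda>h s. current_price p0 h) (snd x) t) = at_time (pdmp_state M flow (\<mu>0, p0)) (snd x) t \<and>
    at_time (pdmp_state M flow (\<mu>0, p0)) (snd x) t = reached (\<mu>0, p0) t (slot t (snd x)) (snd x)"
  using AE_canonical_joint[OF z reputation_tracks_flow[OF z rs]] AE_canonical_joint[OF z record_law_AE_good[OF state_rate_prate z]]
proof eventually_elim
  case (elim x)
  show ?case
  proof (intro allI impI)
    fix t :: real assume t: "0 \<le> t"
    have N: "event_count (snd x) t = slot t (snd x)" by (rule good_slot(3)[OF elim(2) t])
    have "0 \<le> t - arrival (snd x) (slot t (snd x))"
      using good_slot(1)[OF elim(2) t] by (simp add: in_slot_def)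
    then show "(at_time m (snd x) t, at_time (\<lambda>h s. current_price p0 h) (snd x) t) = at_time (pdmp_state M flow (\<mu>0, p0)) (snd x) t \<and>
      at_time (pdmp_state M flow (\<mu>0, p0)) (snd x) t = reached (\<mu>0, p0) t (slot t (snd x)) (snd x)"
      using elim(1) by (simp add: at_time_def N pdmp_state_history reached_def) (simp add: flow_state_def snd_event_state)
  qed
qed

text \<open>The conditional law of the future is one measurable kernel evaluated at the current pair
  of reputation and price, so the past enters through this pair alone.\<close>

lemma reputation_sufficient:
  assumes z: "(\<mu>0, p0) \<in> space Z" and rs: "reputation_system M \<mu>0 p0 m L"
    and t: "0 \<le> t" and B: "B \<in> sets Rec"
  shows "AE x in joint_law M \<mu>0 L.
    real_cond_exp (joint_law M \<mu>0 L) (F t) (indicator {x. future t (snd x) \<in> B}) x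
    = measure (record_law prate (at_time m (snd x) t, at_time (\<lambda>h s. current_price p0 h) (snd x) t)) B"
  unfolding reputation_joint_law[OF z rs]
  using future_cond_exp[OF z t B] reputation_state[OF z rs]
proof eventually_elim
  case (elim x)
  from elim(2)[rule_format, OF t] elim(1) show ?case by simp
qed

end

theorem proposition2:
  fixes M :: market
  assumes "nu M > 0" "kappa M > 0" "val M > 0" "zeta M > 0"
    and "1/2 < prec M" "prec M < 1"
    and "finite (menu M)" "menu M \<subseteq> {0<..}"
    and act_range: "\<forall>\<mu>\<in>{0..1}. \<forall>p\<in>menu M. act M \<mu> p \<in> {0..1}"
    and act_measurable: "(\<lambda>(\<mu>, p). act M \<mu> p) \<in> borel_measurable (state_space M)"
    and rule_support: "\<forall>\<mu>\<in>{0..1}. \<forall>p\<in>menu M. set_pmf (rule M \<mu> p) \<subseteq> menu M"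
    and rule_measurable:
      "\<forall>p'\<in>menu M. (\<lambda>(\<mu>, p). pmf (rule M \<mu> p) p') \<in> borel_measurable (state_space M)"
    and drift_lipschitz:
      "\<forall>p\<in>menu M. local_lipschitz {p} {0..1} (\<lambda>p \<mu>. drift M \<mu> p (act M \<mu> p))"
  shows
    "(\<forall>\<mu>0\<in>{0..1}. \<forall>p0\<in>menu M.
       (\<exists>m L. reputation_system M \<mu>0 p0 m L) \<and>
       (\<forall>m L. reputation_system M \<mu>0 p0 m L \<longrightarrow>
          m [] 0 = \<mu>0 \<and>
          (AE z in joint_law M \<mu>0 L. \<forall>n.
             let h = history (snd z) n; h' = history (snd z) (Suc n);
                 p = current_price p0 h; S = fst (snd z n)
             in (\<forall>s\<in>{0..<S}.
                   (m h has_real_derivative drift M (m h s) p (act M (m h s) p))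
                     (at s within {0..<S})) \<and>
                (\<exists>l. (m h \<longlongrightarrow> l) (at_left S) \<and>
                   (case snd (snd z n) of
                      Purchase \<Rightarrow> m h' 0 = jump M l p (act M l p)
                    | Reset p' \<Rightarrow> m h' 0 = l))))) \<and>
     (\<exists>\<Phi> K.
       (\<forall>\<mu>\<in>{0..1}. \<forall>p\<in>menu M.
          silence_path M \<mu> p (\<Phi> \<mu> p) \<and>
          (\<forall>\<phi>. silence_path M \<mu> p \<phi> \<longrightarrow> (\<forall>s\<ge>0. \<phi> s = \<Phi> \<mu> p s)) \<and>
          (drift M \<mu> p (act M \<mu> p) = 0 \<longrightarrow> (\<forall>s\<ge>0. \<Phi> \<mu> p s = \<mu>))) \<and>
       K \<in> measurable (state_space M) (prob_algebra (record_space M)) \<and>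
       (\<forall>\<mu>0\<in>{0..1}. \<forall>p0\<in>menu M.
          pdmp_law M \<Phi> (\<mu>0, p0) (K (\<mu>0, p0)) \<and>
          (\<forall>R. pdmp_law M \<Phi> (\<mu>0, p0) R \<longrightarrow> R = K (\<mu>0, p0)) \<and>
          (AE \<omega> in K (\<mu>0, p0). (\<forall>n. 0 < fst (\<omega> n)) \<and> nonexplosive \<omega>) \<and>
          (\<forall>m L. reputation_system M \<mu>0 p0 m L \<longrightarrow>
             distr (joint_law M \<mu>0 L) (record_space M) snd = K (\<mu>0, p0) \<and>
             (AE z in joint_law M \<mu>0 L. \<forall>t\<ge>0.
                (at_time m (snd z) t, at_time (\<lambda>h s. current_price p0 h) (snd z) t)
                = at_time (pdmp_state M \<Phi> (\<mu>0, p0)) (snd z) t) \<and>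
             (\<forall>t\<ge>0. \<forall>B\<in>sets (record_space M).
                AE z in joint_law M \<mu>0 L.
                  real_cond_exp (joint_law M \<mu>0 L) (public_filtration M t)
                    (indicator {z. future t (snd z) \<in> B}) z
                  = measure (K (at_time m (snd z) t,
                                at_time (\<lambda>h s. current_price p0 h) (snd z) t)) B))))"
proof -
  interpret market_model M
    by (rule market_model.intro[OF assms(1,2,5-7) act_range act_measurable rule_support rule_measurable drift_lipschitz])
  have z: "(\<mu>0, p0) \<in> space Z" if "\<mu>0 \<in> {0..1}" "p0 \<in> menu M" for \<mu>0 p0
    using that by (simp add: space_Z)
  \<comment> \<open>The kernel of public laws is the same for all priors, initial prices and times;
    this is what turns the conditional law of the future into a function of the current
    state.\<close>
  show ?thesis
  proof (intro conjI ballI exI[of _ flow] exI[of _ "record_law prate"] allI impI)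
    fix \<mu>0 p0 :: real assume a: "\<mu>0 \<in> {0..1}" "p0 \<in> menu M"
    note z = z[OF a]
    show "\<exists>m L. reputation_system M \<mu>0 p0 m L" using reputation_system_exists[OF z] by blast
    show "silence_path M \<mu>0 p0 (flow \<mu>0 p0)" by (rule flow_silence_path[OF a(2,1)])
    show "\<phi> s = flow \<mu>0 p0 s" if "silence_path M \<mu>0 p0 \<phi>" "0 \<le> s" for \<phi> s
      by (rule flow_unique[OF a(2,1) that])
    show "flow \<mu>0 p0 s = \<mu>0" if "drift M \<mu>0 p0 (act M \<mu>0 p0) = 0" "0 \<le> s" for s
      by (rule flow_fixed[OF a(2,1) that])
    show "pdmp_law M flow (\<mu>0, p0) (record_law prate (\<mu>0, p0))"
      unfolding pdmp_law_def by (rule record_law_law[OF state_rate_prate z])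
    show "R = record_law prate (\<mu>0, p0)" if "pdmp_law M flow (\<mu>0, p0) R" for R
      using that unfolding pdmp_law_def by (rule record_law_unique[OF state_rate_prate z])
    show "AE \<omega> in record_law prate (\<mu>0, p0). (\<forall>n. 0 < fst (\<omega> n)) \<and> nonexplosive \<omega>"
      using record_law_AE_good[OF state_rate_prate z] by (simp add: good_def)
    fix m L assume rs: "reputation_system M \<mu>0 p0 m L"
    show "m [] 0 = \<mu>0" by (rule reputation_start[OF z rs])
    show "AE z in joint_law M \<mu>0 L. \<forall>n.
             let h = history (snd z) n; h' = history (snd z) (Suc n);
                 p = current_price p0 h; S = fst (snd z n)
             in (\<forall>s\<in>{0..<S}.
                   (m h has_real_derivative drift M (m h s) p (act M (m h s) p))
                     (at s within {0..<S})) \<and>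
                (\<exists>l. (m h \<longlongrightarrow> l) (at_left S) \<and>
                   (case snd (snd z n) of
                      Purchase \<Rightarrow> m h' 0 = jump M l p (act M l p)
                    | Reset p' \<Rightarrow> m h' 0 = l))"
      by (rule reputation_paths[OF z rs])
    show "distr (joint_law M \<mu>0 L) (record_space M) snd = record_law prate (\<mu>0, p0)"
      unfolding reputation_joint_law[OF z rs] by (rule distr_canonical_joint[OF z])
    show "AE z in joint_law M \<mu>0 L. \<forall>t\<ge>0.
                (at_time m (snd z) t, at_time (\<lambda>h s. current_price p0 h) (snd z) t)
                = at_time (pdmp_state M flow (\<mu>0, p0)) (snd z) t"
      unfolding reputation_joint_law[OF z rs] using reputation_state[OF z rs] by eventually_elim blast
    show "AE z in joint_law M \<mu>0 L.
                  real_cond_exp (joint_law M \<mu>0 L) (public_filtration M t)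
                    (indicator {z. future t (snd z) \<in> B}) z
                  = measure (record_law prate (at_time m (snd z) t,
                                at_time (\<lambda>h s. current_price p0 h) (snd z) t)) B"
      if "0 \<le> t" "B \<in> sets (record_space M)" for t B
      by (rule reputation_sufficient[OF z rs that])
  next
    show "record_law prate \<in> measurable (state_space M) (prob_algebra (record_space M))"
      by (rule record_law_measurable[OF state_rate_prate])
  qed
qed

end
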